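(* Let $f(t)=g(t)+\epsilon X$, $t\in\mathbb{R}^2$, be a perturbed Gaussian field. For any fixed $\epsilon>0$ and $u\in\mathbb{R}$, let $\Theta_\epsilon(u)$ be a random variable whose conditional distribution given $\{X=x\}$ is centered Gaussian with variance $v(u-\epsilon x)$. Let $$Z^\epsilon_T(u)=|T|^{1/2}\left(C_2^{/T}(f,u)-C_2^*(g,u-\epsilon X)\right).$$ Then, as $T\nearrow\mathbb{R}^2$, $$d_W\left(Z^\epsilon_T(u),\Theta_\epsilon(u)\right)=O\left((\log|T|)^{-1/12}\right),$$ where the constant involved in the $O$-notation depends neither on $\epsilon$ nor on $u$.
   Context: **Gaussian field.** $g=\{g(t),t\in\mathbb{R}^2\}$ is a real Gaussian random field, stationary and isotropic, with $\mathbb{E}[g(0)]=0$, $\mathrm{Var}\,g(0)=\sigma_g^2$ with $\sigma_g>0$, gradient covariance matrix $\mathrm{Var}\,g'(0)=\lambda I_2$ with $\lambda>0$ ($I_2$ the $2\times2$ identity matrix), and whose covariance function $r(t)=\mathrm{Cov}(g(0),g(t))$ is $\mathcal{C}^4$ and satisfies $|r(t)|=O(\|t\|^{-\alpha})$ as $\|t\|\to\infty$ for some $\alpha>2$. **Perturbed field.** $X$ is a real random variable, independent of $g$, with $\mathbb{E}[|X|^3]<+\infty$ and $\mathbb{E}[X]=0$; for $\epsilon>0$, $f(t)=g(t)+\epsilon X$, $t\in\mathbb{R}^2$. **Excursion area.** $|\cdot|$ is two-dimensional Lebesgue measure. For $h=g$ or $h=f$, $u\in\mathbb{R}$ and $T$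 a bounded rectangle in $\mathbb{R}^2$ with non-empty interior, $C_2^{/T}(h,u)=|\{t\in T: h(t)\ge u\}|/|T|$. Moreover $C_2^*(g,u)=\mathbb{E}[C_2^{/T}(g,u)]=\Psi(u/\sigma_g)$ with $\Psi(x)=\frac1{\sqrt{2\pi}}\int_x^{+\infty}e^{-t^2/2}\,dt$, and $C_2^*(g,u-\epsilon X)$ is the random variable $\Psi((u-\epsilon X)/\sigma_g)$. The notation $T\nearrow\mathbb{R}^2$ means the limit as $N\to\infty$ along the dilated rectangles $T^{(N)}=\{Nt:t\in T\}$ of a fixed rectangle $T$. **Variance function.** With $\rho(t)=r(t)/\sigma_g^2$, $$v(u)=\frac1{2\pi}\int_{\mathbb{R}^2}\int_0^{\rho(t)}\frac{1}{\sqrt{1-r^2}}\exp\left\{-\frac{u^2}{\sigma_g^2(1+r)}\right\}dr\,dt,\quad u\in\mathbb{R}.$$ **Wasserstein distance.** $d_W(Z_1,Z_2)=\sup_{h\in\mathcal{H}}|\mathbb{E}[h(Z_1)]-\mathbb{E}[h(Z_2)]|$, where $\mathcal{H}$ is the set of Lipschitz functions $\mathbb{R}\to\mathbb{R}$ with Lipschitz constant $\le1$. *)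

theory Defs
  imports "HOL-Probability.Probability"
begin

section \<open>Gaussian random variables and fields\<close>

text \<open>Law of \<open>m + sqrt v * N\<close> with \<open>N\<close> standard normal; for \<open>v = 0\<close> it is the Dirac measure at \<open>m\<close>.\<close>

definition gaussian_law :: "real \<Rightarrow> real \<Rightarrow> real measure" where
  "gaussian_law m v = distr std_normal_distribution borel (\<lambda>z. m + sqrt v * z)"

definition gaussian_rv :: "'a measure \<Rightarrow> ('a \<Rightarrow> real) \<Rightarrow> bool" where
  "gaussian_rv M Y \<longleftrightarrow>
     Y \<in> borel_measurable M \<and> (\<exists>m v. 0 \<le> v \<and> distr M borel Y = gaussian_law m v)"

definition gaussian_field :: "'a measure \<Rightarrow> ('t \<Rightarrow> 'a \<Rightarrow> real) \<Rightarrow> bool" where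
  "gaussian_field M g \<longleftrightarrow>
     (\<forall>S c. finite S \<longrightarrow> gaussian_rv M (\<lambda>\<omega>. \<Sum>t\<in>S. c t * g t \<omega>))"

definition covariance :: "'a measure \<Rightarrow> ('a \<Rightarrow> real) \<Rightarrow> ('a \<Rightarrow> real) \<Rightarrow> real" where
  "covariance M X Y =
     (\<integral>\<omega>. (X \<omega> - (\<integral>\<omega>'. X \<omega>' \<partial>M)) * (Y \<omega> - (\<integral>\<omega>'. Y \<omega>' \<partial>M)) \<partial>M)"

definition covariance_matrix :: "'a measure \<Rightarrow> ('a \<Rightarrow> real^'n) \<Rightarrow> real^'n^'n" where
  "covariance_matrix M G = (\<chi> i j. covariance M (\<lambda>\<omega>. G \<omega> $ i) (\<lambda>\<omega>. G \<omega> $ j))"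

definition covariance_function ::
  "'a measure \<Rightarrow> ('t::zero \<Rightarrow> 'a \<Rightarrow> real) \<Rightarrow> 't \<Rightarrow> real" where
  "covariance_function M g t = covariance M (g 0) (g t)"

text \<open>The law of a field is taken on the product \<open>\<sigma>\<close>-algebra, where it is determined by the
  finite-dimensional distributions.\<close>

definition field_law :: "'a measure \<Rightarrow> ('t \<Rightarrow> 'a \<Rightarrow> real) \<Rightarrow> ('t \<Rightarrow> real) measure" where
  "field_law M g = distr M (\<Pi>\<^sub>M t\<in>UNIV. borel) (\<lambda>\<omega> t. g t \<omega>)"

definition stationary_field :: "'a measure \<Rightarrow> (real^'n \<Rightarrow> 'a \<Rightarrow> real) \<Rightarrow> bool" where
  "stationary_field M g \<longleftrightarrow> (\<forall>s. field_law M (\<lambda>t. g (s + t)) = field_law M g)"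

definition isotropic_field :: "'a measure \<Rightarrow> (real^'n \<Rightarrow> 'a \<Rightarrow> real) \<Rightarrow> bool" where
  "isotropic_field M g \<longleftrightarrow>
     (\<forall>Q. rotation_matrix Q \<longrightarrow> field_law M (\<lambda>t. g (Q *v t)) = field_law M g)"

text \<open>Mean-square gradient. A Gaussian field with covariance function of class \<open>C\<^sup>2\<close> always has one,
  and it coincides almost surely with the gradient of the sample paths where these are
  differentiable.\<close>

definition has_ms_gradient ::
  "'a measure \<Rightarrow> (real^'n \<Rightarrow> 'a \<Rightarrow> real) \<Rightarrow> real^'n \<Rightarrow> ('a \<Rightarrow> real^'n) \<Rightarrow> bool" where
  "has_ms_gradient M g t G \<longleftrightarrow>
     G \<in> borel_measurable M \<and> integrable M (\<lambda>\<omega>. (norm (G \<omega>))\<^sup>2) \<and>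
     ((\<lambda>h. (\<integral>\<omega>. (g (t + h) \<omega> - g t \<omega> - G \<omega> \<bullet> h)\<^sup>2 \<partial>M) / (norm h)\<^sup>2) \<longlongrightarrow> 0) (at 0)"

primrec C_k :: "nat \<Rightarrow> ('v::euclidean_space \<Rightarrow> real) \<Rightarrow> bool" where
  "C_k 0 r \<longleftrightarrow> continuous_on UNIV r"
| "C_k (Suc k) r \<longleftrightarrow>
     (\<forall>t. r differentiable (at t)) \<and> (\<forall>e. C_k k (\<lambda>t. frechet_derivative r (at t) e))"

text \<open>Independence of the generated \<open>\<sigma>\<close>-algebras. The library's \<open>indep_var\<close> requires \<open>X\<close> and \<open>g\<close>
  to take values in the same type.\<close>

definition indep_of_field :: "'a measure \<Rightarrow> ('a \<Rightarrow> real) \<Rightarrow> ('t \<Rightarrow> 'a \<Rightarrow> real) \<Rightarrow> bool" where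
  "indep_of_field M X g \<longleftrightarrow>
     prob_space.indep_set M
       (sets (vimage_algebra (space M) X borel))
       (sets (vimage_algebra (space M) (\<lambda>\<omega> t. g t \<omega>) (\<Pi>\<^sub>M t\<in>UNIV. borel)))"

section \<open>Excursion areas\<close>

text \<open>Rectangles need not be parallel to the axes nor contain their boundary.\<close>

definition rectangle :: "(real^2) set \<Rightarrow> bool" where
  "rectangle T \<longleftrightarrow>
     (\<exists>(Q :: real^2 \<Rightarrow> real^2) a b. orthogonal_transformation Q \<and> box a b \<noteq> {} \<and>
        Q ` box a b \<subseteq> T \<and> T \<subseteq> Q ` cbox a b)"

definition dilate :: "real \<Rightarrow> (real^2) set \<Rightarrow> (real^2) set" where
  "dilate N T = (\<lambda>t. N *\<^sub>R t) ` T"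

abbreviation area :: "(real^2) set \<Rightarrow> real" where
  "area \<equiv> measure lebesgue"

definition C2 :: "(real^2) set \<Rightarrow> (real^2 \<Rightarrow> 'a \<Rightarrow> real) \<Rightarrow> real \<Rightarrow> 'a \<Rightarrow> real" where
  "C2 T h u \<omega> = area {t \<in> T. u \<le> h t \<omega>} / area T"

definition Psi :: "real \<Rightarrow> real" where
  "Psi x = 1 / sqrt (2 * pi) * (LBINT t:{x..}. exp (- t\<^sup>2 / 2))"

text \<open>The density of excursions; see \<open>expectation_C2\<close> below.\<close>

definition C2_star :: "real \<Rightarrow> real \<Rightarrow> real" where
  "C2_star \<sigma> u = Psi (u / \<sigma>)"

definition perturbed_field ::
  "(real^2 \<Rightarrow> 'a \<Rightarrow> real) \<Rightarrow> ('a \<Rightarrow> real) \<Rightarrow> real \<Rightarrow> real^2 \<Rightarrow> 'a \<Rightarrow> real" where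
  "perturbed_field g X \<epsilon> t \<omega> = g t \<omega> + \<epsilon> * X \<omega>"

definition Z_stat ::
  "(real^2 \<Rightarrow> 'a \<Rightarrow> real) \<Rightarrow> ('a \<Rightarrow> real) \<Rightarrow> real \<Rightarrow> real \<Rightarrow> (real^2) set \<Rightarrow> real \<Rightarrow> 'a \<Rightarrow> real" where
  "Z_stat g X \<sigma> \<epsilon> T u \<omega> =
     sqrt (area T) * (C2 T (perturbed_field g X \<epsilon>) u \<omega> - C2_star \<sigma> (u - \<epsilon> * X \<omega>))"

text \<open>The inner integral is oriented: it is negative where \<open>r t < 0\<close>.\<close>

definition asymp_var :: "(real^2 \<Rightarrow> real) \<Rightarrow> real \<Rightarrow> real \<Rightarrow> real" where
  "asymp_var r \<sigma> u = 1 / (2 * pi) *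
     (\<integral>t. (LBINT s=0..ereal (r t / \<sigma>\<^sup>2).
        1 / sqrt (1 - s\<^sup>2) * exp (- (u\<^sup>2 / (\<sigma>\<^sup>2 * (1 + s))))) \<partial>lborel)"

section \<open>Conditional distributions and Wasserstein distance\<close>

text \<open>The Markov kernel \<open>K\<close> is a regular conditional distribution of \<open>Y\<close> given \<open>X\<close>.\<close>

definition cond_distribution ::
  "'a measure \<Rightarrow> ('a \<Rightarrow> real) \<Rightarrow> ('a \<Rightarrow> real) \<Rightarrow> (real \<Rightarrow> real measure) \<Rightarrow> bool" where
  "cond_distribution M X Y K \<longleftrightarrow>
     X \<in> borel_measurable M \<and> Y \<in> borel_measurable M \<and>
     K \<in> borel \<rightarrow>\<^sub>M prob_algebra borel \<and>
     (\<forall>A\<in>sets borel. \<forall>B\<in>sets borel.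
        emeasure M {\<omega> \<in> space M. X \<omega> \<in> A \<and> Y \<omega> \<in> B} =
        (\<integral>\<^sup>+x\<in>A. emeasure (K x) B \<partial>distr M borel X))"

text \<open>With values in \<open>[0, \<infinity>]\<close>, so that the supremum always has its usual meaning.\<close>

definition wasserstein :: "'a measure \<Rightarrow> ('a \<Rightarrow> real) \<Rightarrow> ('a \<Rightarrow> real) \<Rightarrow> ennreal" where
  "wasserstein M Z1 Z2 =
     (SUP h\<in>{h. lipschitz_on 1 UNIV h}.
        ennreal \<bar>(\<integral>\<omega>. h (Z1 \<omega>) \<partial>M) - (\<integral>\<omega>. h (Z2 \<omega>) \<partial>M)\<bar>)"

section \<open>The expected excursion area\<close>

lemma gaussian_law_moments:
  shows expectation_gaussian_law: "(\<integral>x. x \<partial>gaussian_law m v) = m"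
    and variance_gaussian_law: "0 \<le> v \<Longrightarrow> (\<integral>x. (x - m)\<^sup>2 \<partial>gaussian_law m v) = v"
proof -
  interpret N: prob_space std_normal_distribution
    by (rule prob_space_normal_density) simp
  have i1: "integrable std_normal_distribution (\<lambda>z. z)"
    using integrable_std_normal_distribution_moment[of 1] by simp
  have e1: "(\<integral>z. z \<partial>std_normal_distribution) = 0"
    using integral_std_normal_distribution_moment_odd[of 1] by simp
  have e2: "(\<integral>z. z\<^sup>2 \<partial>std_normal_distribution) = 1"
    using std_normal_distribution_even_moments(1)[of 1] by simp
  have "(\<integral>x. x \<partial>gaussian_law m v) = (\<integral>z. m + sqrt v * z \<partial>std_normal_distribution)"
    unfolding gaussian_law_def by (subst integral_distr) auto
  also have "\<dots> = m" using i1 e1 N.prob_space by simp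
  finally show "(\<integral>x. x \<partial>gaussian_law m v) = m" .
  assume "0 \<le> v"
  have "(\<integral>x. (x - m)\<^sup>2 \<partial>gaussian_law m v) = (\<integral>z. v * z\<^sup>2 \<partial>std_normal_distribution)"
    unfolding gaussian_law_def
    by (subst integral_distr) (auto simp: power_mult_distrib \<open>0 \<le> v\<close>)
  also have "\<dots> = v" using e2 by simp
  finally show "(\<integral>x. (x - m)\<^sup>2 \<partial>gaussian_law m v) = v" .
qed

lemma measure_gaussian_law_atLeast:
  assumes "0 < \<sigma>"
  shows "measure (gaussian_law 0 (\<sigma>\<^sup>2)) {u..} = Psi (u / \<sigma>)"
proof -
  have "measure (gaussian_law 0 (\<sigma>\<^sup>2)) {u..} =
      measure std_normal_distribution ((\<lambda>z. \<sigma> * z) -` {u..} \<inter> space std_normal_distribution)"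
    unfolding gaussian_law_def using assms by (subst measure_distr) auto
  also have "(\<lambda>z. \<sigma> * z) -` {u..} \<inter> space std_normal_distribution = {u / \<sigma>..}"
    using assms by (auto simp: field_simps)
  also have "measure std_normal_distribution {u / \<sigma>..} =
      (\<integral>z. indicator {u / \<sigma>..} z \<partial>std_normal_distribution)"
    by simp
  also have "\<dots> = (\<integral>z. std_normal_density z *\<^sub>R indicator {u / \<sigma>..} z \<partial>lborel)"
    by (subst integral_density) auto
  also have "\<dots> = (\<integral>z. (1 / sqrt (2 * pi)) *
      (indicator {u / \<sigma>..} z *\<^sub>R exp (- z\<^sup>2 / 2)) \<partial>lborel)"
    by (rule Bochner_Integration.integral_cong) (auto simp: std_normal_density_def)
  also have "\<dots> = Psi (u / \<sigma>)"
    unfolding Psi_def set_lebesgue_integral_def by simp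
  finally show ?thesis .
qed

lemma expectation_C2:
  fixes g :: "real^2 \<Rightarrow> 'a \<Rightarrow> real"
  assumes "prob_space M"
    and g: "(\<lambda>(t, \<omega>). g t \<omega>) \<in> borel_measurable (borel \<Otimes>\<^sub>M M)"
    and "gaussian_field M g" "stationary_field M g"
    and "(\<integral>\<omega>. g 0 \<omega> \<partial>M) = 0" "covariance M (g 0) (g 0) = \<sigma>\<^sup>2" "0 < \<sigma>"
    and T: "T \<in> sets borel" "emeasure lborel T < \<infinity>" "0 < area T"
  shows "(\<integral>\<omega>. C2 T g u \<omega> \<partial>M) = C2_star \<sigma> u"
proof -
  interpret prob_space M by fact
  have [measurable]: "g t \<in> borel_measurable M" for t
    using measurable_compose[OF measurable_Pair1' g, of t] by simp
  have dist: "distr M borel (g t) = distr M borel (g 0)" for t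
  proof -
    have meas: "(\<lambda>\<omega> s. h s \<omega>) \<in> M \<rightarrow>\<^sub>M (\<Pi>\<^sub>M s\<in>UNIV. borel)"
      if "\<And>s. h s \<in> borel_measurable M" for h :: "real^2 \<Rightarrow> 'a \<Rightarrow> real"
      by (rule measurable_PiM_single') (use that in \<open>auto simp: space_PiM\<close>)
    have proj: "(\<lambda>x. x 0) \<in> (\<Pi>\<^sub>M s\<in>UNIV. borel) \<rightarrow>\<^sub>M (borel :: real measure)"
      by (rule measurable_component_singleton) simp
    have pr: "distr (field_law M h) borel (\<lambda>x. x 0) = distr M borel (h 0)"
      if "\<And>s. h s \<in> borel_measurable M" for h :: "real^2 \<Rightarrow> 'a \<Rightarrow> real"
      unfolding field_law_def
      by (subst distr_distr[OF proj meas[OF that]]) (simp add: o_def)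
    have "field_law M (\<lambda>s. g (t + s)) = field_law M g"
      using assms(4) by (simp add: stationary_field_def)
    then show ?thesis
      using pr[of "\<lambda>s. g (t + s)"] pr[of g] by simp
  qed
  have "gaussian_rv M (g 0)"
    using assms(3)[unfolded gaussian_field_def, rule_format, of "{0}" "\<lambda>_. 1"] by simp
  then obtain m v where v: "0 \<le> v" and mv: "distr M borel (g 0) = gaussian_law m v"
    by (auto simp: gaussian_rv_def)
  have "m = (\<integral>\<omega>. g 0 \<omega> \<partial>M)"
    using expectation_gaussian_law[of m v] unfolding mv[symmetric] by (subst (asm) integral_distr) auto
  with assms(5) have m: "m = 0" by simp
  have "v = (\<integral>\<omega>. (g 0 \<omega>)\<^sup>2 \<partial>M)"
    using variance_gaussian_law[OF v, of m] unfolding mv[symmetric]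
    by (subst (asm) integral_distr) (auto simp: m)
  with assms(5,6) have "v = \<sigma>\<^sup>2" by (simp add: covariance_def power2_eq_square)
  with m mv have law: "distr M borel (g 0) = gaussian_law 0 (\<sigma>\<^sup>2)" by simp
  have prob_ge: "emeasure M {\<omega> \<in> space M. u \<le> g t \<omega>} = ennreal (C2_star \<sigma> u)" for t
  proof -
    have "measure (distr M borel (g t)) {u..} = C2_star \<sigma> u"
      using measure_gaussian_law_atLeast[OF \<open>0 < \<sigma>\<close>, of u] dist[of t] law
      by (simp add: C2_star_def)
    moreover have "measure (distr M borel (g t)) {u..} = measure M {\<omega> \<in> space M. u \<le> g t \<omega>}"
      by (subst measure_distr) (auto intro!: arg_cong[where f = "measure M"])
    ultimately show ?thesis by (simp add: emeasure_eq_measure)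
  qed
  have nonneg: "0 \<le> C2_star \<sigma> u"
    using measure_gaussian_law_atLeast[OF \<open>0 < \<sigma>\<close>, of u] measure_nonneg[of "gaussian_law 0 (\<sigma>\<^sup>2)"]
    by (metis C2_star_def)
  interpret P: pair_sigma_finite lborel M
    by (rule pair_sigma_finite.intro) (unfold_locales)
  let ?E = "{p \<in> space (lborel \<Otimes>\<^sub>M M). fst p \<in> T \<and> u \<le> g (fst p) (snd p)}"
  have g': "(\<lambda>p. g (fst p) (snd p)) \<in> borel_measurable (lborel \<Otimes>\<^sub>M M)"
    using g by (simp add: case_prod_beta' cong: measurable_cong_sets sets_pair_measure_cong)
  have [measurable]: "T \<in> sets lborel" using T by simp
  have E: "?E \<in> sets (lborel \<Otimes>\<^sub>M M)"
    using g' by measurable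
  have sec: "{t \<in> T. u \<le> g t \<omega>} \<in> sets lborel" if "\<omega> \<in> space M" for \<omega>
  proof -
    have "(\<lambda>t. (t, \<omega>)) -` ?E = {t \<in> T. u \<le> g t \<omega>}"
      using that by (auto simp: space_pair_measure)
    then show ?thesis using sets_Pair2[OF E, of \<omega>] by simp
  qed
  have fin: "emeasure lborel {t \<in> T. u \<le> g t \<omega>} < \<infinity>" for \<omega>
    using emeasure_mono[of "{t \<in> T. u \<le> g t \<omega>}" T lborel] T(1,2)
    by (auto simp: less_top[symmetric] top_unique)
  let ?a = "\<lambda>\<omega>. emeasure lborel {t \<in> T. u \<le> g t \<omega>}"
  have am: "?a \<in> borel_measurable M"
  proof -
    have "(\<lambda>\<omega>. emeasure lborel ((\<lambda>t. (t, \<omega>)) -` ?E)) \<in> borel_measurable M"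
      by (rule P.measurable_emeasure_Pair2[OF E])
    then show ?thesis
      by (rule measurable_cong[THEN iffD1, rotated])
        (auto simp: space_pair_measure intro!: arg_cong[where f = "emeasure lborel"])
  qed
  have "(\<integral>\<^sup>+\<omega>. ?a \<omega> \<partial>M) = emeasure (lborel \<Otimes>\<^sub>M M) ?E"
    unfolding P.emeasure_pair_measure_alt2[OF E]
    by (rule nn_integral_cong)
      (auto simp: space_pair_measure intro!: arg_cong[where f = "emeasure lborel"])
  also have "\<dots> = (\<integral>\<^sup>+t. emeasure M (Pair t -` ?E) \<partial>lborel)"
    by (rule emeasure_pair_measure_alt[OF E])
  also have "\<dots> = (\<integral>\<^sup>+t. ennreal (C2_star \<sigma> u) * indicator T t \<partial>lborel)"
  proof (rule nn_integral_cong)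
    fix t :: "real^2"
    have "Pair t -` ?E = (if t \<in> T then {\<omega> \<in> space M. u \<le> g t \<omega>} else {})"
      by (auto simp: space_pair_measure)
    then show "emeasure M (Pair t -` ?E) = ennreal (C2_star \<sigma> u) * indicator T t"
      by (simp add: prob_ge)
  qed
  also have "\<dots> = ennreal (C2_star \<sigma> u) * emeasure lborel T"
    by (rule nn_integral_cmult_indicator) (simp add: T(1))
  also have "\<dots> = ennreal (C2_star \<sigma> u * measure lborel T)"
    using T(2) nonneg by (simp add: ennreal_mult emeasure_eq_ennreal_measure less_top[symmetric])
  finally have tot: "(\<integral>\<^sup>+\<omega>. ?a \<omega> \<partial>M) = ennreal (C2_star \<sigma> u * measure lborel T)" .
  have area: "area {t \<in> T. u \<le> g t \<omega>} = enn2real (?a \<omega>)" if "\<omega> \<in> space M" for \<omega>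
    using sec[OF that] by (simp add: measure_def)
  have "(\<integral>\<omega>. area {t \<in> T. u \<le> g t \<omega>} \<partial>M) = (\<integral>\<omega>. enn2real (?a \<omega>) \<partial>M)"
    by (rule Bochner_Integration.integral_cong) (auto simp: area)
  also have "\<dots> = enn2real (\<integral>\<^sup>+\<omega>. ennreal (enn2real (?a \<omega>)) \<partial>M)"
    by (rule integral_eq_nn_integral) (use am in auto)
  also have "(\<integral>\<^sup>+\<omega>. ennreal (enn2real (?a \<omega>)) \<partial>M) = (\<integral>\<^sup>+\<omega>. ?a \<omega> \<partial>M)"
    using fin by (intro nn_integral_cong) auto
  also have "enn2real \<dots> = C2_star \<sigma> u * measure lborel T"
    unfolding tot using nonneg by simp
  finally have "(\<integral>\<omega>. area {t \<in> T. u \<le> g t \<omega>} \<partial>M) = C2_star \<sigma> u * area T"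
    using T by simp
  then show ?thesis
    using T(3) by (simp add: C2_def[abs_def])
qed

end

theory Submission
  imports Defs
begin

text \<open>
  Conditionally on \<open>X\<close> the level is deterministic, so a bound uniform in the level suffices. Let
  \<open>W\<close> be a Riemann sum of the normalised excursion area, with indicators smoothed at scale
  \<open>\<delta>\<close>. A smoothed indicator \<open>\<phi>\<close> has an explicit Stein kernel \<open>\<kappa>\<close>, and Gaussian integration by parts gives
  \<open>E (W F W) = E (\<Gamma> F' W)\<close> with \<open>\<Gamma>\<close> a double sum of products \<open>\<kappa> (g s) \<phi>' (g t)\<close> weighted by the
  covariance. Testing with complex exponentials turns this into a differential equation for the
  characteristic function of \<open>W\<close>, which is thus close to a Gaussian one if \<open>\<Gamma>\<close> has small variance. That variance is a sum
  of covariances over four points, bounded by Fourier inversion and the integrability of \<open>r\<close>.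
  Truncating and mollifying the test function leads from characteristic functions to the Wasserstein distance. Sheppard's formula identifies the limit
  variance, and the variance on a finite convex region differs from it by a boundary term. The
  resulting rate is polynomial in the area, so the logarithmic one follows.\<close>

section \<open>Gaussian families\<close>

text \<open>Finite families of \<open>g\<close> may have a singular covariance matrix, so no joint
  density is used: laws are handled through characteristic functions of linear combinations, and
  integration by parts through regression on one coordinate. The limit variance is not bounded below
  over all levels; the characteristic function argument never divides by it, which keeps the
  constants independent of the level, hence of \<epsilon> and u. Independence of \<open>X\<close>
  and \<open>g\<close> lives on the product sigma-algebra, whose sets depend on countably many sites
  only; therefore the level is conditioned on at finitely many lattice points, after the region has
  been replaced by the lattice at the random level. The central limit bound does not contain the
  mesh, so the mesh may be refined after the area A is fixed. With smoothing width \<delta> the form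
  \<Gamma> has standard deviation of order A^(-1/2) \<delta>^(-3), while smoothing costs
  \<delta>^(1/2) in L2; \<delta> = A^(-1/12) makes both of them negative powers of A, and truncating
  at A^(1/32) and mollifying at A^(-1/32) fixes the final exponent -1/32.\<close>

lemma weighted_law_unique:
  fixes M :: "'a measure" and M' :: "'b measure"
  assumes M: "prob_space M" and M': "prob_space M'"
    and [measurable]: "U \<in> borel_measurable M" "Y \<in> borel_measurable M"
      "U' \<in> borel_measurable M'" "Y' \<in> borel_measurable M'"
    and bU: "\<And>\<omega>. \<bar>U \<omega>\<bar> \<le> (1::real)" and bU': "\<And>\<omega>. \<bar>U' \<omega>\<bar> \<le> (1::real)"
    and c: "\<And>t. (CLINT \<omega>|M. iexp (t * Y \<omega>)) = (CLINT \<omega>|M'. iexp (t * Y' \<omega>))"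
    and cU: "\<And>t. (CLINT \<omega>|M. U \<omega> *\<^sub>R iexp (t * Y \<omega>)) = (CLINT \<omega>|M'. U' \<omega> *\<^sub>R iexp (t * Y' \<omega>))"
    and A [measurable]: "A \<in> sets borel"
  shows "(\<integral>\<omega>. U \<omega> * indicator A (Y \<omega>) \<partial>M) = (\<integral>\<omega>. U' \<omega> * indicator A (Y' \<omega>) \<partial>M')"
proof -
  \<comment> \<open>Levy's uniqueness theorem concerns probability laws, while \<open>U\<close> is a
    signed weight. As \<open>\<bar>U\<bar> \<le> 1\<close>, the shifted weight \<open>U + k\<close>
    with \<open>k = 2\<close> is positive and can be normalised to a density. The laws of
    \<open>Y\<close> and \<open>Y'\<close> under these densities agree, and the unweighted term,
    equal on both sides by \<open>eqY\<close>, is subtracted at the end.\<close>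
  have **: "real_distribution (distr (density N (\<lambda>\<omega>. ennreal ((u \<omega> + k) / (\<integral>\<omega>. u \<omega> + k \<partial>N)))) borel y)"
    (is "real_distribution (distr (density N ?f) borel y)")
    "char (distr (density N (\<lambda>\<omega>. ennreal ((u \<omega> + k) / (\<integral>\<omega>. u \<omega> + k \<partial>N)))) borel y) t =
        ((CLINT \<omega>|N. u \<omega> *\<^sub>R iexp (t * y \<omega>)) + of_real k * (CLINT \<omega>|N. iexp (t * y \<omega>))) / of_real ((\<integral>\<omega>. u \<omega> \<partial>N) + k)"
    "measure (distr (density N (\<lambda>\<omega>. ennreal ((u \<omega> + k) / (\<integral>\<omega>. u \<omega> + k \<partial>N)))) borel y) A =
        ((\<integral>\<omega>. u \<omega> * indicator A (y \<omega>) \<partial>N) + k * (\<integral>\<omega>. indicator A (y \<omega>) \<partial>N)) / ((\<integral>\<omega>. u \<omega> \<partial>N) + k)"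
    "(\<integral>\<omega>. u \<omega> \<partial>N) + k > 0"
    if N: "prob_space N" and [measurable]: "u \<in> borel_measurable N" "y \<in> borel_measurable N"
      and bu: "\<And>\<omega>. \<bar>u \<omega>\<bar> \<le> (1::real)" and k: "k = (2::real)" for N :: "'c measure" and u y k t
  proof -
    interpret N: prob_space N by fact
    have iu: "integrable N u" by (rule N.integrable_const_bound[of _ 1]) (auto simp: bu)
    have e: "(\<integral>\<omega>. u \<omega> + k \<partial>N) = (\<integral>\<omega>. u \<omega> \<partial>N) + k" using iu by (simp add: N.prob_space)
    have "(\<integral>\<omega>. -1 \<partial>N) \<le> (\<integral>\<omega>. u \<omega> \<partial>N)"
      using iu by (intro integral_mono) (use bu in \<open>auto simp: abs_le_iff minus_le_iff\<close>)
    then have pos: "(\<integral>\<omega>. u \<omega> \<partial>N) + k > 0" by (simp add: N.prob_space k)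
    then show "(\<integral>\<omega>. u \<omega> \<partial>N) + k > 0" .
    have nn: "0 \<le> (u \<omega> + k) / ((\<integral>\<omega>. u \<omega> \<partial>N) + k)" for \<omega>
      using pos bu[of \<omega>] by (intro divide_nonneg_pos) (auto simp: k abs_le_iff)
    have mf: "?f \<in> borel_measurable N" by measurable
    have "(\<integral>\<^sup>+\<omega>. ?f \<omega> \<partial>N) = ennreal (\<integral>\<omega>. (u \<omega> + k) / ((\<integral>\<omega>. u \<omega> \<partial>N) + k) \<partial>N)"
      unfolding e using nn iu by (intro nn_integral_eq_integral) auto
    also have "\<dots> = 1" using pos iu by (simp add: N.prob_space e)
    finally have p: "prob_space (density N ?f)"
      by (intro prob_spaceI) (simp add: emeasure_density mf cong: nn_integral_cong)
    then show "real_distribution (distr (density N ?f) borel y)"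
      by (intro prob_space.real_distribution_distr) auto
    have ii: "integrable N (\<lambda>\<omega>. iexp (t * y \<omega>))"
      by (rule N.integrable_iexp) auto
    have iui: "integrable N (\<lambda>\<omega>. u \<omega> *\<^sub>R iexp (t * y \<omega>))"
      by (rule N.integrable_const_bound[of _ 1]) (auto simp: bu)
    have "char (distr (density N ?f) borel y) t =
        (CLINT \<omega>|N. ((u \<omega> + k) / ((\<integral>\<omega>. u \<omega> \<partial>N) + k)) *\<^sub>R iexp (t * y \<omega>))"
      unfolding char_def by (subst integral_distr, simp, simp, subst integral_density) (auto simp: nn e)
    also have "\<dots> = (CLINT \<omega>|N. (1 / ((\<integral>\<omega>. u \<omega> \<partial>N) + k)) *\<^sub>R (u \<omega> *\<^sub>R iexp (t * y \<omega>) + k *\<^sub>R iexp (t * y \<omega>)))"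
      by (intro Bochner_Integration.integral_cong) (auto simp: scaleR_conv_of_real field_simps)
    also have "\<dots> = (1 / ((\<integral>\<omega>. u \<omega> \<partial>N) + k)) *\<^sub>R ((CLINT \<omega>|N. u \<omega> *\<^sub>R iexp (t * y \<omega>)) + k *\<^sub>R (CLINT \<omega>|N. iexp (t * y \<omega>)))"
      using ii iui by simp
    finally show "char (distr (density N ?f) borel y) t = ((CLINT \<omega>|N. u \<omega> *\<^sub>R iexp (t * y \<omega>)) +
      of_real k * (CLINT \<omega>|N. iexp (t * y \<omega>))) / of_real ((\<integral>\<omega>. u \<omega> \<partial>N) + k)"
      by (simp add: scaleR_conv_of_real)
    interpret D: prob_space "density N ?f" by (rule p)
    have "measure (distr (density N ?f) borel y) A = (\<integral>x. indicator A x \<partial>distr (density N ?f) borel y)"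
      by simp
    also have "\<dots> = (\<integral>\<omega>. ((u \<omega> + k) / ((\<integral>\<omega>. u \<omega> \<partial>N) + k)) *\<^sub>R indicator A (y \<omega>) \<partial>N)"
      by (subst integral_distr, simp, simp, subst integral_density) (auto simp: nn e)
    also have "\<dots> = (\<integral>\<omega>. (1 / ((\<integral>\<omega>. u \<omega> \<partial>N) + k)) * (u \<omega> * indicator A (y \<omega>) + k * indicator A (y \<omega>)) \<partial>N)"
      by (intro Bochner_Integration.integral_cong) (auto simp: field_simps)
    also have "\<dots> = (1 / ((\<integral>\<omega>. u \<omega> \<partial>N) + k)) * ((\<integral>\<omega>. u \<omega> * indicator A (y \<omega>) \<partial>N) + k * (\<integral>\<omega>. indicator A (y \<omega>) \<partial>N))"
    proof -
      have "integrable N (\<lambda>\<omega>. u \<omega> * indicator A (y \<omega>))" "integrable N (\<lambda>\<omega>. indicator A (y \<omega>) :: real)"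
        by (rule N.integrable_const_bound[of _ 1]; auto simp: bu indicator_def)+
      then show ?thesis by simp
    qed
    finally show "measure (distr (density N ?f) borel y) A = ((\<integral>\<omega>. u \<omega> * indicator A (y \<omega>) \<partial>N) +
      k * (\<integral>\<omega>. indicator A (y \<omega>) \<partial>N)) / ((\<integral>\<omega>. u \<omega> \<partial>N) + k)" by simp
  qed
  have eqY: "(\<integral>\<omega>. indicator A (Y \<omega>) \<partial>M) = (\<integral>\<omega>. indicator A (Y' \<omega>) \<partial>M' :: real)"
  proof -
    have "distr M borel Y = distr M' borel Y'"
      using c by (intro Levy_uniqueness prob_space.real_distribution_distr M M')
        (auto simp: char_def fun_eq_iff integral_distr)
    then have "(\<integral>x. indicator A x \<partial>distr M borel Y) = (\<integral>x. indicator A x \<partial>distr M' borel Y' :: real)"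
      by simp
    then show ?thesis by (simp add: integral_distr del: Bochner_Integration.integral_indicator)
  qed
  have eqU: "(\<integral>\<omega>. U \<omega> \<partial>M) = (\<integral>\<omega>. U' \<omega> \<partial>M')"
    using cU[of 0] by (simp add: scaleR_conv_of_real)
  let ?D = "distr (density M (\<lambda>\<omega>. ennreal ((U \<omega> + 2) / (\<integral>\<omega>. U \<omega> + 2 \<partial>M)))) borel Y"
  let ?D' = "distr (density M' (\<lambda>\<omega>. ennreal ((U' \<omega> + 2) / (\<integral>\<omega>. U' \<omega> + 2 \<partial>M')))) borel Y'"
  have "?D = ?D'"
    by (intro Levy_uniqueness **(1) M M' bU bU' ext)
      (simp_all only: **(2)[OF M _ _ bU] **(2)[OF M' _ _ bU'] c cU eqU assms)
  then have "measure ?D A = measure ?D' A" by simp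
  then show ?thesis
    using **(4)[OF M assms(3,4) bU refl] **(4)[OF M' assms(5,6) bU' refl]
    by (simp add: **(3)[OF M _ _ bU] **(3)[OF M' _ _ bU'] eqU eqY del: Bochner_Integration.integral_indicator)
qed


text \<open>A Cramer-Wold argument that needs uniqueness only on the line: in the joint
  characteristic function the exponential of one coordinate after another is exchanged for the
  indicator of a Borel set, until only the probability of a box is left.\<close>

lemma finite_dim_law_unique:
  fixes X :: "'i \<Rightarrow> 'a \<Rightarrow> real" and X' :: "'i \<Rightarrow> 'b \<Rightarrow> real"
  assumes M: "prob_space M" and M': "prob_space M'" and I: "finite I"
    and X [measurable]: "\<And>i. i \<in> I \<Longrightarrow> X i \<in> borel_measurable M"
    and X' [measurable]: "\<And>i. i \<in> I \<Longrightarrow> X' i \<in> borel_measurable M'"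
    and c: "\<And>c. (CLINT \<omega>|M. iexp (\<Sum>i\<in>I. c i * X i \<omega>)) = (CLINT \<omega>|M'. iexp (\<Sum>i\<in>I. c i * X' i \<omega>))"
  shows "distr M (Pi\<^sub>M I (\<lambda>_. borel)) (\<lambda>\<omega>. \<lambda>i\<in>I. X i \<omega>) =
    distr M' (Pi\<^sub>M I (\<lambda>_. borel)) (\<lambda>\<omega>. \<lambda>i\<in>I. X' i \<omega>)"
proof -
  interpret M: prob_space M by fact
  interpret M': prob_space M' by fact
  \<comment> \<open>\<open>J\<close> holds the coordinates already exchanged: \<open>J = {}\<close>
    is the hypothesis \<open>c\<close>, and \<open>J = I\<close> gives the boxes that determine the
    product measure.\<close>
  have step: "(CLINT \<omega>|M. (\<Prod>j\<in>J. indicator (A j) (X j \<omega>)) *\<^sub>R iexp (\<Sum>i\<in>I - J. c i * X i \<omega>)) =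
    (CLINT \<omega>|M'. (\<Prod>j\<in>J. indicator (A j) (X' j \<omega>)) *\<^sub>R iexp (\<Sum>i\<in>I - J. c i * X' i \<omega>))"
    if "finite J" "J \<subseteq> I" "\<And>j. j \<in> J \<Longrightarrow> A j \<in> sets borel" for J A c
    using that
  proof (induction J arbitrary: c rule: finite_induct)
    case empty
    then show ?case using c[of c] by simp
  next
    case (insert k J)
    have kI: "k \<in> I" and JI: "J \<subseteq> I" and Ak [measurable]: "A k \<in> sets borel"
      and AJ [measurable]: "\<And>j. j \<in> J \<Longrightarrow> A j \<in> sets borel" using insert by auto
    define K where "K = I - insert k J"
    have IJ: "I - J = insert k K" and kK: "k \<notin> K" and fK: "finite K" and KI: "K \<subseteq> I"
      using insert kI I by (auto simp: K_def)
    have K [measurable]: "\<And>j. j \<in> K \<Longrightarrow> X j \<in> borel_measurable M" "\<And>j. j \<in> K \<Longrightarrow> X' j \<in> borel_measurable M'"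
      and J [measurable]: "\<And>j. j \<in> J \<Longrightarrow> X j \<in> borel_measurable M" "\<And>j. j \<in> J \<Longrightarrow> X' j \<in> borel_measurable M'"
      and k [measurable]: "X k \<in> borel_measurable M" "X' k \<in> borel_measurable M'"
      using KI JI kI by auto
    define P P' where "P = (\<lambda>\<omega>. \<Prod>j\<in>J. indicator (A j) (X j \<omega>) :: real)"
      and "P' = (\<lambda>\<omega>. \<Prod>j\<in>J. indicator (A j) (X' j \<omega>) :: real)"
    define S S' where "S = (\<lambda>\<omega>. \<Sum>i\<in>K. c i * X i \<omega>)" and "S' = (\<lambda>\<omega>. \<Sum>i\<in>K. c i * X' i \<omega>)"
    have [measurable]: "P \<in> borel_measurable M" "S \<in> borel_measurable M"
      "P' \<in> borel_measurable M'" "S' \<in> borel_measurable M'"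
      unfolding P_def S_def P'_def S'_def by measurable
    have P01: "0 \<le> P \<omega>" "P \<omega> \<le> 1" for \<omega> unfolding P_def
      by (auto intro!: prod_nonneg prod_le_1)
    have P01': "0 \<le> P' \<omega>" "P' \<omega> \<le> 1" for \<omega> unfolding P'_def
      by (auto intro!: prod_nonneg prod_le_1)
    have IH: "(CLINT \<omega>|M. P \<omega> *\<^sub>R iexp (t * X k \<omega> + s * S \<omega>)) =
      (CLINT \<omega>|M'. P' \<omega> *\<^sub>R iexp (t * X' k \<omega> + s * S' \<omega>))" for t s
    proof -
      have "(\<Sum>i\<in>K. (if i = k then t else s * c i) * X i \<omega>) = s * S \<omega>" for \<omega>
        unfolding S_def sum_distrib_left using kK by (intro sum.cong) auto
      moreover have "(\<Sum>i\<in>K. (if i = k then t else s * c i) * X' i \<omega>) = s * S' \<omega>" for \<omega>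
        unfolding S'_def sum_distrib_left using kK by (intro sum.cong) auto
      ultimately show ?thesis
        using insert.IH[of "\<lambda>i. if i = k then t else s * c i"] JI AJ fK kK unfolding IJ
        by (simp add: P_def P'_def)
    qed
    have int: "integrable M (\<lambda>\<omega>. P \<omega> *\<^sub>R iexp (t * X k \<omega> + s * S \<omega>))" for t s
      by (rule M.integrable_const_bound[of _ 1]) (auto simp: P01 simp del: of_real_add of_real_mult)
    have int': "integrable M' (\<lambda>\<omega>. P' \<omega> *\<^sub>R iexp (t * X' k \<omega> + s * S' \<omega>))" for t s
      by (rule M'.integrable_const_bound[of _ 1]) (auto simp: P01' simp del: of_real_add of_real_mult)
    have ck: "(CLINT \<omega>|M. iexp (t * X k \<omega>)) = (CLINT \<omega>|M'. iexp (t * X' k \<omega>))" for t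
      using c[of "\<lambda>i. if i = k then t else 0"] kI I by (simp add: if_distrib[of "\<lambda>x. x * _"] cong: if_cong)
    \<comment> \<open>\<open>weighted_law_unique\<close> takes real weights, so the phase of the
      remaining sum \<open>S\<close> is split into cosine and sine. Each is a combination of the
      phases \<open>S\<close> and \<open>- S\<close>, for which \<open>IH\<close> holds with
      \<open>s = 1\<close> and \<open>s = -1\<close>.\<close>
    have cos1: "of_real (p * cos s) * iexp t =
        (1/2) * (of_real p * iexp (t + 1 * s)) + (1/2) * (of_real p * iexp (t + (-1) * s))"
      and sin1: "of_real (p * sin s) * iexp t =
        (-\<i>/2) * (of_real p * iexp (t + 1 * s)) - (-\<i>/2) * (of_real p * iexp (t + (-1) * s))" for p s t :: real
      unfolding cis_conv_exp[symmetric]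
      by (simp_all add: complex_eq_iff cos_add sin_add cos_diff sin_diff algebra_simps diff_divide_distrib add_divide_distrib)
    have Pc: "(\<integral>\<omega>. P \<omega> * cos (S \<omega>) * indicator (A k) (X k \<omega>) \<partial>M) =
      (\<integral>\<omega>. P' \<omega> * cos (S' \<omega>) * indicator (A k) (X' k \<omega>) \<partial>M')"
    proof (rule weighted_law_unique[OF M M' _ _ _ _ _ _ ck _ Ak])
      fix t
      show "(CLINT \<omega>|M. (P \<omega> * cos (S \<omega>)) *\<^sub>R iexp (t * X k \<omega>)) =
        (CLINT \<omega>|M'. (P' \<omega> * cos (S' \<omega>)) *\<^sub>R iexp (t * X' k \<omega>))"
        unfolding scaleR_conv_of_real cos1
        using int[of t 1] int[of t "-1"] int'[of t 1] int'[of t "-1"] IH[of t 1] IH[of t "-1"]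
        unfolding scaleR_conv_of_real
        by (subst (1 2) Bochner_Integration.integral_add) simp_all
    qed (use P01 P01' in \<open>auto simp: abs_mult intro!: mult_le_one\<close>)
    have Ps: "(\<integral>\<omega>. P \<omega> * sin (S \<omega>) * indicator (A k) (X k \<omega>) \<partial>M) =
      (\<integral>\<omega>. P' \<omega> * sin (S' \<omega>) * indicator (A k) (X' k \<omega>) \<partial>M')"
    proof (rule weighted_law_unique[OF M M' _ _ _ _ _ _ ck _ Ak])
      fix t
      show "(CLINT \<omega>|M. (P \<omega> * sin (S \<omega>)) *\<^sub>R iexp (t * X k \<omega>)) =
        (CLINT \<omega>|M'. (P' \<omega> * sin (S' \<omega>)) *\<^sub>R iexp (t * X' k \<omega>))"
        unfolding scaleR_conv_of_real sin1
        using int[of t 1] int[of t "-1"] int'[of t 1] int'[of t "-1"] IH[of t 1] IH[of t "-1"]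
        unfolding scaleR_conv_of_real
        by (subst (1 2) Bochner_Integration.integral_diff) simp_all
    qed (use P01 P01' in \<open>auto simp: abs_mult intro!: mult_le_one\<close>)
    have exp_eq: "(p * q) *\<^sub>R iexp s = of_real (p * cos s * q) + \<i> * of_real (p * sin s * q)" for p q s :: real
      by (simp add: cis_conv_exp[symmetric] complex_eq_iff)
    have i1: "integrable M (\<lambda>\<omega>. P \<omega> * cos (S \<omega>) * indicator (A k) (X k \<omega>))"
      "integrable M (\<lambda>\<omega>. P \<omega> * sin (S \<omega>) * indicator (A k) (X k \<omega>))"
      by (rule M.integrable_const_bound[of _ 1];
          use P01 in \<open>auto simp: abs_mult intro!: mult_le_one split: split_indicator\<close>)+
    have i2: "integrable M' (\<lambda>\<omega>. P' \<omega> * cos (S' \<omega>) * indicator (A k) (X' k \<omega>))"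
      "integrable M' (\<lambda>\<omega>. P' \<omega> * sin (S' \<omega>) * indicator (A k) (X' k \<omega>))"
      by (rule M'.integrable_const_bound[of _ 1];
          use P01' in \<open>auto simp: abs_mult intro!: mult_le_one split: split_indicator\<close>)+
    have "(CLINT \<omega>|M. (P \<omega> * indicator (A k) (X k \<omega>)) *\<^sub>R iexp (S \<omega>)) =
      (CLINT \<omega>|M'. (P' \<omega> * indicator (A k) (X' k \<omega>)) *\<^sub>R iexp (S' \<omega>))"
      unfolding exp_eq using i1 i2
      by (subst (1 2) Bochner_Integration.integral_add)
        (simp_all only: integral_complex_of_real complex_of_real_integrable_eq integral_mult_right_zero integrable_mult_right Pc Ps)
    then show ?case using insert.hyps
      by (simp add: K_def[symmetric] P_def P'_def S_def S'_def mult.commute)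
  qed
  have meas: "(\<lambda>\<omega>. \<lambda>i\<in>I. X i \<omega>) \<in> M \<rightarrow>\<^sub>M Pi\<^sub>M I (\<lambda>_. borel)"
    "(\<lambda>\<omega>. \<lambda>i\<in>I. X' i \<omega>) \<in> M' \<rightarrow>\<^sub>M Pi\<^sub>M I (\<lambda>_. borel)"
    by measurable
  show ?thesis
  proof (rule measure_eqI_PiM_finite[OF I])
    fix A :: "'i \<Rightarrow> real set" assume A: "\<And>i. i \<in> I \<Longrightarrow> A i \<in> sets borel"
    have P: "Pi\<^sub>E I A \<in> sets (Pi\<^sub>M I (\<lambda>_. borel))"
      using A I by (auto intro!: sets_PiM_I_finite)
    have e: "emeasure (distr M (Pi\<^sub>M I (\<lambda>_. borel)) (\<lambda>\<omega>. \<lambda>i\<in>I. x i \<omega>)) (Pi\<^sub>E I A) =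
      ennreal (\<integral>\<omega>. (\<Prod>j\<in>I. indicator (A j) (x j \<omega>)) \<partial>M)"
      if "prob_space M" and [measurable]: "\<And>i. i \<in> I \<Longrightarrow> x i \<in> borel_measurable M" for M :: "'c measure" and x
    proof -
      interpret N: prob_space M by fact
      have m: "(\<lambda>\<omega>. \<lambda>i\<in>I. x i \<omega>) \<in> M \<rightarrow>\<^sub>M Pi\<^sub>M I (\<lambda>_. borel)" by measurable
      have "(\<integral>\<omega>. (\<Prod>j\<in>I. indicator (A j) (x j \<omega>)) \<partial>M) =
        (\<integral>\<omega>. indicator ((\<lambda>\<omega>. \<lambda>i\<in>I. x i \<omega>) -` Pi\<^sub>E I A \<inter> space M) \<omega> \<partial>M :: real)"
        using I by (intro Bochner_Integration.integral_cong refl)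
          (auto simp: indicator_def PiE_iff prod_zero_iff)
      also have "\<dots> = measure M ((\<lambda>\<omega>. \<lambda>i\<in>I. x i \<omega>) -` Pi\<^sub>E I A \<inter> space M)"
        using measurable_sets[OF m P] by simp
      finally show ?thesis
        using P m by (simp add: emeasure_distr N.emeasure_eq_measure)
    qed
    have "complex_of_real (\<integral>\<omega>. (\<Prod>j\<in>I. indicator (A j) (X j \<omega>)) \<partial>M) =
        complex_of_real (\<integral>\<omega>. (\<Prod>j\<in>I. indicator (A j) (X' j \<omega>)) \<partial>M')"
      using step[OF I subset_refl A] by (simp add: scaleR_conv_of_real del: of_real_prod of_real_indicator)
    then show "emeasure (distr M (Pi\<^sub>M I (\<lambda>_. borel)) (\<lambda>\<omega>. \<lambda>i\<in>I. X i \<omega>)) (Pi\<^sub>E I A) =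
      emeasure (distr M' (Pi\<^sub>M I (\<lambda>_. borel)) (\<lambda>\<omega>. \<lambda>i\<in>I. X' i \<omega>)) (Pi\<^sub>E I A)"
      using e[OF M X] e[OF M' X'] by simp
  next
    show "range (\<lambda>_::nat. Pi\<^sub>E I (\<lambda>_. UNIV :: real set)) \<subseteq> prod_algebra I (\<lambda>_. borel)"
      using I by (auto intro!: prod_algebraI_finite)
    interpret D: prob_space "distr M (Pi\<^sub>M I (\<lambda>_. borel)) (\<lambda>\<omega>. \<lambda>i\<in>I. X i \<omega>)"
      by (rule M.prob_space_distr[OF meas(1)])
    show "emeasure (distr M (Pi\<^sub>M I (\<lambda>_. borel)) (\<lambda>\<omega>. \<lambda>i\<in>I. X i \<omega>)) (Pi\<^sub>E I (\<lambda>_. UNIV)) \<noteq> \<infinity>" for i :: nat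
      by simp
  qed (auto simp: space_PiM)
qed

section \<open>Gaussian families and regression on one coordinate\<close>

abbreviation std_normal :: "real measure" where "std_normal \<equiv> std_normal_distribution"

lemma prob_space_std_normal: "prob_space std_normal"
  by (rule prob_space_normal_density) simp

lemma integral_std_normal:
  fixes f :: "real \<Rightarrow> 'b::{banach, second_countable_topology}"
  assumes [measurable]: "f \<in> borel_measurable borel"
  shows "(\<integral>z. f z \<partial>std_normal) = (\<integral>z. std_normal_density z *\<^sub>R f z \<partial>lborel)"
  by (subst integral_density) auto

lemma char_std_normal_iexp: "(CLINT z|std_normal. iexp (t * z)) = of_real (exp (- (t\<^sup>2) / 2))"
  using char_std_normal_distribution by (simp add: char_def fun_eq_iff)

lemma integral_pair_mult:
  fixes f :: "'a \<Rightarrow> complex" and h :: "'b \<Rightarrow> complex"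
  assumes "prob_space N" "prob_space M"
    and [measurable]: "f \<in> borel_measurable N" "h \<in> borel_measurable M"
    and bf: "\<And>x. norm (f x) \<le> B" and bh: "\<And>x. norm (h x) \<le> B'"
  shows "(CLINT p|N \<Otimes>\<^sub>M M. f (fst p) * h (snd p)) = (CLINT x|N. f x) * (CLINT x|M. h x)"
proof -
  interpret N: prob_space N by fact
  interpret M: prob_space M by fact
  interpret P: pair_prob_space N M ..
  have "integrable (N \<Otimes>\<^sub>M M) (\<lambda>p. f (fst p) * h (snd p))"
    by (rule P.integrable_const_bound[of _ "B * B'"])
      (auto simp: norm_mult intro!: mult_mono bf bh order_trans[OF norm_ge_zero bf])
  from P.integral_fst'[OF this] show ?thesis by simp
qed

text \<open>The joint law is prescribed by the characteristic functions of linear combinations. This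
  admits singular matrices \<open>r\<close> and contains the zero means; the common variance
  \<open>\<sigma>\<^sup>2\<close> is what stationarity provides.\<close>

locale gauss_family = prob_space M for M :: "'a measure" +
  fixes I :: "'i set" and g :: "'i \<Rightarrow> 'a \<Rightarrow> real" and r :: "'i \<Rightarrow> 'i \<Rightarrow> real" and \<sigma> :: real
  assumes finite_I: "finite I"
    and g_measurable: "\<And>i. i \<in> I \<Longrightarrow> g i \<in> borel_measurable M"
    and char_g: "\<And>c. (CLINT \<omega>|M. iexp (\<Sum>i\<in>I. c i * g i \<omega>)) =
      of_real (exp (- (\<Sum>i\<in>I. \<Sum>j\<in>I. c i * c j * r i j) / 2))"
    and r_sym: "\<And>i j. i \<in> I \<Longrightarrow> j \<in> I \<Longrightarrow> r i j = r j i"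
    and r_diag: "\<And>i. i \<in> I \<Longrightarrow> r i i = \<sigma>\<^sup>2"
    and \<sigma>_pos: "0 < \<sigma>"
begin

text \<open>The residual \<open>g j - r i j / \<sigma>\<^sup>2 * g i\<close> is uncorrelated with
  \<open>g i\<close>, so replacing \<open>g i / \<sigma>\<close> by an independent standard normal
  variable preserves the joint law. Comparing characteristic functions shows this without
  densities.\<close>

lemma regression:
  assumes i: "i \<in> I"
  shows "distr M (Pi\<^sub>M I (\<lambda>_. borel)) (\<lambda>\<omega>. \<lambda>j\<in>I. g j \<omega>) =
    distr (std_normal \<Otimes>\<^sub>M M) (Pi\<^sub>M I (\<lambda>_. borel))
      (\<lambda>p. \<lambda>j\<in>I. r i j / \<sigma> * fst p + (g j (snd p) - r i j / \<sigma>\<^sup>2 * g i (snd p)))"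
proof (rule finite_dim_law_unique[OF prob_space_axioms _ finite_I])
  interpret N: prob_space std_normal by (rule prob_space_std_normal)
  interpret P: pair_prob_space std_normal M ..
  show "prob_space (std_normal \<Otimes>\<^sub>M M)" by (rule P.prob_space_axioms)
  note [measurable] = g_measurable
  show "(\<lambda>p. r i j / \<sigma> * fst p + (g j (snd p) - r i j / \<sigma>\<^sup>2 * g i (snd p))) \<in>
    borel_measurable (std_normal \<Otimes>\<^sub>M M)" if "j \<in> I" for j
    using i that by measurable
  fix c :: "'i \<Rightarrow> real"
  \<comment> \<open>\<open>b\<close> is the covariance of the linear form with \<open>g i\<close>,
    and \<open>c'\<close> are its coefficients after the projection on \<open>g i\<close> is
    removed. \<open>Q\<close> says that the variance drops by \<open>(b / \<sigma>)\<^sup>2\<close>,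
    which is what the independent normal variable gives back.\<close>
  define b where "b = (\<Sum>j\<in>I. c j * r i j)"
  define c' where "c' = (\<lambda>j. c j - (if j = i then b / \<sigma>\<^sup>2 else 0))"
  have Q: "(\<Sum>k\<in>I. \<Sum>j\<in>I. c' k * c' j * r k j) = (\<Sum>k\<in>I. \<Sum>j\<in>I. c k * c j * r k j) - (b / \<sigma>)\<^sup>2"
  proof -
    have row: "(\<Sum>j\<in>I. c' j * r k j) = (\<Sum>j\<in>I. c j * r k j) - b / \<sigma>\<^sup>2 * r k i" for k
      using i finite_I unfolding c'_def
      by (simp add: left_diff_distrib sum_subtractf if_distrib[of "\<lambda>x. x * _"] cong: if_cong)
    have "(\<Sum>k\<in>I. \<Sum>j\<in>I. c' k * c' j * r k j) = (\<Sum>k\<in>I. c' k * (\<Sum>j\<in>I. c' j * r k j))"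
      by (simp add: sum_distrib_left mult.assoc)
    also have "\<dots> = (\<Sum>k\<in>I. c' k * (\<Sum>j\<in>I. c j * r k j)) - b / \<sigma>\<^sup>2 * (\<Sum>k\<in>I. c' k * r k i)"
      unfolding row by (simp add: right_diff_distrib sum_subtractf sum_distrib_left mult_ac)
    also have "(\<Sum>k\<in>I. c' k * r k i) = (\<Sum>k\<in>I. c' k * r i k)"
      using i by (intro sum.cong refl) (simp add: r_sym)
    also have "\<dots> = b - b / \<sigma>\<^sup>2 * \<sigma>\<^sup>2" unfolding row b_def using i by (simp add: r_diag)
    also have "\<dots> = 0" using \<sigma>_pos by simp
    also have "(\<Sum>k\<in>I. c' k * (\<Sum>j\<in>I. c j * r k j)) =
      (\<Sum>k\<in>I. c k * (\<Sum>j\<in>I. c j * r k j)) - b / \<sigma>\<^sup>2 * b"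
      using i finite_I unfolding c'_def b_def
      by (simp add: left_diff_distrib sum_subtractf if_distrib[of "\<lambda>x. x * _"] cong: if_cong)
    finally show ?thesis
      by (simp add: sum_distrib_left mult.assoc power2_eq_square)
  qed
  have split: "(\<Sum>j\<in>I. c j * (r i j / \<sigma> * z + (x j - r i j / \<sigma>\<^sup>2 * x i))) =
    b / \<sigma> * z + (\<Sum>j\<in>I. c' j * x j)" for z x
  proof -
    have "(\<Sum>j\<in>I. c' j * x j) = (\<Sum>j\<in>I. c j * x j) - b / \<sigma>\<^sup>2 * x i"
      using i finite_I unfolding c'_def
      by (simp add: left_diff_distrib sum_subtractf if_distrib[of "\<lambda>x. x * _"] cong: if_cong)
    moreover have "(\<Sum>j\<in>I. c j * (r i j / \<sigma> * z + (x j - r i j / \<sigma>\<^sup>2 * x i))) =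
      (\<Sum>j\<in>I. (c j * r i j) * (z / \<sigma>) + (c j * x j - (c j * r i j) * (x i / \<sigma>\<^sup>2)))"
      by (simp add: algebra_simps)
    moreover have "\<dots> = b * (z / \<sigma>) + ((\<Sum>j\<in>I. c j * x j) - b * (x i / \<sigma>\<^sup>2))"
      unfolding sum.distrib sum_subtractf b_def sum_distrib_right ..
    ultimately show ?thesis by simp
  qed
  have "(CLINT p|std_normal \<Otimes>\<^sub>M M. iexp (b / \<sigma> * fst p + (\<Sum>j\<in>I. c' j * g j (snd p)))) =
      (CLINT p|std_normal \<Otimes>\<^sub>M M. iexp (b / \<sigma> * fst p) * iexp (\<Sum>j\<in>I. c' j * g j (snd p)))"
    by (simp add: exp_add[symmetric] distrib_left)
  also have "\<dots> = (CLINT z|std_normal. iexp (b / \<sigma> * z)) * (CLINT \<omega>|M. iexp (\<Sum>j\<in>I. c' j * g j \<omega>))"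
    by (rule integral_pair_mult[where B = 1 and B' = 1])
      (auto simp: prob_space_axioms prob_space_std_normal simp del: of_real_sum of_real_mult)
  also have "\<dots> = of_real (exp (- (\<Sum>i\<in>I. \<Sum>j\<in>I. c i * c j * r i j) / 2))"
    unfolding char_std_normal_iexp char_g Q by (simp add: exp_add[symmetric] field_simps flip: of_real_mult)
  also have "\<dots> = (CLINT \<omega>|M. iexp (\<Sum>i\<in>I. c i * g i \<omega>))" by (rule char_g[symmetric])
  finally show "(CLINT \<omega>|M. iexp (\<Sum>i\<in>I. c i * g i \<omega>)) = (CLINT p|std_normal \<Otimes>\<^sub>M M.
    iexp (\<Sum>j\<in>I. c j * (r i j / \<sigma> * fst p + (g j (snd p) - r i j / \<sigma>\<^sup>2 * g i (snd p)))))"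
    unfolding split[of "fst p" "\<lambda>j. g j (snd p)" for p] by (rule sym)
qed (use g_measurable in auto)

end

section \<open>Integration by parts against the normal law\<close>

lemma bounded_density_tendsto_0:
  fixes F :: "real \<Rightarrow> 'b::real_normed_vector"
  assumes "\<And>z. norm (F z) \<le> B"
  shows "((\<lambda>z. std_normal_density z *\<^sub>R F z) \<longlongrightarrow> 0) at_top" "((\<lambda>z. std_normal_density z *\<^sub>R F z) \<longlongrightarrow> 0) at_bot"
proof -
  have lim: "((\<lambda>z::real. exp (- (z\<^sup>2) / 2) * B) \<longlongrightarrow> 0) at_top" "((\<lambda>z::real. exp (- (z\<^sup>2) / 2) * B) \<longlongrightarrow> 0) at_bot"
    by real_asymp+
  have ev: "\<forall>\<^sub>F z in Fl. norm (std_normal_density z *\<^sub>R F z) \<le> exp (- (z\<^sup>2) / 2) * B" for Fl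
  proof (rule always_eventually, rule)
    fix z
    have "std_normal_density z \<le> exp (- (z\<^sup>2) / 2)"
      unfolding std_normal_density_def
      using pi_gt3 by (auto simp: divide_le_eq mult_le_cancel_left1 intro!: real_le_rsqrt)
    then show "norm (std_normal_density z *\<^sub>R F z) \<le> exp (- (z\<^sup>2) / 2) * B"
      by (auto intro!: mult_mono assms)
  qed
  show "((\<lambda>z. std_normal_density z *\<^sub>R F z) \<longlongrightarrow> 0) at_top"
    "((\<lambda>z. std_normal_density z *\<^sub>R F z) \<longlongrightarrow> 0) at_bot"
    by (rule Lim_null_comparison[OF ev lim(1)], rule Lim_null_comparison[OF ev lim(2)])
qed

lemma std_normal_density_deriv:
  "(std_normal_density has_real_derivative - z * std_normal_density z) (at z)"
proof -
  have "((\<lambda>z. (1 / sqrt (2 * pi)) * exp (- z\<^sup>2 / 2)) has_real_derivative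
      (1 / sqrt (2 * pi)) * (exp (- z\<^sup>2 / 2) * (- z))) (at z)"
    by (rule DERIV_cmult) (auto intro!: derivative_eq_intros)
  then show ?thesis by (simp add: std_normal_density_def[abs_def] mult_ac)
qed

text \<open>By \<open>stein\<close> the function \<open>\<sigma> * \<kappa> (\<sigma> * z)\<close>
  times the normal density has derivative \<open>- \<phi> (\<sigma> * z)\<close> times the density.
  Multiplying by \<open>K\<close> and integrating the derivative of the product over the line leaves
  no boundary terms, as \<open>\<kappa>\<close> and \<open>K\<close> are bounded.\<close>

lemma stein_ibp:
  fixes \<phi> \<kappa> \<kappa>' :: "real \<Rightarrow> real" and K K' :: "real \<Rightarrow> complex"
  assumes s: "0 < \<sigma>"
    and \<kappa>: "\<And>x. (\<kappa> has_real_derivative \<kappa>' x) (at x)"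
    and stein: "\<And>x. \<sigma>\<^sup>2 * \<kappa>' x = x * \<kappa> x - \<phi> x"
    and c\<phi>: "continuous_on UNIV \<phi>"
    and b: "\<And>x. \<bar>\<phi> x\<bar> \<le> B" "\<And>x. \<bar>\<kappa> x\<bar> \<le> B" "\<And>x. norm (K x) \<le> B" "\<And>x. norm (K' x) \<le> B"
    and K: "\<And>x. (K has_vector_derivative K' x) (at x)"
    and cK: "continuous_on UNIV K'"
  shows "(CLINT z|std_normal. \<phi> (\<sigma> * z) *\<^sub>R K z) = (CLINT z|std_normal. (\<sigma> * \<kappa> (\<sigma> * z)) *\<^sub>R K' z)"
proof -
  have B: "0 \<le> B" using b(1)[of 0] by simp
  have c\<kappa>: "continuous_on UNIV \<kappa>"
    using \<kappa> by (auto intro!: continuous_at_imp_continuous_on DERIV_isCont)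
  have cK0: "continuous_on UNIV K"
    using K by (auto intro!: continuous_at_imp_continuous_on has_vector_derivative_continuous)
  have [measurable]: "\<phi> \<in> borel_measurable borel" "\<kappa> \<in> borel_measurable borel"
     "K \<in> borel_measurable borel" "K' \<in> borel_measurable borel"
    using c\<phi> c\<kappa> cK cK0 by (auto intro: borel_measurable_continuous_onI)
  have c1: "continuous_on UNIV (\<lambda>z. \<phi> (\<sigma> * z))" "continuous_on UNIV (\<lambda>z. \<kappa> (\<sigma> * z))"
    by (rule continuous_on_compose2[OF c\<phi>] continuous_on_compose2[OF c\<kappa>]; auto intro!: continuous_intros)+
  let ?p = std_normal_density
  define f where "f z = ?p z *\<^sub>R ((\<sigma> * \<kappa> (\<sigma> * z)) *\<^sub>R K' z) - ?p z *\<^sub>R (\<phi> (\<sigma> * z) *\<^sub>R K z)" for z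
  define F where "F z = ?p z *\<^sub>R ((\<sigma> * \<kappa> (\<sigma> * z)) *\<^sub>R K z)" for z
  have i1: "integrable lborel (\<lambda>z. ?p z *\<^sub>R ((\<sigma> * \<kappa> (\<sigma> * z)) *\<^sub>R K' z))"
    by (rule Bochner_Integration.integrable_bound[of _ "\<lambda>z. ?p z * (\<sigma> * B * B)"])
      (use s B in \<open>auto simp: abs_mult mult.assoc intro!: mult_left_mono mult_mono b\<close>)
  have i2: "integrable lborel (\<lambda>z. ?p z *\<^sub>R (\<phi> (\<sigma> * z) *\<^sub>R K z))"
    by (rule Bochner_Integration.integrable_bound[of _ "\<lambda>z. ?p z * (B * B)"])
      (use s B in \<open>auto simp: abs_mult mult.assoc intro!: mult_left_mono mult_mono b\<close>)
  have dF: "(F has_vector_derivative f z) (at z)" for z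
  proof -
    have "((\<lambda>z. ?p z * (\<sigma> * \<kappa> (\<sigma> * z))) has_real_derivative
       - z * ?p z * (\<sigma> * \<kappa> (\<sigma> * z)) + \<sigma> * (\<kappa>' (\<sigma> * z) * \<sigma>) * ?p z) (at z)"
      by (rule derivative_eq_intros std_normal_density_deriv DERIV_chain2[OF \<kappa>] refl | simp)+
    also have "- z * ?p z * (\<sigma> * \<kappa> (\<sigma> * z)) + \<sigma> * (\<kappa>' (\<sigma> * z) * \<sigma>) * ?p z = - ?p z * \<phi> (\<sigma> * z)"
      using arg_cong[OF stein[of "\<sigma> * z"], of "\<lambda>t. ?p z * t"]
      by (simp add: power2_eq_square algebra_simps)
    finally have "((\<lambda>z. (?p z * (\<sigma> * \<kappa> (\<sigma> * z))) *\<^sub>R K z) has_vector_derivative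
      (?p z * (\<sigma> * \<kappa> (\<sigma> * z))) *\<^sub>R K' z + (- ?p z * \<phi> (\<sigma> * z)) *\<^sub>R K z) (at z)"
      by (intro has_vector_derivative_scaleR K)
    then show ?thesis unfolding F_def[abs_def] f_def by (simp add: mult.assoc)
  qed
  have bF: "norm ((\<sigma> * \<kappa> (\<sigma> * z)) *\<^sub>R K z) \<le> \<sigma> * B * B" for z
    using s B by (auto simp: abs_mult mult.assoc intro!: mult_left_mono mult_mono b)
  have cf: "isCont f z" for z
  proof -
    have "continuous_on UNIV ?p" unfolding std_normal_density_def[abs_def] by (intro continuous_intros) simp
    then have "continuous_on UNIV f" unfolding f_def[abs_def] by (intro continuous_intros c1 cK cK0)
    then show ?thesis by (simp add: continuous_on_eq_continuous_at)
  qed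
  have "(LBINT z=-\<infinity>..\<infinity>. f z) = 0 - 0"
  proof (rule interval_integral_FTC_integrable[of _ _ F])
    show "set_integrable lborel (einterval (- \<infinity>) \<infinity>) f"
      unfolding f_def[abs_def] using i1 i2 by (simp add: set_integrable_def)
    show "((F \<circ> real_of_ereal) \<longlongrightarrow> 0) (at_right (- \<infinity>))" "((F \<circ> real_of_ereal) \<longlongrightarrow> 0) (at_left \<infinity>)"
      using bounded_density_tendsto_0[OF bF]
      unfolding F_def[abs_def] by (simp_all add: ereal_tendsto_simps)
  qed (use dF cf in auto)
  then have "(\<integral>z. f z \<partial>lborel) = 0"
    by (simp add: interval_lebesgue_integral_def set_lebesgue_integral_def)
  then show ?thesis unfolding f_def using i1 i2
    by (simp add: integral_std_normal)
qed

context gauss_family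
begin

text \<open>Lets the normal variable of \<open>regression\<close> be integrated first, with the
  residuals held fixed.\<close>

lemma expectation_regression:
  fixes F :: "('i \<Rightarrow> real) \<Rightarrow> complex"
  assumes i: "i \<in> I" and F [measurable]: "F \<in> borel_measurable (Pi\<^sub>M I (\<lambda>_. borel))"
    and bF: "\<And>x. norm (F x) \<le> B"
  shows "(CLINT \<omega>|M. F (\<lambda>j\<in>I. g j \<omega>)) =
    (CLINT \<omega>|M. CLINT z|std_normal. F (\<lambda>j\<in>I. r i j / \<sigma> * z + (g j \<omega> - r i j / \<sigma>\<^sup>2 * g i \<omega>)))"
proof -
  interpret N: prob_space std_normal by (rule prob_space_std_normal)
  interpret P: pair_prob_space std_normal M ..
  note [measurable] = g_measurable
  have m: "(\<lambda>p. \<lambda>j\<in>I. r i j / \<sigma> * fst p + (g j (snd p) - r i j / \<sigma>\<^sup>2 * g i (snd p))) \<in>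
    std_normal \<Otimes>\<^sub>M M \<rightarrow>\<^sub>M Pi\<^sub>M I (\<lambda>_. borel)"
    using i by measurable
  have m0: "(\<lambda>\<omega>. \<lambda>j\<in>I. g j \<omega>) \<in> M \<rightarrow>\<^sub>M Pi\<^sub>M I (\<lambda>_. borel)"
    by measurable
  have int: "integrable (std_normal \<Otimes>\<^sub>M M)
      (\<lambda>p. F (\<lambda>j\<in>I. r i j / \<sigma> * fst p + (g j (snd p) - r i j / \<sigma>\<^sup>2 * g i (snd p))))"
    using measurable_compose[OF m F] by (intro P.integrable_const_bound[of _ B]) (auto simp: bF)
  have "(CLINT \<omega>|M. F (\<lambda>j\<in>I. g j \<omega>)) =
      (CLINT x|distr M (Pi\<^sub>M I (\<lambda>_. borel)) (\<lambda>\<omega>. \<lambda>j\<in>I. g j \<omega>). F x)"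
    by (rule integral_distr[symmetric, OF m0 F])
  also have "\<dots> = (CLINT p|std_normal \<Otimes>\<^sub>M M. F (\<lambda>j\<in>I. r i j / \<sigma> * fst p + (g j (snd p) - r i j / \<sigma>\<^sup>2 * g i (snd p))))"
    unfolding regression[OF i] by (rule integral_distr[OF m F])
  also have "\<dots> = (CLINT \<omega>|M. CLINT z|std_normal. F (\<lambda>j\<in>I. r i j / \<sigma> * z + (g j \<omega> - r i j / \<sigma>\<^sup>2 * g i \<omega>)))"
    using P.integral_snd[of "\<lambda>z \<omega>. F (\<lambda>j\<in>I. r i j / \<sigma> * z + (g j \<omega> - r i j / \<sigma>\<^sup>2 * g i \<omega>))"] int
    by (simp add: case_prod_beta')
  finally show ?thesis .
qed

text \<open>Once the residuals are frozen, all coordinates are affine functions of one normal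
  variable \<open>z\<close> with slopes \<open>r i j / \<sigma>\<close>, and the one-dimensional
  \<open>stein_ibp\<close> in \<open>z\<close> yields the factors \<open>r i j\<close>. The
  functions \<open>D j\<close> play the part of the partial derivatives of \<open>H\<close>; they
  are asked for along lines, since this is how they enter.\<close>

lemma gaussian_ibp:
  fixes \<phi> \<kappa> \<kappa>' :: "real \<Rightarrow> real" and H :: "('i \<Rightarrow> real) \<Rightarrow> complex" and D :: "'i \<Rightarrow> ('i \<Rightarrow> real) \<Rightarrow> complex"
  assumes i: "i \<in> I"
    and \<kappa>: "\<And>x. (\<kappa> has_real_derivative \<kappa>' x) (at x)"
    and stein: "\<And>x. \<sigma>\<^sup>2 * \<kappa>' x = x * \<kappa> x - \<phi> x"
    and c\<phi>: "continuous_on UNIV \<phi>"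
    and b: "\<And>x. \<bar>\<phi> x\<bar> \<le> B" "\<And>x. \<bar>\<kappa> x\<bar> \<le> B" "\<And>x. norm (H x) \<le> B" "\<And>j x. norm (D j x) \<le> B"
    and H [measurable]: "H \<in> borel_measurable (Pi\<^sub>M I (\<lambda>_. borel))"
    and D [measurable]: "\<And>j. j \<in> I \<Longrightarrow> D j \<in> borel_measurable (Pi\<^sub>M I (\<lambda>_. borel))"
    and dH: "\<And>y b z. ((\<lambda>z. H (\<lambda>j\<in>I. b j * z + y j)) has_vector_derivative
        (\<Sum>j\<in>I. b j *\<^sub>R D j (\<lambda>j\<in>I. b j * z + y j))) (at z)"
    and cD: "\<And>y b j. j \<in> I \<Longrightarrow> continuous_on UNIV (\<lambda>z. D j (\<lambda>j\<in>I. b j * z + y j))"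
  shows "(CLINT \<omega>|M. \<phi> (g i \<omega>) *\<^sub>R H (\<lambda>j\<in>I. g j \<omega>)) =
    (\<Sum>j\<in>I. r i j *\<^sub>R (CLINT \<omega>|M. \<kappa> (g i \<omega>) *\<^sub>R D j (\<lambda>j\<in>I. g j \<omega>)))"
proof -
  note [measurable] = g_measurable
  have B: "0 \<le> B" using b(1)[of 0] by simp
  have c\<kappa>: "continuous_on UNIV \<kappa>"
    using \<kappa> by (auto intro!: continuous_at_imp_continuous_on DERIV_isCont)
  have [measurable]: "\<phi> \<in> borel_measurable borel" "\<kappa> \<in> borel_measurable borel"
    using c\<phi> c\<kappa> by (auto intro: borel_measurable_continuous_onI)
  have [measurable]: "(\<lambda>x. x i) \<in> borel_measurable (Pi\<^sub>M I (\<lambda>_. borel :: real measure))"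
    using i by measurable
  have i2: "r i i / \<sigma>\<^sup>2 = 1" "r i i / \<sigma> = \<sigma>"
    using \<sigma>_pos r_diag[OF i] by (auto simp: power2_eq_square)
  have "(CLINT \<omega>|M. \<phi> (g i \<omega>) *\<^sub>R H (\<lambda>j\<in>I. g j \<omega>)) =
    (CLINT \<omega>|M. (\<lambda>x. \<phi> (x i) *\<^sub>R H x) (\<lambda>j\<in>I. g j \<omega>))" using i by simp
  also have "\<dots> = (CLINT \<omega>|M. CLINT z|std_normal. (\<lambda>x. \<phi> (x i) *\<^sub>R H x)
      (\<lambda>j\<in>I. r i j / \<sigma> * z + (g j \<omega> - r i j / \<sigma>\<^sup>2 * g i \<omega>)))"
    by (rule expectation_regression[OF i, of _ "B * B"])
      (use B in \<open>auto intro!: mult_mono b\<close>)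
  also have "\<dots> = (CLINT \<omega>|M. CLINT z|std_normal. (\<lambda>x. \<Sum>j\<in>I. r i j *\<^sub>R (\<kappa> (x i) *\<^sub>R D j x))
      (\<lambda>j\<in>I. r i j / \<sigma> * z + (g j \<omega> - r i j / \<sigma>\<^sup>2 * g i \<omega>)))"
  proof (rule Bochner_Integration.integral_cong[OF refl])
    fix \<omega>
    define y where "y j = g j \<omega> - r i j / \<sigma>\<^sup>2 * g i \<omega>" for j
    define X where "X z = (\<lambda>j\<in>I. r i j / \<sigma> * z + y j)" for z
    \<comment> \<open>Coordinate \<open>i\<close> has no residual, because
      \<open>r i i = \<sigma>\<^sup>2\<close>.\<close>
    have Xi: "X z i = \<sigma> * z" for z
    proof -
      have "X z i = r i i / \<sigma> * z + (g i \<omega> - r i i / \<sigma>\<^sup>2 * g i \<omega>)" using i by (simp add: X_def y_def)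
      then show ?thesis unfolding i2 by simp
    qed
    \<comment> \<open>The derivative of \<open>H\<close> along the line carries the slopes, so its
      bound exceeds \<open>B\<close>.\<close>
    define B' where "B' = B + (\<Sum>j\<in>I. \<bar>r i j / \<sigma>\<bar> * B)"
    have B': "B \<le> B'" unfolding B'_def using B by (auto intro!: sum_nonneg)
    have nK: "norm (\<Sum>j\<in>I. (r i j / \<sigma>) *\<^sub>R D j (X z)) \<le> B'" for z
    proof -
      have "norm (\<Sum>j\<in>I. (r i j / \<sigma>) *\<^sub>R D j (X z)) \<le> (\<Sum>j\<in>I. \<bar>r i j / \<sigma>\<bar> * B)"
        by (intro sum_norm_le) (auto simp: abs_mult intro!: mult_left_mono b divide_right_mono)
      then show ?thesis using B by (simp add: B'_def)
    qed
    have "(CLINT z|std_normal. \<phi> (\<sigma> * z) *\<^sub>R H (X z)) =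
      (CLINT z|std_normal. (\<sigma> * \<kappa> (\<sigma> * z)) *\<^sub>R (\<Sum>j\<in>I. (r i j / \<sigma>) *\<^sub>R D j (X z)))"
    proof (rule stein_ibp[OF \<sigma>_pos \<kappa> stein c\<phi>, of B'])
      show "((\<lambda>x. H (X x)) has_vector_derivative (\<Sum>j\<in>I. (r i j / \<sigma>) *\<^sub>R D j (X x))) (at x)" for x
        unfolding X_def by (rule dH)
      show "continuous_on UNIV (\<lambda>z. \<Sum>j\<in>I. (r i j / \<sigma>) *\<^sub>R D j (X z))"
        unfolding X_def by (intro continuous_intros cD)
    qed (use b B' nK order_trans in \<open>blast+\<close>)
    also have "\<dots> = (CLINT z|std_normal. (\<Sum>j\<in>I. r i j *\<^sub>R (\<kappa> (X z i) *\<^sub>R D j (X z))))"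
      using \<sigma>_pos by (intro Bochner_Integration.integral_cong refl)
        (simp add: Xi scaleR_sum_right mult_ac)
    finally show "(CLINT z|std_normal. (\<lambda>x. \<phi> (x i) *\<^sub>R H x) (\<lambda>j\<in>I. r i j / \<sigma> * z + (g j \<omega> - r i j / \<sigma>\<^sup>2 * g i \<omega>))) =
      (CLINT z|std_normal. (\<lambda>x. \<Sum>j\<in>I. r i j *\<^sub>R (\<kappa> (x i) *\<^sub>R D j x))
        (\<lambda>j\<in>I. r i j / \<sigma> * z + (g j \<omega> - r i j / \<sigma>\<^sup>2 * g i \<omega>)))"
      by (simp add: Xi[symmetric] X_def y_def)
  qed
  also have "\<dots> = (CLINT \<omega>|M. (\<lambda>x. \<Sum>j\<in>I. r i j *\<^sub>R (\<kappa> (x i) *\<^sub>R D j x)) (\<lambda>j\<in>I. g j \<omega>))"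
  proof (rule expectation_regression[OF i, symmetric, of _ "\<Sum>j\<in>I. \<bar>r i j\<bar> * (B * B)"])
    fix x
    show "norm (\<Sum>j\<in>I. r i j *\<^sub>R (\<kappa> (x i) *\<^sub>R D j x)) \<le> (\<Sum>j\<in>I. \<bar>r i j\<bar> * (B * B))"
    proof (rule sum_norm_le)
      fix j
      show "norm (r i j *\<^sub>R (\<kappa> (x i) *\<^sub>R D j x)) \<le> \<bar>r i j\<bar> * (B * B)"
        unfolding norm_scaleR by (intro mult_left_mono mult_mono b abs_ge_zero norm_ge_zero B)
    qed
  qed simp
  also have "\<dots> = (CLINT \<omega>|M. \<Sum>j\<in>I. r i j *\<^sub>R (\<kappa> (g i \<omega>) *\<^sub>R D j (\<lambda>j\<in>I. g j \<omega>)))"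
    using i by simp
  also have "\<dots> = (\<Sum>j\<in>I. r i j *\<^sub>R (CLINT \<omega>|M. \<kappa> (g i \<omega>) *\<^sub>R D j (\<lambda>j\<in>I. g j \<omega>)))"
  proof -
    have m0: "(\<lambda>\<omega>. \<lambda>j\<in>I. g j \<omega>) \<in> M \<rightarrow>\<^sub>M Pi\<^sub>M I (\<lambda>_. borel)"
      by measurable
    have "integrable M (\<lambda>\<omega>. \<kappa> (g i \<omega>) *\<^sub>R D j (\<lambda>j\<in>I. g j \<omega>))" if "j \<in> I" for j
    proof (rule integrable_const_bound[of _ "B * B"])
      show "(\<lambda>\<omega>. \<kappa> (g i \<omega>) *\<^sub>R D j (\<lambda>j\<in>I. g j \<omega>)) \<in> borel_measurable M"
        using measurable_compose[OF m0 D[OF that]] i by measurable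
    qed (use B in \<open>auto intro!: mult_mono b\<close>)
    then show ?thesis by (subst Bochner_Integration.integral_sum) (simp_all del: scaleR_scaleR)
  qed
  finally show ?thesis .
qed

end

section \<open>The normal distribution function\<close>

definition ncdf :: "real \<Rightarrow> real" where
  "ncdf x = (LBINT t=-\<infinity>..x. std_normal_density t)"

lemma ncdf_deriv: "(ncdf has_real_derivative std_normal_density x) (at x)"
proof -
  have int: "interval_lebesgue_integrable lborel a b std_normal_density" for a b :: ereal
    unfolding interval_lebesgue_integrable_def set_integrable_def
    by (auto intro!: integrable_mult_indicator simp del: real_scaleR_def)
  have c: "continuous_on S std_normal_density" for S
    unfolding std_normal_density_def[abs_def] by (intro continuous_intros) simp
  \<comment> \<open>The fundamental theorem of calculus is applied on a bounded interval; the part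
    from minus infinity to \<open>x - 1\<close> is a constant.\<close>
  have eq: "ncdf y = ncdf (x - 1) + (LBINT t=ereal (x - 1)..y. std_normal_density t)" for y
    unfolding ncdf_def by (rule interval_integral_sum[symmetric]) (rule int)
  have "((\<lambda>y. LBINT t=ereal (x - 1)..y. std_normal_density t) has_vector_derivative std_normal_density x)
      (at x within {x - 1..x + 1})"
    by (rule interval_integral_FTC2[OF _ _ c]) auto
  then have "((\<lambda>y. LBINT t=ereal (x - 1)..y. std_normal_density t) has_vector_derivative std_normal_density x) (at x)"
    by (subst (asm) at_within_interior) auto
  then have D: "((\<lambda>y. ncdf (x - 1) + (LBINT t=ereal (x - 1)..y. std_normal_density t)) has_real_derivative 0 + std_normal_density x) (at x)"
    unfolding has_real_derivative_iff_has_vector_derivative by (intro has_vector_derivative_add has_vector_derivative_const)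
  have "ncdf = (\<lambda>y. ncdf (x - 1) + (LBINT t=ereal (x - 1)..y. std_normal_density t))"
    by (rule ext) (rule eq)
  from D[folded this] show ?thesis by simp
qed

lemma measure_std_normal:
  assumes [measurable]: "A \<in> sets borel"
  shows "measure std_normal A = (\<integral>t. indicator A t * std_normal_density t \<partial>lborel)"
proof -
  have "measure std_normal A = (\<integral>z. indicator A z \<partial>std_normal)" by simp
  also have "\<dots> = (\<integral>t. indicator A t * std_normal_density t \<partial>lborel)"
    by (subst integral_std_normal) (auto simp: mult.commute)
  finally show ?thesis .
qed

lemma ncdf_eq_measure: "ncdf x = measure std_normal {..<x}"
  unfolding ncdf_def by (subst measure_std_normal)
    (auto simp: interval_lebesgue_integral_def set_lebesgue_integral_def einterval_eq)

lemma ncdf_bounds: "0 \<le> ncdf x" "ncdf x \<le> 1"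
  using prob_space.prob_le_1[OF prob_space_std_normal] by (auto simp: ncdf_eq_measure)

lemma std_normal_null: "measure std_normal {x} = 0"
proof (subst measure_std_normal)
  have "AE t in lborel. indicator {x} t * std_normal_density t = 0"
    using AE_lborel_singleton[of x] by eventually_elim simp
  then show "(\<integral>t. indicator {x} t * std_normal_density t \<partial>lborel) = 0" by (rule integral_eq_zero_AE)
qed simp

lemma Psi_ncdf: "Psi x = 1 - ncdf x"
proof -
  interpret N: prob_space std_normal by (rule prob_space_std_normal)
  have "Psi x = measure std_normal {x..}"
    unfolding Psi_def set_lebesgue_integral_def
    by (subst measure_std_normal, simp, subst integral_mult_right_zero[symmetric])
      (simp add: std_normal_density_def mult_ac)
  also have "{x..} = space std_normal - {..<x}" by auto
  also have "measure std_normal \<dots> = 1 - ncdf x"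
    by (subst N.prob_compl) (auto simp: ncdf_eq_measure)
  finally show ?thesis .
qed

lemma ncdf_uminus: "ncdf (- x) = 1 - ncdf x"
proof -
  interpret N: prob_space std_normal by (rule prob_space_std_normal)
  have "ncdf x = (\<integral>t. indicator {..<x} t * std_normal_density t \<partial>lborel)"
    unfolding ncdf_eq_measure by (rule measure_std_normal) simp
  also have "\<dots> = (\<integral>t. indicator {..<x} (0 + (-1) * t) * std_normal_density (0 + (-1) * t) \<partial>lborel)"
    by (subst lborel_integral_real_affine[of "-1" _ 0]) auto
  also have "\<dots> = (\<integral>t. indicator {-x<..} t * std_normal_density t \<partial>lborel)"
    by (intro Bochner_Integration.integral_cong) (auto simp: std_normal_density_def split: split_indicator)
  also have "\<dots> = measure std_normal {-x<..}" by (rule measure_std_normal[symmetric]) simp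
  also have "{-x<..} = space std_normal - ({..<-x} \<union> {-x})" by auto
  also have "measure std_normal \<dots> = 1 - ncdf (- x)"
    by (subst N.prob_compl, simp, subst N.finite_measure_Union) (auto simp: ncdf_eq_measure std_normal_null)
  finally show ?thesis by simp
qed

section \<open>Smoothed indicators and their Stein kernels\<close>

text \<open>The indicator of \<open>{u..}\<close> convolved with a centred normal density of
  standard deviation \<open>\<delta>\<close>. With this mollifier the derivative is a normal density
  and the Stein kernel an average of normal densities, whose Fourier transforms are
  explicit.\<close>

definition smooth_ind :: "real \<Rightarrow> real \<Rightarrow> real \<Rightarrow> real" where
  "smooth_ind \<delta> u x = ncdf ((x - u) / \<delta>)"

definition skernel_sd :: "real \<Rightarrow> real \<Rightarrow> real \<Rightarrow> real" where
  "skernel_sd \<sigma> \<delta> \<tau> = sqrt (\<delta>\<^sup>2 + (1 - \<tau>\<^sup>2) * \<sigma>\<^sup>2)"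

text \<open>The solution \<open>\<kappa>\<close> of \<open>\<sigma>\<^sup>2 \<kappa>' x = x \<kappa> x - (\<phi> x - \<mu>)\<close>, with \<open>\<phi>\<close> the smoothed indicator and \<open>\<mu>\<close> its
  Gaussian mean, is \<open>\<kappa> x = \<integral>\<^sub>0\<^sup>1 E (\<phi>' (\<tau> x + sqrt (1 - \<tau>\<^sup>2) \<sigma> N)) d\<tau>\<close> (Mehler's formula). The convolution
  of the two normal densities is the normal density with standard deviation \<open>skernel_sd \<sigma> \<delta> \<tau>\<close>.\<close>

definition skernel :: "real \<Rightarrow> real \<Rightarrow> real \<Rightarrow> real \<Rightarrow> real" where
  "skernel \<sigma> \<delta> u x = integral {0..1} (\<lambda>\<tau>. normal_density u (skernel_sd \<sigma> \<delta> \<tau>) (\<tau> * x))"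

definition skernel' :: "real \<Rightarrow> real \<Rightarrow> real \<Rightarrow> real \<Rightarrow> real" where
  "skernel' \<sigma> \<delta> u x = integral {0..1} (\<lambda>\<tau>. - (\<tau> * (\<tau> * x - u) / (skernel_sd \<sigma> \<delta> \<tau>)\<^sup>2) *
     normal_density u (skernel_sd \<sigma> \<delta> \<tau>) (\<tau> * x))"

lemma normal_density_eq: "0 < s \<Longrightarrow> normal_density u s y = std_normal_density ((y - u) / s) / s"
  by (simp add: normal_density_def power_divide real_sqrt_mult)

lemma smooth_ind_deriv: "0 < \<delta> \<Longrightarrow> (smooth_ind \<delta> u has_real_derivative normal_density u \<delta> x) (at x)"
proof -
  assume d: "0 < \<delta>"
  have "((\<lambda>x. ncdf ((x - u) / \<delta>)) has_real_derivative std_normal_density ((x - u) / \<delta>) * (1 / \<delta>)) (at x)"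
    by (rule DERIV_chain2[OF ncdf_deriv]) (use d in \<open>auto intro!: derivative_eq_intros\<close>)
  then show ?thesis by (simp add: smooth_ind_def[abs_def] normal_density_eq[OF d])
qed

lemma smooth_ind_bounds: "0 \<le> smooth_ind \<delta> u x" "smooth_ind \<delta> u x \<le> 1"
  by (auto simp: smooth_ind_def ncdf_bounds)

lemma skernel_sd:
  assumes "0 < \<delta>" "0 \<le> \<tau>" "\<tau> \<le> 1"
  shows "\<delta> \<le> skernel_sd \<sigma> \<delta> \<tau>" "0 < skernel_sd \<sigma> \<delta> \<tau>"
    "(skernel_sd \<sigma> \<delta> \<tau>)\<^sup>2 = \<delta>\<^sup>2 + (1 - \<tau>\<^sup>2) * \<sigma>\<^sup>2" "0 < \<delta>\<^sup>2 + (1 - \<tau>\<^sup>2) * \<sigma>\<^sup>2"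
proof -
  have "0 \<le> (1 - \<tau>\<^sup>2) * \<sigma>\<^sup>2" using assms by (intro mult_nonneg_nonneg) (auto simp: power_le_one)
  then show "(skernel_sd \<sigma> \<delta> \<tau>)\<^sup>2 = \<delta>\<^sup>2 + (1 - \<tau>\<^sup>2) * \<sigma>\<^sup>2" "0 < \<delta>\<^sup>2 + (1 - \<tau>\<^sup>2) * \<sigma>\<^sup>2"
     "\<delta> \<le> skernel_sd \<sigma> \<delta> \<tau>"
    using assms by (auto simp: skernel_sd_def add_pos_nonneg intro!: real_le_rsqrt)
  then show "0 < skernel_sd \<sigma> \<delta> \<tau>" using assms by linarith
qed

lemma normal_density_le:
  assumes "0 < \<delta>" "\<delta> \<le> s"
  shows "normal_density u s y \<le> 1 / \<delta>"
proof -
  have p: "std_normal_density z \<le> 1" for z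
  proof -
    have "1 \<le> sqrt (2 * pi)" using pi_gt3 by (intro real_le_rsqrt) auto
    moreover have "exp (- z\<^sup>2 / 2) \<le> 1" by simp
    ultimately have "exp (- z\<^sup>2 / 2) \<le> sqrt (2 * pi)" by linarith
    then show ?thesis unfolding std_normal_density_def using pi_gt3 by (simp add: divide_le_eq)
  qed
  then have s: "0 < s" using assms by simp
  then have "normal_density u s y \<le> 1 / s" unfolding normal_density_eq[OF s] using p by (simp add: divide_right_mono)
  also have "\<dots> \<le> 1 / \<delta>" using assms by (simp add: frac_le)
  finally show ?thesis .
qed

text \<open>Joint continuity in \<open>x\<close> and \<open>\<tau>\<close> permits differentiation
  under the integral in \<open>skernel_deriv\<close>.\<close>

lemma skernel_continuous:
  assumes d: "0 < \<delta>"
  shows "continuous_on (UNIV \<times> {0..1}) (\<lambda>(x, \<tau>). normal_density u (skernel_sd \<sigma> \<delta> \<tau>) (\<tau> * x))" (is ?A)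
    "continuous_on (UNIV \<times> {0..1}) (\<lambda>(x, \<tau>). - (\<tau> * (\<tau> * x - u) / (skernel_sd \<sigma> \<delta> \<tau>)\<^sup>2) *
       normal_density u (skernel_sd \<sigma> \<delta> \<tau>) (\<tau> * x))" (is ?B)
proof -
  have c: "continuous_on (UNIV \<times> {0..1}) (\<lambda>p::real \<times> real. skernel_sd \<sigma> \<delta> (snd p))"
    unfolding skernel_sd_def by (intro continuous_intros)
  show A: ?A unfolding normal_density_def case_prod_beta'
    using skernel_sd(2)[OF d] by (intro continuous_intros c) (auto simp: less_imp_neq[symmetric])
  show ?B unfolding case_prod_beta'
    using skernel_sd(2)[OF d] A[unfolded case_prod_beta'] by (intro continuous_intros c) (auto simp: less_imp_neq[symmetric])
qed

lemma skernel_section_continuous: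
  assumes d: "0 < \<delta>"
  shows "continuous_on {0..1} (\<lambda>\<tau>. normal_density u (skernel_sd \<sigma> \<delta> \<tau>) (\<tau> * x))" (is ?A)
    "continuous_on {0..1} (\<lambda>\<tau>. - (\<tau> * (\<tau> * x - u) / (skernel_sd \<sigma> \<delta> \<tau>)\<^sup>2) *
       normal_density u (skernel_sd \<sigma> \<delta> \<tau>) (\<tau> * x))" (is ?B)
proof -
  have c: "continuous_on {0..1} (skernel_sd \<sigma> \<delta>)"
    unfolding skernel_sd_def[abs_def] by (intro continuous_intros)
  show A: ?A unfolding normal_density_def
    using skernel_sd(2)[OF d] by (intro continuous_intros c) (auto simp: less_imp_neq[symmetric])
  show ?B
    using skernel_sd(2)[OF d] by (intro continuous_intros c A) (auto simp: less_imp_neq[symmetric])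
qed

lemma skernel_deriv:
  assumes d: "0 < \<delta>"
  shows "(skernel \<sigma> \<delta> u has_real_derivative skernel' \<sigma> \<delta> u x) (at x)"
  unfolding skernel_def[abs_def] skernel'_def cbox_interval[symmetric]
proof (rule leibniz_rule_field_derivative[where U = UNIV])
  fix y \<tau> :: real assume "\<tau> \<in> cbox 0 1"
  then have \<tau>: "0 \<le> \<tau>" "\<tau> \<le> 1" by auto
  let ?s = "skernel_sd \<sigma> \<delta> \<tau>"
  have s: "0 < ?s" by (rule skernel_sd(2)[OF d \<tau>])
  show "((\<lambda>x. normal_density u ?s (\<tau> * x)) has_real_derivative
      - (\<tau> * (\<tau> * y - u) / ?s\<^sup>2) * normal_density u ?s (\<tau> * y)) (at y)"
  proof -
    have "((\<lambda>x. std_normal_density ((\<tau> * x - u) / ?s) / ?s) has_real_derivative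
        (- ((\<tau> * y - u) / ?s) * std_normal_density ((\<tau> * y - u) / ?s)) * (\<tau> / ?s) / ?s) (at y)"
      by (intro DERIV_cdivide DERIV_chain2[OF std_normal_density_deriv])
        (auto intro!: derivative_eq_intros)
    then show ?thesis unfolding normal_density_eq[OF s] by (simp add: power2_eq_square mult_ac)
  qed
qed (use skernel_section_continuous(1)[OF d] skernel_continuous(2)[OF d] in
     \<open>auto simp: cbox_interval intro!: integrable_continuous_real\<close>)

text \<open>Algebra for \<open>skernel_stein\<close>: \<open>s\<close> is the standard deviation at
  \<open>t = \<tau>\<close>, whose derivative in \<open>\<tau>\<close> is \<open>- t * c / s\<close>
  with \<open>c = \<sigma>\<^sup>2\<close>, and \<open>y = \<tau> * x - u\<close>. The first line is
  the quotient rule, the second sorts the outcome by the integrands of \<open>skernel\<close> and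
  \<open>skernel'\<close>.\<close>

lemma skernel_stein_aux:
  fixes s x y t c p :: real
  assumes "0 < s"
  shows "(x * s - y * (- t * c / s)) / (s * s) = x / s + y * (t * c) / s ^ 3"
    "p * (x / s + y * (t * c) / s ^ 3) = x * (p / s) - c * (- (t * y / s\<^sup>2) * (p / s))"
proof -
  have "(x * s - y * (- t * c / s)) / (s * s) = (x * s) / (s * s) + (y * (t * c) / s) / (s * s)"
    by (simp add: add_divide_distrib)
  also have "\<dots> = x / s + y * (t * c) / s ^ 3" using assms by (simp add: power3_eq_cube)
  finally show "(x * s - y * (- t * c / s)) / (s * s) = x / s + y * (t * c) / s ^ 3" .
  show "p * (x / s + y * (t * c) / s ^ 3) = x * (p / s) - c * (- (t * y / s\<^sup>2) * (p / s))"
    by (simp add: distrib_left power3_eq_cube power2_eq_square mult_ac)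
qed

text \<open>The function \<open>ncdf ((\<tau> * x - u) / skernel_sd \<sigma> \<delta>
  \<tau>)\<close> of \<open>\<tau>\<close> is a primitive of
  \<open>x * ?f \<tau> - \<sigma>\<^sup>2 * ?g \<tau>\<close>. It equals the smoothed indicator at
  \<open>\<tau> = 1\<close>, where the standard deviation is \<open>\<delta>\<close>, and its
  Gaussian mean at \<open>\<tau> = 0\<close>.\<close>

lemma skernel_stein:
  assumes d: "0 < \<delta>"
  shows "\<sigma>\<^sup>2 * skernel' \<sigma> \<delta> u x = x * skernel \<sigma> \<delta> u x -
    (smooth_ind \<delta> u x - ncdf (- u / skernel_sd \<sigma> \<delta> 0))"
proof -
  let ?s = "skernel_sd \<sigma> \<delta>"
  let ?f = "\<lambda>\<tau>. normal_density u (?s \<tau>) (\<tau> * x)"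
  let ?g = "\<lambda>\<tau>. - (\<tau> * (\<tau> * x - u) / (?s \<tau>)\<^sup>2) * ?f \<tau>"
  have "((\<lambda>\<tau>. x * ?f \<tau> - \<sigma>\<^sup>2 * ?g \<tau>) has_integral
      ncdf ((1 * x - u) / ?s 1) - ncdf ((0 * x - u) / ?s 0)) {0..1}"
  proof (rule fundamental_theorem_of_calculus)
    fix \<tau> :: real assume "\<tau> \<in> {0..1}"
    then have \<tau>: "0 \<le> \<tau>" "\<tau> \<le> 1" by auto
    note s = skernel_sd[OF d \<tau>, of \<sigma>]
    have ds: "(?s has_real_derivative - \<tau> * \<sigma>\<^sup>2 / ?s \<tau>) (at \<tau>)"
      unfolding skernel_sd_def[abs_def] using s(4)
      by (auto intro!: derivative_eq_intros simp: field_simps)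
    have "((\<lambda>\<tau>. (\<tau> * x - u) / ?s \<tau>) has_real_derivative
        x / ?s \<tau> + (\<tau> * x - u) * (\<tau> * \<sigma>\<^sup>2) / (?s \<tau>) ^ 3) (at \<tau>)"
      unfolding skernel_stein_aux(1)[OF s(2), symmetric]
      by (rule DERIV_divide[OF _ ds]) (use s(2) in \<open>auto intro!: derivative_eq_intros\<close>)
    then have "((\<lambda>\<tau>. ncdf ((\<tau> * x - u) / ?s \<tau>)) has_real_derivative
       std_normal_density ((\<tau> * x - u) / ?s \<tau>) * (x / ?s \<tau> + (\<tau> * x - u) * (\<tau> * \<sigma>\<^sup>2) / (?s \<tau>) ^ 3)) (at \<tau>)"
      by (rule DERIV_chain2[OF ncdf_deriv])
    also have "std_normal_density ((\<tau> * x - u) / ?s \<tau>) * (x / ?s \<tau> + (\<tau> * x - u) * (\<tau> * \<sigma>\<^sup>2) / (?s \<tau>) ^ 3) =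
        x * ?f \<tau> - \<sigma>\<^sup>2 * ?g \<tau>"
      unfolding normal_density_eq[OF s(2)] by (rule skernel_stein_aux(2)[OF s(2)])
    finally show "((\<lambda>\<tau>. ncdf ((\<tau> * x - u) / ?s \<tau>)) has_vector_derivative
       x * ?f \<tau> - \<sigma>\<^sup>2 * ?g \<tau>) (at \<tau> within {0..1})"
      by (simp add: has_real_derivative_iff_has_vector_derivative has_vector_derivative_at_within)
  qed simp
  moreover have "((\<lambda>\<tau>. x * ?f \<tau> - \<sigma>\<^sup>2 * ?g \<tau>) has_integral
      x * skernel \<sigma> \<delta> u x - \<sigma>\<^sup>2 * skernel' \<sigma> \<delta> u x) {0..1}"
    unfolding skernel_def skernel'_def
    by (intro has_integral_diff has_integral_mult_right integrable_integral integrable_continuous_real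
        skernel_section_continuous d)
  ultimately have "ncdf ((1 * x - u) / ?s 1) - ncdf ((0 * x - u) / ?s 0) =
      x * skernel \<sigma> \<delta> u x - \<sigma>\<^sup>2 * skernel' \<sigma> \<delta> u x"
    by (rule has_integral_unique)
  moreover have "?s 1 = \<delta>" using d by (simp add: skernel_sd_def)
  ultimately show ?thesis by (simp add: smooth_ind_def)
qed

text \<open>Every standard deviation in the average is at least \<open>\<delta>\<close>, so each
  density is at most \<open>1 / \<delta>\<close>.\<close>

lemma skernel_bounds:
  assumes d: "0 < \<delta>"
  shows "0 \<le> skernel \<sigma> \<delta> u x" "skernel \<sigma> \<delta> u x \<le> 1 / \<delta>"
proof -
  show "0 \<le> skernel \<sigma> \<delta> u x" unfolding skernel_def
    by (intro integral_nonneg integrable_continuous_real skernel_section_continuous d) auto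
  have "skernel \<sigma> \<delta> u x \<le> integral {0..1} (\<lambda>\<tau>::real. 1 / \<delta>)"
    unfolding skernel_def using d
    by (intro integral_le integrable_continuous_real skernel_section_continuous d)
      (auto intro!: normal_density_le skernel_sd)
  then show "skernel \<sigma> \<delta> u x \<le> 1 / \<delta>" by simp
qed

section \<open>Covariances by Fourier transform\<close>

lemma bochner_norm_bound:
  fixes f :: "'a \<Rightarrow> 'b::{banach, second_countable_topology}"
  assumes "integrable M f" "integrable M h" "\<And>x. x \<in> space M \<Longrightarrow> norm (f x) \<le> h x"
  shows "norm (integral\<^sup>L M f) \<le> integral\<^sup>L M h"
proof -
  have "norm (integral\<^sup>L M f) \<le> (\<integral>x. norm (f x) \<partial>M)" by (rule integral_norm_bound)
  also have "\<dots> \<le> integral\<^sup>L M h" using assms by (intro integral_mono) auto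
  finally show ?thesis .
qed

text \<open>Satisfied by integrals \<open>A y = \<integral> exp (i \<xi> y) d\<nu> \<xi>\<close> with \<open>\<integral> d\<bar>\<nu>\<bar> \<le> K0\<close> and \<open>\<integral> \<bar>\<xi>\<bar> d\<bar>\<nu>\<bar> \<le> K1\<close>, and
  stated so that four exponentials can be replaced one at a time by such functions.\<close>

definition fourier_bounded :: "'a measure \<Rightarrow> (real \<Rightarrow> real) \<Rightarrow> real \<Rightarrow> real \<Rightarrow> bool" where
  "fourier_bounded M A K0 K1 \<longleftrightarrow> A \<in> borel_measurable borel \<and> (\<exists>B. \<forall>x. \<bar>A x\<bar> \<le> B) \<and>
    (\<forall>Y Z B b0 b1. Y \<in> borel_measurable M \<longrightarrow> Z \<in> borel_measurable M \<longrightarrow>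
      (\<forall>\<omega>. norm (Z \<omega>) \<le> B) \<longrightarrow> 0 \<le> b0 \<longrightarrow> 0 \<le> b1 \<longrightarrow>
      (\<forall>\<xi>. norm (CLINT \<omega>|M. iexp (\<xi> * Y \<omega>) * Z \<omega>) \<le> b0 + b1 * \<bar>\<xi>\<bar>) \<longrightarrow>
      norm (CLINT \<omega>|M. of_real (A (Y \<omega>)) * Z \<omega>) \<le> K0 * b0 + K1 * b1)"

lemma std_normal_second_moment:
  "integrable std_normal (\<lambda>x. x\<^sup>2)" "(\<integral>x. x\<^sup>2 \<partial>std_normal) = 1"
  using integrable_std_normal_distribution_moment[of 2] std_normal_distribution_even_moments(1)[of 1]
  by simp_all

text \<open>The standard normal density is, up to a factor, its own characteristic function; this
  supplies Fourier inversion in the one case that is used.\<close>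

lemma std_normal_density_fourier:
  "of_real (std_normal_density t) = of_real (1 / sqrt (2 * pi)) * (CLINT \<xi>|std_normal. iexp (t * \<xi>))"
  unfolding char_std_normal_iexp by (simp add: std_normal_density_def)

text \<open>The density is an average of \<open>iexp\<close> over normal frequencies, and hypothesis
  \<open>h\<close> applies to each of them; the mean modulus of the frequency costs one more factor
  \<open>1 / \<delta>\<close>. The argument \<open>\<tau> * Y\<close> and the range
  \<open>\<delta> \<le> s\<close> make the bound uniform over the average that defines
  \<open>skernel\<close>.\<close>

lemma normal_density_fourier_bound:
  fixes Z :: "'a \<Rightarrow> complex"
  assumes M: "prob_space M" and [measurable]: "Y \<in> borel_measurable M" "Z \<in> borel_measurable M"
    and bZ: "\<And>\<omega>. norm (Z \<omega>) \<le> B" and b: "0 \<le> b0" "0 \<le> b1"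
    and h: "\<And>\<xi>. norm (CLINT \<omega>|M. iexp (\<xi> * Y \<omega>) * Z \<omega>) \<le> b0 + b1 * \<bar>\<xi>\<bar>"
    and d: "0 < \<delta>" "\<delta> \<le> s" and \<tau>: "0 \<le> \<tau>" "\<tau> \<le> 1"
  shows "norm (CLINT \<omega>|M. of_real (normal_density u s (\<tau> * Y \<omega>)) * Z \<omega>) \<le> (1 / \<delta>) * b0 + (1 / \<delta>\<^sup>2) * b1"
proof -
  interpret M: prob_space M by fact
  interpret N: prob_space std_normal by (rule prob_space_std_normal)
  interpret P: pair_prob_space std_normal M ..
  have s: "0 < s" using d by simp
  define c where "c = 1 / (s * sqrt (2 * pi))"
  have "1 \<le> sqrt (2 * pi)" using pi_gt3 by (intro real_le_rsqrt) auto
  then have "s * 1 \<le> s * sqrt (2 * pi)" using s by (intro mult_left_mono) auto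
  then have "\<delta> \<le> s * sqrt (2 * pi)" using d by linarith
  then have c: "0 \<le> c" "c \<le> 1 / \<delta>"
    unfolding c_def using s d by (auto intro!: frac_le simp del: real_sqrt_mult)
  have e: "of_real (normal_density u s (\<tau> * Y \<omega>)) * Z \<omega> =
    (CLINT \<xi>|std_normal. of_real c * (iexp (- (u / s) * \<xi>) * (iexp ((\<tau> / s * \<xi>) * Y \<omega>) * Z \<omega>)))" for \<omega>
  proof -
    have "of_real (normal_density u s (\<tau> * Y \<omega>)) * Z \<omega> =
      of_real c * Z \<omega> * (CLINT \<xi>|std_normal. iexp (((\<tau> * Y \<omega> - u) / s) * \<xi>))"
      unfolding normal_density_eq[OF s] of_real_divide std_normal_density_fourier c_def by (simp add: mult_ac)
    also have "\<dots> = (CLINT \<xi>|std_normal. of_real c * Z \<omega> * iexp (((\<tau> * Y \<omega> - u) / s) * \<xi>))"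
      by simp
    also have "(\<lambda>\<xi>. of_real c * Z \<omega> * iexp (((\<tau> * Y \<omega> - u) / s) * \<xi>)) =
      (\<lambda>\<xi>. of_real c * (iexp (- (u / s) * \<xi>) * (iexp ((\<tau> / s * \<xi>) * Y \<omega>) * Z \<omega>)))"
    proof
      fix \<xi>
      have "((\<tau> * Y \<omega> - u) / s) * \<xi> = - (u / s) * \<xi> + (\<tau> / s * \<xi>) * Y \<omega>"
        by (simp add: diff_divide_distrib left_diff_distrib right_diff_distrib mult_ac)
      then have "iexp (((\<tau> * Y \<omega> - u) / s) * \<xi>) = iexp (- (u / s) * \<xi>) * iexp ((\<tau> / s * \<xi>) * Y \<omega>)"
        by (simp only: of_real_add distrib_left exp_add)
      then show "of_real c * Z \<omega> * iexp (((\<tau> * Y \<omega> - u) / s) * \<xi>) =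
        of_real c * (iexp (- (u / s) * \<xi>) * (iexp ((\<tau> / s * \<xi>) * Y \<omega>) * Z \<omega>))"
        by (simp only: mult_ac)
    qed
    finally show ?thesis .
  qed
  have int: "integrable (std_normal \<Otimes>\<^sub>M M) (\<lambda>(\<xi>, \<omega>). of_real c * (iexp (- (u / s) * \<xi>) * (iexp ((\<tau> / s * \<xi>) * Y \<omega>) * Z \<omega>)))"
    by (rule P.integrable_const_bound[of _ "c * B"])
      (use c in \<open>auto simp: norm_mult intro!: mult_left_mono bZ simp del: of_real_mult of_real_divide\<close>)
  have "(CLINT \<omega>|M. of_real (normal_density u s (\<tau> * Y \<omega>)) * Z \<omega>) =
    (CLINT \<xi>|std_normal. CLINT \<omega>|M. of_real c * (iexp (- (u / s) * \<xi>) * (iexp ((\<tau> / s * \<xi>) * Y \<omega>) * Z \<omega>)))"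
    unfolding e by (rule P.Fubini_integral[OF int])
  then have E: "(CLINT \<omega>|M. of_real (normal_density u s (\<tau> * Y \<omega>)) * Z \<omega>) = (CLINT \<xi>|std_normal. of_real c * (iexp (- (u / s) * \<xi>) * (CLINT \<omega>|M. iexp ((\<tau> / s * \<xi>) * Y \<omega>) * Z \<omega>)))"
    by simp
  have "norm (CLINT \<omega>|M. of_real (normal_density u s (\<tau> * Y \<omega>)) * Z \<omega>) \<le> (\<integral>\<xi>. c * (b0 + b1 * (1 / \<delta> * ((1 + \<xi>\<^sup>2) / 2))) \<partial>std_normal)"
    unfolding E
  proof (rule bochner_norm_bound)
    show i: "integrable std_normal (\<lambda>\<xi>. of_real c * (iexp (- (u / s) * \<xi>) * (CLINT \<omega>|M. iexp ((\<tau> / s * \<xi>) * Y \<omega>) * Z \<omega>)))"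
      using P.integrable_fst'[OF int] by simp
    show "integrable std_normal (\<lambda>\<xi>. c * (b0 + b1 * (1 / \<delta> * ((1 + \<xi>\<^sup>2) / 2))))"
      using std_normal_second_moment by auto
    fix \<xi> :: real
    \<comment> \<open>\<open>(1 + \<xi>\<^sup>2) / 2\<close> has mean 1 under the normal law, so the
      first absolute moment is not computed.\<close>
    have 1: "\<bar>\<xi>\<bar> \<le> (1 + \<xi>\<^sup>2) / 2"
      using zero_le_power2[of "1 - \<bar>\<xi>\<bar>"] by (simp add: power2_eq_square algebra_simps)
    have 2: "\<tau> / s \<le> 1 / \<delta>" using \<tau> d by (intro frac_le) auto
    have "\<bar>\<tau> / s * \<xi>\<bar> = \<tau> / s * \<bar>\<xi>\<bar>" using \<tau> s by (simp add: abs_mult)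
    also have "\<dots> \<le> 1 / \<delta> * ((1 + \<xi>\<^sup>2) / 2)"
      using 1 2 d by (intro mult_mono) auto
    finally have "b1 * \<bar>\<tau> / s * \<xi>\<bar> \<le> b1 * (1 / \<delta> * ((1 + \<xi>\<^sup>2) / 2))"
      using b(2) by (rule mult_left_mono)
    with h[of "\<tau> / s * \<xi>"] have "norm (CLINT \<omega>|M. iexp ((\<tau> / s * \<xi>) * Y \<omega>) * Z \<omega>) \<le> b0 + b1 * (1 / \<delta> * ((1 + \<xi>\<^sup>2) / 2))"
      by linarith
    then show "norm (of_real c * (iexp (- (u / s) * \<xi>) * (CLINT \<omega>|M. iexp ((\<tau> / s * \<xi>) * Y \<omega>) * Z \<omega>))) \<le>
       c * (b0 + b1 * (1 / \<delta> * ((1 + \<xi>\<^sup>2) / 2)))"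
      unfolding norm_mult using c by (auto intro!: mult_left_mono simp del: of_real_mult of_real_divide)
  qed
  also have "\<dots> = c * (b0 + b1 * (1 / \<delta>))"
    using std_normal_second_moment N.prob_space by (simp add: add_divide_distrib distrib_left)
  also have "\<dots> \<le> 1 / \<delta> * (b0 + b1 * (1 / \<delta>))"
    using c b d by (intro mult_right_mono) auto
  also have "\<dots> = (1 / \<delta>) * b0 + (1 / \<delta>\<^sup>2) * b1"
    by (simp add: distrib_left power2_eq_square)
  finally show ?thesis .
qed

lemma fourier_bounded_normal_density:
  assumes "prob_space M" "0 < \<delta>"
  shows "fourier_bounded M (normal_density u \<delta>) (1 / \<delta>) (1 / \<delta>\<^sup>2)"
  unfolding fourier_bounded_def
proof (intro conjI allI impI)
  show "\<exists>B. \<forall>x. \<bar>normal_density u \<delta> x\<bar> \<le> B"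
    using normal_density_le[of \<delta> \<delta> u] assms by (auto intro!: exI[of _ "1 / \<delta>"])
next
  fix Y Z B b0 b1
  assume "Y \<in> borel_measurable M" "Z \<in> borel_measurable M" "\<forall>\<omega>. norm (Z \<omega>) \<le> B" "0 \<le> b0" "0 \<le> b1"
    "\<forall>\<xi>. cmod (CLINT \<omega>|M. iexp (\<xi> * Y \<omega>) * Z \<omega>) \<le> b0 + b1 * \<bar>\<xi>\<bar>"
  then show "cmod (CLINT \<omega>|M. of_real (normal_density u \<delta> (Y \<omega>)) * Z \<omega>) \<le> 1 / \<delta> * b0 + 1 / \<delta>\<^sup>2 * b1"
    using normal_density_fourier_bound[of M Y Z B b0 b1 \<delta> \<delta> 1 u] assms by simp
qed simp

lemma continuous_on_skernel: "0 < \<delta> \<Longrightarrow> continuous_on UNIV (skernel \<sigma> \<delta> u)"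
  using skernel_deriv by (blast intro!: continuous_at_imp_continuous_on DERIV_isCont)

text \<open>\<open>skernel\<close> is an average of normal densities at \<open>\<tau> * x\<close>
  with \<open>\<tau>\<close> uniform on the unit interval, which is the law \<open>U\<close>. The
  bound for one density is uniform in \<open>\<tau>\<close>, so the kernel inherits the constants of
  a single density of width \<open>\<delta>\<close>.\<close>

lemma fourier_bounded_skernel:
  fixes M :: "'a measure"
  assumes M: "prob_space M" and d: "0 < \<delta>"
  shows "fourier_bounded M (skernel \<sigma> \<delta> u) (1 / \<delta>) (1 / \<delta>\<^sup>2)"
  unfolding fourier_bounded_def
proof (intro conjI allI impI)
  show "\<exists>B. \<forall>x. \<bar>skernel \<sigma> \<delta> u x\<bar> \<le> B"
    using skernel_bounds[OF d, of \<sigma> u] by (auto intro!: exI[of _ "1 / \<delta>"])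
  show "skernel \<sigma> \<delta> u \<in> borel_measurable borel"
    using continuous_on_skernel[OF d] by (rule borel_measurable_continuous_onI)
  fix Y :: "'a \<Rightarrow> real" and Z B b0 b1
  assume [measurable]: "Y \<in> borel_measurable M" "Z \<in> borel_measurable M" and bZ: "\<forall>\<omega>. norm (Z \<omega>) \<le> B" and b: "0 \<le> b0" "0 \<le> b1"
    and h: "\<forall>\<xi>. cmod (CLINT \<omega>|M. iexp (\<xi> * Y \<omega>) * Z \<omega>) \<le> b0 + b1 * \<bar>\<xi>\<bar>"
  define U where "U = restrict_space lborel {0..1::real}"
  interpret M: prob_space M by fact
  interpret U: prob_space U
    by (intro prob_spaceI) (simp add: U_def space_restrict_space emeasure_restrict_space)
  interpret P: pair_prob_space U M ..
  have id [measurable]: "(\<lambda>x. x) \<in> borel_measurable U" unfolding U_def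
    by (auto intro: measurable_restrict_space1)
  have spU: "space U = {0..1}" by (simp add: U_def space_restrict_space)
  let ?f = "\<lambda>\<tau> \<omega>. of_real (normal_density u (skernel_sd \<sigma> \<delta> \<tau>) (\<tau> * Y \<omega>)) * Z \<omega>"
  have bf: "norm (?f \<tau> \<omega>) \<le> 1 / \<delta> * B" if "\<tau> \<in> space U" for \<tau> \<omega>
  proof -
    have "normal_density u (skernel_sd \<sigma> \<delta> \<tau>) (\<tau> * Y \<omega>) \<le> 1 / \<delta>"
      using that d by (intro normal_density_le) (auto simp: spU intro!: skernel_sd)
    then have "normal_density u (skernel_sd \<sigma> \<delta> \<tau>) (\<tau> * Y \<omega>) * norm (Z \<omega>) \<le> 1 / \<delta> * B"
      using bZ d by (intro mult_mono) auto
    then show ?thesis by (simp add: norm_mult)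
  qed
  have int: "integrable (U \<Otimes>\<^sub>M M) (\<lambda>(\<tau>, \<omega>). ?f \<tau> \<omega>)"
    by (rule P.integrable_const_bound[of _ "1 / \<delta> * B"])
      (use bf in \<open>force simp: space_pair_measure intro!: AE_I2\<close>, simp add: normal_density_def skernel_sd_def)
  have e: "of_real (skernel \<sigma> \<delta> u (Y \<omega>)) * Z \<omega> = (CLINT \<tau>|U. ?f \<tau> \<omega>)" for \<omega>
  proof -
    let ?g = "\<lambda>\<tau>. normal_density u (skernel_sd \<sigma> \<delta> \<tau>) (\<tau> * Y \<omega>)"
    have si: "set_integrable lborel {0..1} ?g"
      by (rule borel_integrable_compact[of "{0..1}", unfolded set_integrable_def[symmetric], simplified])
        (auto intro!: skernel_section_continuous d)
    have "skernel \<sigma> \<delta> u (Y \<omega>) = (LBINT \<tau>:{0..1}. ?g \<tau>)"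
      unfolding skernel_def by (rule set_borel_integral_eq_integral(2)[OF si, symmetric])
    also have "\<dots> = (\<integral>\<tau>. ?g \<tau> \<partial>U)"
      unfolding U_def set_lebesgue_integral_def by (subst integral_restrict_space) auto
    finally show ?thesis by simp
  qed
  have E: "(CLINT \<omega>|M. of_real (skernel \<sigma> \<delta> u (Y \<omega>)) * Z \<omega>) = (CLINT \<tau>|U. CLINT \<omega>|M. ?f \<tau> \<omega>)"
    unfolding e by (rule P.Fubini_integral[OF int])
  have "norm (CLINT \<omega>|M. of_real (skernel \<sigma> \<delta> u (Y \<omega>)) * Z \<omega>) \<le> (\<integral>\<tau>. 1 / \<delta> * b0 + 1 / \<delta>\<^sup>2 * b1 \<partial>U)"
    unfolding E
  proof (rule bochner_norm_bound)
    show "integrable U (\<lambda>\<tau>. CLINT \<omega>|M. ?f \<tau> \<omega>)"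
      using P.integrable_fst'[OF int] by simp
    fix \<tau> assume "\<tau> \<in> space U"
    then show "norm (CLINT \<omega>|M. ?f \<tau> \<omega>) \<le> 1 / \<delta> * b0 + 1 / \<delta>\<^sup>2 * b1"
      using h bZ b d by (intro normal_density_fourier_bound[OF M, of Y Z B]) (auto simp: spU intro!: skernel_sd)
  qed simp
  also have "\<dots> = 1 / \<delta> * b0 + 1 / \<delta>\<^sup>2 * b1" by (simp add: U.prob_space)
  finally show "cmod (CLINT \<omega>|M. of_real (skernel \<sigma> \<delta> u (Y \<omega>)) * Z \<omega>) \<le> 1 / \<delta> * b0 + 1 / \<delta>\<^sup>2 * b1" .
qed

context gauss_family
begin

text \<open>The variance of the sum of the two forms is \<open>Q a + Q b + 2 * S\<close>, with
  \<open>S\<close> their covariance, and \<open>exp (- x)\<close> is Lipschitz with constant 1 on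
  nonnegative arguments.\<close>

lemma cov_exp:
  "norm ((CLINT \<omega>|M. iexp (\<Sum>i\<in>I. (a i + b i) * g i \<omega>)) -
     (CLINT \<omega>|M. iexp (\<Sum>i\<in>I. a i * g i \<omega>)) * (CLINT \<omega>|M. iexp (\<Sum>i\<in>I. b i * g i \<omega>)))
   \<le> \<bar>\<Sum>i\<in>I. \<Sum>j\<in>I. a i * b j * r i j\<bar>"
proof -
  define Q where "Q c = (\<Sum>i\<in>I. \<Sum>j\<in>I. c i * c j * r i j)" for c
  define S where "S = (\<Sum>i\<in>I. \<Sum>j\<in>I. a i * b j * r i j)"
  note [measurable] = g_measurable
  \<comment> \<open>Positive semidefiniteness of \<open>r\<close> comes from the modulus of a
    characteristic function being at most 1.\<close>
  have Q0: "0 \<le> Q c" for c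
  proof -
    have "norm (CLINT \<omega>|M. iexp (\<Sum>i\<in>I. c i * g i \<omega>)) \<le> (\<integral>\<omega>. 1 \<partial>M)"
      by (rule bochner_norm_bound)
        (auto intro!: integrable_const_bound[of _ 1] simp del: of_real_sum of_real_mult)
    then have "exp (- Q c / 2) \<le> 1" unfolding char_g Q_def by (simp add: prob_space)
    then show ?thesis by simp
  qed
  have "S = (\<Sum>j\<in>I. \<Sum>i\<in>I. a i * b j * r i j)" unfolding S_def by (rule sum.swap)
  also have "\<dots> = (\<Sum>i\<in>I. \<Sum>j\<in>I. b i * a j * r i j)"
    by (intro sum.cong refl) (simp add: r_sym mult_ac)
  finally have "Q (\<lambda>i. a i + b i) = Q a + Q b + 2 * S"
    unfolding Q_def S_def
    by (simp add: distrib_left distrib_right sum.distrib)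
  moreover have "\<bar>exp (- x) - exp (- y)\<bar> \<le> \<bar>x - y\<bar>" if "0 \<le> x" "0 \<le> y" for x y :: real
  proof -
    have *: "exp (- y) - exp (- x) \<le> x - y" if "0 \<le> y" "y \<le> x" for x y :: real
    proof -
      have "1 - exp (- (x - y)) \<le> x - y" using exp_ge_add_one_self[of "- (x - y)"] by linarith
      then have "exp (- y) * (1 - exp (- (x - y))) \<le> 1 * (x - y)"
        using that by (intro mult_mono) auto
      then show ?thesis by (simp add: right_diff_distrib exp_add[symmetric])
    qed
    show ?thesis using *[of y x] *[of x y] that by (cases "y \<le> x") auto
  qed
  note this[of "Q (\<lambda>i. a i + b i) / 2" "(Q a + Q b) / 2"]
  ultimately have "\<bar>exp (- (Q (\<lambda>i. a i + b i) / 2)) - exp (- ((Q a + Q b) / 2))\<bar> \<le> \<bar>S\<bar>"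
    using Q0[of a] Q0[of b] Q0[of "\<lambda>i. a i + b i"] by (simp add: add_divide_distrib)
  moreover have "exp (- (Q a) / 2) * exp (- (Q b) / 2) = exp (- ((Q a + Q b) / 2))"
    by (simp add: exp_add[symmetric] add_divide_distrib)
  ultimately show ?thesis
    unfolding char_g Q_def[symmetric] S_def[symmetric] of_real_mult[symmetric] of_real_diff[symmetric] norm_of_real
    by simp
qed

text \<open>Two forms in two variables each, bracketed so that \<open>cov4\<close> can replace the
  exponentials one by one. Each term of the bound contains one frequency from either pair.\<close>

lemma cov_exp4:
  assumes i: "i \<in> I" "j \<in> I" "k \<in> I" "l \<in> I"
  shows "norm (CLINT \<omega>|M. iexp (x * g i \<omega>) * (iexp (y * g j \<omega>) * (iexp (z * g k \<omega>) * iexp (w * g l \<omega>) -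
      (CLINT \<omega>|M. iexp (z * g k \<omega>) * iexp (w * g l \<omega>))))) \<le>
    \<bar>x\<bar> * (\<bar>z\<bar> * \<bar>r i k\<bar> + \<bar>w\<bar> * \<bar>r i l\<bar>) + \<bar>y\<bar> * (\<bar>z\<bar> * \<bar>r j k\<bar> + \<bar>w\<bar> * \<bar>r j l\<bar>)"
proof -
  note [measurable] = g_measurable[OF i(1)] g_measurable[OF i(2)] g_measurable[OF i(3)] g_measurable[OF i(4)]
  \<comment> \<open>The indices may coincide, so coefficients are added up instead of being assigned
    by cases.\<close>
  define a b where "a m = x * of_bool (m = i) + y * of_bool (m = j)"
    and "b m = z * of_bool (m = k) + w * of_bool (m = l)" for m
  have sum1: "(\<Sum>m\<in>I. (p * of_bool (m = n)) * f m) = p * f n" if "n \<in> I" for p n and f :: "'i \<Rightarrow> real"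
    using that finite_I by (simp add: of_bool_def if_distrib[of "\<lambda>x. x * _"] if_distrib[of "\<lambda>x. _ * x"] cong: if_cong)
  have sa: "(\<Sum>m\<in>I. a m * f m) = x * f i + y * f j" and sb: "(\<Sum>m\<in>I. b m * f m) = z * f k + w * f l" for f
    unfolding a_def b_def distrib_right sum.distrib using i by (auto simp: sum1)
  have ea: "iexp (\<Sum>m\<in>I. a m * g m \<omega>) = iexp (x * g i \<omega>) * iexp (y * g j \<omega>)"
    and eb: "iexp (\<Sum>m\<in>I. b m * g m \<omega>) = iexp (z * g k \<omega>) * iexp (w * g l \<omega>)" for \<omega>
    unfolding sa sb by (simp_all add: exp_add distrib_left)
  have eab: "iexp (\<Sum>m\<in>I. (a m + b m) * g m \<omega>) = iexp (x * g i \<omega>) * iexp (y * g j \<omega>) * (iexp (z * g k \<omega>) * iexp (w * g l \<omega>))" for \<omega>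
    unfolding distrib_right sum.distrib of_real_add distrib_left exp_add ea eb ..
  have "(\<Sum>m\<in>I. \<Sum>n\<in>I. a m * b n * r m n) = (\<Sum>m\<in>I. a m * (\<Sum>n\<in>I. b n * r m n))"
    by (simp add: sum_distrib_left mult.assoc)
  also have "\<dots> = x * (z * r i k + w * r i l) + y * (z * r j k + w * r j l)"
    unfolding sb sa ..
  also have "\<bar>\<dots>\<bar> \<le> \<bar>x\<bar> * (\<bar>z\<bar> * \<bar>r i k\<bar> + \<bar>w\<bar> * \<bar>r i l\<bar>) + \<bar>y\<bar> * (\<bar>z\<bar> * \<bar>r j k\<bar> + \<bar>w\<bar> * \<bar>r j l\<bar>)"
  proof -
    have "\<bar>p + q\<bar> \<le> p' + q'" if "\<bar>p\<bar> \<le> p'" "\<bar>q\<bar> \<le> q'" for p q p' q' :: real using that by linarith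
    note this[intro!]
    show ?thesis by (auto simp: abs_mult intro!: mult_left_mono)
  qed
  finally have bound: "\<bar>\<Sum>m\<in>I. \<Sum>n\<in>I. a m * b n * r m n\<bar> \<le> \<bar>x\<bar> * (\<bar>z\<bar> * \<bar>r i k\<bar> + \<bar>w\<bar> * \<bar>r i l\<bar>) + \<bar>y\<bar> * (\<bar>z\<bar> * \<bar>r j k\<bar> + \<bar>w\<bar> * \<bar>r j l\<bar>)" .
  have i1: "integrable M (\<lambda>\<omega>. iexp (x * g i \<omega>) * iexp (y * g j \<omega>) * (iexp (z * g k \<omega>) * iexp (w * g l \<omega>)))"
    "integrable M (\<lambda>\<omega>. iexp (x * g i \<omega>) * iexp (y * g j \<omega>))"
    by (rule integrable_const_bound[of _ 1]; auto simp: norm_mult simp del: of_real_mult)+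
  have "(CLINT \<omega>|M. iexp (x * g i \<omega>) * (iexp (y * g j \<omega>) * (iexp (z * g k \<omega>) * iexp (w * g l \<omega>) -
      (CLINT \<omega>|M. iexp (z * g k \<omega>) * iexp (w * g l \<omega>))))) =
    (CLINT \<omega>|M. iexp (x * g i \<omega>) * iexp (y * g j \<omega>) * (iexp (z * g k \<omega>) * iexp (w * g l \<omega>)) -
      iexp (x * g i \<omega>) * iexp (y * g j \<omega>) * (CLINT \<omega>|M. iexp (z * g k \<omega>) * iexp (w * g l \<omega>)))"
    by (simp only: mult.assoc[symmetric] right_diff_distrib)
  also have "\<dots> = (CLINT \<omega>|M. iexp (x * g i \<omega>) * iexp (y * g j \<omega>) * (iexp (z * g k \<omega>) * iexp (w * g l \<omega>))) -
      (CLINT \<omega>|M. iexp (x * g i \<omega>) * iexp (y * g j \<omega>)) * (CLINT \<omega>|M. iexp (z * g k \<omega>) * iexp (w * g l \<omega>))"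
    using i1 by (subst Bochner_Integration.integral_diff) auto
  finally show ?thesis
    using cov_exp[of a b, unfolded eab ea eb] bound by (auto elim!: order_trans simp only:)
qed

text \<open>Every term of the bound in \<open>cov_exp4\<close> is a product of two of the four
  frequencies. Replacing the exponentials in turn by \<open>A1\<close>, \<open>A2\<close>,
  \<open>A3\<close>, \<open>A4\<close> through \<open>fourier_bounded\<close> turns a frequency that
  is present into \<open>K1\<close> and one that is absent into \<open>K0\<close>; so each term ends
  with two factors of either kind.\<close>

lemma cov4:
  assumes i: "i \<in> I" "j \<in> I" "k \<in> I" "l \<in> I"
    and A: "fourier_bounded M A1 K0 K1" "fourier_bounded M A2 K0 K1"
      "fourier_bounded M A3 K0 K1" "fourier_bounded M A4 K0 K1"
    and K: "0 \<le> K0" "0 \<le> K1"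
  shows "\<bar>(\<integral>\<omega>. A1 (g i \<omega>) * A2 (g j \<omega>) * (A3 (g k \<omega>) * A4 (g l \<omega>)) \<partial>M) -
      (\<integral>\<omega>. A1 (g i \<omega>) * A2 (g j \<omega>) \<partial>M) * (\<integral>\<omega>. A3 (g k \<omega>) * A4 (g l \<omega>) \<partial>M)\<bar> \<le>
    (K0 * K1)\<^sup>2 * (\<bar>r i k\<bar> + \<bar>r i l\<bar> + \<bar>r j k\<bar> + \<bar>r j l\<bar>)"
proof -
  note [measurable] = g_measurable[OF i(1)] g_measurable[OF i(2)] g_measurable[OF i(3)] g_measurable[OF i(4)]
  have [measurable]: "A1 \<in> borel_measurable borel" "A2 \<in> borel_measurable borel"
    "A3 \<in> borel_measurable borel" "A4 \<in> borel_measurable borel"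
    using A by (auto simp: fourier_bounded_def)
  have "\<exists>B. \<forall>x. \<bar>A1 x\<bar> \<le> B" "\<exists>B. \<forall>x. \<bar>A2 x\<bar> \<le> B" "\<exists>B. \<forall>x. \<bar>A3 x\<bar> \<le> B" "\<exists>B. \<forall>x. \<bar>A4 x\<bar> \<le> B"
    using A by (auto simp: fourier_bounded_def)
  then obtain B1 B2 B3 B4 where b0: "\<And>x. \<bar>A1 x\<bar> \<le> B1" "\<And>x. \<bar>A2 x\<bar> \<le> B2" "\<And>x. \<bar>A3 x\<bar> \<le> B3" "\<And>x. \<bar>A4 x\<bar> \<le> B4"
    by auto
  define B where "B = max (max B1 B2) (max B3 B4)"
  have b: "\<bar>A1 x\<bar> \<le> B" "\<bar>A2 x\<bar> \<le> B" "\<bar>A3 x\<bar> \<le> B" "\<bar>A4 x\<bar> \<le> B" for x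
    by (simp_all add: B_def le_max_iff_disj b0)
  have B: "0 \<le> B" using b(1)[of 0] by simp
  have bp: "\<bar>A1 x * A2 y\<bar> \<le> B * B" "\<bar>A3 x * A4 y\<bar> \<le> B * B" for x y
    unfolding abs_mult by (intro mult_mono b; simp add: B)+
  have FB: "norm (CLINT \<omega>|M. of_real (A (Y \<omega>)) * Z \<omega>) \<le> K0 * b0 + K1 * b1"
    if "fourier_bounded M A K0 K1" "Y \<in> borel_measurable M" "Z \<in> borel_measurable M"
      "\<And>\<omega>. norm (Z \<omega>) \<le> B" "0 \<le> b0" "0 \<le> b1"
      "\<And>\<xi>. norm (CLINT \<omega>|M. iexp (\<xi> * Y \<omega>) * Z \<omega>) \<le> b0 + b1 * \<bar>\<xi>\<bar>" for A Y Z B b0 b1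
    using that unfolding fourier_bounded_def by blast
  define m34 where "m34 z w = (CLINT \<omega>|M. iexp (z * g k \<omega>) * iexp (w * g l \<omega>))" for z w
  define F where "F z w \<omega> = iexp (z * g k \<omega>) * iexp (w * g l \<omega>) - m34 z w" for z w \<omega>
  define Q where "Q \<omega> = complex_of_real (A1 (g i \<omega>) * A2 (g j \<omega>))" for \<omega>
  define m12 where "m12 = (CLINT \<omega>|M. Q \<omega>)"
  have [measurable]: "F z w \<in> borel_measurable M" "Q \<in> borel_measurable M" for z w
    unfolding F_def[abs_def] Q_def[abs_def] by measurable
  have bm: "norm (CLINT \<omega>|M. h \<omega>) \<le> C"
    if "h \<in> borel_measurable M" "\<And>\<omega>. norm (h \<omega>) \<le> C" for h :: "'a \<Rightarrow> complex" and C
  proof -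
    have "norm (CLINT \<omega>|M. h \<omega>) \<le> (\<integral>\<omega>. C \<partial>M)"
      by (rule bochner_norm_bound)
        (use that in \<open>auto intro!: integrable_const_bound[of _ C]\<close>)
    then show ?thesis by (simp add: prob_space)
  qed
  have bF: "norm (F z w \<omega>) \<le> 1 + 1" for z w \<omega>
    unfolding F_def m34_def
    by (rule order_trans[OF norm_triangle_ineq4], rule add_mono)
      (auto simp: norm_mult intro!: bm simp del: of_real_mult)
  have bQ: "norm (Q \<omega> - m12) \<le> B * B + B * B" for \<omega>
    unfolding m12_def
    by (rule order_trans[OF norm_triangle_ineq4], rule add_mono)
      (auto simp: Q_def intro!: bm bp simp del: of_real_mult)
  have iQ: "integrable M Q"
    by (rule integrable_const_bound[of _ "B * B"]) (auto simp: Q_def intro!: bp simp del: of_real_mult)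
  have 1: "norm (CLINT \<omega>|M. of_real (A1 (g i \<omega>)) * (iexp (y * g j \<omega>) * F z w \<omega>)) \<le>
    K0 * (\<bar>y\<bar> * (\<bar>z\<bar> * \<bar>r j k\<bar> + \<bar>w\<bar> * \<bar>r j l\<bar>)) + K1 * (\<bar>z\<bar> * \<bar>r i k\<bar> + \<bar>w\<bar> * \<bar>r i l\<bar>)" for y z w
  proof (rule FB[OF A(1), of _ _ "1 + 1"])
    fix x
    show "norm (CLINT \<omega>|M. iexp (x * g i \<omega>) * (iexp (y * g j \<omega>) * F z w \<omega>)) \<le>
      \<bar>y\<bar> * (\<bar>z\<bar> * \<bar>r j k\<bar> + \<bar>w\<bar> * \<bar>r j l\<bar>) + (\<bar>z\<bar> * \<bar>r i k\<bar> + \<bar>w\<bar> * \<bar>r i l\<bar>) * \<bar>x\<bar>"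
      using cov_exp4[OF i, of x y z w] unfolding F_def m34_def
      by (simp only: mult.commute[of "\<bar>x\<bar>"] add.commute[of "_ * \<bar>x\<bar>"])
  qed (use bF in \<open>auto simp: norm_mult simp del: of_real_mult\<close>)
  have 2: "norm (CLINT \<omega>|M. of_real (A2 (g j \<omega>)) * (of_real (A1 (g i \<omega>)) * F z w \<omega>)) \<le>
    K0 * (K1 * (\<bar>z\<bar> * \<bar>r i k\<bar> + \<bar>w\<bar> * \<bar>r i l\<bar>)) + K1 * (K0 * (\<bar>z\<bar> * \<bar>r j k\<bar> + \<bar>w\<bar> * \<bar>r j l\<bar>))" for z w
  proof (rule FB[OF A(2), of _ _ "B * (1 + 1)"])
    fix y
    have "(\<lambda>\<omega>. iexp (y * g j \<omega>) * (of_real (A1 (g i \<omega>)) * F z w \<omega>)) =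
      (\<lambda>\<omega>. of_real (A1 (g i \<omega>)) * (iexp (y * g j \<omega>) * F z w \<omega>))" by (simp only: mult_ac)
    then show "norm (CLINT \<omega>|M. iexp (y * g j \<omega>) * (of_real (A1 (g i \<omega>)) * F z w \<omega>)) \<le>
      K1 * (\<bar>z\<bar> * \<bar>r i k\<bar> + \<bar>w\<bar> * \<bar>r i l\<bar>) + K0 * (\<bar>z\<bar> * \<bar>r j k\<bar> + \<bar>w\<bar> * \<bar>r j l\<bar>) * \<bar>y\<bar>"
      using 1[of y z w] by (simp add: algebra_simps)
    show "norm (of_real (A1 (g i \<omega>)) * F z w \<omega>) \<le> B * (1 + 1)" for \<omega>
      unfolding norm_mult norm_of_real by (intro mult_mono b bF) (auto simp: B)
  qed (use K in auto)
  \<comment> \<open>The constant \<open>m34 z w\<close> depends on \<open>z\<close> and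
    \<open>w\<close>, whereas \<open>fourier_bounded\<close> needs a factor \<open>Z\<close> that is
    free of the frequency being integrated. A covariance may be centred on either side, so the
    centring moves to the first pair before \<open>A3\<close> and \<open>A4\<close> are
    inserted.\<close>
  have swap: "(CLINT \<omega>|M. of_real (A2 (g j \<omega>)) * (of_real (A1 (g i \<omega>)) * F z w \<omega>)) =
      (CLINT \<omega>|M. iexp (z * g k \<omega>) * (iexp (w * g l \<omega>) * (Q \<omega> - m12)))" for z w
  proof -
    have ie: "integrable M (\<lambda>\<omega>. iexp (z * g k \<omega>) * iexp (w * g l \<omega>))"
      by (rule integrable_const_bound[of _ 1]) (auto simp: norm_mult simp del: of_real_mult)
    have iQe: "integrable M (\<lambda>\<omega>. Q \<omega> * (iexp (z * g k \<omega>) * iexp (w * g l \<omega>)))"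
    proof (rule integrable_const_bound[of _ "B * B"])
      have "norm (Q \<omega>) \<le> B * B" for \<omega> unfolding Q_def norm_of_real by (rule bp)
      then show "AE \<omega> in M. norm (Q \<omega> * (iexp (z * g k \<omega>) * iexp (w * g l \<omega>))) \<le> B * B"
        by (auto simp: norm_mult simp del: of_real_mult)
    qed measurable
    have "(CLINT \<omega>|M. of_real (A2 (g j \<omega>)) * (of_real (A1 (g i \<omega>)) * F z w \<omega>)) =
      (CLINT \<omega>|M. Q \<omega> * (iexp (z * g k \<omega>) * iexp (w * g l \<omega>)) - Q \<omega> * m34 z w)"
      unfolding F_def Q_def of_real_mult by (intro Bochner_Integration.integral_cong refl) (simp only: right_diff_distrib mult_ac)
    also have "\<dots> = (CLINT \<omega>|M. Q \<omega> * (iexp (z * g k \<omega>) * iexp (w * g l \<omega>))) - m12 * m34 z w"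
      using iQe iQ by (subst Bochner_Integration.integral_diff) (auto simp: m12_def)
    also have "\<dots> = (CLINT \<omega>|M. Q \<omega> * (iexp (z * g k \<omega>) * iexp (w * g l \<omega>)) - m12 * (iexp (z * g k \<omega>) * iexp (w * g l \<omega>)))"
      using iQe ie by (subst Bochner_Integration.integral_diff) (auto simp: m34_def)
    also have "\<dots> = (CLINT \<omega>|M. iexp (z * g k \<omega>) * (iexp (w * g l \<omega>) * (Q \<omega> - m12)))"
      by (intro Bochner_Integration.integral_cong refl) (simp only: right_diff_distrib left_diff_distrib mult_ac)
    finally show ?thesis .
  qed
  have 3: "norm (CLINT \<omega>|M. of_real (A3 (g k \<omega>)) * (iexp (w * g l \<omega>) * (Q \<omega> - m12))) \<le>
    K0 * (K0 * K1 * (\<bar>w\<bar> * (\<bar>r i l\<bar> + \<bar>r j l\<bar>))) + K1 * (K0 * K1 * (\<bar>r i k\<bar> + \<bar>r j k\<bar>))" for w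
  proof (rule FB[OF A(3), of _ _ "B * B + B * B"])
    fix z
    show "norm (CLINT \<omega>|M. iexp (z * g k \<omega>) * (iexp (w * g l \<omega>) * (Q \<omega> - m12))) \<le>
      K0 * K1 * (\<bar>w\<bar> * (\<bar>r i l\<bar> + \<bar>r j l\<bar>)) + K0 * K1 * (\<bar>r i k\<bar> + \<bar>r j k\<bar>) * \<bar>z\<bar>"
      using 2[of z w] unfolding swap by (simp add: algebra_simps)
  qed (use K bQ in \<open>auto simp: norm_mult simp del: of_real_mult\<close>)
  have 4: "norm (CLINT \<omega>|M. of_real (A4 (g l \<omega>)) * (of_real (A3 (g k \<omega>)) * (Q \<omega> - m12))) \<le>
    K0 * (K1 * (K0 * K1 * (\<bar>r i k\<bar> + \<bar>r j k\<bar>))) + K1 * (K0 * (K0 * K1 * (\<bar>r i l\<bar> + \<bar>r j l\<bar>)))"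
  proof (rule FB[OF A(4), of _ _ "B * (B * B + B * B)"])
    fix w
    have "(\<lambda>\<omega>. iexp (w * g l \<omega>) * (of_real (A3 (g k \<omega>)) * (Q \<omega> - m12))) =
      (\<lambda>\<omega>. of_real (A3 (g k \<omega>)) * (iexp (w * g l \<omega>) * (Q \<omega> - m12)))" by (simp only: mult_ac)
    then show "norm (CLINT \<omega>|M. iexp (w * g l \<omega>) * (of_real (A3 (g k \<omega>)) * (Q \<omega> - m12))) \<le>
      K1 * (K0 * K1 * (\<bar>r i k\<bar> + \<bar>r j k\<bar>)) + K0 * (K0 * K1 * (\<bar>r i l\<bar> + \<bar>r j l\<bar>)) * \<bar>w\<bar>"
      using 3[of w] by (simp add: algebra_simps)
    show "norm (of_real (A3 (g k \<omega>)) * (Q \<omega> - m12)) \<le> B * (B * B + B * B)" for \<omega>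
      unfolding norm_mult norm_of_real by (intro mult_mono b bQ) (auto simp: B)
  qed (use K in auto)
  have m12_eq: "m12 = of_real (\<integral>\<omega>. A1 (g i \<omega>) * A2 (g j \<omega>) \<partial>M)"
    unfolding m12_def Q_def by (rule integral_complex_of_real)
  define P where "P \<omega> = A3 (g k \<omega>) * A4 (g l \<omega>)" for \<omega>
  have [measurable]: "P \<in> borel_measurable M" unfolding P_def[abs_def] by measurable
  have iP: "integrable M P" "integrable M (\<lambda>\<omega>. A1 (g i \<omega>) * A2 (g j \<omega>) * P \<omega>)"
    unfolding P_def[abs_def]
    by (rule integrable_const_bound[of _ "B * B"], auto intro!: bp,
        rule integrable_const_bound[of _ "(B * B) * (B * B)"], auto simp only: abs_mult[of "_ * _" "_ * _"] real_norm_def intro!: AE_I2 mult_mono bp, auto simp: B)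
  have "(CLINT \<omega>|M. of_real (A4 (g l \<omega>)) * (of_real (A3 (g k \<omega>)) * (Q \<omega> - m12))) =
    (CLINT \<omega>|M. of_real (A1 (g i \<omega>) * A2 (g j \<omega>) * P \<omega> - (\<integral>\<omega>. A1 (g i \<omega>) * A2 (g j \<omega>) \<partial>M) * P \<omega>))"
    unfolding m12_eq Q_def[abs_def]
    by (intro Bochner_Integration.integral_cong refl) (simp add: P_def algebra_simps)
  also have "\<dots> = of_real ((\<integral>\<omega>. A1 (g i \<omega>) * A2 (g j \<omega>) * P \<omega> \<partial>M) -
      (\<integral>\<omega>. A1 (g i \<omega>) * A2 (g j \<omega>) \<partial>M) * (\<integral>\<omega>. P \<omega> \<partial>M))"
    unfolding integral_complex_of_real using iP by simp
  finally show ?thesis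
    using 4 unfolding P_def by (simp only: norm_of_real) (simp add: algebra_simps power2_eq_square)
qed

end

section \<open>The Stein-Tikhomirov differential equation\<close>

lemma iexp_expectation_deriv:
  assumes M: "prob_space M" and [measurable]: "W \<in> borel_measurable M"
    and bW: "\<And>\<omega>. \<bar>W \<omega>\<bar> \<le> (C::real)"
  shows "((\<lambda>t. CLINT \<omega>|M. iexp (t * W \<omega>)) has_vector_derivative (\<i> * (CLINT \<omega>|M. W \<omega> *\<^sub>R iexp (t * W \<omega>)))) (at t)"
proof -
  interpret prob_space M by fact
  define \<psi> where "\<psi> t = (CLINT \<omega>|M. iexp (t * W \<omega>))" for t
  define D where "D = \<i> * (CLINT \<omega>|M. W \<omega> *\<^sub>R iexp (t * W \<omega>))"
  have C: "0 \<le> C" using bW[of undefined] by linarith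
  have i1: "integrable M (\<lambda>\<omega>. iexp (t * W \<omega>))" for t
    by (rule integrable_iexp) auto
  have i2: "integrable M (\<lambda>\<omega>. W \<omega> *\<^sub>R iexp (t * W \<omega>))" for t
    by (rule integrable_const_bound[of _ C]) (auto simp: bW simp del: of_real_mult)
  \<comment> \<open>The Taylor remainder of \<open>iexp\<close> is quadratic in \<open>h\<close>,
    uniformly in \<open>\<omega>\<close> because \<open>W\<close> is bounded; this takes the place
    of dominated convergence.\<close>
  have q: "norm (\<psi> (t + h) - \<psi> t - h *\<^sub>R D) \<le> C\<^sup>2 / 2 * h\<^sup>2" for h
  proof -
    have "\<psi> (t + h) - \<psi> t - h *\<^sub>R D =
      \<psi> (t + h) - \<psi> t - (\<i> * of_real h) * (CLINT \<omega>|M. W \<omega> *\<^sub>R iexp (t * W \<omega>))"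
      by (simp add: D_def scaleR_conv_of_real mult_ac del: of_real_mult)
    also have "\<dots> =
      (CLINT \<omega>|M. iexp ((t + h) * W \<omega>) - iexp (t * W \<omega>) - (\<i> * of_real h) * (W \<omega> *\<^sub>R iexp (t * W \<omega>)))"
    proof -
      have "integrable M (\<lambda>\<omega>. (\<i> * of_real h) * (W \<omega> *\<^sub>R iexp (t * W \<omega>)))"
        using i2[of t] by (rule integrable_mult_right)
      then show ?thesis unfolding \<psi>_def integral_mult_right_zero[symmetric]
        by (simp only: Bochner_Integration.integral_diff Bochner_Integration.integrable_diff i1)
    qed
    finally have E: "\<psi> (t + h) - \<psi> t - h *\<^sub>R D = \<dots>" .
    have "norm (\<psi> (t + h) - \<psi> t - h *\<^sub>R D) \<le> (\<integral>\<omega>. C\<^sup>2 / 2 * h\<^sup>2 \<partial>M)"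
      unfolding E
    proof (rule bochner_norm_bound)
      fix \<omega>
      have "iexp ((t + h) * W \<omega>) = iexp (t * W \<omega>) * iexp (h * W \<omega>)"
        by (simp only: distrib_right of_real_add distrib_left exp_add)
      then have "iexp ((t + h) * W \<omega>) - iexp (t * W \<omega>) - (\<i> * of_real h) * (W \<omega> *\<^sub>R iexp (t * W \<omega>)) =
        iexp (t * W \<omega>) * (iexp (h * W \<omega>) - (1 + \<i> * of_real (h * W \<omega>)))"
        by (simp add: algebra_simps scaleR_conv_of_real)
      also have "norm \<dots> = norm (iexp (h * W \<omega>) - (1 + \<i> * of_real (h * W \<omega>)))"
        by (simp add: norm_mult del: of_real_mult)
      also have "\<dots> \<le> \<bar>h * W \<omega>\<bar>\<^sup>2 / 2"
        using iexp_approx1[of "h * W \<omega>" 1] by (simp add: numeral_2_eq_2 del: of_real_mult)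
      also have "\<dots> \<le> C\<^sup>2 / 2 * h\<^sup>2"
        using mult_mono[OF power_mono[OF bW[of \<omega>], of 2] order_refl[of "h\<^sup>2"]] by (simp add: power_mult_distrib mult_ac)
      finally show "norm (iexp ((t + h) * W \<omega>) - iexp (t * W \<omega>) - (\<i> * of_real h) * (W \<omega> *\<^sub>R iexp (t * W \<omega>))) \<le> C\<^sup>2 / 2 * h\<^sup>2" .
    qed ((intro Bochner_Integration.integrable_diff integrable_mult_right i1 i2 | simp)+)
    then show ?thesis by (simp add: prob_space)
  qed
  have "(\<psi> has_vector_derivative D) (at t)"
    unfolding has_vector_derivative_def has_derivative_at
  proof
    show "(\<lambda>h. norm (\<psi> (t + h) - \<psi> t - h *\<^sub>R D) / norm h) \<midarrow>0\<rightarrow> 0"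
    proof (rule Lim_null_comparison)
      show "\<forall>\<^sub>F h in at 0. norm (norm (\<psi> (t + h) - \<psi> t - h *\<^sub>R D) / norm h) \<le> C\<^sup>2 / 2 * \<bar>h\<bar>"
      proof (rule eventually_at_filter[THEN iffD2, OF always_eventually], intro allI impI)
        fix h :: real assume "h \<noteq> 0"
        then show "norm (norm (\<psi> (t + h) - \<psi> t - h *\<^sub>R D) / norm h) \<le> C\<^sup>2 / 2 * \<bar>h\<bar>"
          using q[of h] by (simp add: divide_le_eq power2_eq_square mult.assoc abs_mult_self_eq)
      qed
      show "((\<lambda>h. C\<^sup>2 / 2 * \<bar>h\<bar>) \<longlongrightarrow> 0) (at 0)"
        by (auto intro!: tendsto_eq_intros)
    qed
  qed (rule bounded_linear_scaleR_left)
  then show ?thesis unfolding \<psi>_def[abs_def] D_def .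
qed

text \<open>By \<open>eq\<close> the derivative of \<open>\<psi>\<close> at \<open>t\<close> is
  \<open>- t * s * \<psi> t\<close> up to an error of modulus at most
  \<open>\<bar>t\<bar> * \<Delta>\<close>. The integrating factor
  \<open>exp (s * t\<^sup>2 / 2)\<close> removes the main term, and integrating the error from 0 to
  \<open>t\<close> gives \<open>t\<^sup>2 / 2 * \<Delta>\<close>. Nothing is divided by
  \<open>s\<close>, so \<open>s = 0\<close> is covered.\<close>

lemma stein_tikhomirov:
  assumes M: "prob_space M" and [measurable]: "W \<in> borel_measurable M"
    and bW: "\<And>\<omega>. \<bar>W \<omega>\<bar> \<le> (C::real)" and G: "integrable M G" and s: "0 \<le> (s::real)"
    and eq: "\<And>t. (CLINT \<omega>|M. W \<omega> *\<^sub>R iexp (t * W \<omega>)) = \<i> * of_real t * (CLINT \<omega>|M. G \<omega> *\<^sub>R iexp (t * W \<omega>))"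
  shows "norm ((CLINT \<omega>|M. iexp (t * W \<omega>)) - of_real (exp (- s * t\<^sup>2 / 2))) \<le> t\<^sup>2 / 2 * (\<integral>\<omega>. \<bar>G \<omega> - s\<bar> \<partial>M)"
proof -
  interpret prob_space M by fact
  define \<psi> where "\<psi> t = (CLINT \<omega>|M. iexp (t * W \<omega>))" for t
  define \<Delta> where "\<Delta> = (\<integral>\<omega>. \<bar>G \<omega> - s\<bar> \<partial>M)"
  have iG: "integrable M (\<lambda>\<omega>. G \<omega> *\<^sub>R iexp (t * W \<omega>))" for t
    by (rule Bochner_Integration.integrable_bound[OF G]) (use G in \<open>auto simp del: of_real_mult\<close>)
  have i1: "integrable M (\<lambda>\<omega>. iexp (t * W \<omega>))" for t
    by (rule integrable_iexp) auto
  have d\<psi>: "(\<psi> has_vector_derivative - of_real t * (CLINT \<omega>|M. G \<omega> *\<^sub>R iexp (t * W \<omega>))) (at t)" for t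
    using iexp_expectation_deriv[OF M assms(2) bW, of t] unfolding \<psi>_def[abs_def] eq
    by (simp add: mult.assoc[symmetric])
  \<comment> \<open>The mean value inequality is used on \<open>{0..t}\<close> with positive
    \<open>t\<close>; \<open>e = -1\<close> takes care of negative arguments. The factor
    \<open>exp (s * x\<^sup>2 / 2)\<close> is estimated by its value at \<open>t\<close>, which
    cancels in \<open>key2\<close>.\<close>
  have key: "norm (\<psi> (e * t) * of_real (exp (s * t\<^sup>2 / 2)) - 1) \<le> \<Delta> * exp (s * t\<^sup>2 / 2) * (t\<^sup>2 / 2)"
    if e: "e = 1 \<or> e = -1" and t: "0 < t" for e t :: real
  proof -
    define f where "f x = exp (s * x\<^sup>2 / 2) *\<^sub>R \<psi> (e * x)" for x
    define f' where "f' x = exp (s * x\<^sup>2 / 2) *\<^sub>R (e *\<^sub>R (- of_real (e * x) * (CLINT \<omega>|M. G \<omega> *\<^sub>R iexp (e * x * W \<omega>)))) +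
        (exp (s * x\<^sup>2 / 2) * (s * x)) *\<^sub>R \<psi> (e * x)" for x
    have df: "(f has_vector_derivative f' x) (at x)" for x
    proof -
      have "((\<lambda>x. exp (s * x\<^sup>2 / 2)) has_real_derivative exp (s * x\<^sup>2 / 2) * (s * x)) (at x)"
        by (auto intro!: derivative_eq_intros)
      moreover have "((\<psi> \<circ> (\<lambda>x. e * x)) has_vector_derivative e *\<^sub>R (- of_real (e * x) * (CLINT \<omega>|M. G \<omega> *\<^sub>R iexp (e * x * W \<omega>)))) (at x)"
        by (rule vector_diff_chain_at[OF _ d\<psi>]) (auto intro!: derivative_eq_intros)
      ultimately show ?thesis unfolding f_def[abs_def] f'_def o_def
        by (rule has_vector_derivative_scaleR)
    qed
    have ee: "e * e = 1" using e by auto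
    have nf: "norm (f' x) \<le> \<Delta> * exp (s * t\<^sup>2 / 2) * x" if x: "0 < x" "x < t" for x
    proof -
      have "f' x = of_real (- (exp (s * x\<^sup>2 / 2) * x)) * (CLINT \<omega>|M. G \<omega> *\<^sub>R iexp (e * x * W \<omega>)) + of_real (exp (s * x\<^sup>2 / 2) * x) * (s *\<^sub>R \<psi> (e * x))"
      proof -
        have *: "E * (e' * (- (e' * x') * G)) + (E * (s' * x')) * P = - (E * x') * G + (E * x') * (s' * P)"
          if "e' * e' = 1" for E e' x' s' G P :: complex
        proof -
          have "E * (e' * (- (e' * x') * G)) = - ((e' * e') * (E * x' * G))" by (simp add: mult_ac)
          then show ?thesis using that by (simp add: mult_ac)
        qed
        have "of_real e * of_real e = (1::complex)" using ee by (metis of_real_1 of_real_mult)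
        from *[OF this] show ?thesis
          unfolding f'_def scaleR_conv_of_real of_real_mult of_real_minus .
      qed
      also have "\<dots> = of_real (- (exp (s * x\<^sup>2 / 2) * x)) * (CLINT \<omega>|M. (G \<omega> - s) *\<^sub>R iexp (e * x * W \<omega>))"
        unfolding \<psi>_def scaleR_left_diff_distrib using iG[of "e * x"] i1[of "e * x"]
        by (simp add: algebra_simps del: of_real_mult)
      finally have "norm (f' x) = exp (s * x\<^sup>2 / 2) * x * norm (CLINT \<omega>|M. (G \<omega> - s) *\<^sub>R iexp (e * x * W \<omega>))"
        using x by (simp add: norm_mult abs_mult)
      also have "\<dots> \<le> exp (s * t\<^sup>2 / 2) * x * \<Delta>"
      proof (intro mult_mono mult_right_mono)
        show "norm (CLINT \<omega>|M. (G \<omega> - s) *\<^sub>R iexp (e * x * W \<omega>)) \<le> \<Delta>"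
          unfolding \<Delta>_def
        proof (rule bochner_norm_bound)
          show "integrable M (\<lambda>\<omega>. (G \<omega> - s) *\<^sub>R iexp (e * x * W \<omega>))"
            unfolding scaleR_left_diff_distrib using iG[of "e * x"] i1[of "e * x"] by auto
        qed (use G in \<open>auto simp del: of_real_mult\<close>)
        show "exp (s * x\<^sup>2 / 2) \<le> exp (s * t\<^sup>2 / 2)"
          using x s by (auto intro!: mult_left_mono power_mono)
      qed (use x in auto)
      finally show ?thesis by (simp add: mult_ac)
    qed
    have "norm (f t - f 0) \<le> \<Delta> * exp (s * t\<^sup>2 / 2) * (t\<^sup>2 / 2) - \<Delta> * exp (s * t\<^sup>2 / 2) * (0\<^sup>2 / 2)"
    proof (rule differentiable_bound_general[OF t])
      show "continuous_on {0..t} f"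
        using df by (auto intro!: continuous_at_imp_continuous_on has_vector_derivative_continuous)
      show "continuous_on {0..t} (\<lambda>x. \<Delta> * exp (s * t\<^sup>2 / 2) * (x\<^sup>2 / 2))"
        by (intro continuous_intros) auto
      show "((\<lambda>x. \<Delta> * exp (s * t\<^sup>2 / 2) * (x\<^sup>2 / 2)) has_vector_derivative \<Delta> * exp (s * t\<^sup>2 / 2) * x) (at x)" for x
        unfolding has_real_derivative_iff_has_vector_derivative[symmetric]
        by (auto intro!: derivative_eq_intros)
    qed (use df nf in auto)
    moreover have "f 0 = 1" unfolding f_def \<psi>_def using prob_space by simp
    ultimately show ?thesis by (simp add: f_def scaleR_conv_of_real mult.commute)
  qed
  have key2: "norm (\<psi> (e * t) - of_real (exp (- s * t\<^sup>2 / 2))) \<le> \<Delta> * (t\<^sup>2 / 2)"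
    if e: "e = 1 \<or> e = -1" and t: "0 < t" for e t :: real
  proof -
    have "of_real (exp (- s * t\<^sup>2 / 2)) * of_real (exp (s * t\<^sup>2 / 2)) = (1::complex)"
      by (simp add: exp_add[symmetric] flip: of_real_mult)
    then have "\<psi> (e * t) - of_real (exp (- s * t\<^sup>2 / 2)) =
        of_real (exp (- s * t\<^sup>2 / 2)) * (\<psi> (e * t) * of_real (exp (s * t\<^sup>2 / 2)) - 1)"
      by (simp add: right_diff_distrib mult_ac)
    then have "norm (\<psi> (e * t) - of_real (exp (- s * t\<^sup>2 / 2))) =
        exp (- s * t\<^sup>2 / 2) * norm (\<psi> (e * t) * of_real (exp (s * t\<^sup>2 / 2)) - 1)"
      by (simp add: norm_mult)
    also have "\<dots> \<le> exp (- s * t\<^sup>2 / 2) * (\<Delta> * exp (s * t\<^sup>2 / 2) * (t\<^sup>2 / 2))"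
      by (intro mult_left_mono key that) simp
    also have "\<dots> = (exp (- s * t\<^sup>2 / 2) * exp (s * t\<^sup>2 / 2)) * (\<Delta> * (t\<^sup>2 / 2))" by simp
    also have "\<dots> = \<Delta> * (t\<^sup>2 / 2)" by (simp add: exp_add[symmetric])
    finally show ?thesis .
  qed
  consider "t = 0" | "0 < t" | "0 < - t" by linarith
  then show ?thesis
  proof cases
    case 1 then show ?thesis using prob_space by simp
  next
    case 2 then show ?thesis using key2[of 1 t] by (simp add: \<psi>_def \<Delta>_def mult.commute)
  next
    case 3 then show ?thesis using key2[of "-1" "- t"] by (simp add: \<psi>_def \<Delta>_def mult.commute)
  qed
qed

section \<open>Smoothed weighted sums and their Stein form\<close>

context gauss_family
begin

context
  fixes w :: "'i \<Rightarrow> real" and \<delta> u :: real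
  assumes w: "\<And>i. 0 \<le> w i" and d: "0 < \<delta>"
begin

definition centred_smooth_ind :: "real \<Rightarrow> real" where
  "centred_smooth_ind x = smooth_ind \<delta> u x - ncdf (- u / skernel_sd \<sigma> \<delta> 0)"

definition smooth_sum :: "'a \<Rightarrow> real" where "smooth_sum \<omega> = (\<Sum>j\<in>I. w j * centred_smooth_ind (g j \<omega>))"

text \<open>This is \<Gamma> of the overview, for \<open>smooth_sum\<close> in the place of
  W.\<close>

definition stein_form :: "'a \<Rightarrow> real" where
  "stein_form \<omega> = (\<Sum>i\<in>I. \<Sum>j\<in>I. (w i * w j * r i j) * (skernel \<sigma> \<delta> u (g i \<omega>) * normal_density u \<delta> (g j \<omega>)))"

lemma centred_smooth_ind_bound: "\<bar>centred_smooth_ind x\<bar> \<le> 1"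
  using smooth_ind_bounds[of \<delta> u x] ncdf_bounds[of "- u / skernel_sd \<sigma> \<delta> 0"] by (auto simp: centred_smooth_ind_def)

lemma centred_smooth_ind_deriv: "(centred_smooth_ind has_real_derivative normal_density u \<delta> x) (at x)"
  unfolding centred_smooth_ind_def[abs_def] using smooth_ind_deriv[OF d, of u x]
  by (auto intro!: derivative_eq_intros)

lemma continuous_on_centred_smooth_ind: "continuous_on S centred_smooth_ind"
  using centred_smooth_ind_deriv by (blast intro!: continuous_at_imp_continuous_on DERIV_isCont)

lemma centred_smooth_ind_measurable [measurable]: "centred_smooth_ind \<in> borel_measurable borel"
  by (rule borel_measurable_continuous_onI[OF continuous_on_centred_smooth_ind])

lemma skernel_measurable [measurable]: "skernel \<sigma> \<delta> u \<in> borel_measurable borel"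
  by (rule borel_measurable_continuous_onI[OF continuous_on_skernel[OF d]])

lemma smooth_sum_bound: "\<bar>smooth_sum \<omega>\<bar> \<le> sum w I"
  unfolding smooth_sum_def
proof (rule order_trans[OF sum_abs], rule sum_mono)
  fix i show "\<bar>w i * centred_smooth_ind (g i \<omega>)\<bar> \<le> w i"
    using w[of i] centred_smooth_ind_bound[of "g i \<omega>"] by (simp add: abs_mult mult_left_le)
qed

lemma smooth_sum_measurable [measurable]: "smooth_sum \<in> borel_measurable M"
  unfolding smooth_sum_def[abs_def] using g_measurable by measurable

lemma stein_form_measurable [measurable]: "stein_form \<in> borel_measurable M"
  unfolding stein_form_def[abs_def] using g_measurable by measurable

lemma skernel_density_bound: "\<bar>skernel \<sigma> \<delta> u x * normal_density u \<delta> y\<bar> \<le> 1 / \<delta> * (1 / \<delta>)"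
  unfolding abs_mult using skernel_bounds[OF d, of \<sigma> u x] normal_density_le[OF d order_refl, of u y] d
  by (intro mult_mono) auto

lemma integrable_skernel_density: "i \<in> I \<Longrightarrow> j \<in> I \<Longrightarrow> integrable M (\<lambda>\<omega>. skernel \<sigma> \<delta> u (g i \<omega>) * normal_density u \<delta> (g j \<omega>))"
  by (rule integrable_const_bound[of _ "1 / \<delta> * (1 / \<delta>)"]) (use skernel_density_bound g_measurable in \<open>auto simp del: times_divide_times_eq\<close>)

text \<open>\<open>gaussian_ibp\<close> is applied to each summand, with \<open>F\<close> of the
  whole sum as the other factor; its partial derivative in site \<open>j\<close> contributes
  \<open>w j * normal_density u \<delta> (x j)\<close>. Bounding \<open>F\<close> on the range of
  the sum only admits the identity as a test function.\<close>

lemma ibp_smooth_sum: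
  fixes F F' :: "real \<Rightarrow> complex"
  assumes F: "\<And>x. (F has_vector_derivative F' x) (at x)"
    and b: "\<And>x. \<bar>x\<bar> \<le> sum w I \<Longrightarrow> norm (F x) \<le> B" "\<And>x. norm (F' x) \<le> B"
    and cF: "continuous_on UNIV F'"
  shows "(CLINT \<omega>|M. smooth_sum \<omega> *\<^sub>R F (smooth_sum \<omega>)) = (CLINT \<omega>|M. stein_form \<omega> *\<^sub>R F' (smooth_sum \<omega>))"
proof -
  define V where "V x = (\<Sum>j\<in>I. w j * centred_smooth_ind (x j))" for x :: "'i \<Rightarrow> real"
  have VW: "V (\<lambda>j\<in>I. g j \<omega>) = smooth_sum \<omega>" for \<omega> by (simp add: V_def smooth_sum_def)
  have Vb: "\<bar>V x\<bar> \<le> sum w I" for x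
    unfolding V_def
  proof (rule order_trans[OF sum_abs], rule sum_mono)
    fix i show "\<bar>w i * centred_smooth_ind (x i)\<bar> \<le> w i"
      using w[of i] centred_smooth_ind_bound[of "x i"] by (simp add: abs_mult mult_left_le)
  qed
  have B: "0 \<le> B" using b(2)[of 0] norm_ge_zero order_trans by blast
  have cF0: "continuous_on UNIV F"
    using F by (auto intro!: continuous_at_imp_continuous_on has_vector_derivative_continuous)
  have [measurable]: "F \<in> borel_measurable borel" "F' \<in> borel_measurable borel"
    using cF cF0 by (auto intro: borel_measurable_continuous_onI)
  have [measurable]: "V \<in> borel_measurable (Pi\<^sub>M I (\<lambda>_. borel))"
    unfolding V_def[abs_def] by measurable
  note [measurable] = g_measurable
  \<comment> \<open>\<open>gaussian_ibp\<close> wants one bound for all \<open>D j\<close>, while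
    \<open>w\<close> is controlled by \<open>sum w I\<close> on \<open>I\<close> only; hence the
    factor \<open>of_bool (j \<in> I)\<close>.\<close>
  define D where "D j x = (of_bool (j \<in> I) * (w j * normal_density u \<delta> (x j))) *\<^sub>R F' (V x)" for j and x :: "'i \<Rightarrow> real"
  define B' where "B' = max (max 1 (1 / \<delta>)) (max B (sum w I * (1 / \<delta>) * B))"
  have B': "1 \<le> B'" "1 / \<delta> \<le> B'" "B \<le> B'" "sum w I * (1 / \<delta>) * B \<le> B'"
    unfolding B'_def by simp_all
  have iF: "integrable M (\<lambda>\<omega>. centred_smooth_ind (g i \<omega>) *\<^sub>R F (smooth_sum \<omega>))" if "i \<in> I" for i
  proof (rule integrable_const_bound[of _ "1 * B"])
    show "AE \<omega> in M. norm (centred_smooth_ind (g i \<omega>) *\<^sub>R F (smooth_sum \<omega>)) \<le> 1 * B"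
      unfolding norm_scaleR by (intro AE_I2 mult_mono centred_smooth_ind_bound b smooth_sum_bound) auto
  qed (use that in measurable)
  have iD: "integrable M (\<lambda>\<omega>. (skernel \<sigma> \<delta> u (g i \<omega>) * normal_density u \<delta> (g j \<omega>)) *\<^sub>R F' (smooth_sum \<omega>))" if "i \<in> I" "j \<in> I" for i j
  proof (rule integrable_const_bound[of _ "(1 / \<delta> * (1 / \<delta>)) * B"])
    show "AE \<omega> in M. norm ((skernel \<sigma> \<delta> u (g i \<omega>) * normal_density u \<delta> (g j \<omega>)) *\<^sub>R F' (smooth_sum \<omega>)) \<le> (1 / \<delta> * (1 / \<delta>)) * B"
      unfolding norm_scaleR using d by (intro AE_I2 mult_mono skernel_density_bound b) auto
  qed (use that in measurable)
  have 1: "(CLINT \<omega>|M. centred_smooth_ind (g i \<omega>) *\<^sub>R F (smooth_sum \<omega>)) =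
    (\<Sum>j\<in>I. r i j *\<^sub>R (CLINT \<omega>|M. skernel \<sigma> \<delta> u (g i \<omega>) *\<^sub>R D j (\<lambda>j\<in>I. g j \<omega>)))" if i: "i \<in> I" for i
    unfolding VW[symmetric]
  proof (rule gaussian_ibp[OF i skernel_deriv[OF d], where \<phi> = centred_smooth_ind and B = B'])
    show "\<sigma>\<^sup>2 * skernel' \<sigma> \<delta> u x = x * skernel \<sigma> \<delta> u x - centred_smooth_ind x" for x
      unfolding centred_smooth_ind_def by (rule skernel_stein[OF d])
    show "\<bar>centred_smooth_ind x\<bar> \<le> B'" for x using centred_smooth_ind_bound[of x] B'(1) by linarith
    show "\<bar>skernel \<sigma> \<delta> u x\<bar> \<le> B'" for x using skernel_bounds[OF d, of \<sigma> u x] B'(2) by linarith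
    show "norm (F (V x)) \<le> B'" for x using b(1)[OF Vb] B'(3) by (rule order_trans)
    show "norm (D j x) \<le> B'" for j x
    proof (cases "j \<in> I")
      case True
      have "norm (D j x) = (w j * normal_density u \<delta> (x j)) * norm (F' (V x))"
        using True w[of j] by (simp add: D_def)
      also have "\<dots> \<le> (sum w I * (1 / \<delta>)) * B"
        using d B w member_le_sum[OF True, of w] finite_I
        by (intro mult_mono normal_density_le b) (auto intro!: sum_nonneg divide_nonneg_pos)
      finally show ?thesis using B'(4) by simp
    qed (use B'(1) in \<open>simp add: D_def\<close>)
    show "D j \<in> borel_measurable (Pi\<^sub>M I (\<lambda>_. borel))" if "j \<in> I" for j
      unfolding D_def[abs_def] using that by measurable
    fix y b z
    have "((\<lambda>z. V (\<lambda>j\<in>I. b j * z + y j)) has_real_derivative (\<Sum>j\<in>I. w j * (normal_density u \<delta> (b j * z + y j) * b j))) (at z)"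
      unfolding V_def by (auto intro!: derivative_eq_intros DERIV_chain2[OF centred_smooth_ind_deriv] simp: mult_ac cong: sum.cong)
    then have "((F \<circ> (\<lambda>z. V (\<lambda>j\<in>I. b j * z + y j))) has_vector_derivative
       (\<Sum>j\<in>I. w j * (normal_density u \<delta> (b j * z + y j) * b j)) *\<^sub>R F' (V (\<lambda>j\<in>I. b j * z + y j))) (at z)"
      unfolding has_real_derivative_iff_has_vector_derivative by (rule vector_diff_chain_at) (rule F)
    then show "((\<lambda>z. F (V (\<lambda>j\<in>I. b j * z + y j))) has_vector_derivative
        (\<Sum>j\<in>I. b j *\<^sub>R D j (\<lambda>j\<in>I. b j * z + y j))) (at z)"
      by (simp add: o_def D_def scaleR_sum_left mult_ac cong: sum.cong)
  next
    fix y b :: "'i \<Rightarrow> real" and j assume j: "j \<in> I"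
    have cV: "continuous_on UNIV (\<lambda>z. V (\<lambda>j\<in>I. b j * z + y j))"
      unfolding V_def by (intro continuous_intros continuous_on_compose2[OF continuous_on_centred_smooth_ind[of UNIV]]) (auto intro!: continuous_intros cong: continuous_on_cong)
    have cn: "continuous_on UNIV (normal_density u \<delta>)"
      unfolding normal_density_def[abs_def] using d by (intro continuous_intros) auto
    show "continuous_on UNIV (\<lambda>z. D j (\<lambda>j\<in>I. b j * z + y j))"
      unfolding D_def using j
      by (auto intro!: continuous_intros continuous_on_compose2[OF cF cV] continuous_on_compose2[OF cn])
  qed (auto intro: continuous_on_centred_smooth_ind)
  have "(CLINT \<omega>|M. smooth_sum \<omega> *\<^sub>R F (smooth_sum \<omega>)) = (CLINT \<omega>|M. (\<Sum>i\<in>I. w i *\<^sub>R (centred_smooth_ind (g i \<omega>) *\<^sub>R F (smooth_sum \<omega>))))"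
    by (subst (1) smooth_sum_def) (simp add: scaleR_sum_left)
  also have "\<dots> = (\<Sum>i\<in>I. w i *\<^sub>R (CLINT \<omega>|M. centred_smooth_ind (g i \<omega>) *\<^sub>R F (smooth_sum \<omega>)))"
    using iF by (subst Bochner_Integration.integral_sum) (simp_all del: scaleR_scaleR)
  also have "\<dots> = (\<Sum>i\<in>I. \<Sum>j\<in>I. (w i * w j * r i j) *\<^sub>R (CLINT \<omega>|M. (skernel \<sigma> \<delta> u (g i \<omega>) * normal_density u \<delta> (g j \<omega>)) *\<^sub>R F' (smooth_sum \<omega>)))"
  proof (intro sum.cong refl)
    fix i assume i: "i \<in> I"
    have "(CLINT \<omega>|M. skernel \<sigma> \<delta> u (g i \<omega>) *\<^sub>R D j (\<lambda>j\<in>I. g j \<omega>)) =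
      w j *\<^sub>R (CLINT \<omega>|M. (skernel \<sigma> \<delta> u (g i \<omega>) * normal_density u \<delta> (g j \<omega>)) *\<^sub>R F' (smooth_sum \<omega>))" if j: "j \<in> I" for j
      unfolding integral_scaleR_right[symmetric]
      using j by (intro Bochner_Integration.integral_cong refl) (simp add: D_def VW mult_ac)
    then show "w i *\<^sub>R (CLINT \<omega>|M. centred_smooth_ind (g i \<omega>) *\<^sub>R F (smooth_sum \<omega>)) =
      (\<Sum>j\<in>I. (w i * w j * r i j) *\<^sub>R (CLINT \<omega>|M. (skernel \<sigma> \<delta> u (g i \<omega>) * normal_density u \<delta> (g j \<omega>)) *\<^sub>R F' (smooth_sum \<omega>)))"
      unfolding 1[OF i] by (simp add: scaleR_sum_right mult_ac)
  qed
  also have "\<dots> = (CLINT \<omega>|M. \<Sum>i\<in>I. \<Sum>j\<in>I. (w i * w j * r i j) *\<^sub>R ((skernel \<sigma> \<delta> u (g i \<omega>) * normal_density u \<delta> (g j \<omega>)) *\<^sub>R F' (smooth_sum \<omega>)))"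
    using iD by (simp add: Bochner_Integration.integral_sum Bochner_Integration.integrable_sum del: scaleR_scaleR)
  also have "\<dots> = (CLINT \<omega>|M. stein_form \<omega> *\<^sub>R F' (smooth_sum \<omega>))"
    by (simp add: stein_form_def scaleR_sum_left)
  finally show ?thesis .
qed

lemma integral_smooth_sum: "(\<integral>\<omega>. smooth_sum \<omega> \<partial>M) = 0"
proof -
  have "(CLINT \<omega>|M. smooth_sum \<omega> *\<^sub>R (\<lambda>_. 1) (smooth_sum \<omega>)) = (CLINT \<omega>|M. stein_form \<omega> *\<^sub>R (\<lambda>_. 0) (smooth_sum \<omega>))"
    by (rule ibp_smooth_sum[where B = 1]) auto
  then show ?thesis by (simp add: scaleR_conv_of_real)
qed

text \<open>The test function is the identity. Since the mean of \<open>stein_form\<close> is the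
  variance of the sum, taking this variance for \<open>s\<close> in \<open>stein_tikhomirov\<close>
  leaves an error governed by the fluctuation of \<open>stein_form\<close> alone.\<close>

lemma integral_smooth_sum_square: "(\<integral>\<omega>. (smooth_sum \<omega>)\<^sup>2 \<partial>M) = (\<integral>\<omega>. stein_form \<omega> \<partial>M)"
proof -
  have "(CLINT \<omega>|M. smooth_sum \<omega> *\<^sub>R of_real (smooth_sum \<omega>)) = (CLINT \<omega>|M. stein_form \<omega> *\<^sub>R (\<lambda>_. 1) (smooth_sum \<omega>))"
    by (rule ibp_smooth_sum[where B = "max 1 (sum w I)"])
      (auto intro!: derivative_eq_intros simp: le_max_iff_disj)
  then have "(CLINT \<omega>|M. of_real ((smooth_sum \<omega>)\<^sup>2)) = (CLINT \<omega>|M. of_real (stein_form \<omega>))"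
    by (simp add: scaleR_conv_of_real power2_eq_square)
  then show ?thesis unfolding integral_complex_of_real by simp
qed

lemma smooth_sum_iexp:
  "(CLINT \<omega>|M. smooth_sum \<omega> *\<^sub>R iexp (t * smooth_sum \<omega>)) = \<i> * of_real t * (CLINT \<omega>|M. stein_form \<omega> *\<^sub>R iexp (t * smooth_sum \<omega>))"
proof -
  have c: "((iexp \<circ> (*) t) has_vector_derivative t *\<^sub>R (\<i> * iexp (t * x))) (at x)" for x
    by (rule vector_diff_chain_at) (auto intro!: derivative_eq_intros has_vector_derivative_iexp)
  have "(CLINT \<omega>|M. smooth_sum \<omega> *\<^sub>R iexp (t * smooth_sum \<omega>)) = (CLINT \<omega>|M. stein_form \<omega> *\<^sub>R (t *\<^sub>R (\<i> * iexp (t * smooth_sum \<omega>))))"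
  proof (rule ibp_smooth_sum[where B = "max 1 \<bar>t\<bar>" and F = "\<lambda>x. iexp (t * x)" and F' = "\<lambda>x. t *\<^sub>R (\<i> * iexp (t * x))"])
    show "((\<lambda>x. iexp (t * x)) has_vector_derivative t *\<^sub>R (\<i> * iexp (t * x))) (at x)" for x
      using c[of x] by (simp only: o_def)
  qed (auto intro!: continuous_intros simp: norm_mult simp del: of_real_mult)
  also have "\<dots> = (CLINT \<omega>|M. (\<i> * of_real t) * (stein_form \<omega> *\<^sub>R iexp (t * smooth_sum \<omega>)))"
    by (intro Bochner_Integration.integral_cong refl) (simp add: scaleR_conv_of_real mult_ac)
  also have "\<dots> = \<i> * of_real t * (CLINT \<omega>|M. stein_form \<omega> *\<^sub>R iexp (t * smooth_sum \<omega>))"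
    by (rule integral_mult_right_zero)
  finally show ?thesis .
qed

lemma stein_form_bound: "\<bar>stein_form \<omega>\<bar> \<le> (\<Sum>i\<in>I. \<Sum>j\<in>I. \<bar>w i * w j * r i j\<bar> * (1 / \<delta> * (1 / \<delta>)))"
  unfolding stein_form_def
  by (intro order_trans[OF sum_abs] sum_mono) (simp only: abs_mult[of "_ * _ * _"], intro mult_left_mono skernel_density_bound abs_ge_zero)

text \<open>The variance is a sum over four sites, and \<open>cov4\<close> bounds each covariance by
  \<open>1 / \<delta> ^ 6\<close> times four values of \<open>\<bar>r\<bar>\<close>, each linking a
  site of the first pair to one of the second. With the two values of \<open>\<bar>r\<bar>\<close>
  in the coefficients, the three factors of a term join the four sites into a tree. Summing the
  sites away from the leaves costs \<open>\<rho>\<close> per edge, and the last site costs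
  \<open>sum w I\<close>.\<close>

lemma stein_form_variance:
  assumes row: "\<And>i. i \<in> I \<Longrightarrow> (\<Sum>j\<in>I. w j * \<bar>r i j\<bar>) \<le> \<rho>"
  shows "(\<integral>\<omega>. (stein_form \<omega> - (\<integral>\<omega>. stein_form \<omega> \<partial>M))\<^sup>2 \<partial>M) \<le> 4 * \<rho> ^ 3 * sum w I / \<delta> ^ 6"
proof -
  define a where "a i j = w i * w j * r i j" for i j
  define K where "K i j \<omega> = skernel \<sigma> \<delta> u (g i \<omega>) * normal_density u \<delta> (g j \<omega>)" for i j \<omega>
  define p where "p i j = \<bar>r i j\<bar>" for i j
  have GK: "stein_form \<omega> = (\<Sum>i\<in>I. \<Sum>j\<in>I. a i j * K i j \<omega>)" for \<omega> by (simp add: stein_form_def a_def K_def)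
  note [measurable] = g_measurable
  have iK: "integrable M (K i j)" if "i \<in> I" "j \<in> I" for i j
    unfolding K_def[abs_def] using that by (rule integrable_skernel_density)
  have bK: "\<bar>K i j \<omega>\<bar> \<le> 1 / \<delta> * (1 / \<delta>)" for i j \<omega> unfolding K_def by (rule skernel_density_bound)
  have iKK: "integrable M (\<lambda>\<omega>. K i j \<omega> * K k l \<omega>)" if "i \<in> I" "j \<in> I" "k \<in> I" "l \<in> I" for i j k l
  proof (rule integrable_const_bound[of _ "(1 / \<delta> * (1 / \<delta>)) * (1 / \<delta> * (1 / \<delta>))"])
    show "AE \<omega> in M. norm (K i j \<omega> * K k l \<omega>) \<le> (1 / \<delta> * (1 / \<delta>)) * (1 / \<delta> * (1 / \<delta>))"
      unfolding real_norm_def abs_mult using d by (intro AE_I2 mult_mono bK) auto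
  qed (use iK that in auto)
  define G4 where "G4 i j \<omega> = (\<Sum>k\<in>I. \<Sum>l\<in>I. (a i j * a k l) * (K i j \<omega> * K k l \<omega>))" for i j \<omega>
  have iG4: "integrable M (G4 i j)" "(\<integral>\<omega>. G4 i j \<omega> \<partial>M) = (\<Sum>k\<in>I. \<Sum>l\<in>I. (a i j * a k l) * (\<integral>\<omega>. K i j \<omega> * K k l \<omega> \<partial>M))"
    if "i \<in> I" "j \<in> I" for i j
    unfolding G4_def[abs_def] using that iKK
    by (auto simp: Bochner_Integration.integral_sum intro!: Bochner_Integration.integrable_sum)
  have Gsq: "(stein_form \<omega>)\<^sup>2 = (\<Sum>i\<in>I. \<Sum>j\<in>I. G4 i j \<omega>)" for \<omega>
  proof -
    have "(stein_form \<omega>)\<^sup>2 = (\<Sum>i\<in>I. \<Sum>j\<in>I. a i j * K i j \<omega>) * stein_form \<omega>"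
      by (simp only: power2_eq_square GK)
    also have "\<dots> = (\<Sum>i\<in>I. \<Sum>j\<in>I. a i j * K i j \<omega> * stein_form \<omega>)" by (simp only: sum_distrib_right)
    also have "\<dots> = (\<Sum>i\<in>I. \<Sum>j\<in>I. G4 i j \<omega>)"
      unfolding GK G4_def sum_distrib_left by (intro sum.cong refl) (simp only: mult_ac)
    finally show ?thesis .
  qed
  have iG: "integrable M stein_form" by (rule integrable_const_bound[OF AE_I2[OF stein_form_bound[folded real_norm_def]]]) simp
  have iG2: "integrable M (\<lambda>\<omega>. (stein_form \<omega>)\<^sup>2)" unfolding Gsq by (intro Bochner_Integration.integrable_sum iG4)
  have "(\<integral>\<omega>. (stein_form \<omega> - (\<integral>\<omega>. stein_form \<omega> \<partial>M))\<^sup>2 \<partial>M) = (\<integral>\<omega>. (stein_form \<omega>)\<^sup>2 \<partial>M) - (\<integral>\<omega>. stein_form \<omega> \<partial>M)\<^sup>2"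
    by (rule variance_eq[OF iG iG2])
  also have "(\<integral>\<omega>. (stein_form \<omega>)\<^sup>2 \<partial>M) = (\<Sum>i\<in>I. \<Sum>j\<in>I. \<Sum>k\<in>I. \<Sum>l\<in>I. (a i j * a k l) * (\<integral>\<omega>. K i j \<omega> * K k l \<omega> \<partial>M))"
    unfolding Gsq using iG4 by (simp add: Bochner_Integration.integral_sum Bochner_Integration.integrable_sum)
  also have "(\<integral>\<omega>. stein_form \<omega> \<partial>M)\<^sup>2 = (\<Sum>i\<in>I. \<Sum>j\<in>I. \<Sum>k\<in>I. \<Sum>l\<in>I. (a i j * a k l) * ((\<integral>\<omega>. K i j \<omega> \<partial>M) * (\<integral>\<omega>. K k l \<omega> \<partial>M)))"
  proof -
    have "(\<integral>\<omega>. stein_form \<omega> \<partial>M) = (\<Sum>i\<in>I. \<Sum>j\<in>I. a i j * (\<integral>\<omega>. K i j \<omega> \<partial>M))"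
      unfolding GK using iK by (simp add: Bochner_Integration.integral_sum Bochner_Integration.integrable_sum)
    then have "(\<integral>\<omega>. stein_form \<omega> \<partial>M)\<^sup>2 = (\<Sum>i\<in>I. \<Sum>j\<in>I. a i j * (\<integral>\<omega>. K i j \<omega> \<partial>M)) * (\<Sum>k\<in>I. \<Sum>l\<in>I. a k l * (\<integral>\<omega>. K k l \<omega> \<partial>M))"
      by (simp only: power2_eq_square)
    also have "\<dots> = (\<Sum>i\<in>I. \<Sum>j\<in>I. (a i j * (\<integral>\<omega>. K i j \<omega> \<partial>M)) * (\<Sum>k\<in>I. \<Sum>l\<in>I. a k l * (\<integral>\<omega>. K k l \<omega> \<partial>M)))"
      by (simp only: sum_distrib_right)
    also have "\<dots> = (\<Sum>i\<in>I. \<Sum>j\<in>I. \<Sum>k\<in>I. \<Sum>l\<in>I. (a i j * a k l) * ((\<integral>\<omega>. K i j \<omega> \<partial>M) * (\<integral>\<omega>. K k l \<omega> \<partial>M)))"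
      unfolding sum_distrib_left by (intro sum.cong refl) (simp only: mult_ac)
    finally show ?thesis .
  qed
  also have "(\<Sum>i\<in>I. \<Sum>j\<in>I. \<Sum>k\<in>I. \<Sum>l\<in>I. (a i j * a k l) * (\<integral>\<omega>. K i j \<omega> * K k l \<omega> \<partial>M)) - \<dots> =
    (\<Sum>i\<in>I. \<Sum>j\<in>I. \<Sum>k\<in>I. \<Sum>l\<in>I. (a i j * a k l) * ((\<integral>\<omega>. K i j \<omega> * K k l \<omega> \<partial>M) - (\<integral>\<omega>. K i j \<omega> \<partial>M) * (\<integral>\<omega>. K k l \<omega> \<partial>M)))"
    by (simp only: sum_subtractf right_diff_distrib)
  also have "\<dots> \<le> (\<Sum>i\<in>I. \<Sum>j\<in>I. \<Sum>k\<in>I. \<Sum>l\<in>I. (\<bar>a i j\<bar> * \<bar>a k l\<bar>) * ((1 / \<delta> * (1 / \<delta>\<^sup>2))\<^sup>2 * (p i k + p i l + p j k + p j l)))"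
  proof (intro sum_mono)
    fix i j k l assume i: "i \<in> I" "j \<in> I" "k \<in> I" "l \<in> I"
    have c: "\<bar>(\<integral>\<omega>. K i j \<omega> * K k l \<omega> \<partial>M) - (\<integral>\<omega>. K i j \<omega> \<partial>M) * (\<integral>\<omega>. K k l \<omega> \<partial>M)\<bar> \<le>
      (1 / \<delta> * (1 / \<delta>\<^sup>2))\<^sup>2 * (p i k + p i l + p j k + p j l)"
      unfolding K_def p_def using d
      by (intro cov4 i fourier_bounded_normal_density fourier_bounded_skernel prob_space_axioms) auto
    have m: "x * y * z \<le> \<bar>x\<bar> * \<bar>y\<bar> * c" if "\<bar>z\<bar> \<le> c" for x y z c :: real
      by (rule order_trans[OF abs_ge_self]) (simp only: abs_mult, intro mult_left_mono that, simp)
    show "(a i j * a k l) * ((\<integral>\<omega>. K i j \<omega> * K k l \<omega> \<partial>M) - (\<integral>\<omega>. K i j \<omega> \<partial>M) * (\<integral>\<omega>. K k l \<omega> \<partial>M)) \<le>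
      (\<bar>a i j\<bar> * \<bar>a k l\<bar>) * ((1 / \<delta> * (1 / \<delta>\<^sup>2))\<^sup>2 * (p i k + p i l + p j k + p j l))"
      by (rule m[OF c])
  qed
  also have "\<dots> = (1 / \<delta> * (1 / \<delta>\<^sup>2))\<^sup>2 * (\<Sum>i\<in>I. \<Sum>j\<in>I. \<bar>a i j\<bar> * (\<Sum>k\<in>I. \<Sum>l\<in>I. \<bar>a k l\<bar> * (p i k + p i l + p j k + p j l)))"
    unfolding sum_distrib_left by (intro sum.cong refl) (simp only: mult_ac)
  also have "\<dots> \<le> (1 / \<delta> * (1 / \<delta>\<^sup>2))\<^sup>2 * (4 * \<rho> ^ 3 * sum w I)"
  proof (rule mult_left_mono)
    have ap: "\<bar>a i j\<bar> = w i * (w j * p i j)" for i j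
      using w by (simp add: a_def p_def abs_mult)
    have ps: "p i j = p j i" if "i \<in> I" "j \<in> I" for i j using r_sym that by (simp add: p_def)
    have r1: "(\<Sum>j\<in>I. w j * p i j) \<le> \<rho>" if "i \<in> I" for i using row[OF that] by (simp add: p_def)
    have p0: "0 \<le> p i j" for i j by (simp add: p_def)
    show "(\<Sum>i\<in>I. \<Sum>j\<in>I. \<bar>a i j\<bar> * (\<Sum>k\<in>I. \<Sum>l\<in>I. \<bar>a k l\<bar> * (p i k + p i l + p j k + p j l))) \<le> 4 * \<rho> ^ 3 * sum w I"
    proof (cases "I = {}")
      case False
      then obtain i0 where "i0 \<in> I" by auto
      with r1[OF this] have \<rho>: "0 \<le> \<rho>" using w p0 by (meson order_trans sum_nonneg mult_nonneg_nonneg)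
      have q1: "(\<Sum>k\<in>I. \<Sum>l\<in>I. \<bar>a k l\<bar> * p i k) \<le> \<rho> * \<rho>" if i: "i \<in> I" for i
      proof -
        have "(\<Sum>k\<in>I. \<Sum>l\<in>I. \<bar>a k l\<bar> * p i k) = (\<Sum>k\<in>I. (w k * p i k) * (\<Sum>l\<in>I. w l * p k l))"
          by (simp add: ap sum_distrib_left mult_ac)
        also have "\<dots> \<le> (\<Sum>k\<in>I. (w k * p i k) * \<rho>)"
          by (intro sum_mono mult_left_mono r1) (auto intro!: mult_nonneg_nonneg w p0)
        also have "\<dots> \<le> \<rho> * \<rho>" unfolding sum_distrib_right[symmetric] by (intro mult_right_mono r1 i \<rho>)
        finally show ?thesis .
      qed
      \<comment> \<open>Exchanging \<open>k\<close> and \<open>l\<close> reduces this to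
        \<open>q1\<close>, since \<open>\<bar>a k l\<bar>\<close> is symmetric.\<close>
      have q2: "(\<Sum>k\<in>I. \<Sum>l\<in>I. \<bar>a k l\<bar> * p i l) \<le> \<rho> * \<rho>" if i: "i \<in> I" for i
      proof -
        have "(\<Sum>k\<in>I. \<Sum>l\<in>I. \<bar>a k l\<bar> * p i l) = (\<Sum>l\<in>I. \<Sum>k\<in>I. \<bar>a k l\<bar> * p i l)" by (rule sum.swap)
        also have "\<dots> = (\<Sum>l\<in>I. \<Sum>k\<in>I. \<bar>a l k\<bar> * p i l)"
          using ps by (intro sum.cong refl) (simp add: ap mult_ac)
        also have "\<dots> \<le> \<rho> * \<rho>" by (rule q1[OF i])
        finally show ?thesis .
      qed
      have "(\<Sum>i\<in>I. \<Sum>j\<in>I. \<bar>a i j\<bar> * (\<Sum>k\<in>I. \<Sum>l\<in>I. \<bar>a k l\<bar> * (p i k + p i l + p j k + p j l))) \<le>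
        (\<Sum>i\<in>I. \<Sum>j\<in>I. \<bar>a i j\<bar> * (4 * (\<rho> * \<rho>)))"
      proof (intro sum_mono mult_left_mono)
        fix i j assume "i \<in> I" "j \<in> I"
        then show "(\<Sum>k\<in>I. \<Sum>l\<in>I. \<bar>a k l\<bar> * (p i k + p i l + p j k + p j l)) \<le> 4 * (\<rho> * \<rho>)"
          unfolding distrib_left sum.distrib using q1[of i] q2[of i] q1[of j] q2[of j] by simp
      qed simp
      also have "\<dots> = (\<Sum>i\<in>I. w i * (\<Sum>j\<in>I. w j * p i j)) * (4 * (\<rho> * \<rho>))"
        by (simp add: ap sum_distrib_left sum_distrib_right mult_ac)
      also have "\<dots> \<le> (\<Sum>i\<in>I. w i * \<rho>) * (4 * (\<rho> * \<rho>))"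
        using \<rho> by (intro mult_right_mono sum_mono mult_left_mono r1 w) auto
      also have "\<dots> = 4 * \<rho> ^ 3 * sum w I"
        by (simp add: sum_distrib_right[symmetric] power3_eq_cube)
      finally show ?thesis .
    qed simp
  qed simp
  also have "\<dots> = 4 * \<rho> ^ 3 * sum w I / \<delta> ^ 6"
    using d by (simp add: power2_eq_square power_mult_distrib power_divide field_simps eval_nat_numeral)
  finally show ?thesis .
qed

text \<open>The mean absolute deviation in \<open>stein_tikhomirov\<close> is at most the standard
  deviation of \<open>stein_form\<close>, whose mean is the variance of the sum.\<close>

lemma smooth_sum_char:
  assumes row: "\<And>i. i \<in> I \<Longrightarrow> (\<Sum>j\<in>I. w j * \<bar>r i j\<bar>) \<le> \<rho>"
  shows "norm ((CLINT \<omega>|M. iexp (t * smooth_sum \<omega>)) - of_real (exp (- (\<integral>\<omega>. (smooth_sum \<omega>)\<^sup>2 \<partial>M) * t\<^sup>2 / 2))) \<le>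
    t\<^sup>2 / 2 * sqrt (4 * \<rho> ^ 3 * sum w I / \<delta> ^ 6)"
proof -
  define s where "s = (\<integral>\<omega>. (smooth_sum \<omega>)\<^sup>2 \<partial>M)"
  have s0: "0 \<le> s" unfolding s_def by simp
  have iG: "integrable M stein_form" by (rule integrable_const_bound[OF AE_I2[OF stein_form_bound[folded real_norm_def]]]) simp
  have iG2: "integrable M (\<lambda>\<omega>. (stein_form \<omega> - s)\<^sup>2)"
  proof (rule integrable_const_bound)
    show "AE \<omega> in M. norm ((stein_form \<omega> - s)\<^sup>2) \<le> ((\<Sum>i\<in>I. \<Sum>j\<in>I. \<bar>w i * w j * r i j\<bar> * (1 / \<delta> * (1 / \<delta>))) + s)\<^sup>2"
    proof (rule AE_I2)
      fix \<omega>
      show "norm ((stein_form \<omega> - s)\<^sup>2) \<le> ((\<Sum>i\<in>I. \<Sum>j\<in>I. \<bar>w i * w j * r i j\<bar> * (1 / \<delta> * (1 / \<delta>))) + s)\<^sup>2"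
        unfolding real_norm_def abs_power2
        by (rule abs_le_square_iff[THEN iffD1]) (use stein_form_bound[of \<omega>] s0 in linarith)
    qed
  qed simp
  have "(\<integral>\<omega>. \<bar>stein_form \<omega> - s\<bar> \<partial>M)\<^sup>2 \<le> (\<integral>\<omega>. \<bar>stein_form \<omega> - s\<bar>\<^sup>2 \<partial>M)"
  proof -
    have "0 \<le> variance (\<lambda>\<omega>. \<bar>stein_form \<omega> - s\<bar>)" by simp
    also have "\<dots> = (\<integral>\<omega>. \<bar>stein_form \<omega> - s\<bar>\<^sup>2 \<partial>M) - (\<integral>\<omega>. \<bar>stein_form \<omega> - s\<bar> \<partial>M)\<^sup>2"
      by (rule variance_eq) (use iG iG2 in auto)
    finally show ?thesis by simp
  qed
  also have "\<dots> \<le> 4 * \<rho> ^ 3 * sum w I / \<delta> ^ 6"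
    using stein_form_variance[OF row] unfolding s_def integral_smooth_sum_square by simp
  finally have "(\<integral>\<omega>. \<bar>stein_form \<omega> - s\<bar> \<partial>M) \<le> sqrt (4 * \<rho> ^ 3 * sum w I / \<delta> ^ 6)"
    by (rule real_le_rsqrt)
  then have "t\<^sup>2 / 2 * (\<integral>\<omega>. \<bar>stein_form \<omega> - s\<bar> \<partial>M) \<le> t\<^sup>2 / 2 * sqrt (4 * \<rho> ^ 3 * sum w I / \<delta> ^ 6)"
    by (rule mult_left_mono) simp
  then show ?thesis
    using stein_tikhomirov[OF prob_space_axioms smooth_sum_measurable smooth_sum_bound iG s0 smooth_sum_iexp, of t]
    unfolding s_def[symmetric] by linarith
qed

end

end

section \<open>From characteristic functions to Lipschitz test functions\<close>

lemma abs_le_half_square: "\<bar>x\<bar> \<le> (1 + x\<^sup>2) / (2::real)"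
  using zero_le_power2[of "1 - \<bar>x\<bar>"] by (simp add: power2_eq_square algebra_simps)

lemma integrable_std_normal_id: "integrable std_normal (\<lambda>z. z)" "(\<integral>z. z \<partial>std_normal) = 0"
  using integrable_std_normal_distribution_moment[of 1] integral_std_normal_distribution_moment_odd[of 1] by auto

lemma integrable_abs_std_normal: "integrable std_normal (\<lambda>z. \<bar>z\<bar>)" "(\<integral>z. \<bar>z\<bar> \<partial>std_normal) \<le> 1"
proof -
  interpret N: prob_space std_normal by (rule prob_space_std_normal)
  show i: "integrable std_normal (\<lambda>z. \<bar>z\<bar>)" using integrable_std_normal_id(1) by (rule integrable_abs)
  have "(\<integral>z. \<bar>z\<bar> \<partial>std_normal) \<le> (\<integral>z. (1 + z\<^sup>2) / 2 \<partial>std_normal)"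
    using std_normal_second_moment by (intro integral_mono i abs_le_half_square) auto
  also have "\<dots> = 1" using std_normal_second_moment N.prob_space by (simp add: add_divide_distrib)
  finally show "(\<integral>z. \<bar>z\<bar> \<partial>std_normal) \<le> 1" .
qed

lemma lipschitz_borel [measurable (raw)]:
  fixes h :: "real \<Rightarrow> real"
  assumes "1-lipschitz_on UNIV h"
  shows "h \<in> borel_measurable borel"
  using lipschitz_on_continuous_on[OF assms] by (rule borel_measurable_continuous_onI)

text \<open>A sharp cut suffices: integrability and the L1 norm of the truncated function are what
  enters, while smoothness comes from the normal variable that is added to its argument.\<close>

definition truncate_at :: "real \<Rightarrow> (real \<Rightarrow> real) \<Rightarrow> real \<Rightarrow> real" where
  "truncate_at L h x = h x * indicator {-L..L} x"

text \<open>Adding \<open>\<eta> * z\<close> to the argument changes a 1-Lipschitz function by at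
  most \<open>\<eta> * \<bar>z\<bar>\<close>. Truncation changes it outside \<open>{-L..L}\<close>
  only, by at most \<open>\<bar>x\<bar> \<le> x\<^sup>2 / L\<close>, which the second moment of
  \<open>Y + \<eta> * z\<close> controls. The normalisation \<open>h 0 = 0\<close> gives
  \<open>\<bar>h x\<bar> \<le> \<bar>x\<bar>\<close>.\<close>

lemma smoothing_error:
  fixes h :: "real \<Rightarrow> real"
  assumes P: "prob_space P" and [measurable]: "Y \<in> borel_measurable P" and Y2: "integrable P (\<lambda>\<omega>. (Y \<omega>)\<^sup>2)"
    and h: "1-lipschitz_on UNIV h" "h 0 = 0" and \<eta>: "0 < \<eta>" and L: "0 < L"
  shows "\<bar>(\<integral>\<omega>. h (Y \<omega>) \<partial>P) - (\<integral>\<omega>. (\<integral>z. truncate_at L h (Y \<omega> + \<eta> * z) \<partial>std_normal) \<partial>P)\<bar> \<le>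
    \<eta> + ((\<integral>\<omega>. (Y \<omega>)\<^sup>2 \<partial>P) + \<eta>\<^sup>2) / L"
proof -
  interpret N: prob_space std_normal by (rule prob_space_std_normal)
  interpret P: prob_space P by fact
  interpret PN: pair_prob_space P std_normal ..
  have [measurable]: "h \<in> borel_measurable borel" by (rule lipschitz_borel[OF h(1)])
  have [measurable]: "truncate_at L h \<in> borel_measurable borel" unfolding truncate_at_def[abs_def] by measurable
  have hl: "\<bar>h x - h y\<bar> \<le> \<bar>x - y\<bar>" for x y
    using lipschitz_onD[OF h(1), of x y] by (simp add: dist_real_def)
  have h0: "\<bar>h x\<bar> \<le> \<bar>x\<bar>" for x using hl[of x 0] h(2) by simp
  have tb: "\<bar>truncate_at L h x\<bar> \<le> L" for x
    using h0[of x] L by (auto simp: truncate_at_def indicator_def)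
  have ti: "integrable std_normal (\<lambda>z. truncate_at L h (y + \<eta> * z))" for y
    by (rule N.integrable_const_bound[of _ L]) (auto simp: tb)
  have pt: "\<bar>h y - truncate_at L h (y + \<eta> * z)\<bar> \<le> \<eta> * \<bar>z\<bar> + (y + \<eta> * z)\<^sup>2 / L" for y z
  proof -
    have 1: "\<bar>h y - h (y + \<eta> * z)\<bar> \<le> \<eta> * \<bar>z\<bar>" using hl[of y "y + \<eta> * z"] \<eta> by (simp add: abs_mult)
    have 2: "\<bar>h x - truncate_at L h x\<bar> \<le> x\<^sup>2 / L" for x
    proof (cases "\<bar>x\<bar> \<le> L")
      case True then show ?thesis using L by (simp add: truncate_at_def abs_le_iff minus_le_iff)
    next
      case False
      then have "\<bar>x\<bar> * L \<le> \<bar>x\<bar> * \<bar>x\<bar>" by (intro mult_left_mono) auto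
      then have "\<bar>x\<bar> \<le> x\<^sup>2 / L" using L by (simp add: le_divide_eq power2_eq_square)
      then show ?thesis using h0[of x] L by (auto simp: truncate_at_def indicator_def)
    qed
    show ?thesis using 1 2[of "y + \<eta> * z"] by linarith
  qed
  have inner: "\<bar>h y - (\<integral>z. truncate_at L h (y + \<eta> * z) \<partial>std_normal)\<bar> \<le> \<eta> + (y\<^sup>2 + \<eta>\<^sup>2) / L" for y
  proof -
    have E: "h y - (\<integral>z. truncate_at L h (y + \<eta> * z) \<partial>std_normal) = (\<integral>z. h y - truncate_at L h (y + \<eta> * z) \<partial>std_normal)"
      using ti N.prob_space by simp
    have "norm (h y - (\<integral>z. truncate_at L h (y + \<eta> * z) \<partial>std_normal)) \<le>
       (\<integral>z. \<eta> * \<bar>z\<bar> + (y\<^sup>2 / L + (2 * y * \<eta> / L) * z + (\<eta>\<^sup>2 / L) * z\<^sup>2) \<partial>std_normal)"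
      unfolding E
    proof (rule bochner_norm_bound)
      show "integrable std_normal (\<lambda>z. \<eta> * \<bar>z\<bar> + (y\<^sup>2 / L + (2 * y * \<eta> / L) * z + (\<eta>\<^sup>2 / L) * z\<^sup>2))"
        using integrable_abs_std_normal integrable_std_normal_id std_normal_second_moment
        by (intro Bochner_Integration.integrable_add integrable_mult_right integrable_const) auto
      fix z
      have "(y + \<eta> * z)\<^sup>2 / L = y\<^sup>2 / L + (2 * y * \<eta> / L) * z + (\<eta>\<^sup>2 / L) * z\<^sup>2"
        by (simp add: power2_eq_square algebra_simps add_divide_distrib)
      then show "norm (h y - truncate_at L h (y + \<eta> * z)) \<le> \<eta> * \<bar>z\<bar> + (y\<^sup>2 / L + (2 * y * \<eta> / L) * z + (\<eta>\<^sup>2 / L) * z\<^sup>2)"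
        using pt[of y z] by simp
    qed (use ti in auto)
    also have "\<dots> = \<eta> * (\<integral>z. \<bar>z\<bar> \<partial>std_normal) + (y\<^sup>2 / L + \<eta>\<^sup>2 / L)"
      using integrable_abs_std_normal integrable_std_normal_id std_normal_second_moment N.prob_space by simp
    also have "\<dots> \<le> \<eta> * 1 + (y\<^sup>2 / L + \<eta>\<^sup>2 / L)"
      using integrable_abs_std_normal(2) \<eta> by (intro add_right_mono mult_left_mono) auto
    finally show ?thesis by (simp add: add_divide_distrib)
  qed
  have iY: "integrable P (\<lambda>\<omega>. h (Y \<omega>))"
  proof (rule Bochner_Integration.integrable_bound)
    show "integrable P (\<lambda>\<omega>. (1 + (Y \<omega>)\<^sup>2) / 2)" using Y2 by auto
    show "AE \<omega> in P. norm (h (Y \<omega>)) \<le> norm ((1 + (Y \<omega>)\<^sup>2) / 2)"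
      by (intro AE_I2) (use order_trans[OF h0 abs_le_half_square] in auto)
  qed measurable
  have mt: "(\<lambda>\<omega>. \<integral>z. truncate_at L h (Y \<omega> + \<eta> * z) \<partial>std_normal) \<in> borel_measurable P"
    by (rule N.borel_measurable_lebesgue_integral) measurable
  have it: "integrable P (\<lambda>\<omega>. \<integral>z. truncate_at L h (Y \<omega> + \<eta> * z) \<partial>std_normal)"
  proof (rule P.integrable_const_bound[OF _ mt, of L])
    have "norm (\<integral>z. truncate_at L h (y + \<eta> * z) \<partial>std_normal) \<le> (\<integral>z. L \<partial>std_normal)" for y
      using ti tb by (intro bochner_norm_bound) auto
    then show "AE \<omega> in P. norm (\<integral>z. truncate_at L h (Y \<omega> + \<eta> * z) \<partial>std_normal) \<le> L"
      using N.prob_space by (intro AE_I2) simp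
  qed
  have E: "(\<integral>\<omega>. h (Y \<omega>) \<partial>P) - (\<integral>\<omega>. (\<integral>z. truncate_at L h (Y \<omega> + \<eta> * z) \<partial>std_normal) \<partial>P) =
    (\<integral>\<omega>. h (Y \<omega>) - (\<integral>z. truncate_at L h (Y \<omega> + \<eta> * z) \<partial>std_normal) \<partial>P)"
    using iY it by simp
  have "norm ((\<integral>\<omega>. h (Y \<omega>) \<partial>P) - (\<integral>\<omega>. (\<integral>z. truncate_at L h (Y \<omega> + \<eta> * z) \<partial>std_normal) \<partial>P)) \<le>
     (\<integral>\<omega>. \<eta> + ((Y \<omega>)\<^sup>2 + \<eta>\<^sup>2) / L \<partial>P)"
    unfolding E using iY it Y2 inner by (intro bochner_norm_bound) auto
  also have "\<dots> = \<eta> + ((\<integral>\<omega>. (Y \<omega>)\<^sup>2 \<partial>P) + \<eta>\<^sup>2) / L"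
    using Y2 P.prob_space by (simp add: add_divide_distrib)
  finally show ?thesis by simp
qed

text \<open>A Parseval identity: the density of \<open>\<eta> * z\<close> is an average of
  exponentials with frequencies \<open>\<xi> / \<eta>\<close>, and Fubini's theorem separates the
  Fourier transform of \<open>k\<close> from the characteristic function of \<open>Y\<close>. The
  second claim allows such integrals to be subtracted.\<close>

lemma smoothed_fourier:
  fixes k :: "real \<Rightarrow> real"
  assumes P: "prob_space P" and Ym [measurable]: "Y \<in> borel_measurable P"
    and k: "integrable lborel k" and \<eta>: "0 < \<eta>"
  shows "of_real (\<integral>\<omega>. (\<integral>z. k (Y \<omega> + \<eta> * z) \<partial>std_normal) \<partial>P) =
    of_real (1 / (\<eta> * sqrt (2 * pi))) *
      (CLINT \<xi>|std_normal. (CLINT x|lborel. k x *\<^sub>R iexp (\<xi> / \<eta> * x)) * (CLINT \<omega>|P. iexp (- (\<xi> / \<eta>) * Y \<omega>)))"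
    and "integrable std_normal (\<lambda>\<xi>. (CLINT x|lborel. k x *\<^sub>R iexp (\<xi> / \<eta> * x)) * (CLINT \<omega>|P. iexp (- (\<xi> / \<eta>) * Y \<omega>)))"
proof -
  interpret N: prob_space std_normal by (rule prob_space_std_normal)
  interpret P: prob_space P by fact
  interpret LN: pair_sigma_finite lborel std_normal ..
  interpret PN: pair_prob_space std_normal P ..
  have [measurable]: "k \<in> borel_measurable borel" using k by auto
  define c where "c = 1 / (\<eta> * sqrt (2 * pi))"
  have [measurable]: "(\<lambda>\<xi>. CLINT \<omega>|P. iexp (- (\<xi> / \<eta>) * Y \<omega>)) \<in> borel_measurable borel"
    by (rule P.borel_measurable_lebesgue_integral) measurable
  define K where "K \<xi> = (CLINT x|lborel. k x *\<^sub>R iexp (\<xi> / \<eta> * x))" for \<xi>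
  have [measurable]: "K \<in> borel_measurable borel" unfolding K_def[abs_def]
    by (rule lborel.borel_measurable_lebesgue_integral) measurable
  have Kb: "norm (K \<xi>) \<le> (\<integral>x. \<bar>k x\<bar> \<partial>lborel)" for \<xi>
    unfolding K_def
  proof (rule bochner_norm_bound)
    show "integrable lborel (\<lambda>x. k x *\<^sub>R iexp (\<xi> / \<eta> * x))"
      by (rule Bochner_Integration.integrable_bound[OF k]) (auto simp del: of_real_mult of_real_divide)
  qed (use k in \<open>auto simp del: of_real_mult of_real_divide\<close>)
  have e: "of_real (\<integral>z. k (y + \<eta> * z) \<partial>std_normal) = (CLINT \<xi>|std_normal. of_real c * (K \<xi> * iexp (- (\<xi> / \<eta>) * y)))" for y
  proof -
    have "(\<integral>z. k (y + \<eta> * z) \<partial>std_normal) = (\<integral>z. std_normal_density z *\<^sub>R k (y + \<eta> * z) \<partial>lborel)"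
      by (rule integral_std_normal) measurable
    \<comment> \<open>The substitution \<open>x = y + \<eta> * z\<close> moves the shift from
      \<open>k\<close> to the density, which is then expanded into exponentials.\<close>
    also have "\<dots> = (\<integral>x. std_normal_density ((x - y) / \<eta>) * k x / \<eta> \<partial>lborel)"
      using \<eta> by (subst (2) lborel_integral_real_affine[of "\<eta>" _ y]) (auto simp: divide_simps)
    finally have "complex_of_real (\<integral>z. k (y + \<eta> * z) \<partial>std_normal) =
       (CLINT x|lborel. of_real (std_normal_density ((x - y) / \<eta>) * k x / \<eta>))"
      by (simp only: integral_complex_of_real)
    also have "\<dots> = (CLINT x|lborel. CLINT \<xi>|std_normal. of_real c * (k x *\<^sub>R iexp (\<xi> / \<eta> * x) * iexp (- (\<xi> / \<eta>) * y)))"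
    proof (rule Bochner_Integration.integral_cong[OF refl])
      fix x
      have "complex_of_real (std_normal_density ((x - y) / \<eta>) * k x / \<eta>) =
        (of_real (k x) * of_real c) * (CLINT \<xi>|std_normal. iexp ((x - y) / \<eta> * \<xi>))"
        unfolding of_real_mult of_real_divide std_normal_density_fourier c_def by (simp add: mult_ac)
      also have "\<dots> = (CLINT \<xi>|std_normal. (of_real (k x) * of_real c) * iexp ((x - y) / \<eta> * \<xi>))"
        by (rule integral_mult_right_zero[symmetric])
      also have "\<dots> = (CLINT \<xi>|std_normal. of_real c * (k x *\<^sub>R iexp (\<xi> / \<eta> * x) * iexp (- (\<xi> / \<eta>) * y)))"
      proof (rule Bochner_Integration.integral_cong[OF refl])
        fix \<xi>
        have "(x - y) / \<eta> * \<xi> = \<xi> / \<eta> * x + - (\<xi> / \<eta>) * y" by (simp add: diff_divide_distrib left_diff_distrib right_diff_distrib mult_ac)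
        then have "iexp ((x - y) / \<eta> * \<xi>) = iexp (\<xi> / \<eta> * x) * iexp (- (\<xi> / \<eta>) * y)"
          by (simp only: of_real_add distrib_left exp_add)
        then show "of_real (k x) * of_real c * iexp ((x - y) / \<eta> * \<xi>) = of_real c * (k x *\<^sub>R iexp (\<xi> / \<eta> * x) * iexp (- (\<xi> / \<eta>) * y))"
          by (simp only: scaleR_conv_of_real mult_ac)
      qed
      finally show "complex_of_real (std_normal_density ((x - y) / \<eta>) * k x / \<eta>) =
         (CLINT \<xi>|std_normal. of_real c * (k x *\<^sub>R iexp (\<xi> / \<eta> * x) * iexp (- (\<xi> / \<eta>) * y)))" .
    qed
    also have "\<dots> = (CLINT \<xi>|std_normal. CLINT x|lborel. of_real c * (k x *\<^sub>R iexp (\<xi> / \<eta> * x) * iexp (- (\<xi> / \<eta>) * y)))"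
    proof (rule LN.Fubini_integral[symmetric])
      show "integrable (lborel \<Otimes>\<^sub>M std_normal) (\<lambda>(x, \<xi>). of_real c * (k x *\<^sub>R iexp (\<xi> / \<eta> * x) * iexp (- (\<xi> / \<eta>) * y)))"
      proof (rule LN.Fubini_integrable)
        show "AE x in lborel. integrable std_normal (\<lambda>\<xi>. (\<lambda>(x, \<xi>). of_real c * (k x *\<^sub>R iexp (\<xi> / \<eta> * x) * iexp (- (\<xi> / \<eta>) * y))) (x, \<xi>))"
        proof (rule AE_I2)
          fix x
          show "integrable std_normal (\<lambda>\<xi>. (\<lambda>(x, \<xi>). of_real c * (k x *\<^sub>R iexp (\<xi> / \<eta> * x) * iexp (- (\<xi> / \<eta>) * y))) (x, \<xi>))"
            unfolding prod.case
            by (rule N.integrable_const_bound[of _ "\<bar>c\<bar> * \<bar>k x\<bar>"])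
              (auto simp: norm_mult simp del: of_real_mult of_real_divide of_real_minus)
        qed
        show "integrable lborel (\<lambda>x. \<integral>\<xi>. norm ((\<lambda>(x, \<xi>). of_real c * (k x *\<^sub>R iexp (\<xi> / \<eta> * x) * iexp (- (\<xi> / \<eta>) * y))) (x, \<xi>)) \<partial>std_normal)"
          using k N.prob_space by (simp add: norm_mult del: of_real_mult of_real_divide of_real_minus)
      qed measurable
    qed
    also have "\<dots> = (CLINT \<xi>|std_normal. of_real c * (K \<xi> * iexp (- (\<xi> / \<eta>) * y)))"
      unfolding K_def by (simp only: integral_mult_right_zero integral_mult_left_zero)
    finally show ?thesis .
  qed
  have ip: "integrable (std_normal \<Otimes>\<^sub>M P) (\<lambda>(\<xi>, \<omega>). of_real c * (K \<xi> * iexp (- (\<xi> / \<eta>) * Y \<omega>)))"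
    by (rule PN.integrable_const_bound[of _ "\<bar>c\<bar> * (\<integral>x. \<bar>k x\<bar> \<partial>lborel)"])
      (auto simp: norm_mult case_prod_beta' simp del: of_real_mult of_real_divide of_real_minus times_divide_eq_left intro!: AE_I2 mult_left_mono Kb)
  have "complex_of_real (\<integral>\<omega>. (\<integral>z. k (Y \<omega> + \<eta> * z) \<partial>std_normal) \<partial>P) =
    (CLINT \<omega>|P. CLINT \<xi>|std_normal. of_real c * (K \<xi> * iexp (- (\<xi> / \<eta>) * Y \<omega>)))"
    unfolding e[symmetric] by (simp only: integral_complex_of_real)
  also have "\<dots> = (CLINT \<xi>|std_normal. CLINT \<omega>|P. of_real c * (K \<xi> * iexp (- (\<xi> / \<eta>) * Y \<omega>)))"
    by (rule PN.Fubini_integral[OF ip])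
  also have "\<dots> = of_real c * (CLINT \<xi>|std_normal. K \<xi> * (CLINT \<omega>|P. iexp (- (\<xi> / \<eta>) * Y \<omega>)))"
    by (simp only: integral_mult_right_zero)
  finally show "of_real (\<integral>\<omega>. (\<integral>z. k (Y \<omega> + \<eta> * z) \<partial>std_normal) \<partial>P) =
    of_real (1 / (\<eta> * sqrt (2 * pi))) *
      (CLINT \<xi>|std_normal. (CLINT x|lborel. k x *\<^sub>R iexp (\<xi> / \<eta> * x)) * (CLINT \<omega>|P. iexp (- (\<xi> / \<eta>) * Y \<omega>)))"
    unfolding c_def K_def .
  show "integrable std_normal (\<lambda>\<xi>. (CLINT x|lborel. k x *\<^sub>R iexp (\<xi> / \<eta> * x)) * (CLINT \<omega>|P. iexp (- (\<xi> / \<eta>) * Y \<omega>)))"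
    unfolding K_def[symmetric]
  proof (rule N.integrable_const_bound[of _ "(\<integral>x. \<bar>k x\<bar> \<partial>lborel) * 1"])
    have "norm (CLINT \<omega>|P. iexp (t * Y \<omega>)) \<le> (\<integral>\<omega>. 1 \<partial>P)" for t
      by (rule bochner_norm_bound) (auto intro!: P.integrable_iexp simp del: of_real_mult)
    then have b1: "norm (CLINT \<omega>|P. iexp (t * Y \<omega>)) \<le> 1" for t using P.prob_space by simp
    have "0 \<le> (\<integral>x. \<bar>k x\<bar> \<partial>lborel)" by (rule integral_nonneg_AE) simp
    then show "AE \<xi> in std_normal. norm (K \<xi> * (CLINT \<omega>|P. iexp (- (\<xi> / \<eta>) * Y \<omega>))) \<le> (\<integral>x. \<bar>k x\<bar> \<partial>lborel) * 1"
      unfolding norm_mult by (intro AE_I2 mult_mono Kb b1) auto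
  qed measurable
qed

text \<open>At frequency \<open>\<xi> / \<eta>\<close> the Fourier transform of the truncated
  function is at most \<open>2 * L\<^sup>2\<close>, and the characteristic functions differ by at
  most \<open>(\<xi> / \<eta>)\<^sup>2 / 2 * \<Delta>\<close>. As \<open>\<xi>\<close> has second
  moment 1 and the prefactor \<open>c\<close> is at most \<open>1 / \<eta>\<close>, this makes the
  last term of the bound. The others are smoothing errors, incurred once for \<open>Y\<close> and
  once for the normal law.\<close>

lemma gaussian_approx_of_char:
  fixes h :: "real \<Rightarrow> real"
  assumes P: "prob_space P" and [measurable]: "Y \<in> borel_measurable P" and Y2: "integrable P (\<lambda>\<omega>. (Y \<omega>)\<^sup>2)"
    and h: "1-lipschitz_on UNIV h" and \<eta>: "0 < \<eta>" and L: "0 < L" and v: "0 \<le> v"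
    and ch: "\<And>t. norm ((CLINT \<omega>|P. iexp (t * Y \<omega>)) - of_real (exp (- v * t\<^sup>2 / 2))) \<le> t\<^sup>2 / 2 * \<Delta>"
  shows "\<bar>(\<integral>\<omega>. h (Y \<omega>) \<partial>P) - (\<integral>z. h (sqrt v * z) \<partial>std_normal)\<bar> \<le>
    2 * \<eta> + ((\<integral>\<omega>. (Y \<omega>)\<^sup>2 \<partial>P) + v + 2 * \<eta>\<^sup>2) / L + L\<^sup>2 * \<Delta> / \<eta> ^ 3"
proof -
  interpret N: prob_space std_normal by (rule prob_space_std_normal)
  interpret P: prob_space P by fact
  \<comment> \<open>Only a difference of expectations is estimated, so the constant
    \<open>h 0\<close> may be subtracted to meet the normalisation of
    \<open>smoothing_error\<close>.\<close>
  define k where "k x = h x - h 0" for x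
  have k: "1-lipschitz_on UNIV k" "k 0 = 0"
    using h by (auto simp: k_def lipschitz_on_def dist_real_def)
  have [measurable]: "h \<in> borel_measurable borel" "k \<in> borel_measurable borel"
    using h k by (auto intro: lipschitz_borel)
  have kb: "\<bar>k x\<bar> \<le> \<bar>x\<bar>" for x
    using lipschitz_onD[OF k(1), of x 0] k(2) by (simp add: dist_real_def)
  have hk: "(\<integral>\<omega>. h (Z \<omega>) \<partial>Q) = (\<integral>\<omega>. k (Z \<omega>) \<partial>Q) + h 0"
    if "prob_space Q" and [measurable]: "Z \<in> borel_measurable Q" and Z2: "integrable Q (\<lambda>\<omega>. (Z \<omega>)\<^sup>2)" for Q :: "'c measure" and Z
  proof -
    interpret Q: prob_space Q by fact
    have "integrable Q (\<lambda>\<omega>. k (Z \<omega>))"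
    proof (rule Bochner_Integration.integrable_bound)
      show "integrable Q (\<lambda>\<omega>. (1 + (Z \<omega>)\<^sup>2) / 2)" using Z2 by auto
      show "AE \<omega> in Q. norm (k (Z \<omega>)) \<le> norm ((1 + (Z \<omega>)\<^sup>2) / 2)"
        by (intro AE_I2) (use order_trans[OF kb abs_le_half_square] in auto)
    qed measurable
    then have "(\<integral>\<omega>. k (Z \<omega>) + h 0 \<partial>Q) = (\<integral>\<omega>. k (Z \<omega>) \<partial>Q) + h 0"
      using Q.prob_space by simp
    then show ?thesis by (simp add: k_def)
  qed
  have N2: "integrable std_normal (\<lambda>z. (sqrt v * z)\<^sup>2)" "(\<integral>z. (sqrt v * z)\<^sup>2 \<partial>std_normal) = v"
    using std_normal_second_moment v by (auto simp: power_mult_distrib)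
  define T where "T = truncate_at L k"
  have Tb: "\<bar>T x\<bar> \<le> L * indicator {-L..L} x" for x
    using kb[of x] L by (auto simp: T_def truncate_at_def indicator_def)
  have [measurable]: "T \<in> borel_measurable borel" unfolding T_def truncate_at_def[abs_def] by measurable
  have iI: "integrable lborel (\<lambda>x. L * indicator {-L..L} x)"
    using L by (intro integrable_mult_right) (auto intro!: integrable_real_indicator)
  have iT: "integrable lborel T"
    by (rule Bochner_Integration.integrable_bound[OF iI]) (use Tb L in \<open>auto intro!: AE_I2 intro: order_trans\<close>)
  have "(\<integral>x. \<bar>T x\<bar> \<partial>lborel) \<le> (\<integral>x. L * indicator {-L..L} x \<partial>lborel)"
    using iT iI Tb by (intro integral_mono) auto
  also have "\<dots> = L * (2 * L)" using L by simp
  finally have T1: "(\<integral>x. \<bar>T x\<bar> \<partial>lborel) \<le> 2 * L\<^sup>2" by (simp add: power2_eq_square)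
  define K where "K \<xi> = (CLINT x|lborel. T x *\<^sub>R iexp (\<xi> / \<eta> * x))" for \<xi>
  have Kb: "norm (K \<xi>) \<le> 2 * L\<^sup>2" for \<xi>
  proof -
    have "norm (K \<xi>) \<le> (\<integral>x. \<bar>T x\<bar> \<partial>lborel)"
      unfolding K_def
    proof (rule bochner_norm_bound)
      show "integrable lborel (\<lambda>x. T x *\<^sub>R iexp (\<xi> / \<eta> * x))"
        by (rule Bochner_Integration.integrable_bound[OF iT]) (auto simp del: of_real_mult of_real_divide)
    qed (use iT in \<open>auto simp del: of_real_mult of_real_divide\<close>)
    then show ?thesis using T1 by linarith
  qed
  have \<Delta>: "0 \<le> \<Delta>" using order_trans[OF norm_ge_zero ch[of 1]] by simp
  define a where "a = (\<integral>\<omega>. (\<integral>z. T (Y \<omega> + \<eta> * z) \<partial>std_normal) \<partial>P)"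
  define b where "b = (\<integral>\<omega>. (\<integral>z. T (sqrt v * \<omega> + \<eta> * z) \<partial>std_normal) \<partial>std_normal)"
  define \<psi> where "\<psi> \<xi> = (CLINT \<omega>|P. iexp (- (\<xi> / \<eta>) * Y \<omega>))" for \<xi>
  define \<nu> where "\<nu> \<xi> = (CLINT z|std_normal. iexp (- (\<xi> / \<eta>) * (sqrt v * z)))" for \<xi>
  define c where "c = 1 / (\<eta> * sqrt (2 * pi))"
  have fa: "of_real a = of_real c * (CLINT \<xi>|std_normal. K \<xi> * \<psi> \<xi>)" "integrable std_normal (\<lambda>\<xi>. K \<xi> * \<psi> \<xi>)"
    unfolding a_def c_def K_def \<psi>_def by (rule smoothed_fourier[OF P _ iT \<eta>], measurable)+
  have fb: "of_real b = of_real c * (CLINT \<xi>|std_normal. K \<xi> * \<nu> \<xi>)" "integrable std_normal (\<lambda>\<xi>. K \<xi> * \<nu> \<xi>)"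
    unfolding b_def c_def K_def \<nu>_def by (rule smoothed_fourier[OF prob_space_std_normal _ iT \<eta>], measurable)+
  have \<nu>: "\<nu> \<xi> = of_real (exp (- v * (- (\<xi> / \<eta>))\<^sup>2 / 2))" for \<xi>
    unfolding \<nu>_def mult.assoc[symmetric] char_std_normal_iexp using v by (simp add: power_mult_distrib power_divide mult.commute)
  have c: "0 \<le> c" "c \<le> 1 / \<eta>"
  proof -
    have "1 \<le> sqrt (2 * pi)" using pi_gt3 by (intro real_le_rsqrt) auto
    then have "\<eta> * 1 \<le> \<eta> * sqrt (2 * pi)" using \<eta> by (intro mult_left_mono) auto
    then show "0 \<le> c" "c \<le> 1 / \<eta>" unfolding c_def using \<eta> by (auto intro!: frac_le simp del: real_sqrt_mult)
  qed
  have ab: "\<bar>a - b\<bar> \<le> L\<^sup>2 * \<Delta> / \<eta> ^ 3"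
  proof -
    have "of_real (a - b) = of_real c * (CLINT \<xi>|std_normal. K \<xi> * (\<psi> \<xi> - \<nu> \<xi>))"
      unfolding of_real_diff fa(1) fb(1) right_diff_distrib using fa(2) fb(2) by (simp add: right_diff_distrib)
    then have "norm (complex_of_real (a - b)) = c * norm (CLINT \<xi>|std_normal. K \<xi> * (\<psi> \<xi> - \<nu> \<xi>))"
      using c by (simp only: norm_mult norm_of_real abs_of_nonneg)
    then have "\<bar>a - b\<bar> = c * norm (CLINT \<xi>|std_normal. K \<xi> * (\<psi> \<xi> - \<nu> \<xi>))" by (simp only: norm_of_real)
    also have "\<dots> \<le> (1 / \<eta>) * (\<integral>\<xi>. (L\<^sup>2 * \<Delta> / \<eta>\<^sup>2) * \<xi>\<^sup>2 \<partial>std_normal)"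
    proof (intro mult_mono c bochner_norm_bound)
      show "integrable std_normal (\<lambda>\<xi>. K \<xi> * (\<psi> \<xi> - \<nu> \<xi>))"
        unfolding right_diff_distrib using fa(2) fb(2) by auto
      show "integrable std_normal (\<lambda>\<xi>. (L\<^sup>2 * \<Delta> / \<eta>\<^sup>2) * \<xi>\<^sup>2)" using std_normal_second_moment by auto
      fix \<xi> :: real
      have "norm (\<psi> \<xi> - \<nu> \<xi>) \<le> (- (\<xi> / \<eta>))\<^sup>2 / 2 * \<Delta>"
        unfolding \<nu> unfolding \<psi>_def by (rule ch)
      then have "norm (K \<xi> * (\<psi> \<xi> - \<nu> \<xi>)) \<le> (2 * L\<^sup>2) * ((- (\<xi> / \<eta>))\<^sup>2 / 2 * \<Delta>)"
        unfolding norm_mult by (intro mult_mono Kb) auto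
      then show "norm (K \<xi> * (\<psi> \<xi> - \<nu> \<xi>)) \<le> (L\<^sup>2 * \<Delta> / \<eta>\<^sup>2) * \<xi>\<^sup>2"
        by (simp add: power_divide mult_ac)
    qed (use \<eta> in auto)
    also have "\<dots> = L\<^sup>2 * \<Delta> / \<eta> ^ 3"
      using std_normal_second_moment by (simp add: power3_eq_cube power2_eq_square)
    finally show ?thesis .
  qed
  have 1: "\<bar>(\<integral>\<omega>. k (Y \<omega>) \<partial>P) - a\<bar> \<le> \<eta> + ((\<integral>\<omega>. (Y \<omega>)\<^sup>2 \<partial>P) + \<eta>\<^sup>2) / L"
    unfolding a_def T_def by (rule smoothing_error[OF P _ Y2 k \<eta> L]) measurable
  have 2: "\<bar>(\<integral>z. k (sqrt v * z) \<partial>std_normal) - b\<bar> \<le> \<eta> + ((\<integral>z. (sqrt v * z)\<^sup>2 \<partial>std_normal) + \<eta>\<^sup>2) / L"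
    unfolding b_def T_def by (rule smoothing_error[OF prob_space_std_normal _ N2(1) k \<eta> L]) measurable
  have "(\<integral>\<omega>. h (Y \<omega>) \<partial>P) - (\<integral>z. h (sqrt v * z) \<partial>std_normal) = (\<integral>\<omega>. k (Y \<omega>) \<partial>P) - (\<integral>z. k (sqrt v * z) \<partial>std_normal)"
    using hk[OF P _ Y2] hk[OF prob_space_std_normal _ N2(1)] by simp
  then show ?thesis using 1 2 ab unfolding N2(2) by (simp add: add_divide_distrib)
qed

section \<open>Covariances of indicators\<close>

text \<open>\<open>finite_dim_law_unique\<close>, with \<open>bool\<close> as index set, compares
  the pair with two linear forms in independent standard normal variables that have the same
  covariances. The degenerate correlations 1 and -1 are included.\<close>

lemma bivariate_law:
  fixes F :: "real \<Rightarrow> real \<Rightarrow> real"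
  assumes P: "prob_space P" and [measurable]: "X \<in> borel_measurable P" "Y \<in> borel_measurable P"
    and ch: "\<And>a b. (CLINT \<omega>|P. iexp (a * X \<omega> + b * Y \<omega>)) =
      of_real (exp (- (a\<^sup>2 * \<sigma>\<^sup>2 + 2 * a * b * (\<rho> * \<sigma>\<^sup>2) + b\<^sup>2 * \<sigma>\<^sup>2) / 2))"
    and \<rho>: "\<bar>\<rho>\<bar> \<le> 1"
    and F [measurable]: "case_prod F \<in> borel_measurable (borel \<Otimes>\<^sub>M borel)" and bF: "\<And>x y. \<bar>F x y\<bar> \<le> B"
  shows "(\<integral>\<omega>. F (X \<omega>) (Y \<omega>) \<partial>P) =
    (\<integral>x. (\<integral>z. F (\<sigma> * x) (\<sigma> * (\<rho> * x + sqrt (1 - \<rho>\<^sup>2) * z)) \<partial>std_normal) \<partial>std_normal)"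
proof -
  interpret N: prob_space std_normal by (rule prob_space_std_normal)
  interpret NN: pair_prob_space std_normal std_normal ..
  define q where "q = sqrt (1 - \<rho>\<^sup>2)"
  have q2: "q\<^sup>2 = 1 - \<rho>\<^sup>2" using \<rho> by (simp add: q_def abs_square_le_1)
  define U where "U i \<omega> = (if i then X \<omega> else Y \<omega>)" for i \<omega>
  define V where "V i p = (if i then \<sigma> * fst p else \<sigma> * (\<rho> * fst p + q * snd p))" for i and p :: "real \<times> real"
  have [measurable]: "U i \<in> borel_measurable P" "V i \<in> borel_measurable (std_normal \<Otimes>\<^sub>M std_normal)" for i
    by (cases i; simp add: U_def[abs_def] V_def[abs_def])+
  have law: "distr P (Pi\<^sub>M UNIV (\<lambda>_. borel)) (\<lambda>\<omega>. \<lambda>i\<in>UNIV. U i \<omega>) =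
    distr (std_normal \<Otimes>\<^sub>M std_normal) (Pi\<^sub>M UNIV (\<lambda>_. borel)) (\<lambda>p. \<lambda>i\<in>UNIV. V i p)"
  proof (rule finite_dim_law_unique[OF P])
    show "prob_space (std_normal \<Otimes>\<^sub>M std_normal)" by (rule NN.prob_space_axioms)
    fix c :: "bool \<Rightarrow> real"
    define a b where "a = c True" and "b = c False"
    have 1: "(\<Sum>i\<in>UNIV. c i * U i \<omega>) = a * X \<omega> + b * Y \<omega>" for \<omega> by (simp add: UNIV_bool U_def a_def b_def)
    have 2: "(\<Sum>i\<in>UNIV. c i * V i p) = (a + b * \<rho>) * \<sigma> * fst p + b * q * \<sigma> * snd p" for p
      by (simp add: UNIV_bool V_def a_def b_def algebra_simps)
    have "(CLINT p|std_normal \<Otimes>\<^sub>M std_normal. iexp ((a + b * \<rho>) * \<sigma> * fst p + b * q * \<sigma> * snd p)) =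
      (CLINT p|std_normal \<Otimes>\<^sub>M std_normal. iexp ((a + b * \<rho>) * \<sigma> * fst p) * iexp (b * q * \<sigma> * snd p))"
      by (simp only: of_real_add distrib_left exp_add)
    also have "\<dots> = (CLINT x|std_normal. iexp ((a + b * \<rho>) * \<sigma> * x)) * (CLINT x|std_normal. iexp (b * q * \<sigma> * x))"
      by (rule integral_pair_mult[where B = 1 and B' = 1])
        (auto simp: prob_space_std_normal simp del: of_real_mult)
    also have "\<dots> = of_real (exp (- (((a + b * \<rho>) * \<sigma>)\<^sup>2 + (b * q * \<sigma>)\<^sup>2) / 2))"
      unfolding char_std_normal_iexp by (simp add: exp_add[symmetric] add_divide_distrib diff_divide_distrib flip: of_real_mult)
    also have "((a + b * \<rho>) * \<sigma>)\<^sup>2 + (b * q * \<sigma>)\<^sup>2 = a\<^sup>2 * \<sigma>\<^sup>2 + 2 * a * b * (\<rho> * \<sigma>\<^sup>2) + b\<^sup>2 * \<sigma>\<^sup>2"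
    proof -
      have "(b * q * \<sigma>)\<^sup>2 = b\<^sup>2 * (1 - \<rho>\<^sup>2) * \<sigma>\<^sup>2" by (simp add: power_mult_distrib q2)
      then show ?thesis by (simp add: power2_eq_square algebra_simps)
    qed
    finally show "(CLINT \<omega>|P. iexp (\<Sum>i\<in>UNIV. c i * U i \<omega>)) =
      (CLINT p|std_normal \<Otimes>\<^sub>M std_normal. iexp (\<Sum>i\<in>UNIV. c i * V i p))"
      unfolding 1 2 ch by (rule sym)
  qed simp_all
  have mF: "(\<lambda>x. F (x True) (x False)) \<in> borel_measurable (Pi\<^sub>M UNIV (\<lambda>_. borel))"
    by (rule measurable_compose[OF _ F, of "\<lambda>x. (x True, x False)", simplified]) measurable
  have mU: "(\<lambda>\<omega>. \<lambda>i\<in>UNIV. U i \<omega>) \<in> P \<rightarrow>\<^sub>M Pi\<^sub>M UNIV (\<lambda>_. borel)"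
    and mV: "(\<lambda>p. \<lambda>i\<in>UNIV. V i p) \<in> std_normal \<Otimes>\<^sub>M std_normal \<rightarrow>\<^sub>M Pi\<^sub>M UNIV (\<lambda>_. borel)" by measurable
  have "(\<integral>\<omega>. F (X \<omega>) (Y \<omega>) \<partial>P) = (\<integral>x. F (x True) (x False) \<partial>distr P (Pi\<^sub>M UNIV (\<lambda>_. borel)) (\<lambda>\<omega>. \<lambda>i\<in>UNIV. U i \<omega>))"
    by (subst integral_distr[OF mU mF]) (simp add: U_def)
  also have "\<dots> = (\<integral>p. F (V True p) (V False p) \<partial>(std_normal \<Otimes>\<^sub>M std_normal))"
    unfolding law by (subst integral_distr[OF mV mF]) simp
  also have "\<dots> = (\<integral>p. F (\<sigma> * fst p) (\<sigma> * (\<rho> * fst p + q * snd p)) \<partial>(std_normal \<Otimes>\<^sub>M std_normal))"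
    by (simp add: V_def)
  also have "\<dots> = (\<integral>x. (\<integral>z. F (\<sigma> * x) (\<sigma> * (\<rho> * x + q * z)) \<partial>std_normal) \<partial>std_normal)"
  proof -
    have "integrable (std_normal \<Otimes>\<^sub>M std_normal) (\<lambda>p. F (\<sigma> * fst p) (\<sigma> * (\<rho> * fst p + q * snd p)))"
    proof (rule NN.integrable_const_bound[of _ B])
      show "(\<lambda>p. F (\<sigma> * fst p) (\<sigma> * (\<rho> * fst p + q * snd p))) \<in> borel_measurable (std_normal \<Otimes>\<^sub>M std_normal)"
        by (rule measurable_compose[OF _ F, of "\<lambda>p. (\<sigma> * fst p, \<sigma> * (\<rho> * fst p + q * snd p))", simplified]) measurable
    qed (simp add: bF)
    from NN.integral_fst'[OF this] show ?thesis by simp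
  qed
  finally show ?thesis unfolding q_def .
qed

section \<open>Orthant probabilities as a function of the correlation\<close>

lemma measure_std_normal_ge: "measure std_normal {x..} = 1 - ncdf x"
proof -
  interpret N: prob_space std_normal by (rule prob_space_std_normal)
  have "{x..} = space std_normal - {..<x}" by auto
  also have "measure std_normal \<dots> = 1 - ncdf x"
    by (subst N.prob_compl) (auto simp: ncdf_eq_measure)
  finally show ?thesis .
qed

lemma integral_std_normal_ge: "0 < c \<Longrightarrow> (\<integral>z. indicator {u..} (a + c * z) \<partial>std_normal) = 1 - ncdf ((u - a) / c)"
proof -
  assume c: "0 < c"
  have "(\<integral>z. indicator {u..} (a + c * z) \<partial>std_normal) = (\<integral>z. indicator {(u - a) / c..} z \<partial>std_normal :: real)"
    using c by (intro Bochner_Integration.integral_cong refl) (auto simp: indicator_def field_simps)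
  also have "\<dots> = 1 - ncdf ((u - a) / c)" using measure_std_normal_ge by simp
  finally show ?thesis .
qed

lemma std_normal_density_le_1: "std_normal_density x \<le> 1"
  using normal_density_le[of 1 1 0 x] by simp

lemma ncdf_lipschitz: "\<bar>ncdf x - ncdf y\<bar> \<le> \<bar>x - y\<bar>"
proof -
  have "norm (ncdf x - ncdf y) \<le> 1 * norm (x - y)"
    by (rule field_differentiable_bound[of UNIV ncdf std_normal_density 1 x y])
      (auto intro: has_field_derivative_at_within ncdf_deriv std_normal_density_le_1)
  then show ?thesis by simp
qed

lemma std_normal_density_lipschitz: "\<bar>std_normal_density x - std_normal_density y\<bar> \<le> \<bar>x - y\<bar>"
proof -
  have b: "\<bar>z * std_normal_density z\<bar> \<le> 1" for z
  proof -
    have "\<bar>z\<bar> \<le> (1 + z\<^sup>2) / 2" by (rule abs_le_half_square)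
    also have "\<dots> \<le> 1 + z\<^sup>2 / 2" by (simp add: add_divide_distrib)
    also have "\<dots> \<le> exp (z\<^sup>2 / 2)" by (rule exp_ge_add_one_self)
    finally have "\<bar>z\<bar> * exp (- z\<^sup>2 / 2) \<le> exp (z\<^sup>2 / 2) * exp (- z\<^sup>2 / 2)" by (intro mult_right_mono) auto
    also have "\<dots> = 1" by (simp add: exp_add[symmetric])
    finally have 1: "\<bar>z\<bar> * exp (- z\<^sup>2 / 2) \<le> 1" .
    have "1 \<le> sqrt (2 * pi)" using pi_gt3 by (intro real_le_rsqrt) auto
    then have "1 / sqrt (2 * pi) * (\<bar>z\<bar> * exp (- z\<^sup>2 / 2)) \<le> 1 * 1" using 1 by (intro mult_mono) (auto simp: divide_le_eq simp del: real_sqrt_mult)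
    then show ?thesis by (simp add: std_normal_density_def abs_mult)
  qed
  have "norm (std_normal_density x - std_normal_density y) \<le> 1 * norm (x - y)"
    by (rule field_differentiable_bound[of UNIV std_normal_density "\<lambda>z. - z * std_normal_density z" 1 x y])
      (use b std_normal_density_deriv in \<open>auto intro: has_field_derivative_at_within simp: abs_mult\<close>)
  then show ?thesis by simp
qed

text \<open>The integral of \<open>f s\<close> over \<open>{h..}\<close> is the probability that two
  standard normal variables with correlation \<open>s\<close> both exceed \<open>h\<close>. The
  \<open>s\<close>-derivative \<open>D s x\<close> of \<open>f s x\<close> is also the
  \<open>x\<close>-derivative of \<open>- (E s x / q s)\<close>, which is Plackett's identity.
  Integrating in \<open>x\<close> first leaves the boundary value \<open>E s h / q s\<close>, the
  bivariate density at the point \<open>(h, h)\<close>.\<close>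

lemma sheppard_increment:
  fixes a b h :: real
  assumes ab: "a \<le> b" "-1 < a" "b < 1"
  defines "f \<equiv> \<lambda>s x. std_normal_density x * ncdf ((s * x - h) / sqrt (1 - s\<^sup>2))"
  shows "(\<integral>x. indicator {h..} x * f b x \<partial>lborel) - (\<integral>x. indicator {h..} x * f a x \<partial>lborel) =
    1 / (2 * pi) * (\<integral>s. indicator {a..b} s * (1 / sqrt (1 - s\<^sup>2) * exp (- (h\<^sup>2 / (1 + s)))) \<partial>lborel)"
proof -
  define q where "q s = sqrt (1 - s\<^sup>2)" for s :: real
  define E where "E s x = std_normal_density x * std_normal_density ((s * x - h) / q s)" for s x
  define D where "D s x = E s x * ((x - s * h) / (1 - s\<^sup>2)) / q s" for s x
  have s1: "0 < 1 - s\<^sup>2" if "a \<le> s" "s \<le> b" for s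
    using that ab by (simp add: abs_square_less_1)
  have q0: "0 < q s" "(q s)\<^sup>2 = 1 - s\<^sup>2" if "a \<le> s" "s \<le> b" for s
    using s1[OF that] by (auto simp: q_def)
  have [measurable]: "ncdf \<in> borel_measurable borel"
    using ncdf_deriv by (intro borel_measurable_continuous_onI continuous_at_imp_continuous_on) (blast intro: DERIV_isCont)
  have dq: "(q has_real_derivative - s / q s) (at s)" if "a \<le> s" "s \<le> b" for s
    unfolding q_def[abs_def] using s1[OF that] by (auto intro!: derivative_eq_intros simp: field_simps)
  have df: "((\<lambda>s. f s x) has_real_derivative D s x) (at s)" if s: "a \<le> s" "s \<le> b" for s x
  proof -
    note q = q0[OF s]
    have "((\<lambda>s. (s * x - h) / q s) has_real_derivative (x * q s - (s * x - h) * (- s / q s)) / (q s * q s)) (at s)"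
      by (rule DERIV_divide[OF _ dq[OF s]]) (use q in \<open>auto intro!: derivative_eq_intros\<close>)
    also have "(x * q s - (s * x - h) * (- s / q s)) / (q s * q s) = (x - s * h) / (1 - s\<^sup>2) / q s"
    proof -
      have "x * q s - (s * x - h) * (- s / q s) = (x * (q s)\<^sup>2 + (s * x - h) * s) / q s"
        using q(1) by (simp add: field_simps power2_eq_square)
      also have "x * (q s)\<^sup>2 + (s * x - h) * s = x - s * h" unfolding q(2) by (simp add: algebra_simps power2_eq_square)
      finally show ?thesis using q(1) unfolding q(2)[symmetric] by (simp add: power2_eq_square)
    qed
    finally have d: "((\<lambda>s. (s * x - h) / q s) has_real_derivative (x - s * h) / (1 - s\<^sup>2) / q s) (at s)" .
    have "((\<lambda>s. std_normal_density x * ncdf ((s * x - h) / q s)) has_real_derivative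
      std_normal_density x * (std_normal_density ((s * x - h) / q s) * ((x - s * h) / (1 - s\<^sup>2) / q s))) (at s)"
      by (intro DERIV_cmult DERIV_chain2[OF ncdf_deriv d])
    then show ?thesis by (simp add: f_def q_def[symmetric] D_def E_def mult.assoc)
  qed
  have dE: "((\<lambda>x. - (E s x / q s)) has_real_derivative D s x) (at x)" if s: "a \<le> s" "s \<le> b" for s x
  proof -
    note q = q0[OF s]
    have "((\<lambda>x. (s * x - h) / q s) has_real_derivative s / q s) (at x)"
      using q by (auto intro!: derivative_eq_intros)
    from DERIV_mult[OF std_normal_density_deriv DERIV_chain2[OF std_normal_density_deriv this]]
    have "((\<lambda>x. E s x) has_real_derivative - x * E s x + (- ((s * x - h) / q s) * (s / q s)) * E s x) (at x)"
      unfolding E_def by (simp add: mult_ac)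
    also have "- x * E s x + (- ((s * x - h) / q s) * (s / q s)) * E s x = - ((x - s * h) / (1 - s\<^sup>2)) * E s x"
    proof -
      have "x + (s * x - h) / q s * (s / q s) = (x * (1 - s\<^sup>2) + (s * x - h) * s) / (1 - s\<^sup>2)"
        using q s1[OF s] by (simp add: add_divide_distrib power2_eq_square[symmetric])
      also have "x * (1 - s\<^sup>2) + (s * x - h) * s = x - s * h" by (simp add: algebra_simps power2_eq_square)
      finally have "- (x + (s * x - h) / q s * (s / q s)) * E s x = - ((x - s * h) / (1 - s\<^sup>2)) * E s x" by simp
      then show ?thesis by (simp add: algebra_simps)
    qed
    finally have "((\<lambda>x. - (E s x / q s)) has_real_derivative - (- ((x - s * h) / (1 - s\<^sup>2)) * E s x / q s)) (at x)"
      by (intro DERIV_minus DERIV_cdivide)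
    then show ?thesis by (simp add: D_def mult_ac)
  qed
  have cp: "continuous_on UNIV std_normal_density"
    unfolding std_normal_density_def[abs_def] by (intro continuous_intros) simp
  have cDs: "continuous_on {a..b} (\<lambda>s. D s x)" for x
    unfolding D_def E_def q_def using s1
    by (intro continuous_intros continuous_on_compose2[OF cp]) (auto simp: less_imp_neq[symmetric])
  have cDx: "continuous_on UNIV (\<lambda>x. D s x)" if "a \<le> s" "s \<le> b" for s
    unfolding D_def E_def using s1[OF that] q0[OF that]
    by (intro continuous_intros continuous_on_compose2[OF cp]) (auto simp: less_imp_neq[symmetric])
  \<comment> \<open>On \<open>{a..b}\<close> the quantity \<open>1 - s\<^sup>2\<close> stays above
    \<open>1 - m\<^sup>2\<close>, which is positive. Hence one integrable function \<open>G\<close>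
    dominates all \<open>D s\<close>, and Fubini's theorem applies to \<open>H\<close>.\<close>
  define m where "m = max \<bar>a\<bar> \<bar>b\<bar>"
  have m: "0 < 1 - m\<^sup>2" "0 \<le> m" using ab unfolding m_def
    by (auto simp: max_def abs_square_less_1)
  have Db: "\<bar>D s x\<bar> \<le> std_normal_density x * ((\<bar>x\<bar> + \<bar>h\<bar>) / (1 - m\<^sup>2) / sqrt (1 - m\<^sup>2))" if s: "a \<le> s" "s \<le> b" for s x
  proof -
    have sm: "\<bar>s\<bar> \<le> m" using s unfolding m_def by auto
    then have s2: "1 - m\<^sup>2 \<le> 1 - s\<^sup>2" using power_mono[OF sm, of 2] by simp
    have qm: "sqrt (1 - m\<^sup>2) \<le> q s" unfolding q_def using s2 by simp
    have s_1: "\<bar>s\<bar> \<le> 1" using s ab by auto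
    have "\<bar>x - s * h\<bar> \<le> \<bar>x\<bar> + \<bar>s\<bar> * \<bar>h\<bar>" by (metis abs_mult abs_triangle_ineq4)
    also have "\<dots> \<le> \<bar>x\<bar> + 1 * \<bar>h\<bar>" using s_1 by (intro add_left_mono mult_right_mono) auto
    finally have 1: "\<bar>x - s * h\<bar> \<le> \<bar>x\<bar> + \<bar>h\<bar>" by simp
    have e1: "E s x \<le> std_normal_density x" unfolding E_def
      using mult_left_mono[OF std_normal_density_le_1, of "std_normal_density x"] by simp
    have e2: "\<bar>x - s * h\<bar> / (1 - s\<^sup>2) / q s \<le> (\<bar>x\<bar> + \<bar>h\<bar>) / (1 - m\<^sup>2) / sqrt (1 - m\<^sup>2)"
      using 1 s2 qm m by (intro frac_le) auto
    have e3: "\<bar>D s x\<bar> = E s x * (\<bar>x - s * h\<bar> / (1 - s\<^sup>2) / q s)"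
      using q0[OF s] s1[OF s] by (simp add: D_def E_def abs_mult)
    show ?thesis unfolding e3
      by (rule mult_mono[OF e1 e2]) (use q0[OF s] s1[OF s] in auto)
  qed
  define G where "G x = std_normal_density x * ((\<bar>x\<bar> + \<bar>h\<bar>) / (1 - m\<^sup>2) / sqrt (1 - m\<^sup>2))" for x
  have iG: "integrable lborel G"
  proof -
    have "integrable lborel (\<lambda>x. std_normal_density x *\<^sub>R ((\<bar>x\<bar> + \<bar>h\<bar>) / (1 - m\<^sup>2) / sqrt (1 - m\<^sup>2)))"
    proof (rule integrable_density[THEN iffD1])
      show "integrable std_normal (\<lambda>x. (\<bar>x\<bar> + \<bar>h\<bar>) / (1 - m\<^sup>2) / sqrt (1 - m\<^sup>2))"
        using integrable_abs_std_normal(1) prob_space_std_normal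
        by (intro integrable_divide Bochner_Integration.integrable_add finite_measure.integrable_const prob_space.finite_measure) auto
    qed auto
    then show ?thesis by (simp add: G_def[abs_def])
  qed
  have G0: "0 \<le> G x" for x unfolding G_def using m by (intro mult_nonneg_nonneg divide_nonneg_nonneg) auto
  have DG: "\<bar>D s x\<bar> \<le> \<bar>G x\<bar>" if "a \<le> s" "s \<le> b" for s x
    using Db[OF that, of x] order_trans[OF _ abs_ge_self] unfolding G_def by blast
  have [measurable]: "case_prod D \<in> borel_measurable (borel \<Otimes>\<^sub>M borel)"
    unfolding D_def E_def q_def case_prod_beta' by measurable
  define H where "H x s = indicator {h..} x * (indicator {a..b} s * D s x)" for x s
  have Hb: "\<bar>H x s\<bar> \<le> G x * indicator {a..b} s" for x s
    using Db[of s x] G0[of x] by (auto simp: H_def G_def indicator_def)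
  have iH: "integrable (lborel \<Otimes>\<^sub>M lborel) (\<lambda>(x, s). H x s)"
  proof (rule Bochner_Integration.integrable_bound)
    show "integrable (lborel \<Otimes>\<^sub>M lborel) (\<lambda>(x, s). G x * indicator {a..b} s)"
    proof (rule lborel_pair.Fubini_integrable)
      show "integrable lborel (\<lambda>x. \<integral>s. norm ((\<lambda>(x, s). G x * indicator {a..b} s) (x, s)) \<partial>lborel)"
        using iG by (simp add: abs_mult)
      show "AE x in lborel. integrable lborel (\<lambda>s. (\<lambda>(x, s). G x * indicator {a..b} s) (x, s))"
        using ab by (intro AE_I2) (auto intro!: integrable_mult_right integrable_real_indicator)
    qed (use iG in measurable)
    show "(\<lambda>(x, s). H x s) \<in> borel_measurable (lborel \<Otimes>\<^sub>M lborel)"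
      unfolding H_def by measurable
  qed (rule AE_I2, use order_trans[OF Hb abs_ge_self] in \<open>auto simp: case_prod_beta'\<close>)
  have i1: "(\<integral>s. indicator {a..b} s * D s x \<partial>lborel) = f b x - f a x" for x
  proof -
    have "(\<integral>s. indicator {a..b} s *\<^sub>R D s x \<partial>lborel) = f b x - f a x"
    proof (rule integral_FTC_Icc[OF ab(1) _ cDs[of x]])
      fix s assume "a \<le> s" "s \<le> b"
      then show "((\<lambda>s. f s x) has_vector_derivative D s x) (at s within {a..b})"
        using df[of s x] by (simp add: has_real_derivative_iff_has_vector_derivative has_vector_derivative_at_within)
    qed
    then show ?thesis by simp
  qed
  have i2: "(\<integral>x. indicator {h..} x * D s x \<partial>lborel) = E s h / q s" if s: "a \<le> s" "s \<le> b" for s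
  proof -
    note q = q0[OF s]
    have "(LBINT x=h..\<infinity>. D s x) = 0 - (- (E s h / q s))"
    proof (rule interval_integral_FTC_integrable[of _ _ "\<lambda>x. - (E s x / q s)"])
      show "((\<lambda>x. - (E s x / q s)) has_vector_derivative D s x) (at x)" for x
        using dE[OF s] by (simp add: has_real_derivative_iff_has_vector_derivative)
      show "isCont (D s) x" for x using cDx[OF s] by (simp add: continuous_on_eq_continuous_at)
      show "set_integrable lborel (einterval (ereal h) \<infinity>) (D s)"
        unfolding set_integrable_def
      proof (rule Bochner_Integration.integrable_bound[OF iG])
        show "AE x in lborel. norm (indicator (einterval (ereal h) \<infinity>) x *\<^sub>R D s x) \<le> norm (G x)"
          using DG[OF s] by (auto simp: indicator_def)
      qed (use cDx[OF s] in \<open>auto intro!: borel_measurable_continuous_onI\<close>)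
      have "((\<lambda>x. - (E s x / q s)) \<longlongrightarrow> - (E s h / q s)) (at h)"
        using DERIV_isCont[OF dE[OF s]] unfolding isCont_def .
      then have "((\<lambda>x. - (E s x / q s)) \<longlongrightarrow> - (E s h / q s)) (at_right h)"
        by (rule filterlim_mono[OF _ order_refl at_le[OF subset_UNIV]])
      then show "(((\<lambda>x. - (E s x / q s)) \<circ> real_of_ereal) \<longlongrightarrow> - (E s h / q s)) (at_right (ereal h))"
        by (simp add: ereal_tendsto_simps)
      have "((\<lambda>x. std_normal_density x *\<^sub>R (- (std_normal_density ((s * x - h) / q s) / q s))) \<longlongrightarrow> 0) at_top"
        by (rule bounded_density_tendsto_0(1)[of _ "1 / q s"])
          (use q std_normal_density_le_1 in \<open>auto intro!: divide_right_mono\<close>)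
      then show "(((\<lambda>x. - (E s x / q s)) \<circ> real_of_ereal) \<longlongrightarrow> 0) (at_left \<infinity>)"
        by (simp add: ereal_tendsto_simps E_def)
    qed simp
    moreover have "(LBINT x=h..\<infinity>. D s x) = (\<integral>x. indicator {h<..} x * D s x \<partial>lborel)"
      by (simp add: interval_lebesgue_integral_def set_lebesgue_integral_def einterval_eq)
    moreover have "(\<integral>x. indicator {h<..} x * D s x \<partial>lborel) = (\<integral>x. indicator {h..} x * D s x \<partial>lborel)"
    proof (rule integral_cong_AE)
      show "AE x in lborel. indicator {h<..} x * D s x = indicator {h..} x * D s x"
        using AE_lborel_singleton[of h] by eventually_elim (auto simp: indicator_def)
    qed (use cDx[OF s] in \<open>auto intro!: borel_measurable_continuous_onI borel_measurable_times\<close>)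
    ultimately show ?thesis by simp
  qed
  \<comment> \<open>The exponents combine because \<open>h\<^sup>2 + h\<^sup>2 * (1 - s) / (1 + s) =
    2 * h\<^sup>2 / (1 + s)\<close>.\<close>
  have Eh: "E s h / q s = 1 / (2 * pi) * (1 / sqrt (1 - s\<^sup>2) * exp (- (h\<^sup>2 / (1 + s))))" if s: "a \<le> s" "s \<le> b" for s
  proof -
    note q = q0[OF s]
    have sp: "0 < 1 + s" "0 < 1 - s" using s ab by auto
    have "E s h = 1 / (2 * pi) * exp (- h\<^sup>2 / 2 + - ((s * h - h) / q s)\<^sup>2 / 2)"
      unfolding E_def std_normal_density_def exp_add by (simp add: field_simps flip: power2_eq_square)
    also have "((s * h - h) / q s)\<^sup>2 = h\<^sup>2 * (1 - s) / (1 + s)"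
    proof -
      have "(s * h - h)\<^sup>2 = h\<^sup>2 * ((1 - s) * (1 - s))" by (simp add: power2_eq_square algebra_simps)
      moreover have "1 - s\<^sup>2 = (1 + s) * (1 - s)" by (simp add: power2_eq_square algebra_simps)
      ultimately show ?thesis using sp unfolding power_divide q(2) by simp
    qed
    also have "- h\<^sup>2 / 2 + - (h\<^sup>2 * (1 - s) / (1 + s)) / 2 = - (h\<^sup>2 / (1 + s))"
      using sp by (simp add: divide_simps) (simp add: algebra_simps)
    finally show ?thesis by (simp add: q_def)
  qed
  have fi: "integrable lborel (\<lambda>x. indicator {h..} x * f s x)" for s
  proof (rule Bochner_Integration.integrable_bound[of _ std_normal_density])
    show "AE x in lborel. norm (indicator {h..} x * f s x) \<le> norm (std_normal_density x)"
      using ncdf_bounds by (auto simp: f_def abs_mult indicator_def mult_left_le)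
    show "(\<lambda>x. indicator {h..} x * f s x) \<in> borel_measurable lborel" unfolding f_def by measurable
  qed auto
  have "(\<integral>x. indicator {h..} x * f b x \<partial>lborel) - (\<integral>x. indicator {h..} x * f a x \<partial>lborel) =
     (\<integral>x. (\<integral>s. H x s \<partial>lborel) \<partial>lborel)"
    unfolding H_def integral_mult_right_zero i1 right_diff_distrib
    using fi[of a] fi[of b] by simp
  also have "\<dots> = (\<integral>s. (\<integral>x. H x s \<partial>lborel) \<partial>lborel)"
    by (rule lborel_pair.Fubini_integral[OF iH, symmetric])
  also have "\<dots> = (\<integral>s. 1 / (2 * pi) * (indicator {a..b} s * (1 / sqrt (1 - s\<^sup>2) * exp (- (h\<^sup>2 / (1 + s))))) \<partial>lborel)"
  proof (rule Bochner_Integration.integral_cong[OF refl])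
    fix s
    have "(\<integral>x. H x s \<partial>lborel) = indicator {a..b} s * (\<integral>x. indicator {h..} x * D s x \<partial>lborel)"
      unfolding H_def integral_mult_right_zero[symmetric] by (simp only: mult_ac)
    then show "(\<integral>x. H x s \<partial>lborel) = 1 / (2 * pi) * (indicator {a..b} s * (1 / sqrt (1 - s\<^sup>2) * exp (- (h\<^sup>2 / (1 + s)))))"
      using i2[of s] Eh[of s] by (auto simp: indicator_def)
  qed
  also have "\<dots> = 1 / (2 * pi) * (\<integral>s. indicator {a..b} s * (1 / sqrt (1 - s\<^sup>2) * exp (- (h\<^sup>2 / (1 + s)))) \<partial>lborel)"
    by (rule integral_mult_right_zero)
  finally show ?thesis .
qed

section \<open>The error of smoothing an indicator, and two L2 inequalities\<close>

lemma ncdf_measurable [measurable]: "ncdf \<in> borel_measurable borel"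
  using ncdf_deriv by (intro borel_measurable_continuous_onI continuous_at_imp_continuous_on) (blast intro: DERIV_isCont)

text \<open>Chebyshev's inequality, written with \<open>1 + t\<^sup>2\<close> so that the bound also
  holds near 0 and integrates to a multiple of \<open>pi\<close>.\<close>

lemma ncdf_tail: "ncdf (- \<bar>t\<bar>) \<le> 2 / (1 + t\<^sup>2)"
proof (cases "\<bar>t\<bar> \<le> 1")
  case True
  then have "t\<^sup>2 \<le> 1" by (simp add: abs_square_le_1)
  then have "1 \<le> 2 / (1 + t\<^sup>2)" by (simp add: le_divide_eq add_pos_nonneg)
  then show ?thesis using ncdf_bounds[of "- \<bar>t\<bar>"] by linarith
next
  case False
  interpret N: prob_space std_normal by (rule prob_space_std_normal)
  have "ncdf (- \<bar>t\<bar>) = measure std_normal {..< - \<bar>t\<bar>}" by (rule ncdf_eq_measure)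
  also have "\<dots> = (\<integral>z. indicator {..< - \<bar>t\<bar>} z \<partial>std_normal)" by simp
  also have "\<dots> \<le> (\<integral>z. z\<^sup>2 / t\<^sup>2 \<partial>std_normal)"
  proof (rule integral_mono)
    show "integrable std_normal (indicator {..< - \<bar>t\<bar>} :: real \<Rightarrow> real)"
      by (rule N.integrable_const_bound[of _ 1]) (auto simp: indicator_def)
    show "integrable std_normal (\<lambda>z. z\<^sup>2 / t\<^sup>2)" using std_normal_second_moment by auto
    fix z :: real
    have "\<bar>t\<bar>\<^sup>2 \<le> \<bar>z\<bar>\<^sup>2" if "z < - \<bar>t\<bar>" using that by (intro power_mono) auto
    then show "indicator {..< - \<bar>t\<bar>} z \<le> z\<^sup>2 / t\<^sup>2" using False by (auto simp: indicator_def le_divide_eq)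
  qed
  also have "\<dots> = 1 / t\<^sup>2" using std_normal_second_moment by simp
  also have "\<dots> \<le> 2 / (1 + t\<^sup>2)"
  proof -
    have "1 \<le> t\<^sup>2" using False power_mono[of 1 "\<bar>t\<bar>" 2] by simp
    then show ?thesis by (simp add: divide_simps add_pos_nonneg)
  qed
  finally show ?thesis .
qed

lemma integral_ncdf_tail:
  "integrable lborel (\<lambda>t. ncdf (- \<bar>t\<bar>))" "(\<integral>t. ncdf (- \<bar>t\<bar>) \<partial>lborel) \<le> 2 * pi"
proof -
  have i: "integrable lborel (\<lambda>x::real. 2 * inverse (1 + x\<^sup>2))"
    using integrable_inverse_1_plus_square by (simp add: set_integrable_def)
  have e: "(\<integral>x. inverse (1 + (x::real)\<^sup>2) \<partial>lborel) = pi"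
    using LBINT_inverse_1_plus_square by (simp add: interval_lebesgue_integral_def set_lebesgue_integral_def)
  show i2: "integrable lborel (\<lambda>t. ncdf (- \<bar>t\<bar>))"
  proof (rule Bochner_Integration.integrable_bound[OF i])
    show "AE t in lborel. norm (ncdf (- \<bar>t\<bar>)) \<le> norm (2 * inverse (1 + t\<^sup>2))"
    proof (rule AE_I2)
      fix t :: real
      have "0 \<le> 2 * inverse (1 + t\<^sup>2)" by (simp add: add_pos_nonneg)
      then show "norm (ncdf (- \<bar>t\<bar>)) \<le> norm (2 * inverse (1 + t\<^sup>2))"
        using ncdf_tail[of t] ncdf_bounds[of "- \<bar>t\<bar>"] by (simp add: divide_inverse)
    qed
  qed measurable
  have "(\<integral>t. ncdf (- \<bar>t\<bar>) \<partial>lborel) \<le> (\<integral>x. 2 * inverse (1 + x\<^sup>2) \<partial>lborel)"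
    using ncdf_tail by (intro integral_mono i i2) (auto simp: divide_inverse)
  also have "\<dots> = 2 * pi" using e by simp
  finally show "(\<integral>t. ncdf (- \<bar>t\<bar>) \<partial>lborel) \<le> 2 * pi" .
qed

definition smooth_ind_err :: "real \<Rightarrow> real \<Rightarrow> real \<Rightarrow> real" where
  "smooth_ind_err \<delta> u x = indicator {u..} x - smooth_ind \<delta> u x"

lemma smooth_ind_err_abs: "0 < \<delta> \<Longrightarrow> \<bar>smooth_ind_err \<delta> u x\<bar> \<le> ncdf (- \<bar>(x - u) / \<delta>\<bar>)"
  using ncdf_bounds[of "(x - u) / \<delta>"] ncdf_uminus[of "(x - u) / \<delta>"]
  by (auto simp: smooth_ind_err_def smooth_ind_def indicator_def abs_if not_le divide_less_0_iff)

lemma smooth_ind_err_measurable [measurable]: "smooth_ind_err \<delta> u \<in> borel_measurable borel"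
  unfolding smooth_ind_err_def[abs_def] smooth_ind_def by measurable

lemma smooth_ind_err_le_1: "\<bar>smooth_ind_err \<delta> u x\<bar> \<le> 1"
  using smooth_ind_bounds[of \<delta> u x] by (auto simp: smooth_ind_err_def indicator_def)

text \<open>The error depends on \<open>(x - u) / \<delta>\<close> only, so its L1 norm scales with
  \<open>\<delta>\<close>. This is the source of the smallness of the smoothing error.\<close>

lemma smooth_ind_err_integral:
  assumes d: "0 < \<delta>"
  shows "integrable lborel (smooth_ind_err \<delta> u)" "(\<integral>x. \<bar>smooth_ind_err \<delta> u x\<bar> \<partial>lborel) \<le> 2 * pi * \<delta>"
proof -
  have i: "integrable lborel (\<lambda>x. ncdf (- \<bar>(x - u) / \<delta>\<bar>))"
    using lborel_integrable_real_affine[OF integral_ncdf_tail(1), of "1 / \<delta>" "- u / \<delta>"] d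
    by (simp add: diff_divide_distrib)
  have "(\<integral>t. ncdf (- \<bar>t\<bar>) \<partial>lborel) = \<bar>1 / \<delta>\<bar> *\<^sub>R (\<integral>x. ncdf (- \<bar>- u / \<delta> + 1 / \<delta> * x\<bar>) \<partial>lborel)"
    using d by (intro lborel_integral_real_affine) auto
  then have e: "(\<integral>x. ncdf (- \<bar>(x - u) / \<delta>\<bar>) \<partial>lborel) = \<delta> * (\<integral>t. ncdf (- \<bar>t\<bar>) \<partial>lborel)"
    using d by (simp add: diff_divide_distrib)
  show i2: "integrable lborel (smooth_ind_err \<delta> u)"
    by (rule Bochner_Integration.integrable_bound[OF i])
      (simp, rule AE_I2, use order_trans[OF smooth_ind_err_abs[OF d] abs_ge_self] in simp)
  have "(\<integral>x. \<bar>smooth_ind_err \<delta> u x\<bar> \<partial>lborel) \<le> (\<integral>x. ncdf (- \<bar>(x - u) / \<delta>\<bar>) \<partial>lborel)"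
    using i i2 smooth_ind_err_abs[OF d] by (intro integral_mono) auto
  also have "\<dots> \<le> \<delta> * (2 * pi)" unfolding e using d integral_ncdf_tail by (intro mult_left_mono) auto
  finally show "(\<integral>x. \<bar>smooth_ind_err \<delta> u x\<bar> \<partial>lborel) \<le> 2 * pi * \<delta>" by (simp add: mult_ac)
qed

lemma Cauchy_Schwarz_integral:
  fixes X Y :: "'a \<Rightarrow> real"
  assumes "integrable M (\<lambda>\<omega>. (X \<omega>)\<^sup>2)" "integrable M (\<lambda>\<omega>. (Y \<omega>)\<^sup>2)" "integrable M (\<lambda>\<omega>. X \<omega> * Y \<omega>)"
  shows "(\<integral>\<omega>. X \<omega> * Y \<omega> \<partial>M) \<le> sqrt (\<integral>\<omega>. (X \<omega>)\<^sup>2 \<partial>M) * sqrt (\<integral>\<omega>. (Y \<omega>)\<^sup>2 \<partial>M)"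
proof -
  define a b c where "a = (\<integral>\<omega>. (X \<omega>)\<^sup>2 \<partial>M)" and "b = (\<integral>\<omega>. (Y \<omega>)\<^sup>2 \<partial>M)" and "c = (\<integral>\<omega>. X \<omega> * Y \<omega> \<partial>M)"
  have q: "0 \<le> s\<^sup>2 * a - 2 * s * t * c + t\<^sup>2 * b" for s t
  proof -
    have "(\<integral>\<omega>. (s * X \<omega> - t * Y \<omega>)\<^sup>2 \<partial>M) = (\<integral>\<omega>. s\<^sup>2 * (X \<omega>)\<^sup>2 - (2 * s * t) * (X \<omega> * Y \<omega>) + t\<^sup>2 * (Y \<omega>)\<^sup>2 \<partial>M)"
      by (intro Bochner_Integration.integral_cong refl) (simp add: power2_eq_square algebra_simps)
    also have "\<dots> = s\<^sup>2 * a - 2 * s * t * c + t\<^sup>2 * b"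
      unfolding a_def b_def c_def using assms by simp
    finally have "(\<integral>\<omega>. (s * X \<omega> - t * Y \<omega>)\<^sup>2 \<partial>M) = s\<^sup>2 * a - 2 * s * t * c + t\<^sup>2 * b" .
    moreover have "0 \<le> (\<integral>\<omega>. (s * X \<omega> - t * Y \<omega>)\<^sup>2 \<partial>M)" by (rule integral_nonneg_AE) simp
    ultimately show ?thesis by (simp only:)
  qed
  have a0: "0 \<le> a" and b0: "0 \<le> b" by (simp_all add: a_def b_def)
  have "c * c \<le> a * b"
  proof (cases "b = 0")
    case True
    have "c = 0"
    proof (rule ccontr)
      assume "c \<noteq> 0"
      \<comment> \<open>For \<open>b = 0\<close> the form \<open>q\<close> is affine in
        \<open>t\<close>; this choice of \<open>t\<close> gives it the value -1.\<close>
      then show False using q[of 1 "(a + 1) / (2 * c)"] True by simp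
    qed
    then show ?thesis using a0 b0 by simp
  next
    case False
    then have "0 < b" using b0 by simp
    have "0 \<le> b * (a * b - c * c)" using q[of b c] by (simp add: power2_eq_square algebra_simps)
    then show ?thesis using \<open>0 < b\<close> by (simp add: zero_le_mult_iff)
  qed
  then have "c \<le> sqrt (a * b)" by (intro real_le_rsqrt) (simp add: power2_eq_square)
  then show ?thesis unfolding a_def b_def c_def real_sqrt_mult .
qed

lemma L2_triangle:
  fixes X Y :: "'a \<Rightarrow> real"
  assumes X: "integrable M (\<lambda>\<omega>. (X \<omega>)\<^sup>2)" and Y: "integrable M (\<lambda>\<omega>. (Y \<omega>)\<^sup>2)" and XY: "integrable M (\<lambda>\<omega>. X \<omega> * Y \<omega>)"
  shows "\<bar>sqrt (\<integral>\<omega>. (X \<omega>)\<^sup>2 \<partial>M) - sqrt (\<integral>\<omega>. (Y \<omega>)\<^sup>2 \<partial>M)\<bar> \<le> sqrt (\<integral>\<omega>. (X \<omega> - Y \<omega>)\<^sup>2 \<partial>M)"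
proof (rule real_le_rsqrt)
  have "(\<integral>\<omega>. (X \<omega> - Y \<omega>)\<^sup>2 \<partial>M) = (\<integral>\<omega>. (X \<omega>)\<^sup>2 - 2 * (X \<omega> * Y \<omega>) + (Y \<omega>)\<^sup>2 \<partial>M)"
    by (intro Bochner_Integration.integral_cong refl) (simp add: power2_eq_square algebra_simps)
  also have "\<dots> = (\<integral>\<omega>. (X \<omega>)\<^sup>2 \<partial>M) - 2 * (\<integral>\<omega>. X \<omega> * Y \<omega> \<partial>M) + (\<integral>\<omega>. (Y \<omega>)\<^sup>2 \<partial>M)"
    using assms by simp
  finally show "\<bar>sqrt (\<integral>\<omega>. (X \<omega>)\<^sup>2 \<partial>M) - sqrt (\<integral>\<omega>. (Y \<omega>)\<^sup>2 \<partial>M)\<bar>\<^sup>2 \<le> (\<integral>\<omega>. (X \<omega> - Y \<omega>)\<^sup>2 \<partial>M)"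
    using Cauchy_Schwarz_integral[OF assms] by (simp add: power2_diff)
qed

section \<open>Covariance bounds inside a Gaussian family\<close>

context gauss_family
begin

lemma char_pair:
  assumes "i \<in> I" "j \<in> I"
  shows "(CLINT \<omega>|M. iexp (a * g i \<omega> + b * g j \<omega>)) = of_real (exp (- (a\<^sup>2 * \<sigma>\<^sup>2 + 2 * a * b * r i j + b\<^sup>2 * \<sigma>\<^sup>2) / 2))"
proof -
  define c where "c m = a * of_bool (m = i) + b * of_bool (m = j)" for m
  have sum1: "(\<Sum>m\<in>I. (p * of_bool (m = n)) * f m) = p * f n" if "n \<in> I" for p n and f :: "'i \<Rightarrow> real"
    using that finite_I by (simp add: of_bool_def if_distrib[of "\<lambda>x. x * _"] if_distrib[of "\<lambda>x. _ * x"] cong: if_cong)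
  have sc: "(\<Sum>m\<in>I. c m * f m) = a * f i + b * f j" for f
    unfolding c_def distrib_right sum.distrib using assms by (auto simp: sum1)
  have "(\<Sum>m\<in>I. \<Sum>n\<in>I. c m * c n * r m n) = (\<Sum>m\<in>I. c m * (\<Sum>n\<in>I. c n * r m n))"
    by (simp add: sum_distrib_left mult.assoc)
  also have "\<dots> = a\<^sup>2 * \<sigma>\<^sup>2 + 2 * a * b * r i j + b\<^sup>2 * \<sigma>\<^sup>2"
    unfolding sc using assms r_sym[OF assms] r_diag by (simp add: power2_eq_square algebra_simps)
  finally show ?thesis using char_g[of c] unfolding sc by simp
qed

text \<open>The characteristic functions of \<open>g i + g j\<close> and \<open>g i - g j\<close>
  have modulus at most 1, so both variances are nonnegative.\<close>

lemma r_bound: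
  assumes ij: "i \<in> I" "j \<in> I"
  shows "\<bar>r i j\<bar> \<le> \<sigma>\<^sup>2"
proof -
  note [measurable] = g_measurable[OF ij(1)] g_measurable[OF ij(2)]
  have "0 \<le> 2 * \<sigma>\<^sup>2 + 2 * b * r i j" if b: "b\<^sup>2 = 1" for b
  proof -
    have "norm (CLINT \<omega>|M. iexp (1 * g i \<omega> + b * g j \<omega>)) \<le> (\<integral>\<omega>. 1 \<partial>M)"
      by (rule bochner_norm_bound)
        (auto intro!: integrable_const_bound[of _ 1] simp del: of_real_add of_real_mult)
    then show ?thesis unfolding char_pair[OF ij] using b by (simp add: prob_space)
  qed
  from this[of 1] this[of "-1"] show ?thesis by auto
qed

lemma pair_law:
  fixes F :: "real \<Rightarrow> real \<Rightarrow> real"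
  assumes ij: "i \<in> I" "j \<in> I"
    and F: "case_prod F \<in> borel_measurable (borel \<Otimes>\<^sub>M borel)" and bF: "\<And>x y. \<bar>F x y\<bar> \<le> B"
  shows "(\<integral>\<omega>. F (g i \<omega>) (g j \<omega>) \<partial>M) =
    (\<integral>x. (\<integral>z. F (\<sigma> * x) (\<sigma> * (r i j / \<sigma>\<^sup>2 * x + sqrt (1 - (r i j / \<sigma>\<^sup>2)\<^sup>2) * z)) \<partial>std_normal) \<partial>std_normal)"
proof (rule bivariate_law[where F = F and B = B and X = "g i" and Y = "g j" and \<rho> = "r i j / \<sigma>\<^sup>2" and \<sigma> = \<sigma>, OF prob_space_axioms])
  show "\<bar>r i j / \<sigma>\<^sup>2\<bar> \<le> 1" using r_bound[OF ij] \<sigma>_pos by (simp add: divide_le_eq)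
  show "(CLINT \<omega>|M. iexp (a * g i \<omega> + b * g j \<omega>)) =
     of_real (exp (- (a\<^sup>2 * \<sigma>\<^sup>2 + 2 * a * b * (r i j / \<sigma>\<^sup>2 * \<sigma>\<^sup>2) + b\<^sup>2 * \<sigma>\<^sup>2) / 2))" for a b
    unfolding char_pair[OF ij] using \<sigma>_pos by simp
qed (use g_measurable ij F bF in auto)

lemma marginal_law:
  assumes i: "i \<in> I" and f [measurable]: "f \<in> borel_measurable borel" and bf: "\<And>x. \<bar>f x\<bar> \<le> (B::real)"
  shows "(\<integral>\<omega>. f (g i \<omega>) \<partial>M) = (\<integral>x. f (\<sigma> * x) \<partial>std_normal)"
proof -
  interpret N: prob_space std_normal by (rule prob_space_std_normal)
  have "(\<integral>\<omega>. (\<lambda>x y. f x) (g i \<omega>) (g i \<omega>) \<partial>M) = (\<integral>x. (\<integral>z. f (\<sigma> * x) \<partial>std_normal) \<partial>std_normal)"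
    by (rule pair_law[OF i i, of "\<lambda>x y. f x" B]) (use bf in auto)
  then show ?thesis using N.prob_space by simp
qed

text \<open>\<open>m x\<close> is the conditional mean of \<open>f (g j)\<close> given
  \<open>g i = \<sigma> * x\<close>. The covariance is the mean of \<open>f (\<sigma> * x)\<close>
  times the fluctuation of \<open>m\<close>, and a \<open>\<Lambda>\<close>-Lipschitz function of a
  standard normal variable deviates from its mean by at most
  \<open>\<Lambda> * (\<bar>x\<bar> + 1)\<close>.\<close>

lemma cov_lipschitz:
  assumes ij: "i \<in> I" "j \<in> I" and f [measurable]: "f \<in> borel_measurable borel" and bf: "\<And>x. \<bar>f x\<bar> \<le> (1::real)"
    and m: "\<And>x. m x = (\<integral>z. f (\<sigma> * (r i j / \<sigma>\<^sup>2 * x + sqrt (1 - (r i j / \<sigma>\<^sup>2)\<^sup>2) * z)) \<partial>std_normal)"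
    and lip: "\<And>x y. \<bar>m x - m y\<bar> \<le> \<Lambda> * \<bar>x - y\<bar>"
  shows "\<bar>(\<integral>\<omega>. f (g i \<omega>) * f (g j \<omega>) \<partial>M) - (\<integral>\<omega>. f (g i \<omega>) \<partial>M) * (\<integral>\<omega>. f (g j \<omega>) \<partial>M)\<bar> \<le> 2 * \<Lambda>"
proof -
  interpret N: prob_space std_normal by (rule prob_space_std_normal)
  have \<Lambda>: "0 \<le> \<Lambda>" using order_trans[OF abs_ge_zero lip[of 1 0]] by simp
  have mb: "\<bar>m x\<bar> \<le> 1" for x
  proof -
    have "norm (m x) \<le> (\<integral>z. 1 \<partial>std_normal)" unfolding m
      by (rule bochner_norm_bound) (auto intro!: N.integrable_const_bound[of _ 1] bf)
    then show ?thesis using N.prob_space by simp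
  qed
  have "continuous_on UNIV m"
    by (rule lipschitz_on_continuous_on[of \<Lambda>]) (use lip \<Lambda> in \<open>auto intro!: lipschitz_onI simp: dist_real_def\<close>)
  then have [measurable]: "m \<in> borel_measurable borel" by (rule borel_measurable_continuous_onI)
  have im: "integrable std_normal m" by (rule N.integrable_const_bound[of _ 1]) (auto simp: mb)
  have ifs: "integrable std_normal (\<lambda>x. f (\<sigma> * x))" by (rule N.integrable_const_bound[of _ 1]) (auto simp: bf)
  have ifm: "integrable std_normal (\<lambda>x. f (\<sigma> * x) * m x)"
    by (rule N.integrable_const_bound[of _ 1]) (auto simp: abs_mult intro!: mult_le_one bf mb)
  define mm where "mm = (\<integral>x. m x \<partial>std_normal)"
  have 1: "(\<integral>\<omega>. f (g i \<omega>) * f (g j \<omega>) \<partial>M) = (\<integral>x. f (\<sigma> * x) * m x \<partial>std_normal)"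
    using pair_law[OF ij, of "\<lambda>x y. f x * f y" 1] unfolding m
    by (simp add: abs_mult mult_le_one bf)
  have 2: "(\<integral>\<omega>. f (g j \<omega>) \<partial>M) = mm"
    using pair_law[OF ij, of "\<lambda>x y. f y" 1] unfolding m mm_def by (simp add: bf)
  have 3: "(\<integral>\<omega>. f (g i \<omega>) \<partial>M) = (\<integral>x. f (\<sigma> * x) \<partial>std_normal)" by (rule marginal_law[OF ij(1) f bf])
  have mmx: "\<bar>m x - mm\<bar> \<le> \<Lambda> * (\<bar>x\<bar> + 1)" for x
  proof -
    have E: "m x - mm = (\<integral>y. m x - m y \<partial>std_normal)" unfolding mm_def using im N.prob_space by simp
    have "norm (m x - mm) \<le> (\<integral>y. \<Lambda> * (\<bar>x\<bar> + \<bar>y\<bar>) \<partial>std_normal)"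
      unfolding E
    proof (rule bochner_norm_bound)
      show "integrable std_normal (\<lambda>y. \<Lambda> * (\<bar>x\<bar> + \<bar>y\<bar>))" using integrable_abs_std_normal by auto
      fix y
      have "\<Lambda> * \<bar>x - y\<bar> \<le> \<Lambda> * (\<bar>x\<bar> + \<bar>y\<bar>)" using \<Lambda> by (intro mult_left_mono) auto
      then show "norm (m x - m y) \<le> \<Lambda> * (\<bar>x\<bar> + \<bar>y\<bar>)" using lip[of x y] by simp
    qed (use im in auto)
    also have "\<dots> = \<Lambda> * (\<bar>x\<bar> + (\<integral>y. \<bar>y\<bar> \<partial>std_normal))" using integrable_abs_std_normal N.prob_space by simp
    also have "\<dots> \<le> \<Lambda> * (\<bar>x\<bar> + 1)" using integrable_abs_std_normal(2) \<Lambda> by (intro mult_left_mono) auto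
    finally show ?thesis by simp
  qed
  have E: "(\<integral>x. f (\<sigma> * x) * m x \<partial>std_normal) - (\<integral>x. f (\<sigma> * x) \<partial>std_normal) * mm = (\<integral>x. f (\<sigma> * x) * (m x - mm) \<partial>std_normal)"
    unfolding right_diff_distrib using ifm ifs by simp
  have "norm ((\<integral>x. f (\<sigma> * x) * m x \<partial>std_normal) - (\<integral>x. f (\<sigma> * x) \<partial>std_normal) * mm) \<le> (\<integral>x. \<Lambda> * (\<bar>x\<bar> + 1) \<partial>std_normal)"
    unfolding E
  proof (rule bochner_norm_bound)
    show "integrable std_normal (\<lambda>x. f (\<sigma> * x) * (m x - mm))"
      unfolding right_diff_distrib using ifm ifs by auto
    fix x
    have "\<bar>f (\<sigma> * x)\<bar> * \<bar>m x - mm\<bar> \<le> 1 * (\<Lambda> * (\<bar>x\<bar> + 1))" by (intro mult_mono bf mmx) auto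
    then show "norm (f (\<sigma> * x) * (m x - mm)) \<le> \<Lambda> * (\<bar>x\<bar> + 1)" by (simp add: abs_mult)
  qed (use integrable_abs_std_normal in auto)
  also have "\<dots> = \<Lambda> * ((\<integral>x. \<bar>x\<bar> \<partial>std_normal) + 1)" using integrable_abs_std_normal N.prob_space by simp
  also have "\<dots> \<le> \<Lambda> * (1 + 1)" using integrable_abs_std_normal(2) \<Lambda> by (intro mult_left_mono) auto
  finally show ?thesis unfolding 1 2 3 by simp
qed

lemma sqrt_ge_half: "\<bar>\<rho>\<bar> \<le> 1 / 2 \<Longrightarrow> 1 / 2 \<le> sqrt (1 - \<rho>\<^sup>2)" for \<rho> :: real
proof (rule real_le_rsqrt)
  assume "\<bar>\<rho>\<bar> \<le> 1 / 2"
  from power_mono[OF this, of 2] show "(1 / 2)\<^sup>2 \<le> 1 - \<rho>\<^sup>2" by (simp add: power_divide)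
qed

text \<open>For correlations above 1/2 in modulus, where no decay has to be extracted: one factor is
  bounded by 1 and the other one is integrated.\<close>

lemma cov_trivial:
  assumes ij: "i \<in> I" "j \<in> I" and f [measurable]: "f \<in> borel_measurable borel" and bf: "\<And>x. \<bar>f x\<bar> \<le> (1::real)"
  shows "\<bar>(\<integral>\<omega>. f (g i \<omega>) * f (g j \<omega>) \<partial>M) - (\<integral>\<omega>. f (g i \<omega>) \<partial>M) * (\<integral>\<omega>. f (g j \<omega>) \<partial>M)\<bar> \<le> 2 * (\<integral>x. \<bar>f (\<sigma> * x)\<bar> \<partial>std_normal)"
proof -
  note [measurable] = g_measurable[OF ij(1)] g_measurable[OF ij(2)]
  have i1: "integrable M (\<lambda>\<omega>. \<bar>f (g i \<omega>)\<bar>)" "integrable M (\<lambda>\<omega>. f (g i \<omega>) * f (g j \<omega>))" "integrable M (\<lambda>\<omega>. f (g i \<omega>))" "integrable M (\<lambda>\<omega>. f (g j \<omega>))"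
    by (rule integrable_const_bound[of _ 1]; auto simp: abs_mult bf intro!: mult_le_one)+
  define e where "e = (\<integral>\<omega>. \<bar>f (g i \<omega>)\<bar> \<partial>M)"
  have e: "e = (\<integral>x. \<bar>f (\<sigma> * x)\<bar> \<partial>std_normal)" unfolding e_def
    by (rule marginal_law[OF ij(1), of "\<lambda>x. \<bar>f x\<bar>" 1]) (auto simp: bf)
  have 1: "norm (\<integral>\<omega>. f (g i \<omega>) * f (g j \<omega>) \<partial>M) \<le> e" unfolding e_def
    using i1 by (intro bochner_norm_bound) (auto simp: abs_mult bf mult_left_le)
  have 2: "norm (\<integral>\<omega>. f (g i \<omega>) \<partial>M) \<le> e" unfolding e_def using i1 by (intro bochner_norm_bound) auto
  have "norm (\<integral>\<omega>. f (g j \<omega>) \<partial>M) \<le> (\<integral>\<omega>. 1 \<partial>M)" using i1 bf by (intro bochner_norm_bound) auto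
  then have "\<bar>(\<integral>\<omega>. f (g i \<omega>) \<partial>M) * (\<integral>\<omega>. f (g j \<omega>) \<partial>M)\<bar> \<le> e * 1"
    unfolding abs_mult using 2 by (intro mult_mono) (auto simp: prob_space)
  then show ?thesis using 1 unfolding e[symmetric] by simp
qed

text \<open>For \<open>\<bar>\<rho>\<bar> \<le> 1 / 2\<close> the conditional probability that
  \<open>g j\<close> exceeds \<open>u\<close> is Lipschitz with constant
  \<open>2 * \<bar>\<rho>\<bar>\<close>, by \<open>ncdf_lipschitz\<close>; otherwise the trivial
  bound 2 is below \<open>4 * \<bar>\<rho>\<bar>\<close>. The constant 4 does not depend on the
  level, which is what makes the final estimate uniform.\<close>

lemma cov_ind_bound:
  fixes u :: real
  assumes ij: "i \<in> I" "j \<in> I"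
  defines "f \<equiv> indicator {u..} :: real \<Rightarrow> real"
  shows "\<bar>(\<integral>\<omega>. f (g i \<omega>) * f (g j \<omega>) \<partial>M) - (\<integral>\<omega>. f (g i \<omega>) \<partial>M) * (\<integral>\<omega>. f (g j \<omega>) \<partial>M)\<bar> \<le> 4 * \<bar>r i j / \<sigma>\<^sup>2\<bar>"
proof -
  interpret N: prob_space std_normal by (rule prob_space_std_normal)
  define \<rho> where "\<rho> = r i j / \<sigma>\<^sup>2"
  define q where "q = sqrt (1 - \<rho>\<^sup>2)"
  have f [measurable]: "f \<in> borel_measurable borel" and bf: "\<bar>f x\<bar> \<le> 1" for x
    unfolding f_def by (auto simp: indicator_def)
  show ?thesis
  proof (cases "\<bar>\<rho>\<bar> \<le> 1 / 2")
    case True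
    then have q: "1 / 2 \<le> q" unfolding q_def by (rule sqrt_ge_half)
    define m where "m x = 1 - ncdf ((u - \<sigma> * \<rho> * x) / (\<sigma> * q))" for x
    have "\<bar>(\<integral>\<omega>. f (g i \<omega>) * f (g j \<omega>) \<partial>M) - (\<integral>\<omega>. f (g i \<omega>) \<partial>M) * (\<integral>\<omega>. f (g j \<omega>) \<partial>M)\<bar> \<le> 2 * (2 * \<bar>\<rho>\<bar>)"
    proof (rule cov_lipschitz[OF ij f bf])
      fix x y
      show "m x = (\<integral>z. f (\<sigma> * (r i j / \<sigma>\<^sup>2 * x + sqrt (1 - (r i j / \<sigma>\<^sup>2)\<^sup>2) * z)) \<partial>std_normal)"
      proof -
        have "0 < \<sigma> * q" using q \<sigma>_pos by simp
        from integral_std_normal_ge[OF this, of u "\<sigma> * \<rho> * x"]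
        have "(\<integral>z. f (\<sigma> * \<rho> * x + \<sigma> * q * z) \<partial>std_normal) = m x" unfolding f_def m_def .
        moreover have "\<sigma> * (\<rho> * x + q * z) = \<sigma> * \<rho> * x + \<sigma> * q * z" for z by (simp add: algebra_simps)
        ultimately show ?thesis unfolding \<rho>_def[symmetric] q_def[symmetric] by simp
      qed
      have "\<bar>m x - m y\<bar> \<le> \<bar>(u - \<sigma> * \<rho> * x) / (\<sigma> * q) - (u - \<sigma> * \<rho> * y) / (\<sigma> * q)\<bar>"
        unfolding m_def using ncdf_lipschitz[of "(u - \<sigma> * \<rho> * x) / (\<sigma> * q)" "(u - \<sigma> * \<rho> * y) / (\<sigma> * q)"] by linarith
      also have "(u - \<sigma> * \<rho> * x) / (\<sigma> * q) - (u - \<sigma> * \<rho> * y) / (\<sigma> * q) = \<rho> * (y - x) / q"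
        using \<sigma>_pos q by (simp add: diff_divide_distrib[symmetric]) (simp add: field_simps)
      also have "\<bar>\<dots>\<bar> = \<bar>\<rho>\<bar> * \<bar>x - y\<bar> / q" using q by (simp add: abs_mult abs_minus_commute)
      also have "\<dots> \<le> \<bar>\<rho>\<bar> * \<bar>x - y\<bar> / (1 / 2)" using q by (intro divide_left_mono) auto
      finally show "\<bar>m x - m y\<bar> \<le> 2 * \<bar>\<rho>\<bar> * \<bar>x - y\<bar>" by simp
    qed
    then show ?thesis by (simp add: \<rho>_def)
  next
    case False
    have "(\<integral>x. \<bar>f (\<sigma> * x)\<bar> \<partial>std_normal) \<le> (\<integral>x. 1 \<partial>std_normal)"
      by (intro integral_mono N.integrable_const_bound[of _ 1]) (auto simp: bf)
    then show ?thesis using cov_trivial[OF ij f bf] False N.prob_space unfolding \<rho>_def[symmetric] by simp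
  qed
qed

text \<open>Gains the L1 norm of \<open>f\<close> and the correlation at the same time. For small
  correlation the conditional mean is \<open>f\<close> integrated against a normal density, and
  moving the centre of that density changes the mean by at most the L1 norm times a Lipschitz
  constant. It is made for \<open>smooth_ind_err\<close>, whose L1 norm is of order
  \<open>\<delta>\<close>.\<close>

lemma cov_L1_bound:
  assumes ij: "i \<in> I" "j \<in> I" and bf: "\<And>x. \<bar>f x\<bar> \<le> (1::real)"
    and f: "integrable lborel f" and \<kappa>: "(\<integral>x. \<bar>f x\<bar> \<partial>lborel) \<le> \<kappa>"
  shows "\<bar>(\<integral>\<omega>. f (g i \<omega>) * f (g j \<omega>) \<partial>M) - (\<integral>\<omega>. f (g i \<omega>) \<partial>M) * (\<integral>\<omega>. f (g j \<omega>) \<partial>M)\<bar> \<le> 8 * \<kappa> / \<sigma> * \<bar>r i j / \<sigma>\<^sup>2\<bar>"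
proof -
  interpret N: prob_space std_normal by (rule prob_space_std_normal)
  define \<rho> where "\<rho> = r i j / \<sigma>\<^sup>2"
  define q where "q = sqrt (1 - \<rho>\<^sup>2)"
  have fm [measurable]: "f \<in> borel_measurable borel" using f by auto
  have "0 \<le> (\<integral>x. \<bar>f x\<bar> \<partial>lborel)" by (rule integral_nonneg_AE) simp
  then have \<kappa>0: "0 \<le> \<kappa>" using \<kappa> by linarith
  show ?thesis
  proof (cases "\<bar>\<rho>\<bar> \<le> 1 / 2")
    case True
    then have q: "1 / 2 \<le> q" unfolding q_def by (rule sqrt_ge_half)
    define s where "s = \<sigma> * q"
    \<comment> \<open>The conditional standard deviation stays above \<open>\<sigma> / 2\<close>;
      this is what the case \<open>\<bar>\<rho>\<bar> \<le> 1 / 2\<close> provides.\<close>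
    have s: "0 < s" "\<sigma> / 2 \<le> s" unfolding s_def using q \<sigma>_pos mult_left_mono[OF q, of \<sigma>] by auto
    define m where "m x = (\<integral>z. f (\<sigma> * (\<rho> * x + q * z)) \<partial>std_normal)" for x
    have m: "m x = (\<integral>y. std_normal_density ((y - \<sigma> * \<rho> * x) / s) * f y / s \<partial>lborel)" for x
    proof -
      have "m x = (\<integral>z. std_normal_density z *\<^sub>R f (\<sigma> * \<rho> * x + s * z) \<partial>lborel)"
        unfolding m_def s_def by (subst integral_std_normal) (auto simp: algebra_simps)
      also have "\<dots> = (\<integral>y. std_normal_density ((y - \<sigma> * \<rho> * x) / s) * f y / s \<partial>lborel)"
        using s by (subst (2) lborel_integral_real_affine[of s _ "\<sigma> * \<rho> * x"]) (auto simp: divide_simps)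
      finally show ?thesis .
    qed
    have i1: "integrable lborel (\<lambda>y. std_normal_density ((y - c) / s) * f y / s)" for c
    proof (rule Bochner_Integration.integrable_bound[of _ "\<lambda>y. f y / s"])
      show "AE y in lborel. norm (std_normal_density ((y - c) / s) * f y / s) \<le> norm (f y / s)"
        using s std_normal_density_le_1 by (auto simp: abs_mult intro!: AE_I2 divide_right_mono mult_right_le_one_le mult_left_le_one_le)
    qed (use f in auto)
    have "\<bar>(\<integral>\<omega>. f (g i \<omega>) * f (g j \<omega>) \<partial>M) - (\<integral>\<omega>. f (g i \<omega>) \<partial>M) * (\<integral>\<omega>. f (g j \<omega>) \<partial>M)\<bar> \<le> 2 * (4 * \<kappa> / \<sigma> * \<bar>\<rho>\<bar>)"
    proof (rule cov_lipschitz[OF ij fm bf])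
      fix x y
      show "m x = (\<integral>z. f (\<sigma> * (r i j / \<sigma>\<^sup>2 * x + sqrt (1 - (r i j / \<sigma>\<^sup>2)\<^sup>2) * z)) \<partial>std_normal)"
        unfolding m_def q_def \<rho>_def ..
      define \<Lambda> where "\<Lambda> = \<sigma> * \<bar>\<rho>\<bar> * \<bar>x - y\<bar> / s / s"
      have E: "m x - m y = (\<integral>t. std_normal_density ((t - \<sigma> * \<rho> * x) / s) * f t / s - std_normal_density ((t - \<sigma> * \<rho> * y) / s) * f t / s \<partial>lborel)"
        unfolding m using i1 by simp
      have "norm (m x - m y) \<le> (\<integral>t. \<Lambda> * \<bar>f t\<bar> \<partial>lborel)"
        unfolding E
      proof (rule bochner_norm_bound)
        fix t
        have "std_normal_density ((t - \<sigma> * \<rho> * x) / s) * f t / s - std_normal_density ((t - \<sigma> * \<rho> * y) / s) * f t / s =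
          (std_normal_density ((t - \<sigma> * \<rho> * x) / s) - std_normal_density ((t - \<sigma> * \<rho> * y) / s)) * f t / s"
          by (simp add: left_diff_distrib diff_divide_distrib)
        then have "norm (std_normal_density ((t - \<sigma> * \<rho> * x) / s) * f t / s - std_normal_density ((t - \<sigma> * \<rho> * y) / s) * f t / s) =
          \<bar>std_normal_density ((t - \<sigma> * \<rho> * x) / s) - std_normal_density ((t - \<sigma> * \<rho> * y) / s)\<bar> * \<bar>f t\<bar> / s"
          using s by (simp add: abs_mult)
        also have "\<dots> \<le> \<bar>(t - \<sigma> * \<rho> * x) / s - (t - \<sigma> * \<rho> * y) / s\<bar> * \<bar>f t\<bar> / s"
          using s by (intro divide_right_mono mult_right_mono std_normal_density_lipschitz) auto
        also have "(t - \<sigma> * \<rho> * x) / s - (t - \<sigma> * \<rho> * y) / s = \<sigma> * \<rho> * (y - x) / s"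
          by (simp add: diff_divide_distrib[symmetric] algebra_simps)
        also have "\<bar>\<sigma> * \<rho> * (y - x) / s\<bar> * \<bar>f t\<bar> / s = \<Lambda> * \<bar>f t\<bar>"
          using s \<sigma>_pos by (simp add: \<Lambda>_def abs_mult abs_minus_commute)
        finally show "norm (std_normal_density ((t - \<sigma> * \<rho> * x) / s) * f t / s - std_normal_density ((t - \<sigma> * \<rho> * y) / s) * f t / s) \<le> \<Lambda> * \<bar>f t\<bar>" .
      qed (use i1 f in auto)
      also have "\<dots> \<le> \<Lambda> * \<kappa>"
      proof -
        have "0 \<le> \<Lambda>" using s \<sigma>_pos by (simp add: \<Lambda>_def)
        from mult_left_mono[OF \<kappa> this] show ?thesis by simp
      qed
      also have "\<Lambda> \<le> \<sigma> * \<bar>\<rho>\<bar> * \<bar>x - y\<bar> / (\<sigma> / 2) / (\<sigma> / 2)"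
        unfolding \<Lambda>_def using s \<sigma>_pos by (intro frac_le) auto
      then have "\<Lambda> * \<kappa> \<le> (\<sigma> * \<bar>\<rho>\<bar> * \<bar>x - y\<bar> / (\<sigma> / 2) / (\<sigma> / 2)) * \<kappa>" using \<kappa>0 by (rule mult_right_mono)
      also have "\<dots> = 4 * \<kappa> / \<sigma> * \<bar>\<rho>\<bar> * \<bar>x - y\<bar>" using \<sigma>_pos by (simp add: field_simps)
      finally show "\<bar>m x - m y\<bar> \<le> 4 * \<kappa> / \<sigma> * \<bar>\<rho>\<bar> * \<bar>x - y\<bar>" by simp
    qed
    then show ?thesis by (simp add: \<rho>_def)
  next
    case False
    have i2: "integrable lborel (\<lambda>x. \<bar>f (\<sigma> * x)\<bar>)"
      using lborel_integrable_real_affine[OF f, of \<sigma> 0] \<sigma>_pos by auto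
    have "(\<integral>x. \<bar>f (\<sigma> * x)\<bar> \<partial>std_normal) = (\<integral>x. std_normal_density x *\<^sub>R \<bar>f (\<sigma> * x)\<bar> \<partial>lborel)"
      by (rule integral_std_normal) measurable
    also have "\<dots> \<le> (\<integral>x. \<bar>f (\<sigma> * x)\<bar> \<partial>lborel)"
    proof (rule integral_mono)
      show "integrable lborel (\<lambda>x. std_normal_density x *\<^sub>R \<bar>f (\<sigma> * x)\<bar>)"
        by (rule Bochner_Integration.integrable_bound[OF i2])
          (auto simp: abs_mult std_normal_density_le_1 intro!: AE_I2 mult_left_le_one_le)
    qed (use i2 std_normal_density_le_1 in \<open>auto intro!: mult_left_le_one_le\<close>)
    also have "\<dots> = (\<integral>x. \<bar>f x\<bar> \<partial>lborel) / \<sigma>"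
      using lborel_integral_real_affine[of \<sigma> "\<lambda>x. \<bar>f x\<bar>" 0] \<sigma>_pos by simp
    also have "\<dots> \<le> \<kappa> / \<sigma>" using \<kappa> \<sigma>_pos by (intro divide_right_mono) auto
    finally have 1: "(\<integral>x. \<bar>f (\<sigma> * x)\<bar> \<partial>std_normal) \<le> \<kappa> / \<sigma>" .
    have "2 * (\<kappa> / \<sigma>) \<le> 8 * \<kappa> / \<sigma> * \<bar>\<rho>\<bar>"
    proof -
      have "(\<kappa> / \<sigma>) * 2 \<le> (\<kappa> / \<sigma>) * (8 * \<bar>\<rho>\<bar>)" using False \<kappa>0 \<sigma>_pos by (intro mult_left_mono) auto
      then show ?thesis by (simp add: mult_ac)
    qed
    then show ?thesis using cov_trivial[OF ij fm bf] 1 unfolding \<rho>_def by linarith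
  qed
qed

lemma prob_ge: "i \<in> I \<Longrightarrow> (\<integral>\<omega>. indicator {u..} (g i \<omega>) \<partial>M) = Psi (u / \<sigma>)"
  using marginal_law[of i "indicator {u..}" 1] integral_std_normal_ge[of \<sigma> u 0] \<sigma>_pos
  by (simp add: Psi_ncdf indicator_def)

text \<open>\<open>P s\<close> is the orthant probability at correlation \<open>s\<close>.
  Independence makes it the squared tail at \<open>s = 0\<close>, and
  \<open>sheppard_increment\<close> leads from 0 to the actual correlation. A negative correlation
  exchanges the endpoints, in accordance with the oriented integral.\<close>

lemma sheppard:
  assumes ij: "i \<in> I" "j \<in> I" and \<rho>1: "\<bar>r i j / \<sigma>\<^sup>2\<bar> < 1"
  shows "(\<integral>\<omega>. indicator {u..} (g i \<omega>) * indicator {u..} (g j \<omega>) \<partial>M) - (Psi (u / \<sigma>))\<^sup>2 =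
    1 / (2 * pi) * (LBINT s=0..ereal (r i j / \<sigma>\<^sup>2). 1 / sqrt (1 - s\<^sup>2) * exp (- (u\<^sup>2 / (\<sigma>\<^sup>2 * (1 + s)))))"
proof -
  interpret N: prob_space std_normal by (rule prob_space_std_normal)
  define \<rho> where "\<rho> = r i j / \<sigma>\<^sup>2"
  define h where "h = u / \<sigma>"
  define f where "f s x = std_normal_density x * ncdf ((s * x - h) / sqrt (1 - s\<^sup>2))" for s x
  define k where "k s = 1 / sqrt (1 - s\<^sup>2) * exp (- (h\<^sup>2 / (1 + s)))" for s
  define P where "P s = (\<integral>x. indicator {h..} x * f s x \<partial>lborel)" for s
  have inc: "P b - P a = 1 / (2 * pi) * (\<integral>s. indicator {a..b} s * k s \<partial>lborel)"
    if "a \<le> b" "-1 < a" "b < 1" for a b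
    unfolding P_def f_def k_def by (rule sheppard_increment[OF that])
  have "\<bar>\<rho>\<bar> < 1" using \<rho>1 unfolding \<rho>_def .
  then have \<rho>: "-1 < \<rho>" "\<rho> < 1" by (auto simp only: abs_less_iff)
  have "P \<rho> - P 0 = 1 / (2 * pi) * (LBINT s=0..ereal \<rho>. k s)"
  proof (cases "0 \<le> \<rho>")
    case True
    then have "(LBINT s=ereal 0..ereal \<rho>. k s) = (\<integral>s. indicator {0..\<rho>} s * k s \<partial>lborel)"
      by (subst interval_integral_Icc) (auto simp: set_lebesgue_integral_def)
    then show ?thesis using inc[of 0 \<rho>] True \<rho> by (simp add: zero_ereal_def)
  next
    case False
    then have "(LBINT s=ereal \<rho>..ereal 0. k s) = (\<integral>s. indicator {\<rho>..0} s * k s \<partial>lborel)"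
      by (subst interval_integral_Icc) (auto simp: set_lebesgue_integral_def)
    then show ?thesis using inc[of \<rho> 0] False \<rho>
      by (subst interval_integral_endpoints_reverse) (simp add: zero_ereal_def)
  qed
  moreover have "P 0 = (Psi (u / \<sigma>))\<^sup>2"
  proof -
    have "P 0 = (\<integral>x. ncdf (- h) * (indicator {h..} x * std_normal_density x) \<partial>lborel)"
      unfolding P_def f_def by (simp add: mult_ac)
    also have "\<dots> = ncdf (- h) * measure std_normal {h..}"
      unfolding integral_mult_right_zero by (subst measure_std_normal) auto
    finally show ?thesis
      by (simp add: ncdf_uminus measure_std_normal_ge Psi_ncdf h_def power2_eq_square)
  qed
  moreover have "(\<integral>\<omega>. indicat_real {u..} (g i \<omega>) * indicat_real {u..} (g j \<omega>) \<partial>M) = P \<rho>"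
  proof -
    have q: "0 < sqrt (1 - \<rho>\<^sup>2)" using \<rho> by (simp add: abs_square_less_1)
    have "(\<integral>\<omega>. indicat_real {u..} (g i \<omega>) * indicat_real {u..} (g j \<omega>) \<partial>M) =
      (\<integral>x. (\<integral>z. indicat_real {u..} (\<sigma> * x) * indicat_real {u..} (\<sigma> * (\<rho> * x + sqrt (1 - \<rho>\<^sup>2) * z)) \<partial>std_normal) \<partial>std_normal)"
      unfolding \<rho>_def by (rule pair_law[OF ij, of "\<lambda>x y. indicat_real {u..} x * indicat_real {u..} y" 1])
        (auto simp: indicator_def)
    also have "\<dots> = (\<integral>x. indicator {h..} x * ncdf ((\<rho> * x - h) / sqrt (1 - \<rho>\<^sup>2)) \<partial>std_normal)"
    proof (rule Bochner_Integration.integral_cong[OF refl])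
      fix x
      have 1: "indicat_real {u..} (\<sigma> * x) = (indicator {h..} x :: real)" using \<sigma>_pos by (auto simp: h_def indicator_def field_simps)
      have "(\<integral>z. indicat_real {u..} (\<sigma> * (\<rho> * x + sqrt (1 - \<rho>\<^sup>2) * z)) \<partial>std_normal) = 1 - ncdf ((u - \<sigma> * \<rho> * x) / (\<sigma> * sqrt (1 - \<rho>\<^sup>2)))"
        using integral_std_normal_ge[of "\<sigma> * sqrt (1 - \<rho>\<^sup>2)" u "\<sigma> * \<rho> * x"] q \<sigma>_pos by (simp add: distrib_left mult.assoc)
      also have "(u - \<sigma> * \<rho> * x) / (\<sigma> * sqrt (1 - \<rho>\<^sup>2)) = - ((\<rho> * x - h) / sqrt (1 - \<rho>\<^sup>2))"
        using q \<sigma>_pos by (simp add: h_def field_simps)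
      finally have "(\<integral>z. indicat_real {u..} (\<sigma> * (\<rho> * x + sqrt (1 - \<rho>\<^sup>2) * z)) \<partial>std_normal) = ncdf ((\<rho> * x - h) / sqrt (1 - \<rho>\<^sup>2))"
        by (simp add: ncdf_uminus)
      then show "(\<integral>z. indicat_real {u..} (\<sigma> * x) * indicat_real {u..} (\<sigma> * (\<rho> * x + sqrt (1 - \<rho>\<^sup>2) * z)) \<partial>std_normal) =
        indicator {h..} x * ncdf ((\<rho> * x - h) / sqrt (1 - \<rho>\<^sup>2))"
        unfolding 1 integral_mult_right_zero by simp
    qed
    also have "\<dots> = (\<integral>x. std_normal_density x *\<^sub>R (indicator {h..} x * ncdf ((\<rho> * x - h) / sqrt (1 - \<rho>\<^sup>2))) \<partial>lborel)"
      by (rule integral_std_normal) measurable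
    also have "\<dots> = P \<rho>" unfolding P_def f_def by (simp add: mult_ac)
    finally show ?thesis .
  qed
  ultimately show ?thesis
    unfolding k_def h_def \<rho>_def by (simp add: power_divide)
qed

end

section \<open>A central limit theorem for weighted indicator sums\<close>

text \<open>Coefficients of \<open>A powr (- (1 / 32))\<close> in \<open>finite_clt\<close>: twice
  the L2 cost of smoothing, once for the sum and once for its variance; \<open>4 + 2 * V\<close>
  from mollifying and truncating, where \<open>V\<close> bounds the variance of the smoothed sum;
  and the contribution of the characteristic functions.\<close>

definition clt_const :: "real \<Rightarrow> real \<Rightarrow> real" where
  "clt_const \<sigma> R = 2 * sqrt (16 * pi * R / \<sigma> ^ 3) + 4 + 2 * (8 * R / \<sigma>\<^sup>2 + 32 * pi * R / \<sigma> ^ 3) + 2 * R powr (3/2)"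

context gauss_family
begin

definition indicator_sum :: "('i \<Rightarrow> real) \<Rightarrow> real \<Rightarrow> 'a \<Rightarrow> real" where
  "indicator_sum w u \<omega> = (\<Sum>j\<in>I. w j * (indicator {u..} (g j \<omega>) - Psi (u / \<sigma>)))"

lemma integral_square_sum:
  assumes f [measurable]: "f \<in> borel_measurable borel" and bf: "\<And>x. \<bar>f x\<bar> \<le> (1::real)"
    and \<mu>: "\<And>i. i \<in> I \<Longrightarrow> (\<integral>\<omega>. f (g i \<omega>) \<partial>M) = \<mu>"
  shows "(\<integral>\<omega>. (\<Sum>j\<in>I. w j * (f (g j \<omega>) - \<mu>))\<^sup>2 \<partial>M) =
    (\<Sum>i\<in>I. \<Sum>j\<in>I. w i * w j * ((\<integral>\<omega>. f (g i \<omega>) * f (g j \<omega>) \<partial>M) - \<mu>\<^sup>2))"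
proof -
  note [measurable] = g_measurable
  have i1: "integrable M (\<lambda>\<omega>. f (g i \<omega>))" "integrable M (\<lambda>\<omega>. f (g i \<omega>) * f (g j \<omega>))" if "i \<in> I" "j \<in> I" for i j
    using that by (intro integrable_const_bound[of _ 1]; auto simp: abs_mult bf intro!: mult_le_one)+
  have c: "(\<integral>\<omega>. (f (g i \<omega>) - \<mu>) * (f (g j \<omega>) - \<mu>) \<partial>M) = (\<integral>\<omega>. f (g i \<omega>) * f (g j \<omega>) \<partial>M) - \<mu>\<^sup>2"
    "integrable M (\<lambda>\<omega>. (f (g i \<omega>) - \<mu>) * (f (g j \<omega>) - \<mu>))" if ij: "i \<in> I" "j \<in> I" for i j
  proof -
    have e: "(\<lambda>\<omega>. (f (g i \<omega>) - \<mu>) * (f (g j \<omega>) - \<mu>)) = (\<lambda>\<omega>. f (g i \<omega>) * f (g j \<omega>) - \<mu> * f (g i \<omega>) - \<mu> * f (g j \<omega>) + \<mu>\<^sup>2)"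
      by (auto simp: power2_eq_square algebra_simps)
    show "(\<integral>\<omega>. (f (g i \<omega>) - \<mu>) * (f (g j \<omega>) - \<mu>) \<partial>M) = (\<integral>\<omega>. f (g i \<omega>) * f (g j \<omega>) \<partial>M) - \<mu>\<^sup>2"
      unfolding e using i1[OF ij] i1[OF ij(2,1)] \<mu>[OF ij(1)] \<mu>[OF ij(2)] by (simp add: prob_space power2_eq_square)
    show "integrable M (\<lambda>\<omega>. (f (g i \<omega>) - \<mu>) * (f (g j \<omega>) - \<mu>))"
      unfolding e using i1[OF ij] i1[OF ij(2,1)] by auto
  qed
  have "(\<integral>\<omega>. (\<Sum>j\<in>I. w j * (f (g j \<omega>) - \<mu>))\<^sup>2 \<partial>M) =
    (\<integral>\<omega>. (\<Sum>i\<in>I. \<Sum>j\<in>I. w i * w j * ((f (g i \<omega>) - \<mu>) * (f (g j \<omega>) - \<mu>))) \<partial>M)"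
    unfolding power2_eq_square sum_product by (intro Bochner_Integration.integral_cong refl sum.cong) (simp only: mult_ac)
  also have "\<dots> = (\<Sum>i\<in>I. \<Sum>j\<in>I. w i * w j * ((\<integral>\<omega>. f (g i \<omega>) * f (g j \<omega>) \<partial>M) - \<mu>\<^sup>2))"
    using c by (simp add: Bochner_Integration.integral_sum Bochner_Integration.integrable_sum)
  finally show ?thesis .
qed

text \<open>The same summation as in \<open>stein_form_variance\<close>, with a single edge:
  \<open>\<rho>\<close> for the edge and \<open>sum w I\<close> for the remaining site.\<close>

lemma integral_square_sum_le:
  assumes f: "f \<in> borel_measurable borel" and bf: "\<And>x. \<bar>f x\<bar> \<le> (1::real)"
    and \<mu>: "\<And>i. i \<in> I \<Longrightarrow> (\<integral>\<omega>. f (g i \<omega>) \<partial>M) = \<mu>"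
    and w: "\<And>i. 0 \<le> w i" and row: "\<And>i. i \<in> I \<Longrightarrow> (\<Sum>j\<in>I. w j * \<bar>r i j\<bar>) \<le> \<rho>"
    and K: "0 \<le> K" and cov: "\<And>i j. i \<in> I \<Longrightarrow> j \<in> I \<Longrightarrow> \<bar>(\<integral>\<omega>. f (g i \<omega>) * f (g j \<omega>) \<partial>M) - (\<integral>\<omega>. f (g i \<omega>) \<partial>M) * (\<integral>\<omega>. f (g j \<omega>) \<partial>M)\<bar> \<le> K * \<bar>r i j / \<sigma>\<^sup>2\<bar>"
  shows "(\<integral>\<omega>. (\<Sum>j\<in>I. w j * (f (g j \<omega>) - \<mu>))\<^sup>2 \<partial>M) \<le> K / \<sigma>\<^sup>2 * (\<rho> * sum w I)"
proof -
  have E: "(\<integral>\<omega>. (\<Sum>j\<in>I. w j * (f (g j \<omega>) - \<mu>))\<^sup>2 \<partial>M) =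
      (\<Sum>i\<in>I. \<Sum>j\<in>I. w i * w j * ((\<integral>\<omega>. f (g i \<omega>) * f (g j \<omega>) \<partial>M) - \<mu>\<^sup>2))"
    by (rule integral_square_sum[OF f bf]) (rule \<mu>)
  have "(\<integral>\<omega>. (\<Sum>j\<in>I. w j * (f (g j \<omega>) - \<mu>))\<^sup>2 \<partial>M) \<le> (\<Sum>i\<in>I. \<Sum>j\<in>I. w i * w j * (K * \<bar>r i j / \<sigma>\<^sup>2\<bar>))"
    unfolding E
  proof (intro sum_mono mult_left_mono mult_nonneg_nonneg w)
    fix i j assume "i \<in> I" "j \<in> I"
    then show "(\<integral>\<omega>. f (g i \<omega>) * f (g j \<omega>) \<partial>M) - \<mu>\<^sup>2 \<le> K * \<bar>r i j / \<sigma>\<^sup>2\<bar>"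
      using cov[of i j] \<mu> by (simp add: power2_eq_square)
  qed
  also have "\<dots> = K / \<sigma>\<^sup>2 * (\<Sum>i\<in>I. w i * (\<Sum>j\<in>I. w j * \<bar>r i j\<bar>))"
    by (simp add: sum_distrib_left abs_mult mult_ac)
  also have "\<dots> \<le> K / \<sigma>\<^sup>2 * (\<Sum>i\<in>I. w i * \<rho>)"
    using K by (intro mult_left_mono sum_mono w row) auto
  also have "\<dots> = K / \<sigma>\<^sup>2 * (\<rho> * sum w I)" by (simp add: sum_distrib_left sum_distrib_right mult.commute)
  finally show ?thesis .
qed

text \<open>The mean is read off from \<open>integral_smooth_sum\<close> for the weight concentrated
  at \<open>i\<close>, in place of a convolution of normal laws.\<close>

lemma smooth_ind_mean:
  assumes i: "i \<in> I" and d: "0 < \<delta>"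
  shows "(\<integral>\<omega>. smooth_ind \<delta> u (g i \<omega>) \<partial>M) = ncdf (- u / skernel_sd \<sigma> \<delta> 0)"
proof -
  note [measurable] = g_measurable[OF i]
  have [measurable]: "smooth_ind \<delta> u \<in> borel_measurable borel" unfolding smooth_ind_def[abs_def] by measurable
  have w: "0 \<le> (of_bool (j = i) :: real)" for j by simp
  have e: "smooth_sum (\<lambda>j. of_bool (j = i)) \<delta> u \<omega> = centred_smooth_ind \<delta> u (g i \<omega>)" for \<omega>
    unfolding smooth_sum_def[where w = "\<lambda>j. of_bool (j = i)", OF w d] using i finite_I
    by (simp add: of_bool_def if_distrib[of "\<lambda>x. x * _"] cong: if_cong)
  have "(\<integral>\<omega>. centred_smooth_ind \<delta> u (g i \<omega>) \<partial>M) = 0"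
    using integral_smooth_sum[where w = "\<lambda>j. of_bool (j = i)", OF w d, of u] unfolding e by simp
  moreover have "integrable M (\<lambda>\<omega>. smooth_ind \<delta> u (g i \<omega>))"
    by (rule integrable_const_bound[of _ 1]) (use smooth_ind_bounds in \<open>auto simp: abs_le_iff intro: order_trans[of _ 0]\<close>)
  ultimately show ?thesis unfolding centred_smooth_ind_def[where w = "\<lambda>j. of_bool (j = i)", OF w d] by (simp add: prob_space)
qed

lemma smooth_ind_err_diff:
  assumes d: "0 < \<delta>" and w: "\<And>i. 0 \<le> w i"
  shows "indicator_sum w u \<omega> - smooth_sum w \<delta> u \<omega> = (\<Sum>j\<in>I. w j * (smooth_ind_err \<delta> u (g j \<omega>) - (Psi (u / \<sigma>) - ncdf (- u / skernel_sd \<sigma> \<delta> 0))))"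
  unfolding indicator_sum_def smooth_sum_def[where w = w, OF w d] centred_smooth_ind_def[where w = w, OF w d] smooth_ind_err_def
  by (simp add: sum_subtractf[symmetric] algebra_simps)

text \<open>The chain runs from the indicator sum to the smoothed sum, to the normal law with the
  variance of the smoothed sum, and to the normal law with variance \<open>v\<close>. The two
  normalisations make the row bound times \<open>sum w I\<close> equal to \<open>R\<close>, so
  second moments stay bounded in \<open>A\<close>, and the number of sites does not appear.\<close>

lemma finite_clt:
  assumes A: "1 \<le> A" and w: "\<And>i. 0 \<le> w i" and S: "sum w I = sqrt A"
    and R: "0 \<le> R" and row: "\<And>i. i \<in> I \<Longrightarrow> (\<Sum>j\<in>I. w j * \<bar>r i j\<bar>) \<le> R / sqrt A"
    and h: "1-lipschitz_on UNIV h" and v: "0 \<le> v"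
  shows "\<bar>(\<integral>\<omega>. h (indicator_sum w u \<omega>) \<partial>M) - (\<integral>z. h (sqrt v * z) \<partial>std_normal)\<bar> \<le>
    clt_const \<sigma> R * A powr (- (1 / 32)) + sqrt \<bar>(\<integral>\<omega>. (indicator_sum w u \<omega>)\<^sup>2 \<partial>M) - v\<bar>"
proof -
  interpret N: prob_space std_normal by (rule prob_space_std_normal)
  note [measurable] = g_measurable
  have [measurable]: "h \<in> borel_measurable borel" by (rule lipschitz_borel[OF h])
  have hl: "\<bar>h x - h y\<bar> \<le> \<bar>x - y\<bar>" for x y
    using lipschitz_onD[OF h, of x y] by (simp add: dist_real_def)
  have p1: "A powr (- c) \<le> 1" if "0 \<le> c" for c using powr_mono[of "- c" 0 A] that A by simp
  \<comment> \<open>The scales: \<open>\<delta>\<close> of order A^(-1/12) gives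
    \<open>\<Delta>\<close> of order A^(-1/4), while the smoothing error, of order the square root
    of \<open>\<delta>\<close>, is A^(-1/24) and thus below A^(-1/32) = \<open>x\<close>. With
    \<open>\<eta> = 1 / L = x\<close> the Fourier error
    \<open>L\<^sup>2 * \<Delta> / \<eta> ^ 3\<close> is of order A^(-3/32), and the mollification
    and truncation errors are of order \<open>x\<close>.\<close>
  define x where "x = A powr (- (1 / 32))"
  have x: "0 < x" "x \<le> 1" using A p1[of "1/32"] by (auto simp: x_def)
  define \<delta> where "\<delta> = A powr (- (1 / 12))"
  have d: "0 < \<delta>" "\<delta> \<le> 1" using A p1[of "1/12"] by (auto simp: \<delta>_def)
  define \<eta> where "\<eta> = x"
  define L where "L = A powr (1 / 32)"
  have L: "0 < L" using A by (auto simp: L_def)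
  have sA: "0 < sqrt A" using A by simp
  have RS: "R / sqrt A * sum w I = R" unfolding S using sA by simp
  have [measurable]: "indicator_sum w u \<in> borel_measurable M" unfolding indicator_sum_def[abs_def] by measurable
  note [measurable] = smooth_sum_measurable[where w = w, OF w d(1), of u]
  let ?W = "indicator_sum w u" and ?V = "smooth_sum w \<delta> u"
  have P01: "0 \<le> Psi t" "Psi t \<le> 1" for t using ncdf_bounds[of t] by (auto simp: Psi_ncdf)
  have Wb: "\<bar>?W \<omega>\<bar> \<le> sum w I" for \<omega>
    unfolding indicator_sum_def
  proof (rule order_trans[OF sum_abs], rule sum_mono)
    fix i
    have "\<bar>indicator {u..} (g i \<omega>) - Psi (u / \<sigma>)\<bar> \<le> 1" using P01[of "u / \<sigma>"] by (auto simp: indicator_def)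
    then show "\<bar>w i * (indicator {u..} (g i \<omega>) - Psi (u / \<sigma>))\<bar> \<le> w i"
      using w[of i] by (simp add: abs_mult mult_left_le)
  qed
  note Vb = smooth_sum_bound[where w = w, OF w d(1), of u]
  have sq: "integrable M (\<lambda>\<omega>. X \<omega> * Y \<omega>)" if "X \<in> borel_measurable M" "Y \<in> borel_measurable M" "\<And>\<omega>. \<bar>X \<omega>\<bar> \<le> C" "\<And>\<omega>. \<bar>Y \<omega>\<bar> \<le> C" for X Y :: "'a \<Rightarrow> real" and C
  proof (rule integrable_const_bound[of _ "C * C"])
    have "0 \<le> C" using that(3)[of undefined] by linarith
    then show "AE \<omega> in M. norm (X \<omega> * Y \<omega>) \<le> C * C"
      unfolding real_norm_def abs_mult by (intro AE_I2 mult_mono that) auto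
  qed (use that in measurable)
  have iW2: "integrable M (\<lambda>\<omega>. (?W \<omega>)\<^sup>2)" and iV2: "integrable M (\<lambda>\<omega>. (?V \<omega>)\<^sup>2)" and iVW: "integrable M (\<lambda>\<omega>. ?V \<omega> * ?W \<omega>)"
    unfolding power2_eq_square by (rule sq[OF _ _ Wb Wb] sq[OF _ _ Vb Vb] sq[OF _ _ Vb Wb]; simp)+
  have iD2: "integrable M (\<lambda>\<omega>. (?V \<omega> - ?W \<omega>)\<^sup>2)"
    unfolding power2_diff using iW2 iV2 iVW by (auto simp: mult.assoc)
  define e where "e = (\<integral>\<omega>. (?V \<omega> - ?W \<omega>)\<^sup>2 \<partial>M)"
  have e: "e \<le> 16 * pi * R / \<sigma> ^ 3 * \<delta>"
  proof -
    have "e = (\<integral>\<omega>. (\<Sum>j\<in>I. w j * (smooth_ind_err \<delta> u (g j \<omega>) - (Psi (u / \<sigma>) - ncdf (- u / skernel_sd \<sigma> \<delta> 0))))\<^sup>2 \<partial>M)"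
      unfolding e_def smooth_ind_err_diff[OF d(1) w, symmetric] by (simp add: power2_commute)
    also have "\<dots> \<le> (8 * (2 * pi * \<delta>) / \<sigma>) / \<sigma>\<^sup>2 * (R / sqrt A * sum w I)"
    proof (rule integral_square_sum_le[OF _ smooth_ind_err_le_1 _ w row])
      fix i assume i: "i \<in> I"
      have i1: "integrable M (\<lambda>\<omega>. indicat_real {u..} (g i \<omega>))"
        using i by (intro integrable_const_bound[of _ 1]) (auto simp: indicator_def)
      have [measurable]: "smooth_ind \<delta> u \<in> borel_measurable borel" unfolding smooth_ind_def[abs_def] by measurable
      have i2: "integrable M (\<lambda>\<omega>. smooth_ind \<delta> u (g i \<omega>))"
        using i by (intro integrable_const_bound[of _ 1]) (use smooth_ind_bounds in \<open>auto simp: abs_le_iff intro: order_trans[of _ 0]\<close>)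
      show "(\<integral>\<omega>. smooth_ind_err \<delta> u (g i \<omega>) \<partial>M) = Psi (u / \<sigma>) - ncdf (- u / skernel_sd \<sigma> \<delta> 0)"
        unfolding smooth_ind_err_def using i1 i2 by (simp add: prob_ge[OF i] smooth_ind_mean[OF i d(1)])
    next
      fix i j assume "i \<in> I" "j \<in> I"
      then show "\<bar>(\<integral>\<omega>. smooth_ind_err \<delta> u (g i \<omega>) * smooth_ind_err \<delta> u (g j \<omega>) \<partial>M) - (\<integral>\<omega>. smooth_ind_err \<delta> u (g i \<omega>) \<partial>M) * (\<integral>\<omega>. smooth_ind_err \<delta> u (g j \<omega>) \<partial>M)\<bar> \<le>
        8 * (2 * pi * \<delta>) / \<sigma> * \<bar>r i j / \<sigma>\<^sup>2\<bar>"
        by (rule cov_L1_bound[OF _ _ smooth_ind_err_le_1 smooth_ind_err_integral[OF d(1)]])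
    qed (use d \<sigma>_pos in auto)
    also have "\<dots> = 16 * pi * R / \<sigma> ^ 3 * \<delta>" unfolding RS by (simp add: power3_eq_cube power2_eq_square mult_ac)
    finally show ?thesis .
  qed
  define c1 where "c1 = 16 * pi * R / \<sigma> ^ 3"
  have c1: "0 \<le> c1" unfolding c1_def using R \<sigma>_pos by simp
  have se: "sqrt e \<le> sqrt c1 * x"
  proof -
    have "\<delta> \<le> x\<^sup>2"
    proof -
      have "x\<^sup>2 = A powr (- (1/16))" unfolding x_def power2_eq_square by (simp add: powr_add[symmetric])
      then show ?thesis unfolding \<delta>_def using A by (auto intro!: powr_mono)
    qed
    then have "e \<le> c1 * x\<^sup>2" using e c1 unfolding c1_def[symmetric] by (meson mult_left_mono order_trans)
    then have "sqrt e \<le> sqrt (c1 * x\<^sup>2)" by simp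
    then show ?thesis using x by (simp add: real_sqrt_mult)
  qed
  have W2: "(\<integral>\<omega>. (?W \<omega>)\<^sup>2 \<partial>M) \<le> 4 * R / \<sigma>\<^sup>2"
  proof -
    have "(\<integral>\<omega>. (?W \<omega>)\<^sup>2 \<partial>M) \<le> 4 / \<sigma>\<^sup>2 * (R / sqrt A * sum w I)"
      unfolding indicator_sum_def
      by (rule integral_square_sum_le[OF _ _ prob_ge w row _ cov_ind_bound]) (auto simp: indicator_def)
    then show ?thesis unfolding RS by simp
  qed
  define v\<delta> where "v\<delta> = (\<integral>\<omega>. (?V \<omega>)\<^sup>2 \<partial>M)"
  have v\<delta>0: "0 \<le> v\<delta>" unfolding v\<delta>_def by simp
  define V where "V = 8 * R / \<sigma>\<^sup>2 + 32 * pi * R / \<sigma> ^ 3"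
  \<comment> \<open>A bound independent of \<open>A\<close>, obtained from the second moment of the
    indicator sum and from the L2 distance of the two sums.\<close>
  have v\<delta>V: "v\<delta> \<le> V"
  proof -
    have "v\<delta> \<le> (\<integral>\<omega>. 2 * (?V \<omega> - ?W \<omega>)\<^sup>2 + 2 * (?W \<omega>)\<^sup>2 \<partial>M)"
      unfolding v\<delta>_def
    proof (rule integral_mono)
      fix \<omega>
      have "2 * (?V \<omega> - ?W \<omega>)\<^sup>2 + 2 * (?W \<omega>)\<^sup>2 - (?V \<omega>)\<^sup>2 = (?V \<omega> - 2 * ?W \<omega>)\<^sup>2"
        by (simp add: power2_eq_square algebra_simps)
      then show "(?V \<omega>)\<^sup>2 \<le> 2 * (?V \<omega> - ?W \<omega>)\<^sup>2 + 2 * (?W \<omega>)\<^sup>2"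
        using zero_le_power2[of "?V \<omega> - 2 * ?W \<omega>"] by linarith
    qed (use iV2 iW2 iD2 in auto)
    also have "\<dots> = 2 * e + 2 * (\<integral>\<omega>. (?W \<omega>)\<^sup>2 \<partial>M)" unfolding e_def using iW2 iD2 by simp
    also have "\<dots> \<le> 2 * c1 + 2 * (4 * R / \<sigma>\<^sup>2)"
    proof -
      have "c1 * \<delta> \<le> c1 * 1" using c1 d by (intro mult_left_mono) auto
      then show ?thesis using e W2 unfolding c1_def by linarith
    qed
    also have "\<dots> = V" by (simp add: V_def c1_def)
    finally show ?thesis .
  qed
  define \<Delta> where "\<Delta> = sqrt (4 * (R / sqrt A) ^ 3 * sum w I / \<delta> ^ 6)"
  have \<Delta>: "\<Delta> = 2 * R powr (3/2) * A powr (-(1/4))"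
  proof -
    have "4 * (R / sqrt A) ^ 3 * sum w I / \<delta> ^ 6 = (2 * R powr (3/2) * A powr (-(1/4)))\<^sup>2"
    proof -
      have "(R powr (3/2))\<^sup>2 = R ^ 3"
        using R by (cases "R = 0") (auto simp: power2_eq_square powr_add[symmetric] powr_numeral)
      moreover have "(A powr (-(1/4)))\<^sup>2 = A powr (-(1/2))" by (simp add: power2_eq_square powr_add[symmetric])
      moreover have "\<delta> ^ 6 = A powr (-(1/2))"
        unfolding \<delta>_def using A by (simp add: powr_power)
      moreover have "(R / sqrt A) ^ 3 * sum w I = R ^ 3 / A"
        unfolding S using A by (simp add: power3_eq_cube power_divide)
      moreover have "R ^ 3 / A / A powr (-(1/2)) = R ^ 3 * A powr (-(1/2))"
      proof -
        have "A powr (-(1/2)) * A powr (-(1/2)) = 1 / A" using A by (simp add: powr_add[symmetric] powr_minus_divide)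
        moreover have "0 < A powr (-(1/2))" using A by simp
        ultimately show ?thesis using A by (simp add: field_simps)
      qed
      ultimately show ?thesis by (simp add: power_mult_distrib mult.assoc)
    qed
    moreover have "0 \<le> 2 * R powr (3/2) * A powr (-(1/4))" by simp
    ultimately show ?thesis unfolding \<Delta>_def by (simp only: real_sqrt_abs abs_of_nonneg)
  qed
  have g: "\<bar>(\<integral>\<omega>. h (?V \<omega>) \<partial>M) - (\<integral>z. h (sqrt v\<delta> * z) \<partial>std_normal)\<bar> \<le>
    2 * \<eta> + ((\<integral>\<omega>. (?V \<omega>)\<^sup>2 \<partial>M) + v\<delta> + 2 * \<eta>\<^sup>2) / L + L\<^sup>2 * \<Delta> / \<eta> ^ 3"
  proof (rule gaussian_approx_of_char[OF prob_space_axioms _ iV2 h _ L v\<delta>0])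
    show "norm ((CLINT \<omega>|M. iexp (t * ?V \<omega>)) - of_real (exp (- v\<delta> * t\<^sup>2 / 2))) \<le> t\<^sup>2 / 2 * \<Delta>" for t
      unfolding v\<delta>_def \<Delta>_def by (rule smooth_sum_char[where w = w, OF w d(1) row])
  qed (use x in \<open>auto simp: \<eta>_def\<close>)
  have Lx: "1 / L = x" unfolding L_def x_def using A by (simp add: powr_minus_divide)
  have t1: "((\<integral>\<omega>. (?V \<omega>)\<^sup>2 \<partial>M) + v\<delta> + 2 * \<eta>\<^sup>2) / L \<le> (2 * V + 2) * x"
  proof -
    have "(\<integral>\<omega>. (?V \<omega>)\<^sup>2 \<partial>M) + v\<delta> + 2 * \<eta>\<^sup>2 \<le> 2 * V + 2"
      using v\<delta>V x power_le_one[of x 2] unfolding v\<delta>_def[symmetric] \<eta>_def by simp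
    then have "((\<integral>\<omega>. (?V \<omega>)\<^sup>2 \<partial>M) + v\<delta> + 2 * \<eta>\<^sup>2) * (1 / L) \<le> (2 * V + 2) * (1 / L)"
      using L by (intro mult_right_mono) auto
    then show ?thesis unfolding Lx by (simp add: Lx[symmetric])
  qed
  have t2: "L\<^sup>2 * \<Delta> / \<eta> ^ 3 \<le> 2 * R powr (3/2) * x"
  proof -
    have "L\<^sup>2 * \<Delta> / \<eta> ^ 3 = 2 * R powr (3/2) * (L\<^sup>2 * A powr (-(1/4)) / x ^ 3)"
      unfolding \<Delta> \<eta>_def by simp
    also have "L\<^sup>2 * A powr (-(1/4)) / x ^ 3 = A powr (-(3/32))"
    proof -
      have "L\<^sup>2 = A powr (2/32)" unfolding L_def using A by (simp add: powr_power)
      moreover have "x ^ 3 = A powr (-(3/32))" unfolding x_def using A by (simp add: powr_power)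
      ultimately show ?thesis by (simp add: powr_add[symmetric] powr_diff[symmetric])
    qed
    also have "A powr (-(3/32)) \<le> x" unfolding x_def using A by (intro powr_mono) auto
    finally show ?thesis by (simp add: mult_left_mono)
  qed
  have ihW: "integrable M (\<lambda>\<omega>. h (?W \<omega>))" and ihV: "integrable M (\<lambda>\<omega>. h (?V \<omega>))"
  proof -
    have *: "integrable M (\<lambda>\<omega>. h (X \<omega>))" if [measurable]: "X \<in> borel_measurable M" and "\<And>\<omega>. \<bar>X \<omega>\<bar> \<le> sum w I" for X :: "'a \<Rightarrow> real"
    proof (rule integrable_const_bound[of _ "\<bar>h 0\<bar> + sum w I"])
      have "\<bar>h (X \<omega>)\<bar> \<le> \<bar>h 0\<bar> + sum w I" for \<omega> using hl[of "X \<omega>" 0] that(2)[of \<omega>] by linarith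
      then show "AE \<omega> in M. norm (h (X \<omega>)) \<le> \<bar>h 0\<bar> + sum w I" by simp
    qed measurable
    show "integrable M (\<lambda>\<omega>. h (?W \<omega>))" "integrable M (\<lambda>\<omega>. h (?V \<omega>))" by (rule *; use Wb Vb in simp)+
  qed
  have t3: "\<bar>(\<integral>\<omega>. h (?W \<omega>) \<partial>M) - (\<integral>\<omega>. h (?V \<omega>) \<partial>M)\<bar> \<le> sqrt e"
  proof -
    have iD: "integrable M (\<lambda>\<omega>. \<bar>?V \<omega> - ?W \<omega>\<bar>)"
    proof (rule integrable_const_bound[of _ "sum w I + sum w I"])
      have "\<bar>?V \<omega> - ?W \<omega>\<bar> \<le> sum w I + sum w I" for \<omega> using Wb[of \<omega>] Vb[of \<omega>] by linarith
      then show "AE \<omega> in M. norm \<bar>?V \<omega> - ?W \<omega>\<bar> \<le> sum w I + sum w I" by simp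
    qed measurable
    have E: "(\<integral>\<omega>. h (?W \<omega>) \<partial>M) - (\<integral>\<omega>. h (?V \<omega>) \<partial>M) = (\<integral>\<omega>. h (?W \<omega>) - h (?V \<omega>) \<partial>M)"
      using ihW ihV by simp
    have "norm ((\<integral>\<omega>. h (?W \<omega>) \<partial>M) - (\<integral>\<omega>. h (?V \<omega>) \<partial>M)) \<le> (\<integral>\<omega>. \<bar>?V \<omega> - ?W \<omega>\<bar> \<partial>M)"
      unfolding E using ihW ihV iD hl by (intro bochner_norm_bound) (auto simp: abs_minus_commute)
    also have "\<dots> = (\<integral>\<omega>. \<bar>?V \<omega> - ?W \<omega>\<bar> * 1 \<partial>M)" by simp
    also have "\<dots> \<le> sqrt (\<integral>\<omega>. \<bar>?V \<omega> - ?W \<omega>\<bar>\<^sup>2 \<partial>M) * sqrt (\<integral>\<omega>. 1\<^sup>2 \<partial>M)"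
      by (rule Cauchy_Schwarz_integral) (use iD iD2 in auto)
    also have "\<dots> = sqrt e" by (simp add: e_def prob_space)
    finally show ?thesis by simp
  qed
  have t4: "\<bar>(\<integral>z. h (sqrt v\<delta> * z) \<partial>std_normal) - (\<integral>z. h (sqrt v * z) \<partial>std_normal)\<bar> \<le> \<bar>sqrt v\<delta> - sqrt v\<bar>"
  proof -
    have ih: "integrable std_normal (\<lambda>z. h (c * z))" for c
    proof (rule Bochner_Integration.integrable_bound)
      show "integrable std_normal (\<lambda>z. \<bar>h 0\<bar> + \<bar>c\<bar> * \<bar>z\<bar>)" using integrable_abs_std_normal by auto
      have "\<bar>h (c * z)\<bar> \<le> \<bar>h 0\<bar> + \<bar>c\<bar> * \<bar>z\<bar>" for z using hl[of "c * z" 0] by (simp add: abs_mult)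
      then show "AE z in std_normal. norm (h (c * z)) \<le> norm (\<bar>h 0\<bar> + \<bar>c\<bar> * \<bar>z\<bar>)" by simp
    qed measurable
    have E: "(\<integral>z. h (sqrt v\<delta> * z) \<partial>std_normal) - (\<integral>z. h (sqrt v * z) \<partial>std_normal) = (\<integral>z. h (sqrt v\<delta> * z) - h (sqrt v * z) \<partial>std_normal)"
      using ih[of "sqrt v\<delta>"] ih[of "sqrt v"] by simp
    have "norm ((\<integral>z. h (sqrt v\<delta> * z) \<partial>std_normal) - (\<integral>z. h (sqrt v * z) \<partial>std_normal)) \<le> (\<integral>z. \<bar>sqrt v\<delta> - sqrt v\<bar> * \<bar>z\<bar> \<partial>std_normal)"
      unfolding E
    proof (rule bochner_norm_bound)
      show "norm (h (sqrt v\<delta> * z) - h (sqrt v * z)) \<le> \<bar>sqrt v\<delta> - sqrt v\<bar> * \<bar>z\<bar>" for z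
        using hl[of "sqrt v\<delta> * z" "sqrt v * z"] by (simp add: abs_mult[symmetric] left_diff_distrib)
    qed (use ih[of "sqrt v\<delta>"] ih[of "sqrt v"] integrable_abs_std_normal in auto)
    also have "\<dots> = \<bar>sqrt v\<delta> - sqrt v\<bar> * (\<integral>z. \<bar>z\<bar> \<partial>std_normal)" by simp
    also have "\<dots> \<le> \<bar>sqrt v\<delta> - sqrt v\<bar> * 1" using integrable_abs_std_normal(2) by (intro mult_left_mono) auto
    finally show ?thesis by simp
  qed
  \<comment> \<open>The square root is Hoelder continuous of order 1/2, which compares standard
    deviations even where \<open>v\<close> vanishes.\<close>
  have sqd: "\<bar>sqrt a - sqrt b\<bar> \<le> sqrt \<bar>a - b\<bar>" if "0 \<le> a" "0 \<le> b" for a b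
  proof (rule real_le_rsqrt)
    have "\<bar>sqrt a - sqrt b\<bar> \<le> \<bar>sqrt a + sqrt b\<bar>" using that by (auto simp: abs_le_iff)
    then have "\<bar>sqrt a - sqrt b\<bar> * \<bar>sqrt a - sqrt b\<bar> \<le> \<bar>sqrt a - sqrt b\<bar> * \<bar>sqrt a + sqrt b\<bar>" by (intro mult_left_mono) auto
    also have "\<dots> = \<bar>(sqrt a - sqrt b) * (sqrt a + sqrt b)\<bar>" by (simp only: abs_mult)
    also have "(sqrt a - sqrt b) * (sqrt a + sqrt b) = a - b" using that by (simp add: algebra_simps)
    finally show "\<bar>sqrt a - sqrt b\<bar>\<^sup>2 \<le> \<bar>a - b\<bar>" by (simp add: power2_eq_square)
  qed
  have t5: "\<bar>sqrt v\<delta> - sqrt v\<bar> \<le> sqrt e + sqrt \<bar>(\<integral>\<omega>. (?W \<omega>)\<^sup>2 \<partial>M) - v\<bar>"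
    using L2_triangle[OF iV2 iW2 iVW] sqd[of "\<integral>\<omega>. (?W \<omega>)\<^sup>2 \<partial>M" v] v unfolding e_def v\<delta>_def by simp
  have "\<bar>(\<integral>\<omega>. h (?W \<omega>) \<partial>M) - (\<integral>z. h (sqrt v * z) \<partial>std_normal)\<bar> \<le>
    2 * (sqrt c1 * x) + (2 * x + (2 * V + 2) * x + 2 * R powr (3/2) * x) + sqrt \<bar>(\<integral>\<omega>. (?W \<omega>)\<^sup>2 \<partial>M) - v\<bar>"
    using g t1 t2 t3 t4 t5 se unfolding \<eta>_def by linarith
  also have "2 * (sqrt c1 * x) + (2 * x + (2 * V + 2) * x + 2 * R powr (3/2) * x) = clt_const \<sigma> R * x"
    unfolding clt_const_def c1_def V_def by (simp add: algebra_simps)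
  finally show ?thesis unfolding x_def .
qed

end

section \<open>Stationary fields\<close>

lemma char_gaussian_law: "(CLINT x|gaussian_law m v. iexp x) = iexp m * of_real (exp (- (sqrt v)\<^sup>2 / 2))"
proof -
  have "(CLINT x|gaussian_law m v. iexp x) = (CLINT z|std_normal. iexp (m + sqrt v * z))"
    unfolding gaussian_law_def by (subst integral_distr) auto
  also have "\<dots> = (CLINT z|std_normal. iexp m * iexp (sqrt v * z))"
    by (simp only: of_real_add distrib_left exp_add)
  also have "\<dots> = iexp m * (CLINT z|std_normal. iexp (sqrt v * z))" by (rule integral_mult_right_zero)
  finally show ?thesis unfolding char_std_normal_iexp .
qed

lemma integrable_gaussian_law_square: "integrable (gaussian_law m v) (\<lambda>x. x\<^sup>2)"
  unfolding gaussian_law_def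
proof (subst integrable_distr_eq)
  have "(\<lambda>z. (m + sqrt v * z)\<^sup>2) = (\<lambda>z. m\<^sup>2 + (2 * m * sqrt v) * z + (sqrt v)\<^sup>2 * z\<^sup>2)"
    by (auto simp: power2_eq_square algebra_simps)
  moreover have "integrable std_normal (\<lambda>z. m\<^sup>2 + (2 * m * sqrt v) * z + (sqrt v)\<^sup>2 * z\<^sup>2)"
    using integrable_std_normal_id std_normal_second_moment prob_space_std_normal
    by (intro Bochner_Integration.integrable_add integrable_mult_right finite_measure.integrable_const prob_space.finite_measure) auto
  ultimately show "integrable std_normal (\<lambda>z. (m + sqrt v * z)\<^sup>2)" by simp
qed auto

lemma integrable_mult_of_square:
  fixes f h :: "'a \<Rightarrow> real"
  assumes [measurable]: "f \<in> borel_measurable M" "h \<in> borel_measurable M"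
    and "integrable M (\<lambda>x. (f x)\<^sup>2)" "integrable M (\<lambda>x. (h x)\<^sup>2)"
  shows "integrable M (\<lambda>x. f x * h x)"
proof (rule Bochner_Integration.integrable_bound)
  show "integrable M (\<lambda>x. (f x)\<^sup>2 + (h x)\<^sup>2)" using assms by auto
  have "\<bar>f x * h x\<bar> \<le> (f x)\<^sup>2 + (h x)\<^sup>2" for x
  proof -
    have "2 * (\<bar>f x\<bar> * \<bar>h x\<bar>) \<le> \<bar>f x\<bar>\<^sup>2 + \<bar>h x\<bar>\<^sup>2"
      using zero_le_power2[of "\<bar>f x\<bar> - \<bar>h x\<bar>"] by (simp add: power2_diff)
    moreover have "0 \<le> \<bar>f x\<bar> * \<bar>h x\<bar>" by simp
    ultimately show ?thesis unfolding abs_mult by (simp only: power2_abs)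
  qed
  then show "AE x in M. norm (f x * h x) \<le> norm ((f x)\<^sup>2 + (h x)\<^sup>2)" by simp
qed measurable

locale excursion_field = prob_space M for M :: "'a measure" +
  fixes g :: "real^2 \<Rightarrow> 'a \<Rightarrow> real" and \<sigma> :: real
  assumes g_joint: "(\<lambda>(t, \<omega>). g t \<omega>) \<in> borel_measurable (borel \<Otimes>\<^sub>M M)"
    and gauss: "gaussian_field M g" and stat: "stationary_field M g"
    and mean0: "(\<integral>\<omega>. g 0 \<omega> \<partial>M) = 0" and \<sigma>_pos: "0 < \<sigma>" and var0: "covariance M (g 0) (g 0) = \<sigma>\<^sup>2"
begin

abbreviation r :: "real^2 \<Rightarrow> real" where "r \<equiv> covariance_function M g"

lemma g_meas [measurable]: "g t \<in> borel_measurable M"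
  using measurable_compose[OF measurable_Pair1' g_joint, of t] by simp

lemma g_sq: "integrable M (\<lambda>\<omega>. (g t \<omega>)\<^sup>2)"
proof -
  have "gaussian_rv M (g t)"
    using gauss[unfolded gaussian_field_def, rule_format, of "{t}" "\<lambda>_. 1"] by simp
  then obtain m v where "distr M borel (g t) = gaussian_law m v" by (auto simp: gaussian_rv_def)
  with integrable_gaussian_law_square[of m v] have "integrable (distr M borel (g t)) (\<lambda>x. x\<^sup>2)" by simp
  then show ?thesis by (subst (asm) integrable_distr_eq) auto
qed

lemma g_prod: "integrable M (\<lambda>\<omega>. g s \<omega> * g t \<omega>)"
  by (intro integrable_mult_of_square g_sq g_meas)

lemma g_int: "integrable M (g t)"
  using integrable_mult_of_square[OF g_meas _ g_sq[of t], of "\<lambda>_. 1"] by simp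

text \<open>Evaluation at two sites is measurable on the product sigma-algebra, so equality of the
  field laws passes to integrals over pairs. Means, covariances and joint excursion probabilities
  are reduced to the origin in this way.\<close>

lemma shift_pair:
  assumes F [measurable]: "case_prod F \<in> borel_measurable (borel \<Otimes>\<^sub>M borel)"
  shows "(\<integral>\<omega>. F (g (s + a) \<omega>) (g (s + b) \<omega>) \<partial>M) = (\<integral>\<omega>. F (g a \<omega>) (g b \<omega>) \<partial>M :: real)"
proof -
  have meas: "(\<lambda>\<omega> t. h t \<omega>) \<in> M \<rightarrow>\<^sub>M (\<Pi>\<^sub>M t\<in>UNIV. borel)"
    if "\<And>t. h t \<in> borel_measurable M" for h :: "real^2 \<Rightarrow> 'a \<Rightarrow> real"
    by (rule measurable_PiM_single') (use that in \<open>auto simp: space_PiM\<close>)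
  have mF: "(\<lambda>x. F (x a) (x b)) \<in> borel_measurable (\<Pi>\<^sub>M t\<in>(UNIV::(real^2) set). borel)"
    by (rule measurable_compose[OF _ F, of "\<lambda>x. (x a, x b)", simplified]) measurable
  have eq: "(\<integral>x. F (x a) (x b) \<partial>field_law M h) = (\<integral>\<omega>. F (h a \<omega>) (h b \<omega>) \<partial>M)"
    if "\<And>t. h t \<in> borel_measurable M" for h :: "real^2 \<Rightarrow> 'a \<Rightarrow> real"
    unfolding field_law_def by (rule integral_distr[OF meas[OF that] mF])
  have "field_law M (\<lambda>t. g (s + t)) = field_law M g" using stat by (simp add: stationary_field_def)
  then show ?thesis using eq[of "\<lambda>t. g (s + t)"] eq[of g] by simp
qed

lemma g_mean: "(\<integral>\<omega>. g t \<omega> \<partial>M) = 0"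
  using shift_pair[of "\<lambda>x y. x" t 0 0] mean0 by simp

lemma g_cov: "(\<integral>\<omega>. g s \<omega> * g t \<omega> \<partial>M) = r (t - s)"
  using shift_pair[of "\<lambda>x y. x * y" s 0 "t - s"] by (simp add: covariance_function_def covariance_def g_mean)

lemma r_0: "r 0 = \<sigma>\<^sup>2" using var0 by (simp add: covariance_function_def)

lemma r_minus: "r (s - t) = r (t - s)"
  using g_cov[of s t] g_cov[of t s] by (simp add: mult.commute)

text \<open>A linear combination of field values is Gaussian with mean 0, and its variance is the
  quadratic form of \<open>r\<close>; this yields the characteristic functions that a
  \<open>gauss_family\<close> asks for.\<close>

lemma gauss_family_field:
  assumes I: "finite I"
  shows "gauss_family M I g (\<lambda>s t. r (t - s)) \<sigma>"
proof
  fix c :: "real^2 \<Rightarrow> real"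
  define S where "S \<omega> = (\<Sum>t\<in>I. c t * g t \<omega>)" for \<omega>
  have S2: "(S \<omega>)\<^sup>2 = (\<Sum>s\<in>I. \<Sum>t\<in>I. c s * c t * (g s \<omega> * g t \<omega>))" for \<omega>
    unfolding S_def power2_eq_square sum_product by (intro sum.cong refl) (simp only: mult_ac)
  have [measurable]: "S \<in> borel_measurable M" unfolding S_def[abs_def] by measurable
  have "gaussian_rv M S"
    using gauss[unfolded gaussian_field_def, rule_format, OF I, of c] by (simp add: S_def[abs_def])
  then obtain m v where v: "0 \<le> v" and mv: "distr M borel S = gaussian_law m v"
    by (auto simp: gaussian_rv_def)
  have "m = (\<integral>\<omega>. S \<omega> \<partial>M)"
    using expectation_gaussian_law[of m v] unfolding mv[symmetric] by (subst (asm) integral_distr) auto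
  also have "\<dots> = 0" unfolding S_def using g_int g_mean by (simp add: Bochner_Integration.integral_sum)
  finally have m: "m = 0" .
  have "v = (\<integral>\<omega>. (S \<omega>)\<^sup>2 \<partial>M)"
    using variance_gaussian_law[OF v, of m] unfolding mv[symmetric]
    by (subst (asm) integral_distr) (auto simp: m)
  also have "\<dots> = (\<Sum>s\<in>I. \<Sum>t\<in>I. c s * c t * r (t - s))"
    unfolding S2 using g_prod by (simp add: Bochner_Integration.integral_sum Bochner_Integration.integrable_sum g_cov)
  finally have v': "v = (\<Sum>s\<in>I. \<Sum>t\<in>I. c s * c t * r (t - s))" .
  have "(CLINT \<omega>|M. iexp (S \<omega>)) = (CLINT x|distr M borel S. iexp x)"
    by (subst integral_distr) auto
  also have "\<dots> = of_real (exp (- v / 2))"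
    unfolding mv char_gaussian_law m using v by simp
  finally show "(CLINT \<omega>|M. iexp (\<Sum>i\<in>I. c i * g i \<omega>)) = of_real (exp (- (\<Sum>s\<in>I. \<Sum>t\<in>I. c s * c t * r (t - s)) / 2))"
    unfolding v' S_def .
qed (use I r_0 r_minus \<sigma>_pos in auto)

lemma increment_sq: "(\<integral>\<omega>. (g s \<omega> - g t \<omega>)\<^sup>2 \<partial>M) = 2 * (\<sigma>\<^sup>2 - r (t - s))"
proof -
  have "(\<lambda>\<omega>. (g s \<omega> - g t \<omega>)\<^sup>2) = (\<lambda>\<omega>. (g s \<omega>)\<^sup>2 - 2 * (g s \<omega> * g t \<omega>) + (g t \<omega>)\<^sup>2)"
    by (auto simp: power2_eq_square algebra_simps)
  then show ?thesis
    using g_sq g_prod g_cov[of s s] g_cov[of t t] g_cov[of s t] r_0 by (simp add: power2_eq_square)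
qed

lemma r_le: "\<bar>r z\<bar> \<le> \<sigma>\<^sup>2"
proof -
  interpret F: gauss_family M "{0, z}" g "\<lambda>s t. r (t - s)" \<sigma> by (rule gauss_family_field) simp
  show ?thesis using F.r_bound[of 0 z] by simp
qed

text \<open>Equality in the Cauchy-Schwarz inequality: with \<open>e\<close> the sign of
  \<open>r z\<close> and \<open>a\<close>, \<open>b\<close> the field at two consecutive multiples
  of \<open>z\<close>, the second moment of \<open>b - e * a\<close> is
  \<open>2 * (\<sigma>\<^sup>2 - e * r z) = 0\<close>. So one more step multiplies the covariance
  with \<open>g 0\<close> by \<open>e\<close>.\<close>

lemma r_periodic:
  assumes "\<bar>r z\<bar> = \<sigma>\<^sup>2"
  shows "\<bar>r (real n *\<^sub>R z)\<bar> = \<sigma>\<^sup>2"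
proof (induction n)
  case 0 then show ?case using r_0 by simp
next
  case (Suc n)
  define e where "e = sgn (r z)"
  have s2: "0 < \<sigma>\<^sup>2" using \<sigma>_pos by simp
  have e: "e * e = 1" "e * r z = \<sigma>\<^sup>2" "\<bar>e\<bar> = 1"
    using assms s2 by (auto simp: e_def sgn_real_def abs_if split: if_splits)
  define a b where "a = g (real n *\<^sub>R z)" and "b = g (real (Suc n) *\<^sub>R z)"
  have ab: "real (Suc n) *\<^sub>R z - real n *\<^sub>R z = z" by (simp add: algebra_simps)
  have [measurable]: "a \<in> borel_measurable M" "b \<in> borel_measurable M" by (simp_all add: a_def b_def)
  have i: "integrable M (\<lambda>\<omega>. (a \<omega>)\<^sup>2)" "integrable M (\<lambda>\<omega>. (b \<omega>)\<^sup>2)" "integrable M (\<lambda>\<omega>. b \<omega> * a \<omega>)"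
    by (simp_all add: a_def b_def g_sq g_prod)
  have sq: "(\<lambda>\<omega>. (b \<omega> - e * a \<omega>)\<^sup>2) = (\<lambda>\<omega>. (b \<omega>)\<^sup>2 - 2 * e * (b \<omega> * a \<omega>) + (a \<omega>)\<^sup>2)"
    using e(1) by (auto simp: power2_eq_square algebra_simps)
  have "(\<integral>\<omega>. (b \<omega> - e * a \<omega>)\<^sup>2 \<partial>M) = \<sigma>\<^sup>2 - 2 * e * r z + \<sigma>\<^sup>2"
    unfolding sq using i g_cov[of "real n *\<^sub>R z" "real n *\<^sub>R z"] g_cov[of "real (Suc n) *\<^sub>R z" "real (Suc n) *\<^sub>R z"]
      g_cov[of "real n *\<^sub>R z" "real (Suc n) *\<^sub>R z"] r_0
    unfolding ab a_def[symmetric] b_def[symmetric] by (simp add: power2_eq_square mult.commute)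
  then have 0: "(\<integral>\<omega>. (b \<omega> - e * a \<omega>)\<^sup>2 \<partial>M) = 0" using e(2) by simp
  have "AE \<omega> in M. (b \<omega> - e * a \<omega>)\<^sup>2 = 0"
    by (rule integral_nonneg_eq_0_iff_AE[THEN iffD1, OF _ _ 0]) (use i in \<open>auto simp: sq\<close>)
  then have ae: "AE \<omega> in M. b \<omega> = e * a \<omega>" by simp
  have "r (real (Suc n) *\<^sub>R z) = (\<integral>\<omega>. g 0 \<omega> * b \<omega> \<partial>M)" using g_cov[of 0 "real (Suc n) *\<^sub>R z"] by (simp add: b_def)
  also have "\<dots> = (\<integral>\<omega>. e * (g 0 \<omega> * a \<omega>) \<partial>M)"
    by (rule integral_cong_AE) (use ae in \<open>auto elim!: eventually_mono\<close>)
  also have "\<dots> = e * r (real n *\<^sub>R z)" using g_cov[of 0 "real n *\<^sub>R z"] by (simp add: a_def)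
  finally show ?case using Suc e(3) by (simp add: abs_mult)
qed

definition level_cov :: "real \<Rightarrow> real^2 \<Rightarrow> real" where
  "level_cov x z = (\<integral>\<omega>. indicator {x..} (g 0 \<omega>) * indicator {x..} (g z \<omega>) \<partial>M) - (Psi (x / \<sigma>))\<^sup>2"

lemma cov_eq_level_cov: "(\<integral>\<omega>. indicator {x..} (g s \<omega>) * indicator {x..} (g t \<omega>) \<partial>M) - (Psi (x / \<sigma>))\<^sup>2 = level_cov x (t - s)"
  using shift_pair[of "\<lambda>a b. indicator {x..} a * indicator {x..} b" s 0 "t - s"] by (simp add: level_cov_def)

lemma level_cov_bound: "\<bar>level_cov x z\<bar> \<le> 4 / \<sigma>\<^sup>2 * \<bar>r z\<bar>"
proof -
  interpret F: gauss_family M "{0, z}" g "\<lambda>s t. r (t - s)" \<sigma> by (rule gauss_family_field) simp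
  show ?thesis using F.cov_ind_bound[of 0 z x] F.prob_ge[of 0 x] F.prob_ge[of z x]
    by (simp add: level_cov_def power2_eq_square)
qed

lemma level_cov_sheppard:
  assumes "\<bar>r z\<bar> < \<sigma>\<^sup>2"
  shows "level_cov x z = 1 / (2 * pi) * (LBINT s=0..ereal (r z / \<sigma>\<^sup>2). 1 / sqrt (1 - s\<^sup>2) * exp (- (x\<^sup>2 / (\<sigma>\<^sup>2 * (1 + s)))))"
proof -
  interpret F: gauss_family M "{0, z}" g "\<lambda>s t. r (t - s)" \<sigma> by (rule gauss_family_field) simp
  have "\<bar>r z / \<sigma>\<^sup>2\<bar> < 1" using assms \<sigma>_pos by simp
  then show ?thesis using F.sheppard[of 0 z x] by (simp add: level_cov_def)
qed

text \<open>The indicators differ only if \<open>g t\<close> is within \<open>\<kappa>\<close> of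
  the level or the increment is at least \<open>\<kappa>\<close>. The former has probability at most
  \<open>2 * \<kappa> / \<sigma>\<close>, as the density of \<open>g t / \<sigma>\<close> is at most
  1; the latter is handled by Chebyshev's inequality. The level is absent from the bound.\<close>

lemma ind_diff_bound:
  assumes k: "0 < \<kappa>"
  shows "(\<integral>\<omega>. \<bar>indicator {x..} (g s \<omega>) - indicator {x..} (g t \<omega>)\<bar> \<partial>M) \<le> 2 * \<kappa> / \<sigma> + 2 * (\<sigma>\<^sup>2 - r (t - s)) / \<kappa>\<^sup>2"
proof -
  interpret F: gauss_family M "{t}" g "\<lambda>s t. r (t - s)" \<sigma> by (rule gauss_family_field) simp
  interpret N: prob_space std_normal by (rule prob_space_std_normal)
  have pt: "\<bar>indicator {x..} a - indicator {x..} b\<bar> \<le> indicator {x - \<kappa>..x + \<kappa>} b + (a - b)\<^sup>2 / \<kappa>\<^sup>2" for a b :: real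
  proof (cases "\<bar>a - b\<bar> < \<kappa>")
    case True
    define q where "q = (a - b)\<^sup>2 / \<kappa>\<^sup>2"
    have "0 \<le> q" by (simp add: q_def)
    then show ?thesis using True unfolding q_def[symmetric] by (auto simp: indicator_def abs_less_iff)
  next
    case False
    then have "\<kappa>\<^sup>2 \<le> (a - b)\<^sup>2" using power_mono[of \<kappa> "\<bar>a - b\<bar>" 2] k by simp
    then have "1 \<le> (a - b)\<^sup>2 / \<kappa>\<^sup>2" using k by simp
    then show ?thesis by (auto simp: indicator_def)
  qed
  have iD: "integrable M (\<lambda>\<omega>. (g s \<omega> - g t \<omega>)\<^sup>2)"
    unfolding power2_diff using g_sq g_prod by (auto simp: mult.assoc)
  have i1: "integrable M (\<lambda>\<omega>. indicat_real {x - \<kappa>..x + \<kappa>} (g t \<omega>))"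
    by (rule integrable_const_bound[of _ 1]) (auto simp: indicator_def)
  have "(\<integral>\<omega>. \<bar>indicator {x..} (g s \<omega>) - indicator {x..} (g t \<omega>)\<bar> \<partial>M) \<le>
    (\<integral>\<omega>. indicator {x - \<kappa>..x + \<kappa>} (g t \<omega>) + (g s \<omega> - g t \<omega>)\<^sup>2 / \<kappa>\<^sup>2 \<partial>M)"
  proof (rule integral_mono)
    show "integrable M (\<lambda>\<omega>. \<bar>indicat_real {x..} (g s \<omega>) - indicat_real {x..} (g t \<omega>)\<bar>)"
      by (rule integrable_const_bound[of _ 1]) (auto simp: indicator_def)
    show "integrable M (\<lambda>\<omega>. indicat_real {x - \<kappa>..x + \<kappa>} (g t \<omega>) + (g s \<omega> - g t \<omega>)\<^sup>2 / \<kappa>\<^sup>2)"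
      using iD i1 by (intro Bochner_Integration.integrable_add integrable_divide) auto
  qed (rule pt)
  also have "\<dots> = (\<integral>\<omega>. indicat_real {x - \<kappa>..x + \<kappa>} (g t \<omega>) \<partial>M) + 2 * (\<sigma>\<^sup>2 - r (t - s)) / \<kappa>\<^sup>2"
    using iD i1 by (simp add: increment_sq)
  also have "(\<integral>\<omega>. indicat_real {x - \<kappa>..x + \<kappa>} (g t \<omega>) \<partial>M) = (\<integral>z. indicat_real {x - \<kappa>..x + \<kappa>} (\<sigma> * z) \<partial>std_normal)"
    by (rule F.marginal_law[of t _ 1]) (auto simp: indicator_def)
  also have "\<dots> = (\<integral>z. indicator {(x - \<kappa>) / \<sigma>..(x + \<kappa>) / \<sigma>} z \<partial>std_normal)"
    using \<sigma>_pos by (intro Bochner_Integration.integral_cong refl) (auto simp: indicator_def field_simps)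
  also have "\<dots> = (\<integral>z. std_normal_density z *\<^sub>R indicator {(x - \<kappa>) / \<sigma>..(x + \<kappa>) / \<sigma>} z \<partial>lborel)"
    by (rule integral_std_normal) measurable
  also have "\<dots> \<le> (\<integral>z. indicator {(x - \<kappa>) / \<sigma>..(x + \<kappa>) / \<sigma>} z \<partial>lborel)"
  proof (rule integral_mono)
    show i: "integrable lborel (indicat_real {(x - \<kappa>) / \<sigma>..(x + \<kappa>) / \<sigma>})"
      using \<sigma>_pos k by (intro integrable_real_indicator) (auto simp: divide_right_mono emeasure_lborel_Icc)
    show "integrable lborel (\<lambda>z. std_normal_density z *\<^sub>R indicat_real {(x - \<kappa>) / \<sigma>..(x + \<kappa>) / \<sigma>} z)"
      by (rule Bochner_Integration.integrable_bound[OF i]) (auto simp: indicator_def std_normal_density_le_1)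
  qed (auto simp: indicator_def std_normal_density_le_1)
  also have "\<dots> = 2 * \<kappa> / \<sigma>"
    using \<sigma>_pos k by (simp add: measure_lborel_Icc divide_right_mono) (simp add: diff_divide_distrib[symmetric])
  finally show ?thesis by simp
qed

end

section \<open>Riemann sums on a lattice\<close>

definition grid :: "nat \<Rightarrow> real^2 \<Rightarrow> real^2" where
  "grid n t = (\<chi> i. of_int \<lfloor>real n * t $ i\<rfloor> / real n)"

lemma grid_close:
  assumes n: "0 < n"
  shows "norm (grid n t - t) \<le> 2 / real n"
proof -
  have "\<bar>(grid n t - t) $ i\<bar> \<le> 1 / real n" for i
  proof -
    have "\<bar>of_int \<lfloor>real n * t $ i\<rfloor> - real n * t $ i\<bar> \<le> 1" by linarith
    then have "\<bar>of_int \<lfloor>real n * t $ i\<rfloor> - real n * t $ i\<bar> / real n \<le> 1 / real n" by (rule divide_right_mono) simp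
    also have "\<bar>of_int \<lfloor>real n * t $ i\<rfloor> - real n * t $ i\<bar> / real n = \<bar>(of_int \<lfloor>real n * t $ i\<rfloor> - real n * t $ i) / real n\<bar>" by simp
    also have "(of_int \<lfloor>real n * t $ i\<rfloor> - real n * t $ i) / real n = (grid n t - t) $ i"
      using n by (simp add: grid_def diff_divide_distrib)
    finally show ?thesis .
  qed
  then have "(\<Sum>i\<in>UNIV. \<bar>(grid n t - t) $ i\<bar>) \<le> (\<Sum>i\<in>(UNIV::2 set). 1 / real n)" by (intro sum_mono)
  then show ?thesis using norm_le_l1_cart[of "grid n t - t"] by simp
qed

lemma grid_measurable [measurable]: "grid n \<in> borel_measurable borel"
proof (rule borel_measurable_euclidean_space[THEN iffD2], rule ballI)
  fix b :: "real^2" assume "b \<in> Basis"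
  then obtain i where b: "b = axis i 1" by (auto simp: Basis_vec_def)
  have "(\<lambda>t::real^2. t $ i) \<in> borel_measurable borel"
    by (intro borel_measurable_continuous_onI continuous_intros)
  then show "(\<lambda>t. grid n t \<bullet> b) \<in> borel_measurable borel"
    unfolding b inner_axis grid_def by simp
qed

lemma grid_finite:
  assumes "bounded B"
  shows "finite (grid n ` B)"
proof -
  obtain K where K: "\<And>t. t \<in> B \<Longrightarrow> norm t \<le> K" using assms by (auto simp: bounded_iff)
  define m where "m = \<lceil>real n * K\<rceil>"
  have "grid n t \<in> (\<lambda>f. \<chi> i. of_int (f i) / real n) ` (Pi\<^sub>E UNIV (\<lambda>_. {- m - 1..m + 1}))" if "t \<in> B" for t
  proof -
    have "\<lfloor>real n * t $ i\<rfloor> \<in> {- m - 1..m + 1}" for i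
    proof -
      have "\<bar>t $ i\<bar> \<le> K" using component_le_norm_cart[of t i] K[OF that] by linarith
      then have "\<bar>real n * t $ i\<bar> \<le> real n * K" by (simp add: abs_mult mult_left_mono)
      then have "\<bar>real n * t $ i\<bar> \<le> of_int m" unfolding m_def by linarith
      then show ?thesis by (simp; linarith)
    qed
    then show ?thesis
      unfolding grid_def by (intro image_eqI[of _ _ "\<lambda>i. \<lfloor>real n * t $ i\<rfloor>"]) auto
  qed
  then have "grid n ` B \<subseteq> (\<lambda>f. \<chi> i. of_int (f i) / real n) ` (Pi\<^sub>E (UNIV::2 set) (\<lambda>_. {- m - 1..m + 1}))" by blast
  then show ?thesis by (rule finite_subset) (intro finite_imageI finite_PiE, auto)
qed

definition cell :: "(real^2) set \<Rightarrow> nat \<Rightarrow> real^2 \<Rightarrow> real" where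
  "cell B n p = measure lborel {t \<in> B. grid n t = p}"

lemma cell_nonneg: "0 \<le> cell B n p" by (simp add: cell_def)

text \<open>A finite sum over lattice points is an integral over \<open>B\<close> of a function of
  \<open>grid n t\<close>. Riemann sums and integrals can thus be compared under one integral
  sign.\<close>

lemma grid_sum:
  fixes F :: "real^2 \<Rightarrow> real"
  assumes B [measurable]: "B \<in> sets borel" and bB: "bounded B"
  shows "(\<integral>t. indicator B t * F (grid n t) \<partial>lborel) = (\<Sum>p\<in>grid n ` B. cell B n p * F p)"
    and "integrable lborel (\<lambda>t. indicator B t * F (grid n t))"
proof -
  have ms [measurable]: "{t \<in> B. grid n t = p} \<in> sets borel" for p
  proof -
    have "{t \<in> B. grid n t = p} = B \<inter> (grid n -` {p} \<inter> space borel)" by auto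
    then show ?thesis using measurable_sets[OF grid_measurable, of "{p}" n] by simp
  qed
  have fin: "emeasure lborel {t \<in> B. grid n t = p} < \<infinity>" for p
    by (rule emeasure_bounded_finite, rule bounded_subset[OF bB]) blast
  have e: "indicator B t * F (grid n t) = (\<Sum>p\<in>grid n ` B. F p * indicator {t \<in> B. grid n t = p} t)" for t
  proof (cases "t \<in> B")
    case True
    have "(\<Sum>p\<in>grid n ` B. F p * indicator {t \<in> B. grid n t = p} t) = (\<Sum>p\<in>grid n ` B. if p = grid n t then F p else 0)"
      using True by (intro sum.cong) (auto simp: indicator_def)
    then show ?thesis using True grid_finite[OF bB, of n] by (simp add: sum.delta)
  qed (simp add: indicator_def)
  have i: "integrable lborel (\<lambda>t. F p * indicator {t \<in> B. grid n t = p} t)" for p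
    using fin[of p] by (intro integrable_mult_right integrable_real_indicator) auto
  show "integrable lborel (\<lambda>t. indicator B t * F (grid n t))" unfolding e using i by (rule Bochner_Integration.integrable_sum)
  show "(\<integral>t. indicator B t * F (grid n t) \<partial>lborel) = (\<Sum>p\<in>grid n ` B. cell B n p * F p)"
    unfolding e using i by (subst Bochner_Integration.integral_sum) (auto simp: cell_def mult.commute)
qed

section \<open>Conditioning on the level\<close>

locale perturbed_excursion = excursion_field M g \<sigma> for M :: "'a measure" and g \<sigma> +
  fixes X :: "'a \<Rightarrow> real"
  assumes X_meas [measurable]: "X \<in> borel_measurable M" and indep: "indep_of_field M X g"
begin

text \<open>Restriction to the finitely many coordinates in \<open>I\<close> is measurable on the
  product sigma-algebra, so independence of the generated sigma-algebras gives the product formula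
  on measurable rectangles.\<close>

lemma joint_law:
  assumes I: "finite I"
  shows "distr M borel X \<Otimes>\<^sub>M distr M (Pi\<^sub>M I (\<lambda>_. borel)) (\<lambda>\<omega>. \<lambda>i\<in>I. g i \<omega>) =
    distr M (borel \<Otimes>\<^sub>M Pi\<^sub>M I (\<lambda>_. borel)) (\<lambda>\<omega>. (X \<omega>, \<lambda>i\<in>I. g i \<omega>))"
proof (rule pair_measure_eqI)
  have mI: "(\<lambda>\<omega>. \<lambda>i\<in>I. g i \<omega>) \<in> M \<rightarrow>\<^sub>M Pi\<^sub>M I (\<lambda>_. borel)" by measurable
  interpret PX: prob_space "distr M borel X" by (rule prob_space_distr) simp
  interpret PI: prob_space "distr M (Pi\<^sub>M I (\<lambda>_. borel)) (\<lambda>\<omega>. \<lambda>i\<in>I. g i \<omega>)" by (rule prob_space_distr[OF mI])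
  show "sigma_finite_measure (distr M borel X)" "sigma_finite_measure (distr M (Pi\<^sub>M I (\<lambda>_. borel)) (\<lambda>\<omega>. \<lambda>i\<in>I. g i \<omega>))"
    by unfold_locales
  show "sets (distr M borel X \<Otimes>\<^sub>M distr M (Pi\<^sub>M I (\<lambda>_. borel)) (\<lambda>\<omega>. \<lambda>i\<in>I. g i \<omega>)) =
    sets (distr M (borel \<Otimes>\<^sub>M Pi\<^sub>M I (\<lambda>_. borel)) (\<lambda>\<omega>. (X \<omega>, \<lambda>i\<in>I. g i \<omega>)))"
    by (simp cong: sets_pair_measure_cong)
  fix A D assume "A \<in> sets (distr M borel X)" "D \<in> sets (distr M (Pi\<^sub>M I (\<lambda>_. borel)) (\<lambda>\<omega>. \<lambda>i\<in>I. g i \<omega>))"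
  then have A: "A \<in> sets borel" and D: "D \<in> sets (Pi\<^sub>M I (\<lambda>_. borel))" by auto
  define E1 E2 where "E1 = X -` A \<inter> space M" and "E2 = (\<lambda>\<omega>. \<lambda>i\<in>I. g i \<omega>) -` D \<inter> space M"
  have [measurable]: "E1 \<in> sets M" "E2 \<in> sets M"
    unfolding E1_def E2_def using measurable_sets[OF X_meas A] measurable_sets[OF mI D] by auto
  have r: "(\<lambda>x. restrict x I) \<in> (\<Pi>\<^sub>M t\<in>(UNIV::(real^2) set). borel) \<rightarrow>\<^sub>M Pi\<^sub>M I (\<lambda>_. borel :: real measure)"
    by (rule measurable_restrict_subset) simp
  have e1: "E1 \<in> sets (vimage_algebra (space M) X borel)"
    unfolding E1_def by (rule in_vimage_algebra[OF A])
  have "(\<lambda>\<omega> t. g t \<omega>) -` ((\<lambda>x. restrict x I) -` D \<inter> space (\<Pi>\<^sub>M t\<in>UNIV. borel)) \<inter> space M = E2"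
    by (auto simp: E2_def space_PiM)
  with in_vimage_algebra[OF measurable_sets[OF r D], of "\<lambda>\<omega> t. g t \<omega>" "space M"]
  have e2: "E2 \<in> sets (vimage_algebra (space M) (\<lambda>\<omega> t. g t \<omega>) (\<Pi>\<^sub>M t\<in>UNIV. borel))" by simp
  have "prob (E1 \<inter> E2) = prob E1 * prob E2"
    using indep[unfolded indep_of_field_def] e1 e2 by (rule indep_setD)
  moreover have "(\<lambda>\<omega>. (X \<omega>, \<lambda>i\<in>I. g i \<omega>)) -` (A \<times> D) \<inter> space M = E1 \<inter> E2"
    by (auto simp: E1_def E2_def)
  ultimately show "emeasure (distr M borel X) A * emeasure (distr M (Pi\<^sub>M I (\<lambda>_. borel)) (\<lambda>\<omega>. \<lambda>i\<in>I. g i \<omega>)) D =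
     emeasure (distr M (borel \<Otimes>\<^sub>M Pi\<^sub>M I (\<lambda>_. borel)) (\<lambda>\<omega>. (X \<omega>, \<lambda>i\<in>I. g i \<omega>))) (A \<times> D)"
    using A D mI by (simp add: emeasure_distr E1_def[symmetric] E2_def[symmetric] emeasure_eq_measure ennreal_mult)
qed

text \<open>Fubini's theorem for the product law of \<open>joint_law\<close> freezes the level at
  \<open>x\<close>. Only finitely many sites occur, because an area functional of the whole field
  need not be measurable on the product sigma-algebra.\<close>

lemma random_level:
  fixes F :: "real \<Rightarrow> (real^2 \<Rightarrow> real) \<Rightarrow> real"
  assumes I: "finite I" and F [measurable]: "case_prod F \<in> borel_measurable (borel \<Otimes>\<^sub>M Pi\<^sub>M I (\<lambda>_. borel))"
    and bF: "\<And>x y. \<bar>F x y\<bar> \<le> B"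
  shows "(\<integral>\<omega>. F (X \<omega>) (\<lambda>i\<in>I. g i \<omega>) \<partial>M) = (\<integral>x. (\<integral>\<omega>. F x (\<lambda>i\<in>I. g i \<omega>) \<partial>M) \<partial>distr M borel X)"
    and "(\<lambda>x. \<integral>\<omega>. F x (\<lambda>i\<in>I. g i \<omega>) \<partial>M) \<in> borel_measurable borel"
proof -
  let ?PX = "distr M borel X" and ?PI = "distr M (Pi\<^sub>M I (\<lambda>_. borel)) (\<lambda>\<omega>. \<lambda>i\<in>I. g i \<omega>)"
  have mI: "(\<lambda>\<omega>. \<lambda>i\<in>I. g i \<omega>) \<in> M \<rightarrow>\<^sub>M Pi\<^sub>M I (\<lambda>_. borel)" by measurable
  interpret PX: prob_space ?PX by (rule prob_space_distr) simp
  interpret PI: prob_space ?PI by (rule prob_space_distr[OF mI])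
  interpret P: pair_prob_space ?PX ?PI ..
  have in1: "(\<integral>y. F x y \<partial>?PI) = (\<integral>\<omega>. F x (\<lambda>i\<in>I. g i \<omega>) \<partial>M)" for x
    by (rule integral_distr[OF mI]) measurable
  have mF: "case_prod F \<in> borel_measurable (?PX \<Otimes>\<^sub>M ?PI)" using F
    by (simp cong: measurable_cong_sets sets_pair_measure_cong)
  have int: "integrable (?PX \<Otimes>\<^sub>M ?PI) (case_prod F)"
    by (rule P.integrable_const_bound[OF _ mF, of B]) (use bF in auto)
  have "(\<integral>\<omega>. F (X \<omega>) (\<lambda>i\<in>I. g i \<omega>) \<partial>M) = (\<integral>p. case_prod F p \<partial>(?PX \<Otimes>\<^sub>M ?PI))"
    unfolding joint_law[OF I] by (subst integral_distr) auto
  also have "\<dots> = (\<integral>x. (\<integral>y. F x y \<partial>?PI) \<partial>?PX)"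
    using P.integral_fst'[OF int] by simp
  finally show "(\<integral>\<omega>. F (X \<omega>) (\<lambda>i\<in>I. g i \<omega>) \<partial>M) = (\<integral>x. (\<integral>\<omega>. F x (\<lambda>i\<in>I. g i \<omega>) \<partial>M) \<partial>distr M borel X)"
    unfolding in1 .
  have "(\<lambda>x. \<integral>y. F x y \<partial>?PI) \<in> borel_measurable ?PX"
    by (rule PI.borel_measurable_lebesgue_integral) (use mF in simp)
  then show "(\<lambda>x. \<integral>\<omega>. F x (\<lambda>i\<in>I. g i \<omega>) \<partial>M) \<in> borel_measurable borel" unfolding in1 by simp
qed

end

lemma std_normal_uminus:
  assumes [measurable]: "f \<in> borel_measurable borel"
  shows "(\<integral>z. f (- z) \<partial>std_normal) = (\<integral>z. (f z :: real) \<partial>std_normal)"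
proof -
  have "(\<integral>z. f z \<partial>std_normal) = (\<integral>z. std_normal_density z *\<^sub>R f z \<partial>lborel)"
    by (rule integral_std_normal) measurable
  also have "\<dots> = (\<integral>z. std_normal_density z *\<^sub>R f (- z) \<partial>lborel)"
    by (subst lborel_integral_real_affine[of "-1" _ 0]) (auto simp: std_normal_density_def)
  also have "\<dots> = (\<integral>z. f (- z) \<partial>std_normal)" by (rule integral_std_normal[symmetric]) measurable
  finally show ?thesis ..
qed

text \<open>For negative \<open>v\<close> the real square root is
  \<open>- sqrt \<bar>v\<bar>\<close>, and the normal law is symmetric. So the limit variance can be
  replaced by its absolute value before its sign is known.\<close>

lemma std_normal_sqrt_abs:
  assumes "f \<in> borel_measurable borel"
  shows "(\<integral>z. f (sqrt v * z) \<partial>std_normal) = (\<integral>z. (f (sqrt \<bar>v\<bar> * z) :: real) \<partial>std_normal)"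
proof (cases "0 \<le> v")
  case False
  then have "sqrt v = - sqrt \<bar>v\<bar>" by (simp add: real_sqrt_minus[symmetric])
  then show ?thesis
    using std_normal_uminus[of "\<lambda>z. f (sqrt \<bar>v\<bar> * z)"] assms by simp
qed simp

section \<open>Variance on a region and the edge correction\<close>

locale excursion_decay = perturbed_excursion +
  assumes r_cont: "continuous_on UNIV r" and r_int: "integrable lborel r"
    and r_nondeg: "\<And>z. z \<noteq> 0 \<Longrightarrow> \<bar>r z\<bar> < \<sigma>\<^sup>2"
begin

lemma level_cov_measurable: "case_prod level_cov \<in> borel_measurable (borel \<Otimes>\<^sub>M borel)"
proof -
  have g1 [measurable]: "(\<lambda>q. g (snd (fst q)) (snd q)) \<in> borel_measurable ((borel \<Otimes>\<^sub>M borel) \<Otimes>\<^sub>M M)"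
    by (rule measurable_compose[OF _ g_joint, of "\<lambda>q. (snd (fst q), snd q)", simplified]) measurable
  have [measurable]: "Psi \<in> borel_measurable borel" unfolding Psi_ncdf[abs_def] by measurable
  have m [measurable]: "(\<lambda>p. \<integral>\<omega>. (if fst p \<le> g 0 \<omega> \<and> fst p \<le> g (snd p) \<omega> then 1 else 0 :: real) \<partial>M) \<in> borel_measurable (borel \<Otimes>\<^sub>M borel)"
    by (rule borel_measurable_lebesgue_integral) (simp add: case_prod_beta', measurable)
  have "(\<integral>\<omega>. indicator {x..} (g 0 \<omega>) * indicator {x..} (g z \<omega>) \<partial>M) =
    (\<integral>\<omega>. (if x \<le> g 0 \<omega> \<and> x \<le> g z \<omega> then 1 else 0 :: real) \<partial>M)" for x z
    by (intro Bochner_Integration.integral_cong refl) (auto simp: indicator_def)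
  then have "case_prod level_cov = (\<lambda>p. (\<integral>\<omega>. (if fst p \<le> g 0 \<omega> \<and> fst p \<le> g (snd p) \<omega> then 1 else 0 :: real) \<partial>M) - (Psi (fst p / \<sigma>))\<^sup>2)"
    by (auto simp: level_cov_def fun_eq_iff)
  then show ?thesis by simp
qed

lemma level_cov_measurable1 [measurable]: "level_cov x \<in> borel_measurable borel"
  using measurable_compose[OF measurable_Pair1' level_cov_measurable, of x] by simp

lemma level_cov_integrable: "integrable lborel (level_cov x)"
proof (rule Bochner_Integration.integrable_bound)
  show "integrable lborel (\<lambda>z. 4 / \<sigma>\<^sup>2 * \<bar>r z\<bar>)" using r_int by auto
  show "AE z in lborel. norm (level_cov x z) \<le> norm (4 / \<sigma>\<^sup>2 * \<bar>r z\<bar>)"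
    using order_trans[OF level_cov_bound abs_ge_self] by simp
qed simp

definition limit_var :: "real \<Rightarrow> real" where "limit_var x = (\<integral>z. level_cov x z \<partial>lborel)"

lemma limit_var_measurable [measurable]: "limit_var \<in> borel_measurable borel"
  unfolding limit_var_def[abs_def]
  by (rule lborel.borel_measurable_lebesgue_integral) (use level_cov_measurable in \<open>simp cong: measurable_cong_sets sets_pair_measure_cong\<close>)

lemma limit_var_bound: "\<bar>limit_var x\<bar> \<le> 4 / \<sigma>\<^sup>2 * (\<integral>z. \<bar>r z\<bar> \<partial>lborel)"
proof -
  have "norm (limit_var x) \<le> (\<integral>z. 4 / \<sigma>\<^sup>2 * \<bar>r z\<bar> \<partial>lborel)"
    unfolding limit_var_def using level_cov_integrable r_int level_cov_bound by (intro bochner_norm_bound) auto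
  then show ?thesis by simp
qed

text \<open>Sheppard's formula covers every lag except \<open>z = 0\<close>, where the correlation
  is 1. That lag is a null set, and \<open>k0\<close> merely names the value there so that
  \<open>k\<close> is seen to be measurable.\<close>

lemma asymp_var_eq: "asymp_var r \<sigma> x = limit_var x"
proof -
  define k where "k z = (LBINT s=0..ereal (r z / \<sigma>\<^sup>2). 1 / sqrt (1 - s\<^sup>2) * exp (- (x\<^sup>2 / (\<sigma>\<^sup>2 * (1 + s)))))" for z
  define k0 where "k0 = k 0"
  have k: "k z = (if z = 0 then k0 else 2 * pi * level_cov x z)" for z
    unfolding k0_def using level_cov_sheppard[OF r_nondeg, of z x] unfolding k_def by simp
  have "k = (\<lambda>z. if z = 0 then k0 else 2 * pi * level_cov x z)" by (rule ext) (rule k)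
  moreover have "(\<lambda>z. if z = 0 then k0 else 2 * pi * level_cov x z) \<in> borel_measurable borel" by measurable
  ultimately have mk: "k \<in> borel_measurable borel" by simp
  have "(\<integral>z. k z \<partial>lborel) = (\<integral>z. 2 * pi * level_cov x z \<partial>lborel)"
  proof (rule integral_cong_AE)
    show "AE z in lborel. k z = 2 * pi * level_cov x z"
      using AE_lborel_singleton[of "0::real^2"] by eventually_elim (simp add: k)
  qed (use mk in auto)
  then show ?thesis unfolding asymp_var_def limit_var_def k_def by simp
qed

text \<open>With \<open>\<kappa> = e * \<sigma> / 4\<close> the first term of
  \<open>ind_diff_bound\<close> is \<open>e / 2\<close>, and continuity of \<open>r\<close> at 0
  makes the second term as small once the mesh is fine. The bound depends on the displacement only,
  so one mesh serves all sites and levels.\<close>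

lemma ind_diff_uniform:
  fixes e :: real
  assumes e: "0 < e"
  shows "\<exists>n0>0. \<forall>n\<ge>n0. \<forall>x t. (\<integral>\<omega>. \<bar>indicator {x..} (g (grid n t) \<omega>) - indicator {x..} (g t \<omega>)\<bar> \<partial>M) \<le> e"
proof -
  define \<kappa> where "\<kappa> = e * \<sigma> / 4"
  have k: "0 < \<kappa>" using e \<sigma>_pos by (simp add: \<kappa>_def)
  have "0 < e * \<kappa>\<^sup>2 / 4" using e k by simp
  moreover have "continuous (at 0) r" using r_cont by (simp add: continuous_on_eq_continuous_at)
  then have "\<forall>\<epsilon>>0. \<exists>\<delta>>0. \<forall>z. norm z < \<delta> \<longrightarrow> \<bar>r z - r 0\<bar> < \<epsilon>"
    unfolding continuous_at_eps_delta by (simp add: dist_norm)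
  ultimately obtain d where d: "0 < d" "\<And>z. norm z < d \<Longrightarrow> \<bar>r z - r 0\<bar> < e * \<kappa>\<^sup>2 / 4" by blast
  define n0 where "n0 = Suc (nat \<lceil>2 / d\<rceil>)"
  have "(\<integral>\<omega>. \<bar>indicator {x..} (g (grid n t) \<omega>) - indicator {x..} (g t \<omega>)\<bar> \<partial>M) \<le> e" if n: "n0 \<le> n" for n x t
  proof -
    have n0: "0 < n" using n by (simp add: n0_def)
    have "2 / d < real n" using n unfolding n0_def by linarith
    then have "2 / real n < d" using d(1) n0 by (simp add: field_simps)
    with grid_close[OF n0, of t] have "norm (t - grid n t) < d" by (simp add: norm_minus_commute)
    from d(2)[OF this] have "\<sigma>\<^sup>2 - r (t - grid n t) \<le> e * \<kappa>\<^sup>2 / 4" unfolding r_0 by linarith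
    then have "2 * (\<sigma>\<^sup>2 - r (t - grid n t)) / \<kappa>\<^sup>2 \<le> 2 * (e * \<kappa>\<^sup>2 / 4) / \<kappa>\<^sup>2"
      by (intro divide_right_mono mult_left_mono) auto
    also have "\<dots> = e / 2" using k by simp
    finally have "2 * (\<sigma>\<^sup>2 - r (t - grid n t)) / \<kappa>\<^sup>2 \<le> e / 2" .
    moreover have "2 * \<kappa> / \<sigma> = e / 2" using \<sigma>_pos by (simp add: \<kappa>_def)
    ultimately show ?thesis using ind_diff_bound[OF k, of x "grid n t" t] by linarith
  qed
  moreover have "0 < n0" by (simp add: n0_def)
  ultimately show ?thesis by blast
qed

text \<open>Covariance mass between \<open>B\<close> and its complement, per unit area of
  \<open>B\<close>: up to a factor it dominates what a finite region misses of the limit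
  variance.\<close>

definition boundary :: "(real^2) set \<Rightarrow> real" where
  "boundary B = (\<integral>s. indicator B s * (\<integral>t. indicator (- B) t * \<bar>r (t - s)\<bar> \<partial>lborel) \<partial>lborel) / measure lborel B"

context
  fixes B :: "(real^2) set" and A :: real
  assumes Bo: "B \<in> sets borel" and Bb: "bounded B" and AB: "A = measure lborel B" and A1: "1 \<le> A"
begin

text \<open>Cell areas divided by the square root of the total area, so that the weighted indicator
  sum is the Riemann sum of the normalised excursion area.\<close>

definition cell_weight :: "nat \<Rightarrow> real^2 \<Rightarrow> real" where "cell_weight n p = (if p \<in> grid n ` B then cell B n p / sqrt A else 0)"

lemma cell_weight_nonneg: "0 \<le> cell_weight n p" using A1 by (simp add: cell_weight_def cell_nonneg)

lemma emeasure_region_finite: "emeasure lborel B < \<infinity>" by (rule emeasure_bounded_finite[OF Bb])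

lemma grid_sum_cell_weight: "(\<Sum>p\<in>grid n ` B. cell_weight n p * F p) = (\<integral>t. indicator B t * F (grid n t) \<partial>lborel) / sqrt A"
  unfolding grid_sum(1)[OF Bo Bb] sum_divide_distrib by (intro sum.cong refl) (simp add: cell_weight_def)

lemma region_indicator: "(\<integral>t. indicator B t * c \<partial>lborel) = A * c" "integrable lborel (\<lambda>t. indicator B t * (c::real))"
  using Bo emeasure_region_finite by (auto simp: AB)

lemma sum_cell_weight: "sum (cell_weight n) (grid n ` B) = sqrt A"
  using grid_sum_cell_weight[of n "\<lambda>_. 1"] region_indicator(1)[of 1] A1 by (simp add: real_div_sqrt)

lemma grid_family: "gauss_family M (grid n ` B) g (\<lambda>s t. r (t - s)) \<sigma>"
  by (rule gauss_family_field) (rule grid_finite[OF Bb])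

lemma integral_shift: "integrable lborel (\<lambda>t. f (t - s))" "(\<integral>t. f (t - s) \<partial>lborel) = (\<integral>t. f t \<partial>lborel)"
  if "integrable lborel f" for f :: "real^2 \<Rightarrow> real" and s
proof -
  have e: "distr lborel borel (\<lambda>t::real^2. - s + t) = lborel" by (rule lborel_distr_plus)
  have [measurable]: "f \<in> borel_measurable borel" using that by auto
  have "integrable (distr lborel borel (\<lambda>t. - s + t)) f" using that unfolding e .
  then show "integrable lborel (\<lambda>t. f (t - s))" by (subst (asm) integrable_distr_eq) auto
  have "(\<integral>t. f t \<partial>distr lborel borel (\<lambda>t. - s + t)) = (\<integral>t. f (- s + t) \<partial>lborel)"
    by (rule integral_distr) auto
  then show "(\<integral>t. f (t - s) \<partial>lborel) = (\<integral>t. f t \<partial>lborel)" unfolding e by simp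
qed

text \<open>A row is a Riemann sum of \<open>\<bar>r\<bar>\<close>, shifted by a lattice point and
  divided by \<open>sqrt A\<close>. Replacing \<open>grid n t\<close> by \<open>t\<close> costs at
  most \<open>1 / A\<close> pointwise on an area \<open>A\<close>, which is the summand 1.\<close>

lemma row_bound:
  "\<exists>n0>0. \<forall>n\<ge>n0. \<forall>p\<in>grid n ` B. (\<Sum>q\<in>grid n ` B. cell_weight n q * \<bar>r (q - p)\<bar>) \<le> ((\<integral>z. \<bar>r z\<bar> \<partial>lborel) + 1) / sqrt A"
proof -
  obtain K where K: "\<And>t. t \<in> B \<Longrightarrow> norm t \<le> K" using Bb by (auto simp: bounded_iff)
  \<comment> \<open>Rounding moves a point by at most 2, so lattice points of \<open>B\<close> have
    norm at most \<open>K + 2\<close> and their differences lie in this ball.\<close>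
  have "uniformly_continuous_on (cball 0 (2 * K + 4)) r"
    by (rule compact_uniformly_continuous) (use r_cont in \<open>auto intro: continuous_on_subset\<close>)
  moreover have "0 < 1 / A" using A1 by simp
  ultimately obtain d where d: "0 < d" "\<And>a b. a \<in> cball 0 (2 * K + 4) \<Longrightarrow> b \<in> cball 0 (2 * K + 4) \<Longrightarrow> dist b a < d \<Longrightarrow> dist (r b) (r a) < 1 / A"
    unfolding uniformly_continuous_on_def by blast
  define n0 where "n0 = Suc (nat \<lceil>2 / d\<rceil>)"
  have "(\<Sum>q\<in>grid n ` B. cell_weight n q * \<bar>r (q - p)\<bar>) \<le> ((\<integral>z. \<bar>r z\<bar> \<partial>lborel) + 1) / sqrt A" if n: "n0 \<le> n" and p: "p \<in> grid n ` B" for n p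
  proof -
    obtain s where s: "s \<in> B" "p = grid n s" using p by auto
    have n0: "0 < n" using n by (simp add: n0_def)
    have "2 / d < real n" using n unfolding n0_def by linarith
    then have nd: "2 / real n < d" using d(1) n0 by (simp add: field_simps)
    have n2: "2 / real n \<le> 2" using n0 by (simp add: divide_le_eq)
    have pn: "norm p \<le> K + 2" using grid_close[OF n0, of s, folded s(2)] K[OF s(1)] norm_triangle_sub[of p s] n2 by linarith
    have le: "\<bar>r (grid n t - p)\<bar> \<le> \<bar>r (t - p)\<bar> + 1 / A" if t: "t \<in> B" for t
    proof -
      have gn: "norm (grid n t) \<le> K + 2" using grid_close[OF n0, of t] K[OF t] norm_triangle_sub[of "grid n t" t] n2 by linarith
      have "dist (r (grid n t - p)) (r (t - p)) < 1 / A"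
      proof (rule d(2))
        show "t - p \<in> cball 0 (2 * K + 4)" "grid n t - p \<in> cball 0 (2 * K + 4)"
          using norm_triangle_ineq4[of t p] norm_triangle_ineq4[of "grid n t" p] pn gn K[OF t] by auto
        show "dist (grid n t - p) (t - p) < d" using grid_close[OF n0, of t] nd by (simp add: dist_norm)
      qed
      then show ?thesis by (simp add: dist_real_def)
    qed
    have i: "integrable lborel (\<lambda>t. \<bar>r (t - p)\<bar>)" using integral_shift(1)[OF integrable_abs[OF r_int]] .
    have "(\<integral>t. indicator B t * \<bar>r (grid n t - p)\<bar> \<partial>lborel) \<le> (\<integral>t. \<bar>r (t - p)\<bar> + indicator B t * (1 / A) \<partial>lborel)"
    proof (rule integral_mono)
      show "integrable lborel (\<lambda>t. indicator B t * \<bar>r (grid n t - p)\<bar>)" by (rule grid_sum(2)[OF Bo Bb])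
      show "integrable lborel (\<lambda>t. \<bar>r (t - p)\<bar> + indicator B t * (1 / A))"
        using i region_indicator(2) by (rule Bochner_Integration.integrable_add)
      show "indicator B t * \<bar>r (grid n t - p)\<bar> \<le> \<bar>r (t - p)\<bar> + indicator B t * (1 / A)" for t
        using le[of t] by (auto simp: indicator_def)
    qed
    also have "\<dots> = (\<integral>z. \<bar>r z\<bar> \<partial>lborel) + 1"
      unfolding Bochner_Integration.integral_add[OF i region_indicator(2)] region_indicator(1) integral_shift(2)[OF integrable_abs[OF r_int]]
      using A1 by simp
    finally show ?thesis unfolding grid_sum_cell_weight by (rule divide_right_mono) (use A1 in simp)
  qed
  moreover have "0 < n0" by (simp add: n0_def)
  ultimately show ?thesis by blast
qed

definition region_var :: "real \<Rightarrow> real" where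
  "region_var x = (\<integral>s. indicator B s * (\<integral>t. indicator B t * level_cov x (t - s) \<partial>lborel) \<partial>lborel) / A"

lemma outer_integrable:
  fixes f :: "real^2 \<Rightarrow> real"
  assumes f: "integrable lborel f" and D [measurable]: "D \<in> sets borel"
  shows "integrable lborel (\<lambda>s. indicator B s * (\<integral>t. indicator D t * f (t - s) \<partial>lborel))"
    and "integrable lborel (\<lambda>t. indicator D t * f (t - s))"
proof -
  have [measurable]: "f \<in> borel_measurable borel" using f by auto
  have i: "integrable lborel (\<lambda>t. indicator D t * f (t - s))" for s
    by (rule Bochner_Integration.integrable_bound[OF integral_shift(1)[OF f, of s]]) (auto simp: indicator_def)
  then show "integrable lborel (\<lambda>t. indicator D t * f (t - s))" .
  have b: "\<bar>\<integral>t. indicator D t * f (t - s) \<partial>lborel\<bar> \<le> (\<integral>t. \<bar>f t\<bar> \<partial>lborel)" for s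
  proof -
    have "norm (\<integral>t. indicator D t * f (t - s) \<partial>lborel) \<le> (\<integral>t. \<bar>f (t - s)\<bar> \<partial>lborel)"
      using i integral_shift(1)[OF integrable_abs[OF f]] by (intro bochner_norm_bound) (auto simp: indicator_def)
    then show ?thesis unfolding integral_shift(2)[OF integrable_abs[OF f]] by simp
  qed
  show "integrable lborel (\<lambda>s. indicator B s * (\<integral>t. indicator D t * f (t - s) \<partial>lborel))"
    by (rule Bochner_Integration.integrable_bound[OF region_indicator(2)[of "\<integral>t. \<bar>f t\<bar> \<partial>lborel"]])
      (use Bo b in \<open>auto simp: indicator_def intro!: AE_I2 intro: order_trans[OF _ abs_ge_self]\<close>)
qed

text \<open>For each \<open>s\<close> the integrals of \<open>level_cov x (t - s)\<close> over
  \<open>B\<close> and over its complement add up to \<open>limit_var x\<close>; the complement part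
  is controlled by \<open>level_cov_bound\<close>.\<close>

lemma region_var_limit_var: "\<bar>region_var x - limit_var x\<bar> \<le> 4 / \<sigma>\<^sup>2 * boundary B"
proof -
  note [measurable] = Bo
  have cB: "- B \<in> sets borel" by measurable
  let ?I = "\<lambda>D f s. indicator B s * (\<integral>t. indicator D t * f (t - s) \<partial>lborel)"
  have iC: "integrable lborel (?I D (level_cov x))" if "D \<in> sets borel" for D
    by (rule outer_integrable(1)[OF level_cov_integrable that])
  have ir: "integrable lborel (?I (- B) (\<lambda>z. \<bar>r z\<bar>))"
    by (rule outer_integrable(1)[OF integrable_abs[OF r_int] cB])
  have sp: "?I B (level_cov x) s - indicator B s * limit_var x = - ?I (- B) (level_cov x) s" for s
  proof -
    have "limit_var x = (\<integral>t. level_cov x (t - s) \<partial>lborel)" unfolding limit_var_def by (rule integral_shift(2)[OF level_cov_integrable, symmetric])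
    also have "\<dots> = (\<integral>t. indicator B t * level_cov x (t - s) + indicator (- B) t * level_cov x (t - s) \<partial>lborel)"
      by (intro Bochner_Integration.integral_cong refl) (auto simp: indicator_def)
    also have "\<dots> = (\<integral>t. indicator B t * level_cov x (t - s) \<partial>lborel) + (\<integral>t. indicator (- B) t * level_cov x (t - s) \<partial>lborel)"
      by (rule Bochner_Integration.integral_add) (rule outer_integrable(2)[OF level_cov_integrable Bo] outer_integrable(2)[OF level_cov_integrable cB])+
    finally show ?thesis by (simp add: algebra_simps)
  qed
  have "A * (region_var x - limit_var x) = (\<integral>s. ?I B (level_cov x) s \<partial>lborel) - A * limit_var x"
    unfolding region_var_def using A1 by (simp add: right_diff_distrib)
  also have "\<dots> = (\<integral>s. ?I B (level_cov x) s - indicator B s * limit_var x \<partial>lborel)"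
    by (simp only: Bochner_Integration.integral_diff[OF iC[OF Bo] region_indicator(2)] region_indicator(1))
  also have "\<dots> = (\<integral>s. - ?I (- B) (level_cov x) s \<partial>lborel)" unfolding sp ..
  finally have e: "A * (region_var x - limit_var x) = (\<integral>s. - ?I (- B) (level_cov x) s \<partial>lborel)" .
  have "norm (A * (region_var x - limit_var x)) \<le> (\<integral>s. 4 / \<sigma>\<^sup>2 * ?I (- B) (\<lambda>z. \<bar>r z\<bar>) s \<partial>lborel)"
    unfolding e
  proof (rule bochner_norm_bound)
    fix s
    have "norm (\<integral>t. indicator (- B) t * level_cov x (t - s) \<partial>lborel) \<le> (\<integral>t. 4 / \<sigma>\<^sup>2 * (indicator (- B) t * \<bar>r (t - s)\<bar>) \<partial>lborel)"
    proof (rule bochner_norm_bound)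
      show "integrable lborel (\<lambda>t. 4 / \<sigma>\<^sup>2 * (indicator (- B) t * \<bar>r (t - s)\<bar>))"
        using outer_integrable(2)[OF integrable_abs[OF r_int] cB, of s] by (rule integrable_mult_right)
      show "norm (indicator (- B) t * level_cov x (t - s)) \<le> 4 / \<sigma>\<^sup>2 * (indicator (- B) t * \<bar>r (t - s)\<bar>)" for t
        using level_cov_bound[of x "t - s"] by (auto simp: indicator_def)
    qed (rule outer_integrable(2)[OF level_cov_integrable cB])
    then show "norm (- ?I (- B) (level_cov x) s) \<le> 4 / \<sigma>\<^sup>2 * ?I (- B) (\<lambda>z. \<bar>r z\<bar>) s"
      by (auto simp: indicator_def)
  qed (use iC[OF cB] ir in auto)
  also have "\<dots> = 4 / \<sigma>\<^sup>2 * (A * boundary B)"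
    unfolding boundary_def AB[symmetric] using A1 by simp
  finally have "A * \<bar>region_var x - limit_var x\<bar> \<le> A * (4 / \<sigma>\<^sup>2 * boundary B)" using A1 by (simp add: abs_mult mult_ac)
  then show ?thesis by (rule mult_left_le_imp_le) (use A1 in simp)
qed

lemma indicator_sum_variance:
  "(\<integral>\<omega>. (gauss_family.indicator_sum (grid n ` B) g \<sigma> (cell_weight n) x \<omega>)\<^sup>2 \<partial>M) =
    (\<integral>s. indicator B s * (\<integral>t. indicator B t * level_cov x (grid n t - grid n s) \<partial>lborel) \<partial>lborel) / A"
proof -
  interpret F: gauss_family M "grid n ` B" g "\<lambda>s t. r (t - s)" \<sigma> by (rule grid_family)
  have "(\<integral>\<omega>. (F.indicator_sum (cell_weight n) x \<omega>)\<^sup>2 \<partial>M) =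
    (\<Sum>p\<in>grid n ` B. \<Sum>q\<in>grid n ` B. cell_weight n p * cell_weight n q * ((\<integral>\<omega>. indicator {x..} (g p \<omega>) * indicator {x..} (g q \<omega>) \<partial>M) - (Psi (x / \<sigma>))\<^sup>2))"
    unfolding F.indicator_sum_def by (rule F.integral_square_sum[OF _ _ F.prob_ge]) (auto simp: indicator_def)
  also have "\<dots> = (\<Sum>p\<in>grid n ` B. cell_weight n p * (\<Sum>q\<in>grid n ` B. cell_weight n q * level_cov x (q - p)))"
    unfolding cov_eq_level_cov by (simp add: sum_distrib_left mult.assoc)
  also have "\<dots> = (\<integral>s. indicator B s * ((\<integral>t. indicator B t * level_cov x (grid n t - grid n s) \<partial>lborel) / sqrt A) \<partial>lborel) / sqrt A"
    unfolding grid_sum_cell_weight ..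
  also have "\<dots> = (\<integral>s. indicator B s * (\<integral>t. indicator B t * level_cov x (grid n t - grid n s) \<partial>lborel) \<partial>lborel) / A"
    using A1 by simp
  finally show ?thesis .
qed

text \<open>A product of two indicators changes in mean by at most \<open>2 * e\<close> when both
  sites move to the lattice; integrating over \<open>B\<close> twice gives \<open>A * A\<close>, and
  the normalisation divides by \<open>A\<close>.\<close>

lemma indicator_sum_region_var:
  assumes e: "\<And>x t. (\<integral>\<omega>. \<bar>indicator {x..} (g (grid n t) \<omega>) - indicator {x..} (g t \<omega>)\<bar> \<partial>M) \<le> e"
  shows "\<bar>(\<integral>\<omega>. (gauss_family.indicator_sum (grid n ` B) g \<sigma> (cell_weight n) x \<omega>)\<^sup>2 \<partial>M) - region_var x\<bar> \<le> 2 * e * A"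
proof -
  note [measurable] = Bo
  have i: "integrable M (\<lambda>\<omega>. indicat_real {x..} (g s \<omega>) * indicator {x..} (g t \<omega>))"
     "integrable M (\<lambda>\<omega>. \<bar>indicat_real {x..} (g s \<omega>) - indicator {x..} (g t \<omega>)\<bar>)" for s t
    by (rule integrable_const_bound[of _ 1]; auto simp: indicator_def)+
  have d: "\<bar>level_cov x (grid n t - grid n s) - level_cov x (t - s)\<bar> \<le> 2 * e" for s t
  proof -
    have E: "level_cov x (grid n t - grid n s) - level_cov x (t - s) =
      (\<integral>\<omega>. indicat_real {x..} (g (grid n s) \<omega>) * indicator {x..} (g (grid n t) \<omega>) - indicator {x..} (g s \<omega>) * indicator {x..} (g t \<omega>) \<partial>M)"
      unfolding cov_eq_level_cov[symmetric] using i by simp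
    have "norm (level_cov x (grid n t - grid n s) - level_cov x (t - s)) \<le> (\<integral>\<omega>. \<bar>indicat_real {x..} (g (grid n s) \<omega>) - indicator {x..} (g s \<omega>)\<bar> +
      \<bar>indicat_real {x..} (g (grid n t) \<omega>) - indicator {x..} (g t \<omega>)\<bar> \<partial>M)"
      unfolding E using i by (intro bochner_norm_bound) (auto simp: indicator_def)
    also have "\<dots> \<le> e + e" using i e[of x s] e[of x t] by simp
    finally show ?thesis by simp
  qed
  have Cg: "integrable lborel (\<lambda>t. indicator B t * level_cov x (grid n t - grid n s))" for s by (rule grid_sum(2)[OF Bo Bb])
  have ig: "integrable lborel (\<lambda>s. indicator B s * (\<integral>t. indicator B t * level_cov x (grid n t - grid n s) \<partial>lborel))"
    by (rule grid_sum(2)[OF Bo Bb, of "\<lambda>p. \<integral>t. indicator B t * level_cov x (grid n t - p) \<partial>lborel"])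
  have ic: "integrable lborel (\<lambda>s. indicator B s * (\<integral>t. indicator B t * level_cov x (t - s) \<partial>lborel))"
    by (rule outer_integrable(1)[OF level_cov_integrable Bo])
  have inner: "\<bar>(\<integral>t. indicator B t * level_cov x (grid n t - grid n s) \<partial>lborel) - (\<integral>t. indicator B t * level_cov x (t - s) \<partial>lborel)\<bar> \<le> A * (2 * e)" for s
  proof -
    note ii = Cg[of s] outer_integrable(2)[OF level_cov_integrable Bo, of x s]
    have E: "(\<integral>t. indicator B t * level_cov x (grid n t - grid n s) \<partial>lborel) - (\<integral>t. indicator B t * level_cov x (t - s) \<partial>lborel) =
      (\<integral>t. indicator B t * level_cov x (grid n t - grid n s) - indicator B t * level_cov x (t - s) \<partial>lborel)"
      using ii by simp
    have "norm ((\<integral>t. indicator B t * level_cov x (grid n t - grid n s) \<partial>lborel) - (\<integral>t. indicator B t * level_cov x (t - s) \<partial>lborel)) \<le> (\<integral>t. indicator B t * (2 * e) \<partial>lborel)"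
      unfolding E using ii region_indicator(2)[of "2 * e"] d by (intro bochner_norm_bound) (auto simp: indicator_def)
    then show ?thesis unfolding region_indicator(1) by simp
  qed
  have E: "(\<integral>s. indicator B s * (\<integral>t. indicator B t * level_cov x (grid n t - grid n s) \<partial>lborel) \<partial>lborel) -
    (\<integral>s. indicator B s * (\<integral>t. indicator B t * level_cov x (t - s) \<partial>lborel) \<partial>lborel) =
    (\<integral>s. indicator B s * (\<integral>t. indicator B t * level_cov x (grid n t - grid n s) \<partial>lborel) - indicator B s * (\<integral>t. indicator B t * level_cov x (t - s) \<partial>lborel) \<partial>lborel)"
    using ig ic by simp
  have "norm ((\<integral>s. indicator B s * (\<integral>t. indicator B t * level_cov x (grid n t - grid n s) \<partial>lborel) \<partial>lborel) -
    (\<integral>s. indicator B s * (\<integral>t. indicator B t * level_cov x (t - s) \<partial>lborel) \<partial>lborel)) \<le> (\<integral>s. indicator B s * (A * (2 * e)) \<partial>lborel)"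
    unfolding E using ig ic region_indicator(2)[of "A * (2 * e)"] inner by (intro bochner_norm_bound) (auto simp: indicator_def)
  also have "\<dots> = A * (A * (2 * e))" by (rule region_indicator(1))
  finally have "\<bar>(\<integral>s. indicator B s * (\<integral>t. indicator B t * level_cov x (grid n t - grid n s) \<partial>lborel) \<partial>lborel) -
    (\<integral>s. indicator B s * (\<integral>t. indicator B t * level_cov x (t - s) \<partial>lborel) \<partial>lborel)\<bar> / A \<le> A * (A * (2 * e)) / A"
    using A1 by (intro divide_right_mono) auto
  then show ?thesis unfolding indicator_sum_variance region_var_def diff_divide_distrib[symmetric] using A1 by (simp add: mult_ac)
qed

end

end

section \<open>Random levels\<close>

text \<open>The conditional distribution enters through the law of \<open>\<Theta>\<close> alone,
  which is a normal variance mixture over the law of \<open>X\<close>. Hence one bound serves every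
  \<open>\<Theta>\<close> with this conditional distribution.\<close>

lemma cond_distribution_mixture:
  fixes w :: "real \<Rightarrow> real"
  assumes M: "prob_space M" and cd: "cond_distribution M X \<Theta> (\<lambda>x. gaussian_law 0 (v x))"
    and [measurable]: "v \<in> borel_measurable borel"
  shows "distr M borel \<Theta> = distr (distr M borel X \<Otimes>\<^sub>M std_normal) borel (\<lambda>p. sqrt (v (fst p)) * snd p)"
proof (rule measure_eqI)
  have [measurable]: "X \<in> borel_measurable M" "\<Theta> \<in> borel_measurable M"
    using cd by (auto simp: cond_distribution_def)
  interpret M: prob_space M by fact
  interpret N: prob_space std_normal by (rule prob_space_std_normal)
  interpret PX: prob_space "distr M borel X" by (rule M.prob_space_distr) simp
  interpret P: pair_prob_space "distr M borel X" std_normal ..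
  fix B assume "B \<in> sets (distr M borel \<Theta>)"
  then have B [measurable]: "B \<in> sets borel" by simp
  let ?Q = "(\<lambda>p. sqrt (v (fst p)) * snd p) -` B \<inter> space (distr M borel X \<Otimes>\<^sub>M std_normal)"
  have mq: "(\<lambda>p. sqrt (v (fst p)) * snd p) \<in> borel_measurable (distr M borel X \<Otimes>\<^sub>M std_normal)"
    by measurable
  have Q: "?Q \<in> sets (distr M borel X \<Otimes>\<^sub>M std_normal)"
    using measurable_sets[OF mq B] .
  have "emeasure (distr M borel \<Theta>) B = emeasure M {\<omega> \<in> space M. X \<omega> \<in> UNIV \<and> \<Theta> \<omega> \<in> B}"
    by (subst emeasure_distr) (auto intro!: arg_cong[where f = "emeasure M"])
  also have "\<dots> = (\<integral>\<^sup>+x\<in>UNIV. emeasure (gaussian_law 0 (v x)) B \<partial>distr M borel X)"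
    using cd[unfolded cond_distribution_def, THEN conjunct2, THEN conjunct2, THEN conjunct2, rule_format, of UNIV B] B by simp
  also have "\<dots> = (\<integral>\<^sup>+x. emeasure std_normal (Pair x -` ?Q) \<partial>distr M borel X)"
  proof (rule nn_integral_cong)
    fix x
    have "emeasure (gaussian_law 0 (v x)) B = emeasure std_normal ((\<lambda>z. 0 + sqrt (v x) * z) -` B \<inter> space std_normal)"
      unfolding gaussian_law_def by (rule emeasure_distr) auto
    also have "(\<lambda>z. 0 + sqrt (v x) * z) -` B \<inter> space std_normal = Pair x -` ?Q"
      by (auto simp: space_pair_measure)
    finally show "emeasure (gaussian_law 0 (v x)) B * indicator UNIV x = emeasure std_normal (Pair x -` ?Q)" by simp
  qed
  also have "\<dots> = emeasure (distr M borel X \<Otimes>\<^sub>M std_normal) ?Q"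
    by (rule N.emeasure_pair_measure_alt[OF Q, symmetric])
  also have "\<dots> = emeasure (distr (distr M borel X \<Otimes>\<^sub>M std_normal) borel (\<lambda>p. sqrt (v (fst p)) * snd p)) B"
    by (rule emeasure_distr[OF mq B, symmetric])
  finally show "emeasure (distr M borel \<Theta>) B = emeasure (distr (distr M borel X \<Otimes>\<^sub>M std_normal) borel (\<lambda>p. sqrt (v (fst p)) * snd p)) B" .
qed simp

text \<open>A Lipschitz function grows at most linearly and \<open>v\<close> is bounded, so the
  integrand is dominated by an affine function of \<open>\<bar>z\<bar>\<close> and Fubini's theorem
  applies.\<close>

lemma expectation_mixture:
  fixes h :: "real \<Rightarrow> real"
  assumes M: "prob_space M" and cd: "cond_distribution M X \<Theta> (\<lambda>x. gaussian_law 0 (v x))"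
    and v [measurable]: "v \<in> borel_measurable borel" and vb: "\<And>x. \<bar>v x\<bar> \<le> (c::real)"
    and h: "1-lipschitz_on UNIV h"
  shows "(\<integral>\<omega>. h (\<Theta> \<omega>) \<partial>M) = (\<integral>x. (\<integral>z. h (sqrt (v x) * z) \<partial>std_normal) \<partial>distr M borel X)"
    and "integrable (distr M borel X) (\<lambda>x. \<integral>z. h (sqrt (v x) * z) \<partial>std_normal)"
proof -
  have [measurable]: "X \<in> borel_measurable M" "\<Theta> \<in> borel_measurable M"
    using cd by (auto simp: cond_distribution_def)
  have [measurable]: "h \<in> borel_measurable borel" by (rule lipschitz_borel[OF h])
  interpret M: prob_space M by fact
  interpret N: prob_space std_normal by (rule prob_space_std_normal)
  interpret PX: prob_space "distr M borel X" by (rule M.prob_space_distr) simp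
  interpret P: pair_prob_space "distr M borel X" std_normal ..
  have mq: "(\<lambda>p. sqrt (v (fst p)) * snd p) \<in> borel_measurable (distr M borel X \<Otimes>\<^sub>M std_normal)"
    by measurable
  have iz: "integrable (distr M borel X \<Otimes>\<^sub>M std_normal) (\<lambda>p. \<bar>snd p\<bar>)"
  proof -
    have "integrable (distr M borel X \<Otimes>\<^sub>M std_normal) (\<lambda>(x, z). \<bar>z\<bar>)"
    proof (rule P.Fubini_integrable)
      show "AE x in distr M borel X. integrable std_normal (\<lambda>z. (\<lambda>(x, z). \<bar>z\<bar>) (x, z))"
        using integrable_abs_std_normal by simp
    qed auto
    then show ?thesis by (simp add: case_prod_beta')
  qed
  have ih: "integrable (distr M borel X \<Otimes>\<^sub>M std_normal) (\<lambda>p. h (sqrt (v (fst p)) * snd p))"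
  proof (rule Bochner_Integration.integrable_bound)
    show "integrable (distr M borel X \<Otimes>\<^sub>M std_normal) (\<lambda>p. \<bar>h 0\<bar> + sqrt c * \<bar>snd p\<bar>)"
      using iz by auto
    have "\<bar>h (sqrt (v x) * z)\<bar> \<le> \<bar>h 0\<bar> + sqrt c * \<bar>z\<bar>" for x z
    proof -
      have "\<bar>h (sqrt (v x) * z) - h 0\<bar> \<le> \<bar>sqrt (v x) * z\<bar>"
        using lipschitz_onD[OF h, of "sqrt (v x) * z" 0] by (simp add: dist_real_def)
      also have "\<dots> = sqrt \<bar>v x\<bar> * \<bar>z\<bar>" 
      proof -
        have "\<bar>sqrt (v x)\<bar> = sqrt \<bar>v x\<bar>"
          by (cases "0 \<le> v x") (simp_all add: real_sqrt_minus abs_of_neg)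
        then show ?thesis by (simp only: abs_mult)
      qed
      also have "\<dots> \<le> sqrt c * \<bar>z\<bar>" using vb[of x] by (intro mult_right_mono) auto
      finally show ?thesis by linarith
    qed
    then show "AE p in distr M borel X \<Otimes>\<^sub>M std_normal. norm (h (sqrt (v (fst p)) * snd p)) \<le> norm (\<bar>h 0\<bar> + sqrt c * \<bar>snd p\<bar>)"
      by (intro AE_I2) (auto intro: order_trans[OF _ abs_ge_self])
  qed measurable
  have "(\<integral>\<omega>. h (\<Theta> \<omega>) \<partial>M) = (\<integral>y. h y \<partial>distr M borel \<Theta>)" by (subst integral_distr) auto
  also have "\<dots> = (\<integral>p. h (sqrt (v (fst p)) * snd p) \<partial>(distr M borel X \<Otimes>\<^sub>M std_normal))"
    unfolding cond_distribution_mixture[OF M cd v] by (subst integral_distr[OF mq]) auto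
  also have "\<dots> = (\<integral>x. (\<integral>z. h (sqrt (v x) * z) \<partial>std_normal) \<partial>distr M borel X)"
    using P.integral_fst'[OF ih] by simp
  finally show "(\<integral>\<omega>. h (\<Theta> \<omega>) \<partial>M) = (\<integral>x. (\<integral>z. h (sqrt (v x) * z) \<partial>std_normal) \<partial>distr M borel X)" .
  show "integrable (distr M borel X) (\<lambda>x. \<integral>z. h (sqrt (v x) * z) \<partial>std_normal)"
    using P.integrable_fst'[OF ih] by simp
qed

context excursion_decay
begin

text \<open>A bound valid at every fixed level carries over to the independent random level; only
  the sites \<open>s\<close> and \<open>t\<close> are involved, so \<open>random_level\<close> is
  available.\<close>

lemma random_level_ind_diff:
  assumes e: "\<And>x. (\<integral>\<omega>. \<bar>indicator {x..} (g s \<omega>) - indicator {x..} (g t \<omega>)\<bar> \<partial>M) \<le> (e::real)"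
  shows "(\<integral>\<omega>. \<bar>indicator {u - \<epsilon> * X \<omega>..} (g s \<omega>) - indicator {u - \<epsilon> * X \<omega>..} (g t \<omega>)\<bar> \<partial>M) \<le> e"
proof -
  define F where "F x y = \<bar>(if u - \<epsilon> * x \<le> y s then 1 else 0) - (if u - \<epsilon> * x \<le> y t then 1 else 0 :: real)\<bar>" for x and y :: "real^2 \<Rightarrow> real"
  interpret PX: prob_space "distr M borel X" by (rule prob_space_distr) simp
  have mF: "case_prod F \<in> borel_measurable (borel \<Otimes>\<^sub>M Pi\<^sub>M {s, t} (\<lambda>_. borel))"
    unfolding F_def case_prod_beta' by measurable
  have bF: "\<bar>F x y\<bar> \<le> 1" for x y by (auto simp: F_def)
  have Fe: "F x (\<lambda>i\<in>{s, t}. g i \<omega>) = \<bar>indicator {u - \<epsilon> * x..} (g s \<omega>) - indicator {u - \<epsilon> * x..} (g t \<omega>)\<bar>" for x \<omega>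
    by (simp add: F_def indicator_def)
  note rl = random_level[OF _ mF bF]
  have "(\<integral>\<omega>. F (X \<omega>) (\<lambda>i\<in>{s, t}. g i \<omega>) \<partial>M) = (\<integral>x. (\<integral>\<omega>. F x (\<lambda>i\<in>{s, t}. g i \<omega>) \<partial>M) \<partial>distr M borel X)"
    by (rule rl(1)) simp
  also have "\<dots> \<le> (\<integral>x. e \<partial>distr M borel X)"
  proof (rule integral_mono)
    have *: "0 \<le> (\<integral>\<omega>. F x (\<lambda>i\<in>{s, t}. g i \<omega>) \<partial>M)" "(\<integral>\<omega>. F x (\<lambda>i\<in>{s, t}. g i \<omega>) \<partial>M) \<le> e" for x
      using e[of "u - \<epsilon> * x"] unfolding Fe by (auto intro: integral_nonneg_AE)
    show "integrable (distr M borel X) (\<lambda>x. \<integral>\<omega>. F x (\<lambda>i\<in>{s, t}. g i \<omega>) \<partial>M)"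
      by (rule PX.integrable_const_bound[of _ e]) (use * rl(2) in auto)
    show "(\<integral>\<omega>. F x (\<lambda>i\<in>{s, t}. g i \<omega>) \<partial>M) \<le> e" for x by (rule *)
  qed simp
  also have "\<dots> = e" using PX.prob_space by simp
  finally show ?thesis unfolding Fe .
qed

text \<open>The lattice is chosen after \<open>e\<close>, and \<open>e\<close> is arbitrary, so no
  mesh is left in the bound. The continuous statistic \<open>Zc\<close> is first replaced by its
  lattice version \<open>Zn\<close> at the random level; then \<open>random_level\<close> freezes
  the level, and \<open>finite_clt\<close> applies for each value \<open>x\<close> with constants
  that do not depend on \<open>x\<close>.\<close>

lemma region_bound:
  assumes Bo: "B \<in> sets borel" and Bb: "bounded B" and AB: "A = measure lborel B" and A1: "1 \<le> A"
    and cd: "cond_distribution M X \<Theta> (\<lambda>x. gaussian_law 0 (asymp_var r \<sigma> (u - \<epsilon> * x)))"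
    and Z: "\<And>\<omega>. \<omega> \<in> space M \<Longrightarrow> Z \<omega> = (\<integral>t. indicator B t * (indicator {u - \<epsilon> * X \<omega>..} (g t \<omega>) - Psi ((u - \<epsilon> * X \<omega>) / \<sigma>)) \<partial>lborel) / sqrt A"
    and h: "1-lipschitz_on UNIV h"
  shows "\<bar>(\<integral>\<omega>. h (Z \<omega>) \<partial>M) - (\<integral>\<omega>. h (\<Theta> \<omega>) \<partial>M)\<bar> \<le>
    clt_const \<sigma> ((\<integral>z. \<bar>r z\<bar> \<partial>lborel) + 1) * A powr (- (1 / 32)) + sqrt (4 / \<sigma>\<^sup>2 * boundary B)"
proof (rule field_le_epsilon)
  fix e :: real assume e: "0 < e"
  note reg = Bo Bb AB A1
  note [measurable] = Bo
  have sA: "0 < sqrt A" "1 \<le> sqrt A" using A1 by auto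
  \<comment> \<open>The mesh serves two purposes: \<open>sqrt A * e1\<close> bounds the L1 distance
    between the statistic and its lattice version, and \<open>sqrt (2 * e1 * A)\<close> the effect
    on the standard deviation. Each receives \<open>e / 2\<close>.\<close>
  define e1 where "e1 = min (e / (2 * sqrt A)) (e\<^sup>2 / (8 * A))"
  have e1: "0 < e1" using e A1 by (simp add: e1_def)
  have e1a: "sqrt A * e1 \<le> e / 2"
  proof -
    have "sqrt A * e1 \<le> sqrt A * (e / (2 * sqrt A))" using sA by (intro mult_left_mono) (auto simp: e1_def)
    then show ?thesis using sA by simp
  qed
  have e1b: "sqrt (2 * e1 * A) \<le> e / 2"
  proof (rule real_le_lsqrt)
    have "2 * e1 * A \<le> 2 * (e\<^sup>2 / (8 * A)) * A" using A1 by (intro mult_right_mono mult_left_mono) (auto simp: e1_def)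
    then show "2 * e1 * A \<le> (e / 2)\<^sup>2" using A1 by (simp add: power_divide)
  qed (use e e1 A1 in auto)
  obtain n1 where n1: "\<And>n x t. n1 \<le> n \<Longrightarrow> (\<integral>\<omega>. \<bar>indicator {x..} (g (grid n t) \<omega>) - indicator {x..} (g t \<omega>)\<bar> \<partial>M) \<le> e1"
    using ind_diff_uniform[OF e1] by blast
  define R where "R = (\<integral>z. \<bar>r z\<bar> \<partial>lborel) + 1"
  have "0 \<le> (\<integral>z. \<bar>r z\<bar> \<partial>lborel)" by (rule integral_nonneg_AE) simp
  then have R: "0 \<le> R" unfolding R_def by simp
  obtain n2 where n2: "\<And>n p. n2 \<le> n \<Longrightarrow> p \<in> grid n ` B \<Longrightarrow> (\<Sum>q\<in>grid n ` B. cell_weight B A n q * \<bar>r (q - p)\<bar>) \<le> R / sqrt A"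
    using row_bound[OF reg] unfolding R_def by blast
  define n where "n = max n1 n2"
  have nn: "n1 \<le> n" "n2 \<le> n" by (auto simp: n_def)
  interpret F: gauss_family M "grid n ` B" g "\<lambda>s t. r (t - s)" \<sigma> by (rule grid_family[OF reg])
  interpret PX: prob_space "distr M borel X" by (rule prob_space_distr) simp
  interpret N: prob_space std_normal by (rule prob_space_std_normal)
  have [measurable]: "h \<in> borel_measurable borel" by (rule lipschitz_borel[OF h])
  have [measurable]: "Psi \<in> borel_measurable borel" unfolding Psi_ncdf[abs_def] by measurable
  have hl: "\<bar>h x - h y\<bar> \<le> \<bar>x - y\<bar>" for x y
    using lipschitz_onD[OF h, of x y] by (simp add: dist_real_def)
  define U where "U \<omega> = u - \<epsilon> * X \<omega>" for \<omega>
  have [measurable]: "U \<in> borel_measurable M" unfolding U_def[abs_def] by measurable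
  define W where "W = F.indicator_sum (cell_weight B A n)"
  define Zn where "Zn \<omega> = W (U \<omega>) \<omega>" for \<omega>
  define D where "D x = (\<integral>\<omega>. h (W (u - \<epsilon> * x) \<omega>) \<partial>M)" for x
  define G where "G x = (\<integral>z. h (sqrt (limit_var (u - \<epsilon> * x)) * z) \<partial>std_normal)" for x
  have P01: "0 \<le> Psi t" "Psi t \<le> 1" for t using ncdf_bounds[of t] by (auto simp: Psi_ncdf)
  have W_b: "\<bar>W x \<omega>\<bar> \<le> sqrt A" for x \<omega>
    unfolding W_def F.indicator_sum_def sum_cell_weight[OF reg, of n, symmetric]
  proof (rule order_trans[OF sum_abs], rule sum_mono)
    fix i
    have "\<bar>indicator {x..} (g i \<omega>) - Psi (x / \<sigma>)\<bar> \<le> 1" using P01[of "x / \<sigma>"] by (auto simp: indicator_def)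
    then show "\<bar>cell_weight B A n i * (indicator {x..} (g i \<omega>) - Psi (x / \<sigma>))\<bar> \<le> cell_weight B A n i"
      using cell_weight_nonneg[OF reg, of n i] by (simp add: abs_mult mult_left_le)
  qed

  \<comment> \<open>The comparison at a fixed level. \<open>finite_clt\<close> takes a nonnegative
    variance and is used with \<open>\<bar>limit_var y\<bar>\<close>; as \<open>VW\<close> is
    nonnegative, the absolute value does not increase the distance.\<close>
  have D_G: "\<bar>D x - G x\<bar> \<le> clt_const \<sigma> R * A powr (- (1 / 32)) + (sqrt (4 / \<sigma>\<^sup>2 * boundary B) + sqrt (2 * e1 * A))" for x
  proof -
    define y where "y = u - \<epsilon> * x"
    define VW where "VW = (\<integral>\<omega>. (W y \<omega>)\<^sup>2 \<partial>M)"
    have VW0: "0 \<le> VW" by (simp add: VW_def)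
    have "\<bar>VW - region_var B A y\<bar> \<le> 2 * e1 * A"
      unfolding VW_def W_def using n1[OF nn(1)] by (intro indicator_sum_region_var[OF reg])
    with region_var_limit_var[OF reg, of y] have "\<bar>VW - limit_var y\<bar> \<le> 4 / \<sigma>\<^sup>2 * boundary B + 2 * e1 * A" by linarith
    then have "\<bar>VW - \<bar>limit_var y\<bar>\<bar> \<le> 4 / \<sigma>\<^sup>2 * boundary B + 2 * e1 * A" using VW0 by linarith
    then have "sqrt \<bar>VW - \<bar>limit_var y\<bar>\<bar> \<le> sqrt (4 / \<sigma>\<^sup>2 * boundary B + 2 * e1 * A)" by simp
    also have "\<dots> \<le> sqrt (4 / \<sigma>\<^sup>2 * boundary B) + sqrt (2 * e1 * A)"
    proof (rule sqrt_add_le_add_sqrt)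
      have "0 \<le> 4 / \<sigma>\<^sup>2 * boundary B" using region_var_limit_var[OF reg, of y] by linarith
      then show "0 \<le> 4 / \<sigma>\<^sup>2 * boundary B" .
    qed (use e1 A1 in auto)
    finally have s: "sqrt \<bar>VW - \<bar>limit_var y\<bar>\<bar> \<le> sqrt (4 / \<sigma>\<^sup>2 * boundary B) + sqrt (2 * e1 * A)" .
    have "\<bar>D x - (\<integral>z. h (sqrt \<bar>limit_var y\<bar> * z) \<partial>std_normal)\<bar> \<le> clt_const \<sigma> R * A powr (- (1 / 32)) + sqrt \<bar>VW - \<bar>limit_var y\<bar>\<bar>"
      unfolding D_def W_def VW_def y_def
      by (rule F.finite_clt[OF A1 cell_weight_nonneg[OF reg] sum_cell_weight[OF reg] R n2[OF nn(2)] h]) auto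
    moreover have "G x = (\<integral>z. h (sqrt \<bar>limit_var y\<bar> * z) \<partial>std_normal)"
      unfolding G_def y_def[symmetric] by (rule std_normal_sqrt_abs) measurable
    ultimately show ?thesis using s by linarith
  qed

  have Z_n: "Zn \<omega> = (\<integral>t. indicator B t * (indicator {U \<omega>..} (g (grid n t) \<omega>) - Psi (U \<omega> / \<sigma>)) \<partial>lborel) / sqrt A" for \<omega>
    unfolding Zn_def W_def F.indicator_sum_def by (rule grid_sum_cell_weight[OF reg])
  define Zc where "Zc \<omega> = (\<integral>t. indicator B t * (indicator {U \<omega>..} (g t \<omega>) - Psi (U \<omega> / \<sigma>)) \<partial>lborel) / sqrt A" for \<omega>
  have gj [measurable]: "(\<lambda>q. g (fst q) (snd q)) \<in> borel_measurable (lborel \<Otimes>\<^sub>M M)"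
    using g_joint by (simp add: case_prod_beta' cong: measurable_cong_sets sets_pair_measure_cong)
  have gj': "(\<lambda>q. g (grid n (fst q)) (snd q)) \<in> borel_measurable (lborel \<Otimes>\<^sub>M M)"
  proof -
    have "(\<lambda>q. (grid n (fst q), snd q)) \<in> lborel \<Otimes>\<^sub>M M \<rightarrow>\<^sub>M borel \<Otimes>\<^sub>M M" by measurable
    from measurable_compose[OF this g_joint] show ?thesis by simp
  qed
  note [measurable] = gj'
  interpret LM: pair_sigma_finite lborel M ..
  \<comment> \<open>All integrands on the product are dominated by the indicator of
    \<open>B\<close>, which has finite area.\<close>
  have LB: "integrable (lborel \<Otimes>\<^sub>M M) f"
    if [measurable]: "f \<in> borel_measurable (lborel \<Otimes>\<^sub>M M)" and fb: "\<And>t \<omega>. \<bar>f (t, \<omega>)\<bar> \<le> indicator B t" for f :: "(real^2) \<times> 'a \<Rightarrow> real"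
  proof (rule Bochner_Integration.integrable_bound[of _ "\<lambda>(t, \<omega>). indicator B t"])
    show "integrable (lborel \<Otimes>\<^sub>M M) (\<lambda>(t, \<omega>). indicat_real B t)"
    proof (rule LM.Fubini_integrable)
      show "integrable lborel (\<lambda>t. \<integral>\<omega>. norm ((\<lambda>(t, \<omega>). indicat_real B t) (t, \<omega>)) \<partial>M)"
        using region_indicator(2)[OF reg, of 1] by (simp add: prob_space)
    qed auto
    show "AE q in lborel \<Otimes>\<^sub>M M. norm (f q) \<le> norm ((\<lambda>(t, \<omega>). indicat_real B t) q)"
      using fb by (intro AE_I2) auto
  qed measurable
  have indm [measurable]: "(\<lambda>q. indicat_real {U (snd q)..} (g (fst q) (snd q))) \<in> borel_measurable (lborel \<Otimes>\<^sub>M M)"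
    "(\<lambda>q. indicat_real {U (snd q)..} (g (grid n (fst q)) (snd q))) \<in> borel_measurable (lborel \<Otimes>\<^sub>M M)"
  proof -
    have e: "indicat_real {a..} b = (if a \<le> b then 1 else 0)" for a b by (simp add: indicator_def)
    show "(\<lambda>q. indicat_real {U (snd q)..} (g (fst q) (snd q))) \<in> borel_measurable (lborel \<Otimes>\<^sub>M M)"
      "(\<lambda>q. indicat_real {U (snd q)..} (g (grid n (fst q)) (snd q))) \<in> borel_measurable (lborel \<Otimes>\<^sub>M M)"
      unfolding e by measurable
  qed
  have b1: "\<bar>indicat_real {a..} b - Psi c\<bar> \<le> 1" for a b c using P01[of c] by (auto simp: indicator_def)
  have iZ: "integrable (lborel \<Otimes>\<^sub>M M) (\<lambda>q. indicator B (fst q) * (indicator {U (snd q)..} (g (fst q) (snd q)) - Psi (U (snd q) / \<sigma>)))"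
    "integrable (lborel \<Otimes>\<^sub>M M) (\<lambda>q. indicator B (fst q) * (indicator {U (snd q)..} (g (grid n (fst q)) (snd q)) - Psi (U (snd q) / \<sigma>)))"
    by (rule LB; use b1 in \<open>auto simp: indicator_def[of B]\<close>)+
  have mZ: "Zc \<in> borel_measurable M" "Zn \<in> borel_measurable M"
  proof -
    have "integrable M (\<lambda>\<omega>. \<integral>t. indicator B t * (indicat_real {U \<omega>..} (g t \<omega>) - Psi (U \<omega> / \<sigma>)) \<partial>lborel)"
      using LM.integrable_snd[of "\<lambda>t \<omega>. indicator B t * (indicat_real {U \<omega>..} (g t \<omega>) - Psi (U \<omega> / \<sigma>))"] iZ(1)
      by (simp only: case_prod_beta')
    then show "Zc \<in> borel_measurable M" unfolding Zc_def[abs_def] by (intro borel_measurable_divide) auto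
    have "integrable M (\<lambda>\<omega>. \<integral>t. indicator B t * (indicat_real {U \<omega>..} (g (grid n t) \<omega>) - Psi (U \<omega> / \<sigma>)) \<partial>lborel)"
      using LM.integrable_snd[of "\<lambda>t \<omega>. indicator B t * (indicat_real {U \<omega>..} (g (grid n t) \<omega>) - Psi (U \<omega> / \<sigma>))"] iZ(2)
      by (simp only: case_prod_beta')
    then have "(\<lambda>\<omega>. (\<integral>t. indicator B t * (indicat_real {U \<omega>..} (g (grid n t) \<omega>) - Psi (U \<omega> / \<sigma>)) \<partial>lborel) / sqrt A) \<in> borel_measurable M"
      by (intro borel_measurable_divide) auto
    moreover have "Zn = (\<lambda>\<omega>. (\<integral>t. indicator B t * (indicat_real {U \<omega>..} (g (grid n t) \<omega>) - Psi (U \<omega> / \<sigma>)) \<partial>lborel) / sqrt A)"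
      by (rule ext) (rule Z_n)
    ultimately show "Zn \<in> borel_measurable M" by simp
  qed
  have section_int: "integrable lborel (\<lambda>t. f (t, \<omega>))"
    if f: "f \<in> borel_measurable (lborel \<Otimes>\<^sub>M M)" and fb: "\<And>t \<omega>. \<bar>f (t, \<omega>)\<bar> \<le> indicator B t" and w: "\<omega> \<in> space M" for f :: "(real^2) \<times> 'a \<Rightarrow> real" and \<omega>
  proof (rule Bochner_Integration.integrable_bound[of _ "\<lambda>t. indicator B t * 1"])
    show "integrable lborel (\<lambda>t. indicator B t * (1::real))" by (rule region_indicator(2)[OF reg])
    show "(\<lambda>t. f (t, \<omega>)) \<in> borel_measurable lborel"
      by (rule measurable_compose[OF measurable_Pair2'[OF w] f])
  qed (use fb in auto)
  have sec: "integrable lborel (\<lambda>t. indicator B t * (indicat_real {U \<omega>..} (g t \<omega>) - Psi (U \<omega> / \<sigma>)))"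
    if w: "\<omega> \<in> space M" for \<omega>
  proof -
    let ?f = "\<lambda>q. indicator B (fst q) * (indicat_real {U (snd q)..} (g (fst q) (snd q)) - Psi (U (snd q) / \<sigma>))"
    have m: "?f \<in> borel_measurable (lborel \<Otimes>\<^sub>M M)" by measurable
    have b: "\<bar>?f (t, \<omega>)\<bar> \<le> indicator B t" for t \<omega> using b1 by (auto simp: indicator_def[of B])
    from section_int[OF m b w] show ?thesis by simp
  qed
  \<comment> \<open>The order of integration over \<open>B\<close> and over \<open>M\<close> is
    exchanged for \<open>df\<close>, which reduces the mean distance of \<open>Zc\<close> and
    \<open>Zn\<close> to a bound at each single site.\<close>
  define df where "df q = indicator B (fst q) * \<bar>indicat_real {U (snd q)..} (g (grid n (fst q)) (snd q)) - indicat_real {U (snd q)..} (g (fst q) (snd q))\<bar>" for q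
  have mdf: "df \<in> borel_measurable (lborel \<Otimes>\<^sub>M M)" unfolding df_def[abs_def] by measurable
  have bdf: "\<bar>df (t, \<omega>)\<bar> \<le> indicator B t" for t \<omega> by (auto simp: df_def indicator_def)
  have idf: "integrable (lborel \<Otimes>\<^sub>M M) df" by (rule LB[OF mdf bdf])
  have Zd: "\<bar>Zc \<omega> - Zn \<omega>\<bar> \<le> (\<integral>t. df (t, \<omega>) \<partial>lborel) / sqrt A" if w: "\<omega> \<in> space M" for \<omega>
  proof -
    let ?a = "\<lambda>t. indicator B t * (indicat_real {U \<omega>..} (g t \<omega>) - Psi (U \<omega> / \<sigma>))"
    let ?b = "\<lambda>t. indicator B t * (indicat_real {U \<omega>..} (g (grid n t) \<omega>) - Psi (U \<omega> / \<sigma>))"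
    have ia: "integrable lborel ?a" by (rule sec[OF w])
    have ib: "integrable lborel ?b" by (rule grid_sum(2)[OF Bo Bb, of "\<lambda>p. indicat_real {U \<omega>..} (g p \<omega>) - Psi (U \<omega> / \<sigma>)"])
    have E: "(\<integral>t. ?a t \<partial>lborel) - (\<integral>t. ?b t \<partial>lborel) = (\<integral>t. ?a t - ?b t \<partial>lborel)"
      using ia ib by simp
    have "norm ((\<integral>t. ?a t \<partial>lborel) - (\<integral>t. ?b t \<partial>lborel)) \<le> (\<integral>t. df (t, \<omega>) \<partial>lborel)"
      unfolding E using ia ib section_int[OF mdf bdf w] by (intro bochner_norm_bound) (auto simp: df_def indicator_def)
    then have "\<bar>(\<integral>t. ?a t \<partial>lborel) - (\<integral>t. ?b t \<partial>lborel)\<bar> / sqrt A \<le> (\<integral>t. df (t, \<omega>) \<partial>lborel) / sqrt A"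
      using sA by (intro divide_right_mono) auto
    then show ?thesis unfolding Zc_def Z_n diff_divide_distrib[symmetric] using sA by simp
  qed
  have iD1: "integrable M (\<lambda>\<omega>. \<integral>t. df (t, \<omega>) \<partial>lborel)"
    using LM.integrable_snd[of "\<lambda>t \<omega>. df (t, \<omega>)"] idf by simp
  have "(\<integral>\<omega>. (\<integral>t. df (t, \<omega>) \<partial>lborel) \<partial>M) = (\<integral>t. (\<integral>\<omega>. df (t, \<omega>) \<partial>M) \<partial>lborel)"
    using LM.Fubini_integral[of "\<lambda>t \<omega>. df (t, \<omega>)"] idf by simp
  also have "\<dots> \<le> (\<integral>t. indicator B t * e1 \<partial>lborel)"
  proof (rule integral_mono)
    show "integrable lborel (\<lambda>t. \<integral>\<omega>. df (t, \<omega>) \<partial>M)" using LM.integrable_fst'[OF idf] .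
    show "(\<integral>\<omega>. df (t, \<omega>) \<partial>M) \<le> indicator B t * e1" for t
      unfolding df_def U_def fst_conv snd_conv integral_mult_right_zero
      using random_level_ind_diff[of "grid n t" t e1 u \<epsilon>] n1[OF nn(1)]
      by (intro mult_left_mono) auto
  qed (rule region_indicator(2)[OF reg])
  also have "\<dots> = A * e1" by (rule region_indicator(1)[OF reg])
  finally have dfA: "(\<integral>\<omega>. (\<integral>t. df (t, \<omega>) \<partial>lborel) \<partial>M) \<le> A * e1" .
  \<comment> \<open>A crude bound, wanted for the integrability of
    \<open>h (Zc \<omega>)\<close>.\<close>
  have Zcb: "\<bar>Zc \<omega>\<bar> \<le> 3 * A" if w: "\<omega> \<in> space M" for \<omega>
  proof -
    have "\<bar>\<integral>t. indicator B t * (indicat_real {U \<omega>..} (g t \<omega>) - Psi (U \<omega> / \<sigma>)) \<partial>lborel\<bar> \<le> (\<integral>t. indicator B t * 1 \<partial>lborel)"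
      unfolding real_norm_def[symmetric]
    proof (rule bochner_norm_bound)
      show "integrable lborel (\<lambda>t. indicator B t * (indicat_real {U \<omega>..} (g t \<omega>) - Psi (U \<omega> / \<sigma>)))"
        by (rule sec[OF w])
    qed (use region_indicator(2)[OF reg, of 1] b1 in \<open>auto simp: indicator_def[of B]\<close>)
    then have 1: "\<bar>\<integral>t. indicator B t * (indicat_real {U \<omega>..} (g t \<omega>) - Psi (U \<omega> / \<sigma>)) \<partial>lborel\<bar> \<le> A"
      unfolding region_indicator(1)[OF reg] by simp
    have "\<bar>Zc \<omega>\<bar> = \<bar>\<integral>t. indicator B t * (indicat_real {U \<omega>..} (g t \<omega>) - Psi (U \<omega> / \<sigma>)) \<partial>lborel\<bar> / sqrt A"
      unfolding Zc_def using sA by simp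
    also have "\<dots> \<le> A / 1" using 1 sA A1 by (intro frac_le) auto
    finally show ?thesis using A1 by simp
  qed
  have ihb: "integrable M (\<lambda>\<omega>. h (Q \<omega>))" if [measurable]: "Q \<in> borel_measurable M" and Q: "\<And>\<omega>. \<omega> \<in> space M \<Longrightarrow> \<bar>Q \<omega>\<bar> \<le> c" for Q :: "'a \<Rightarrow> real" and c
  proof (rule integrable_const_bound[of _ "\<bar>h 0\<bar> + c"])
    have "\<bar>h (Q \<omega>)\<bar> \<le> \<bar>h 0\<bar> + c" if "\<omega> \<in> space M" for \<omega> using hl[of "Q \<omega>" 0] Q[OF that] by linarith
    then show "AE \<omega> in M. norm (h (Q \<omega>)) \<le> \<bar>h 0\<bar> + c" by (intro AE_I2) simp
  qed measurable
  have Znb: "\<bar>Zn \<omega>\<bar> \<le> sqrt A" for \<omega> unfolding Zn_def by (rule W_b)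
  have ihc: "integrable M (\<lambda>\<omega>. h (Zc \<omega>))" by (rule ihb[OF mZ(1) Zcb])
  have ihn: "integrable M (\<lambda>\<omega>. h (Zn \<omega>))" by (rule ihb[OF mZ(2) Znb])
  have s1: "\<bar>(\<integral>\<omega>. h (Zc \<omega>) \<partial>M) - (\<integral>\<omega>. h (Zn \<omega>) \<partial>M)\<bar> \<le> sqrt A * e1"
  proof -
    have E: "(\<integral>\<omega>. h (Zc \<omega>) \<partial>M) - (\<integral>\<omega>. h (Zn \<omega>) \<partial>M) = (\<integral>\<omega>. h (Zc \<omega>) - h (Zn \<omega>) \<partial>M)" using ihc ihn by simp
    have "norm ((\<integral>\<omega>. h (Zc \<omega>) \<partial>M) - (\<integral>\<omega>. h (Zn \<omega>) \<partial>M)) \<le> (\<integral>\<omega>. (\<integral>t. df (t, \<omega>) \<partial>lborel) / sqrt A \<partial>M)"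
      unfolding E using ihc ihn iD1 order_trans[OF hl Zd] by (intro bochner_norm_bound) auto
    also have "\<dots> = (\<integral>\<omega>. (\<integral>t. df (t, \<omega>) \<partial>lborel) \<partial>M) / sqrt A" by simp
    also have "\<dots> \<le> (A * e1) / sqrt A" using dfA sA by (intro divide_right_mono) auto
    also have "\<dots> = (A / sqrt A) * e1" by simp
    also have "A / sqrt A = sqrt A" using A1 by (intro real_div_sqrt) simp
    finally show ?thesis by simp
  qed
  \<comment> \<open>The test function of the lattice sum, as a function of the level and of finitely
    many field values; this is the form that \<open>random_level\<close> takes.\<close>
  define F where "F x y = h (\<Sum>p\<in>grid n ` B. cell_weight B A n p * ((if u - \<epsilon> * x \<le> y p then 1 else 0) - Psi ((u - \<epsilon> * x) / \<sigma>)))" for x and y :: "real^2 \<Rightarrow> real"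
  have mF: "case_prod F \<in> borel_measurable (borel \<Otimes>\<^sub>M Pi\<^sub>M (grid n ` B) (\<lambda>_. borel))"
    unfolding F_def case_prod_beta' by measurable
  have bF: "\<bar>F x y\<bar> \<le> \<bar>h 0\<bar> + sqrt A" for x y
  proof -
    have "\<bar>\<Sum>p\<in>grid n ` B. cell_weight B A n p * ((if u - \<epsilon> * x \<le> y p then 1 else 0) - Psi ((u - \<epsilon> * x) / \<sigma>))\<bar> \<le> sqrt A"
      unfolding sum_cell_weight[OF reg, of n, symmetric]
    proof (rule order_trans[OF sum_abs], rule sum_mono)
      fix p
      have "\<bar>(if u - \<epsilon> * x \<le> y p then 1 else 0) - Psi ((u - \<epsilon> * x) / \<sigma>)\<bar> \<le> 1" using P01[of "(u - \<epsilon> * x) / \<sigma>"] by auto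
      then show "\<bar>cell_weight B A n p * ((if u - \<epsilon> * x \<le> y p then 1 else 0) - Psi ((u - \<epsilon> * x) / \<sigma>))\<bar> \<le> cell_weight B A n p"
        using cell_weight_nonneg[OF reg, of n p] by (simp only: abs_mult mult_left_le abs_of_nonneg abs_ge_zero)
    qed
    then show ?thesis using hl[of "\<Sum>p\<in>grid n ` B. cell_weight B A n p * ((if u - \<epsilon> * x \<le> y p then 1 else 0) - Psi ((u - \<epsilon> * x) / \<sigma>))" 0]
      unfolding F_def by linarith
  qed
  have FW: "F x (\<lambda>i\<in>grid n ` B. g i \<omega>) = h (W (u - \<epsilon> * x) \<omega>)" for x \<omega>
    unfolding F_def W_def F.indicator_sum_def by (intro arg_cong[where f = h] sum.cong) (auto simp: indicator_def)
  note rl = random_level[OF grid_finite[OF Bb] mF bF]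
  have s2: "(\<integral>\<omega>. h (Zn \<omega>) \<partial>M) = (\<integral>x. D x \<partial>distr M borel X)"
    using rl(1) unfolding FW Zn_def U_def D_def .
  have mD: "D \<in> borel_measurable borel" using rl(2) unfolding FW D_def[symmetric] .
  have iD: "integrable (distr M borel X) D"
  proof (rule PX.integrable_const_bound[of _ "\<bar>h 0\<bar> + sqrt A"])
    have "norm (D x) \<le> (\<integral>\<omega>. \<bar>h 0\<bar> + sqrt A \<partial>M)" for x
      unfolding D_def FW[symmetric]
    proof (rule bochner_norm_bound)
      have mW: "W (u - \<epsilon> * x) \<in> borel_measurable M" unfolding W_def F.indicator_sum_def[abs_def] by measurable
      show "integrable M (\<lambda>\<omega>. F x (\<lambda>i\<in>grid n ` B. g i \<omega>))" unfolding FW by (rule ihb[OF mW W_b])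
    qed (use bF in auto)
    then show "AE x in distr M borel X. norm (D x) \<le> \<bar>h 0\<bar> + sqrt A" by (simp add: prob_space)
  qed (use mD in simp)
  have cd': "cond_distribution M X \<Theta> (\<lambda>x. gaussian_law 0 (limit_var (u - \<epsilon> * x)))"
    using cd unfolding asymp_var_eq .
  note mix = expectation_mixture[OF prob_space_axioms cd' _ limit_var_bound h]
  have s3: "(\<integral>\<omega>. h (\<Theta> \<omega>) \<partial>M) = (\<integral>x. G x \<partial>distr M borel X)" unfolding G_def by (rule mix(1)) measurable
  have iG: "integrable (distr M borel X) G" unfolding G_def[abs_def] by (rule mix(2)) measurable
  define b where "b = clt_const \<sigma> R * A powr (- (1 / 32)) + (sqrt (4 / \<sigma>\<^sup>2 * boundary B) + sqrt (2 * e1 * A))"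
  have s4: "\<bar>(\<integral>x. D x \<partial>distr M borel X) - (\<integral>x. G x \<partial>distr M borel X)\<bar> \<le> b"
  proof -
    have E: "(\<integral>x. D x \<partial>distr M borel X) - (\<integral>x. G x \<partial>distr M borel X) = (\<integral>x. D x - G x \<partial>distr M borel X)" using iD iG by simp
    have "norm ((\<integral>x. D x \<partial>distr M borel X) - (\<integral>x. G x \<partial>distr M borel X)) \<le> (\<integral>x. b \<partial>distr M borel X)"
      unfolding E using iD iG D_G unfolding b_def by (intro bochner_norm_bound) auto
    then show ?thesis using PX.prob_space by simp
  qed
  have ZZ: "(\<integral>\<omega>. h (Z \<omega>) \<partial>M) = (\<integral>\<omega>. h (Zc \<omega>) \<partial>M)"
    by (intro Bochner_Integration.integral_cong refl) (simp add: Z Zc_def U_def)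
  show "\<bar>(\<integral>\<omega>. h (Z \<omega>) \<partial>M) - (\<integral>\<omega>. h (\<Theta> \<omega>) \<partial>M)\<bar> \<le>
    clt_const \<sigma> ((\<integral>z. \<bar>r z\<bar> \<partial>lborel) + 1) * A powr (- (1 / 32)) + sqrt (4 / \<sigma>\<^sup>2 * boundary B) + e"
    using s1 s4 e1a e1b unfolding ZZ s3 s2[symmetric] b_def R_def by linarith
qed

end

section \<open>Decay of the covariance and the boundary term\<close>

lemma ln_powr_le_powr:
  fixes \<gamma> :: real assumes "0 < \<gamma>"
  shows "\<forall>\<^sub>F x in at_top. x powr - \<gamma> \<le> ln x powr (- (1/12))"
  using assms by real_asymp

lemma integrable_one_plus_abs_powr:
  fixes p :: real assumes p: "1 < p"
  shows "integrable lborel (\<lambda>x::real. (1 + \<bar>x\<bar>) powr - p)"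
proof -
  define F where "F x = - ((1 + x) powr (1 - p)) / (p - 1)" for x :: real
  have "(\<integral>\<^sup>+x. ennreal ((1 + x) powr - p) * indicator {0..} x \<partial>lborel) = ennreal (0 - F 0)"
  proof (rule nn_integral_FTC_atLeast)
    show "DERIV F x :> (1 + x) powr - p" if "0 \<le> x" for x
      proof -
      have "DERIV F x :> - ((1 - p) * (1 + x) powr (1 - p - 1)) / (p - 1)"
        unfolding F_def using that p by (auto intro!: derivative_eq_intros)
      moreover have "- ((1 - p) * (1 + x) powr (1 - p - 1)) / (p - 1) = (1 + x) powr - p" using p by (simp add: field_simps)
      ultimately show ?thesis by simp
    qed
    show "(F \<longlongrightarrow> 0) at_top" unfolding F_def using p by real_asymp
  qed (use p in auto)
  then have fin: "(\<integral>\<^sup>+x. ennreal ((1 + x) powr - p) * indicator {0..} x \<partial>lborel) < \<infinity>" by simp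
  have refl: "(\<integral>\<^sup>+x. ennreal ((1 + - x) powr - p) * indicator {0..} (- x) \<partial>lborel) =
    (\<integral>\<^sup>+x. ennreal ((1 + x) powr - p) * indicator {0..} x \<partial>lborel)"
    by (subst (2) lborel_distr_uminus[symmetric], subst nn_integral_distr) auto
  have "(\<integral>\<^sup>+x. ennreal ((1 + \<bar>x\<bar>) powr - p) \<partial>lborel) \<le>
    (\<integral>\<^sup>+x. ennreal ((1 + x) powr - p) * indicator {0..} x + ennreal ((1 + - x) powr - p) * indicator {0..} (- x) \<partial>lborel)"
    by (intro nn_integral_mono) (auto simp: indicator_def abs_if)
  also have "\<dots> = (\<integral>\<^sup>+x. ennreal ((1 + x) powr - p) * indicator {0..} x \<partial>lborel) + (\<integral>\<^sup>+x. ennreal ((1 + - x) powr - p) * indicator {0..} (- x) \<partial>lborel)"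
    by (intro nn_integral_add) auto
  also have "\<dots> < \<infinity>" unfolding refl using fin by simp
  finally show ?thesis by (intro integrableI_nonneg) auto
qed

text \<open>By its construction Lebesgue measure is the image of a finite product of one-dimensional
  ones, where products of integrable functions are integrable.\<close>

lemma integrable_lborel_prod_Basis:
  fixes f :: "real \<Rightarrow> real"
  assumes f: "integrable lborel f"
  shows "integrable lborel (\<lambda>z::'a::euclidean_space. \<Prod>b\<in>Basis. f (z \<bullet> b))"
proof -
  interpret product_sigma_finite "\<lambda>_::'a. lborel :: real measure" by unfold_locales
  have [measurable]: "f \<in> borel_measurable borel" using f by auto
  have i: "integrable (Pi\<^sub>M Basis (\<lambda>_. lborel)) (\<lambda>x. \<Prod>b\<in>(Basis::'a set). f (x b))"
    by (rule product_integrable_prod) (use f in auto)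
  have L: "(lborel :: 'a measure) = distr (Pi\<^sub>M Basis (\<lambda>_. lborel)) borel (\<lambda>x. \<Sum>b\<in>Basis. x b *\<^sub>R b)"
    unfolding lborel_eq_real by (rule lborel_def)
  have "integrable (distr (Pi\<^sub>M Basis (\<lambda>_. lborel)) borel (\<lambda>x. \<Sum>b\<in>Basis. x b *\<^sub>R b))
    (\<lambda>z::'a. \<Prod>b\<in>Basis. f (z \<bullet> b))"
    by (subst integrable_distr_eq)
      (use i in \<open>auto simp: inner_sum_left inner_Basis if_distrib sum.delta cong: if_cong prod.cong\<close>)
  then show ?thesis unfolding L[symmetric] .
qed

text \<open>\<open>1 + norm z\<close> dominates \<open>1 + \<bar>z \<bullet> b\<bar>\<close> for
  every basis vector. Sharing the exponent evenly among the coordinates bounds the function by a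
  product of one-dimensional ones with exponent \<open>\<gamma> / DIM('a)\<close>, which exceeds 1;
  polar coordinates are avoided.\<close>

lemma integrable_one_plus_norm_powr:
  assumes g: "real DIM('a) < \<gamma>"
  shows "integrable lborel (\<lambda>z::'a::euclidean_space. (1 + norm z) powr - \<gamma>)"
proof (rule Bochner_Integration.integrable_bound)
  define p where "p = \<gamma> / real DIM('a)"
  have p: "1 < p" unfolding p_def using g by simp
  show "integrable lborel (\<lambda>z::'a. \<Prod>b\<in>Basis. (1 + \<bar>z \<bullet> b\<bar>) powr - p)"
    by (rule integrable_lborel_prod_Basis[OF integrable_one_plus_abs_powr[OF p]])
  show "AE z in lborel. norm ((1 + norm z) powr - \<gamma>) \<le> norm (\<Prod>b\<in>(Basis::'a set). (1 + \<bar>z \<bullet> b\<bar>) powr - p)"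
  proof (rule AE_I2)
    fix z :: 'a
    have "(1 + norm z) powr - \<gamma> = (\<Prod>b\<in>(Basis::'a set). (1 + norm z) powr - p)"
      by (simp add: powr_power p_def add_nonneg_eq_0_iff)
    also have "\<dots> \<le> (\<Prod>b\<in>(Basis::'a set). (1 + \<bar>z \<bullet> b\<bar>) powr - p)"
      using p by (intro prod_mono conjI powr_mono2') (auto simp: Basis_le_norm)
    finally show "norm ((1 + norm z) powr - \<gamma>) \<le> norm (\<Prod>b\<in>(Basis::'a set). (1 + \<bar>z \<bullet> b\<bar>) powr - p)"
      by (simp add: prod_nonneg)
  qed
qed simp

text \<open>Shrinking \<open>B\<close> towards \<open>c\<close> by the factor \<open>1 - norm z / \<rho>\<close> gives a subset whose shift by \<open>z\<close> stays in
  \<open>B\<close>.\<close>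

lemma convex_shift_exit_measure:
  fixes B :: "'a::euclidean_space set"
  assumes B: "convex B" "bounded B" "B \<in> sets borel" and c: "cball c \<rho> \<subseteq> B" and \<rho>: "0 < \<rho>"
    and \<beta>: "0 < \<beta>" "\<beta> \<le> 1"
  shows "measure lborel {s \<in> B. s + z \<notin> B} \<le> DIM('a) * (norm z / \<rho>) powr \<beta> * measure lborel B"
proof -
  note [measurable] = B(3)
  have sM: "{s \<in> B. s + z \<in> B} \<in> sets borel" "{s \<in> B. s + z \<notin> B} \<in> sets borel" by measurable
  have D1: "1 \<le> real DIM('a)" using DIM_positive[where 'a='a] by linarith
  have fm: "{s \<in> B. s + z \<in> B} \<in> fmeasurable lborel" "{s \<in> B. s + z \<notin> B} \<in> fmeasurable lborel" "B \<in> fmeasurable lborel"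
    using sM B(2,3) by (auto intro!: fmeasurableI emeasure_bounded_finite intro: bounded_subset)
  have le: "measure lborel {s \<in> B. s + z \<notin> B} \<le> measure lborel B"
    by (intro measure_mono_fmeasurable fm) (use sM in auto)
  consider "z = 0" | "\<rho> \<le> norm z" | "z \<noteq> 0" "norm z < \<rho>" by linarith
  then show ?thesis
  proof cases
    case 1
    then have e: "{s \<in> B. s + z \<notin> B} = {}" by auto
    show ?thesis unfolding e by simp
  next
    case 2
    then have "1 \<le> norm z / \<rho>" using \<rho> by simp
    then have "1 \<le> (norm z / \<rho>) powr \<beta>" using \<beta> by (simp add: ge_one_powr_ge_zero)
    with D1 have "1 \<le> real DIM('a) * (norm z / \<rho>) powr \<beta>" by (metis mult_mono' mult_1 zero_le_one)
    then have "1 * measure lborel B \<le> DIM('a) * (norm z / \<rho>) powr \<beta> * measure lborel B"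
      by (rule mult_right_mono) simp
    with le show ?thesis by simp
  next
    case 3
    define \<theta> where "\<theta> = norm z / \<rho>"
    have \<theta>: "0 < \<theta>" "\<theta> < 1" unfolding \<theta>_def using 3 \<rho> by auto
    let ?S = "(\<lambda>x. (1 - \<theta>) *\<^sub>R x + \<theta> *\<^sub>R c) ` B"
    have S: "?S \<subseteq> {s \<in> B. s + z \<in> B}"
    proof (clarsimp, intro conjI)
      fix x assume x: "x \<in> B"
      \<comment> \<open>\<open>c + z /\<^sub>R \<theta>\<close> lies at distance
        \<open>\<rho>\<close> from \<open>c\<close>, hence in \<open>B\<close>. Mixing it into
        \<open>x\<close> with weight \<open>\<theta>\<close>, instead of \<open>c\<close>, produces
        exactly the additional shift \<open>z\<close>.\<close>
      have cB: "c \<in> B" "c + z /\<^sub>R \<theta> \<in> B"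
        using c \<rho> 3 by (auto intro!: subsetD[OF c] simp: dist_norm \<theta>_def)
      show "(1 - \<theta>) *\<^sub>R x + \<theta> *\<^sub>R c \<in> B"
        using convexD_alt[OF B(1) x cB(1), of \<theta>] \<theta> by (simp add: add.commute)
      have "(1 - \<theta>) *\<^sub>R x + \<theta> *\<^sub>R (c + z /\<^sub>R \<theta>) \<in> B"
        using convexD_alt[OF B(1) x cB(2), of \<theta>] \<theta> by simp
      then show "(1 - \<theta>) *\<^sub>R x + \<theta> *\<^sub>R c + z \<in> B" using \<theta> by (simp add: algebra_simps)
    qed
    have "(1 - \<theta>) ^ DIM('a) * measure lborel B = measure lebesgue ?S"
      using \<theta> B(3) by (simp add: measure_lebesgue_affine)
    also have "\<dots> \<le> measure lebesgue {s \<in> B. s + z \<in> B}"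
    proof (rule measure_mono_fmeasurable[OF S])
      have "?S = (\<lambda>x. \<theta> *\<^sub>R c + (1 - \<theta>) *\<^sub>R x) ` B" by (simp add: add.commute)
      then have "convex ?S" using convex_affinity[OF B(1), of "\<theta> *\<^sub>R c" "1 - \<theta>"] by simp
      moreover have "bounded ?S" using bounded_subset[OF B(2)] S by blast
      ultimately show "?S \<in> sets lebesgue" using measurable_convex by (auto simp: fmeasurable_def)
      show "{s \<in> B. s + z \<in> B} \<in> lmeasurable"
        using sM B(2) by (intro bounded_set_imp_lmeasurable) (auto intro: bounded_subset)
    qed
    also have "\<dots> = measure lborel {s \<in> B. s + z \<in> B}" using sM by simp
    also have "\<dots> = measure lborel B - measure lborel {s \<in> B. s + z \<notin> B}"
    proof -
      have "measure lborel ({s \<in> B. s + z \<in> B} \<union> {s \<in> B. s + z \<notin> B}) = measure lborel {s \<in> B. s + z \<in> B} + measure lborel {s \<in> B. s + z \<notin> B}"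
        by (rule measure_Union) (use fm in \<open>auto simp: fmeasurable_def\<close>)
      moreover have "{s \<in> B. s + z \<in> B} \<union> {s \<in> B. s + z \<notin> B} = B" by auto
      ultimately show ?thesis by simp
    qed
    finally have 1: "measure lborel {s \<in> B. s + z \<notin> B} \<le> (1 - (1 - \<theta>) ^ DIM('a)) * measure lborel B" by (simp add: algebra_simps)
    \<comment> \<open>Bernoulli's inequality gives a bound linear in \<open>\<theta>\<close>. It is
      weakened to \<open>\<theta> powr \<beta>\<close>, because for a decay exponent close to 2 only
      small powers of \<open>norm z\<close> can be integrated against the covariance.\<close>
    have "1 - (1 - \<theta>) ^ DIM('a) \<le> DIM('a) * \<theta>"
      using Bernoulli_inequality[of "- \<theta>" "DIM('a)"] \<theta> by simp
    moreover have "\<theta> \<le> \<theta> powr \<beta>" using powr_mono'[of \<beta> 1 \<theta>] \<theta> \<beta> by simp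
    ultimately have "1 - (1 - \<theta>) ^ DIM('a) \<le> DIM('a) * \<theta> powr \<beta>" using D1 by (smt (verit) mult_left_mono)
    from mult_right_mono[OF this, of "measure lborel B"] 1 show ?thesis unfolding \<theta>_def by simp
  qed
qed

text \<open>The Bochner integral of a non-integrable function is 0 by convention, and then the
  inequality is trivial.\<close>

lemma ennreal_integral_le_nn_integral:
  assumes "\<And>x. 0 \<le> f x"
  shows "ennreal (integral\<^sup>L M f) \<le> (\<integral>\<^sup>+x. ennreal (f x) \<partial>M)"
  using assms nn_integral_eq_integral[of M f] by (cases "integrable M f") (auto simp: not_integrable_integral_eq)

text \<open>After the substitution \<open>t = s + z\<close> and an exchange of the integrals, each
  lag \<open>z\<close> is weighted by the measure of the points that leave \<open>B\<close> when
  shifted by \<open>z\<close>, to which \<open>convex_shift_exit_measure\<close> applies.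
  Nonnegative integrals make the exchange unconditional.\<close>

lemma double_integral_across_boundary:
  fixes B :: "'a::euclidean_space set"
  assumes B: "convex B" "bounded B" "B \<in> sets borel" and c: "cball c \<rho> \<subseteq> B" and \<rho>: "0 < \<rho>"
    and \<beta>: "0 < \<beta>" "\<beta> \<le> 1"
    and f: "f \<in> borel_measurable borel" "\<And>z. 0 \<le> f z" and fi: "integrable lborel (\<lambda>z. f z * norm z powr \<beta>)"
  shows "(\<integral>s. indicator B s * (\<integral>t. indicator (- B) t * f (t - s) \<partial>lborel) \<partial>lborel) \<le>
    (DIM('a) * \<rho> powr - \<beta> * (\<integral>z. f z * norm z powr \<beta> \<partial>lborel)) * measure lborel B"
proof (rule integral_real_bounded)
  note [measurable] = B(3) f(1)
  let ?I = "\<integral>z. f z * norm z powr \<beta> \<partial>lborel"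
  have I0: "0 \<le> ?I" using f by simp
  then show "0 \<le> (DIM('a) * \<rho> powr - \<beta> * ?I) * measure lborel B" by simp
  define m where "m = real DIM('a) * \<rho> powr - \<beta> * measure lborel B"
  have m0: "0 \<le> m" unfolding m_def by simp
  have "(\<integral>\<^sup>+s. ennreal (indicator B s * (\<integral>t. indicator (- B) t * f (t - s) \<partial>lborel)) \<partial>lborel) \<le>
    (\<integral>\<^sup>+s. indicator B s * (\<integral>\<^sup>+t. indicator (- B) t * ennreal (f (t - s)) \<partial>lborel) \<partial>lborel)"
  proof (rule nn_integral_mono)
    fix s
    have "ennreal (\<integral>t. indicator (- B) t * f (t - s) \<partial>lborel) \<le> (\<integral>\<^sup>+t. ennreal (indicator (- B) t * f (t - s)) \<partial>lborel)"
      by (rule ennreal_integral_le_nn_integral) (use f in auto)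
    also have "\<dots> = (\<integral>\<^sup>+t. indicator (- B) t * ennreal (f (t - s)) \<partial>lborel)"
      by (intro nn_integral_cong) (auto simp: indicator_def)
    finally show "ennreal (indicator B s * (\<integral>t. indicator (- B) t * f (t - s) \<partial>lborel)) \<le>
      indicator B s * (\<integral>\<^sup>+t. indicator (- B) t * ennreal (f (t - s)) \<partial>lborel)"
      by (auto simp: indicator_def)
  qed
  also have "\<dots> = (\<integral>\<^sup>+s. (\<integral>\<^sup>+z. indicator B s * (indicator (- B) (s + z) * ennreal (f z)) \<partial>lborel) \<partial>lborel)"
  proof (rule nn_integral_cong)
    fix s :: 'a
    have "(\<integral>\<^sup>+t. indicator (- B) t * ennreal (f (t - s)) \<partial>lborel) = (\<integral>\<^sup>+z. indicator (- B) (s + z) * ennreal (f z) \<partial>lborel)"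
      by (subst lborel_distr_plus[of s, symmetric], subst nn_integral_distr) auto
    then show "indicator B s * (\<integral>\<^sup>+t. indicator (- B) t * ennreal (f (t - s)) \<partial>lborel) =
      (\<integral>\<^sup>+z. indicator B s * (indicator (- B) (s + z) * ennreal (f z)) \<partial>lborel)"
      by (subst nn_integral_cmult) auto
  qed
  also have "\<dots> = (\<integral>\<^sup>+z. (\<integral>\<^sup>+s. indicator B s * (indicator (- B) (s + z) * ennreal (f z)) \<partial>lborel) \<partial>lborel)"
    by (rule lborel_pair.Fubini') measurable
  also have "\<dots> \<le> (\<integral>\<^sup>+z. ennreal (m * (f z * norm z powr \<beta>)) \<partial>lborel)"
  proof (rule nn_integral_mono)
    fix z :: 'a
    have fB: "emeasure lborel {s \<in> B. s + z \<notin> B} < \<infinity>"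
      by (rule emeasure_bounded_finite[OF bounded_subset[OF B(2)]]) auto
    have "(\<integral>\<^sup>+s. indicator B s * (indicator (- B) (s + z) * ennreal (f z)) \<partial>lborel) =
      (\<integral>\<^sup>+s. ennreal (f z) * indicator {s \<in> B. s + z \<notin> B} s \<partial>lborel)"
      by (intro nn_integral_cong) (auto simp: indicator_def)
    also have "\<dots> = ennreal (f z) * emeasure lborel {s \<in> B. s + z \<notin> B}"
      by (rule nn_integral_cmult_indicator) measurable
    also have "\<dots> = ennreal (f z * measure lborel {s \<in> B. s + z \<notin> B})"
      using fB f(2)[of z] by (simp add: emeasure_eq_ennreal_measure ennreal_mult')
    also have "\<dots> \<le> ennreal (f z * (DIM('a) * (norm z / \<rho>) powr \<beta> * measure lborel B))"
      by (intro ennreal_leI mult_left_mono convex_shift_exit_measure[OF B c \<rho> \<beta>] f)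
    also have "f z * (DIM('a) * (norm z / \<rho>) powr \<beta> * measure lborel B) = m * (f z * norm z powr \<beta>)"
      unfolding m_def using \<rho> by (simp add: powr_divide powr_minus_divide)
    finally show "(\<integral>\<^sup>+s. indicator B s * (indicator (- B) (s + z) * ennreal (f z)) \<partial>lborel) \<le> ennreal (m * (f z * norm z powr \<beta>))" .
  qed
  also have "\<dots> = ennreal (\<integral>z. m * (f z * norm z powr \<beta>) \<partial>lborel)"
    using fi m0 f by (intro nn_integral_eq_integral) auto
  also have "(\<integral>z. m * (f z * norm z powr \<beta>) \<partial>lborel) = (DIM('a) * \<rho> powr - \<beta> * ?I) * measure lborel B"
    by (simp add: m_def)
  finally show "(\<integral>\<^sup>+s. ennreal (indicator B s * (\<integral>t. indicator (- B) t * f (t - s) \<partial>lborel)) \<partial>lborel) \<le>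
    ennreal ((DIM('a) * \<rho> powr - \<beta> * ?I) * measure lborel B)" .
qed

text \<open>The O-condition controls large \<open>t\<close>; on the remaining ball
  \<open>\<bar>r t\<bar> \<le> \<sigma>\<^sup>2\<close> suffices. The base \<open>1 + norm t\<close>
  removes the singularity at the origin.\<close>

lemma (in excursion_field) covariance_decay:
  assumes \<alpha>: "0 < \<alpha>" and O: "r \<in> O[at_infinity](\<lambda>t. norm t powr - \<alpha>)"
  obtains c where "\<And>t. \<bar>r t\<bar> \<le> c * (1 + norm t) powr - \<alpha>"
proof -
  from O obtain c0 where c0: "0 < c0" "\<forall>\<^sub>F t in at_infinity. norm (r t) \<le> c0 * norm (norm t powr - \<alpha>)"
    by (rule landau_o.bigE)
  then obtain b where b: "\<And>t. b \<le> norm t \<Longrightarrow> \<bar>r t\<bar> \<le> c0 * norm t powr - \<alpha>"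
    unfolding eventually_at_infinity by auto
  define b' where "b' = max b 1"
  have b': "1 \<le> b'" "b \<le> b'" unfolding b'_def by auto
  have near: "\<bar>r t\<bar> \<le> \<sigma>\<^sup>2 * (1 + b') powr \<alpha> * (1 + norm t) powr - \<alpha>" if "norm t < b'" for t
  proof -
    have "(1 + b') powr - \<alpha> \<le> (1 + norm t) powr - \<alpha>"
      using \<alpha> that by (intro powr_mono2') (auto intro: add_pos_nonneg)
    then have "(1 + b') powr \<alpha> * (1 + b') powr - \<alpha> \<le> (1 + b') powr \<alpha> * (1 + norm t) powr - \<alpha>"
      by (intro mult_left_mono) auto
    moreover have "(1 + b') powr \<alpha> * (1 + b') powr - \<alpha> = 1" using b' by (simp add: powr_add[symmetric])
    ultimately have "1 \<le> (1 + b') powr \<alpha> * (1 + norm t) powr - \<alpha>" by simp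
    then have "\<sigma>\<^sup>2 * 1 \<le> \<sigma>\<^sup>2 * ((1 + b') powr \<alpha> * (1 + norm t) powr - \<alpha>)" by (rule mult_left_mono) simp
    then show ?thesis using r_le[of t] by (simp add: mult.assoc)
  qed
  have far: "\<bar>r t\<bar> \<le> c0 * 2 powr \<alpha> * (1 + norm t) powr - \<alpha>" if "b' \<le> norm t" for t
  proof -
    have "norm t powr - \<alpha> \<le> ((1 + norm t) / 2) powr - \<alpha>"
      using \<alpha> that b' by (intro powr_mono2') auto
    also have "\<dots> = 2 powr \<alpha> * (1 + norm t) powr - \<alpha>" by (simp add: powr_divide powr_minus_divide)
    finally have "c0 * norm t powr - \<alpha> \<le> c0 * (2 powr \<alpha> * (1 + norm t) powr - \<alpha>)"
      using c0(1) by (intro mult_left_mono) auto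
    then show ?thesis using b[of t] that b' by (simp add: mult.assoc)
  qed
  have "\<bar>r t\<bar> \<le> (\<sigma>\<^sup>2 * (1 + b') powr \<alpha> + c0 * 2 powr \<alpha>) * (1 + norm t) powr - \<alpha>" for t
  proof -
    have "0 \<le> \<sigma>\<^sup>2 * (1 + b') powr \<alpha> * (1 + norm t) powr - \<alpha>" "0 \<le> c0 * 2 powr \<alpha> * (1 + norm t) powr - \<alpha>"
      using c0(1) by simp_all
    then show ?thesis using near[of t] far[of t] unfolding distrib_right by linarith
  qed
  then show ?thesis by (rule that)
qed

text \<open>If \<open>\<bar>r z\<bar> = \<sigma>\<^sup>2\<close>, then \<open>g (t + z) = \<plusminus> g t\<close> almost surely, so \<open>r\<close> would not decay along the multiples of \<open>z\<close>.\<close>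

lemma (in excursion_field) covariance_nondegenerate:
  assumes \<alpha>: "0 < \<alpha>" and d: "\<And>t. \<bar>r t\<bar> \<le> c * (1 + norm t) powr - \<alpha>" and z: "z \<noteq> 0"
  shows "\<bar>r z\<bar> < \<sigma>\<^sup>2"
proof (rule ccontr)
  assume "\<not> \<bar>r z\<bar> < \<sigma>\<^sup>2"
  with r_le[of z] have "\<bar>r z\<bar> = \<sigma>\<^sup>2" by simp
  then have "\<sigma>\<^sup>2 \<le> c * (1 + real n * norm z) powr - \<alpha>" for n
    using r_periodic[of z n] d[of "real n *\<^sub>R z"] by simp
  moreover have "0 < norm z" using z by simp
  then have "(\<lambda>n. c * (1 + real n * norm z) powr - \<alpha>) \<longlonglongrightarrow> 0" using \<alpha> by real_asymp
  ultimately have "\<sigma>\<^sup>2 \<le> 0" using LIMSEQ_le_const by blast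
  then show False using \<sigma>_pos by simp
qed

text \<open>Trading \<open>norm t powr \<beta>\<close> against the decay leaves the exponent
  \<open>\<alpha> - \<beta>\<close>, still above the dimension 2 of the plane.\<close>

lemma integrable_norm_powr_of_decay:
  fixes f :: "real^2 \<Rightarrow> real"
  assumes [measurable]: "f \<in> borel_measurable borel" and d: "\<And>t. \<bar>f t\<bar> \<le> c * (1 + norm t) powr - \<alpha>"
    and \<beta>: "0 \<le> \<beta>" "2 < \<alpha> - \<beta>"
  shows "integrable lborel (\<lambda>t. \<bar>f t\<bar> * norm t powr \<beta>)"
proof (rule Bochner_Integration.integrable_bound)
  show "integrable lborel (\<lambda>t::real^2. c * (1 + norm t) powr - (\<alpha> - \<beta>))"
    by (rule integrable_mult_right, rule integrable_one_plus_norm_powr) (use \<beta> in simp)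
  have "\<bar>f t\<bar> * norm t powr \<beta> \<le> c * (1 + norm t) powr - (\<alpha> - \<beta>)" for t
  proof -
    have "\<bar>f t\<bar> * norm t powr \<beta> \<le> (c * (1 + norm t) powr - \<alpha>) * (1 + norm t) powr \<beta>"
      using d[of t] \<beta> by (intro mult_mono powr_mono2) (auto intro: order_trans[OF abs_ge_zero])
    also have "\<dots> = c * (1 + norm t) powr - (\<alpha> - \<beta>)" by (simp add: powr_add[symmetric])
    finally show ?thesis .
  qed
  from order_trans[OF this abs_ge_self] show "AE t in lborel. norm (\<bar>f t\<bar> * norm t powr \<beta>) \<le> norm (c * (1 + norm t) powr - (\<alpha> - \<beta>))"
    by (intro AE_I2) (simp only: real_norm_def abs_mult abs_abs abs_of_nonneg[OF powr_ge_zero])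
qed measurable

text \<open>A rectangle may contain an arbitrary part of its boundary and need not be Borel. The
  image of the open box is open and convex, and its closure already contains the rectangle.\<close>

lemma rectangle_convex_core:
  assumes "rectangle T"
  obtains U where "open U" "convex U" "bounded U" "U \<noteq> {}" "U \<subseteq> T" "T \<subseteq> closure U"
proof -
  obtain Q :: "real^2 \<Rightarrow> real^2" and a b where Q: "orthogonal_transformation Q" and ne: "box a b \<noteq> {}"
    and T: "Q ` box a b \<subseteq> T" "T \<subseteq> Q ` cbox a b"
    using assms unfolding rectangle_def by blast
  have l: "linear Q" using Q by (rule orthogonal_transformation_linear)
  have "Q ` cbox a b \<subseteq> closure (Q ` box a b)"
    unfolding closure_box[OF ne, symmetric]
    by (rule image_closure_subset) (auto simp: l linear_continuous_on linear_conv_bounded_linear[symmetric] closure_subset[THEN subsetD])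
  then show ?thesis
    using T ne l by (intro that[of "Q ` box a b"])
      (auto intro!: open_surjective_linear_image orthogonal_transformation_surj[OF Q] convex_linear_image bounded_linear_image simp: linear_conv_bounded_linear)
qed

text \<open>The frontier of a convex set is negligible, so \<open>T\<close> and \<open>U\<close>
  differ by a null set, and completeness of Lebesgue measure takes care of measurability.\<close>

lemma measure_between_convex_closure:
  fixes U :: "'a::euclidean_space set"
  assumes U: "open U" "convex U" "bounded U" "U \<subseteq> T" "T \<subseteq> closure U" and P: "{t \<in> U. P t} \<in> sets borel"
  shows "measure lebesgue {t \<in> T. P t} = measure lborel {t \<in> U. P t}"
proof -
  have "negligible (frontier U)" by (rule negligible_convex_frontier[OF U(2)])
  then have "negligible ({t \<in> U. P t} - {t \<in> T. P t} \<union> ({t \<in> T. P t} - {t \<in> U. P t}))"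
    by (rule negligible_subset) (use U in \<open>auto simp: frontier_def interior_open\<close>)
  moreover have "{t \<in> U. P t} \<in> lmeasurable"
    using P U(3) by (intro bounded_set_imp_lmeasurable) (auto intro: bounded_subset)
  ultimately have "measure lebesgue {t \<in> T. P t} = measure lebesgue {t \<in> U. P t}" by (rule measure_negligible_symdiff[rotated])
  then show ?thesis using P by simp
qed

text \<open>Puts the statistic into the form that \<open>region_bound\<close> takes: level
  \<open>u\<close> for the perturbed field is level \<open>u - \<epsilon> * X \<omega>\<close> for
  \<open>g\<close>, and the centring moves under the integral over the open core.\<close>

lemma (in excursion_decay) Z_stat_eq:
  assumes U: "open U" "convex U" "bounded U" "U \<subseteq> T" "T \<subseteq> closure U" and A: "0 < measure lborel U"
    and \<omega>: "\<omega> \<in> space M"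
  shows "Z_stat g X \<sigma> \<epsilon> T u \<omega> =
    (\<integral>t. indicator U t * (indicator {u - \<epsilon> * X \<omega>..} (g t \<omega>) - Psi ((u - \<epsilon> * X \<omega>) / \<sigma>)) \<partial>lborel) / sqrt (measure lborel U)"
proof -
  define x where "x = u - \<epsilon> * X \<omega>"
  have [measurable]: "U \<in> sets borel" using U(1) by simp
  have [measurable]: "(\<lambda>t. g t \<omega>) \<in> borel_measurable borel"
    using measurable_compose[OF measurable_Pair2'[OF \<omega>] g_joint] by simp
  let ?E = "{t \<in> U. x \<le> g t \<omega>}"
  have E [measurable]: "?E \<in> sets borel" by measurable
  have fin: "emeasure lborel ?E < \<infinity>" "emeasure lborel U < \<infinity>"
    by (rule emeasure_bounded_finite[OF bounded_subset[OF U(3)]], blast) (rule emeasure_bounded_finite[OF U(3)])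
  have "area T = measure lborel U"
    using measure_between_convex_closure[OF U, of "\<lambda>_. True"] by simp
  moreover have "area {t \<in> T. u \<le> perturbed_field g X \<epsilon> t \<omega>} = measure lborel ?E"
    using measure_between_convex_closure[OF U E] by (simp add: perturbed_field_def x_def algebra_simps)
  ultimately have "Z_stat g X \<sigma> \<epsilon> T u \<omega> = sqrt (measure lborel U) * (measure lborel ?E / measure lborel U - Psi (x / \<sigma>))"
    unfolding Z_stat_def C2_def C2_star_def x_def by simp
  also have "\<dots> = (measure lborel ?E - Psi (x / \<sigma>) * measure lborel U) / sqrt (measure lborel U)"
    using A by (simp add: field_simps)
  also have "measure lborel ?E - Psi (x / \<sigma>) * measure lborel U =
    (\<integral>t. indicator ?E t - Psi (x / \<sigma>) * indicator U t \<partial>lborel)"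
    using fin by simp
  also have "\<dots> = (\<integral>t. indicator U t * (indicator {x..} (g t \<omega>) - Psi (x / \<sigma>)) \<partial>lborel)"
    by (intro Bochner_Integration.integral_cong refl) (auto simp: indicator_def)
  finally show ?thesis unfolding x_def .
qed

text \<open>The shape of the region enters only through its area and the radius
  \<open>\<rho>\<close> of an inscribed ball.\<close>

lemma (in excursion_decay) convex_region_bound:
  assumes U: "open U" "convex U" "bounded U" "U \<subseteq> T" "T \<subseteq> closure U" and A: "1 \<le> measure lborel U"
    and c: "cball c \<rho> \<subseteq> U" and \<rho>: "0 < \<rho>" and \<beta>: "0 < \<beta>" "\<beta> \<le> 1"
    and ri: "integrable lborel (\<lambda>z. \<bar>r z\<bar> * norm z powr \<beta>)"
    and cd: "cond_distribution M X \<Theta> (\<lambda>x. gaussian_law 0 (asymp_var r \<sigma> (u - \<epsilon> * x)))"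
    and h: "1-lipschitz_on UNIV h"
  shows "\<bar>(\<integral>\<omega>. h (Z_stat g X \<sigma> \<epsilon> T u \<omega>) \<partial>M) - (\<integral>\<omega>. h (\<Theta> \<omega>) \<partial>M)\<bar> \<le>
    clt_const \<sigma> ((\<integral>z. \<bar>r z\<bar> \<partial>lborel) + 1) * measure lborel U powr (- (1 / 32)) +
    sqrt (4 / \<sigma>\<^sup>2 * (2 * \<rho> powr - \<beta> * (\<integral>z. \<bar>r z\<bar> * norm z powr \<beta> \<partial>lborel)))"
proof -
  have Ub: "U \<in> sets borel" using U(1) by simp
  have rb: "(\<lambda>z. \<bar>r z\<bar>) \<in> borel_measurable borel" using r_cont by (intro borel_measurable_continuous_onI continuous_intros)
  have "boundary U \<le> (2 * \<rho> powr - \<beta> * (\<integral>z. \<bar>r z\<bar> * norm z powr \<beta> \<partial>lborel)) * measure lborel U / measure lborel U"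
    unfolding boundary_def
    by (intro divide_right_mono order_trans[OF double_integral_across_boundary[OF U(2,3) Ub c \<rho> \<beta> rb _ ri]]) auto
  also have "\<dots> = 2 * \<rho> powr - \<beta> * (\<integral>z. \<bar>r z\<bar> * norm z powr \<beta> \<partial>lborel)" using A by simp
  finally have "sqrt (4 / \<sigma>\<^sup>2 * boundary U) \<le> sqrt (4 / \<sigma>\<^sup>2 * (2 * \<rho> powr - \<beta> * (\<integral>z. \<bar>r z\<bar> * norm z powr \<beta> \<partial>lborel)))"
    by (intro real_sqrt_le_mono mult_left_mono) auto
  moreover have "\<bar>(\<integral>\<omega>. h (Z_stat g X \<sigma> \<epsilon> T u \<omega>) \<partial>M) - (\<integral>\<omega>. h (\<Theta> \<omega>) \<partial>M)\<bar> \<le>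
    clt_const \<sigma> ((\<integral>z. \<bar>r z\<bar> \<partial>lborel) + 1) * measure lborel U powr (- (1 / 32)) + sqrt (4 / \<sigma>\<^sup>2 * boundary U)"
    by (rule region_bound[OF Ub U(3) refl A cd Z_stat_eq[OF U] h]) (use A in auto)
  ultimately show ?thesis by linarith
qed

text \<open>The boundary term is of order \<open>N powr - (\<beta> / 2)\<close>, which is the area
  to the power \<open>- \<beta> / 4\<close>. So \<open>\<gamma> = min (1 / 32) (\<beta> / 4)\<close>
  serves both terms, and every negative power of the area is eventually below the logarithmic
  rate.\<close>

lemma ln_rate:
  assumes A: "0 < A" and \<beta>: "0 < \<beta>" and K: "0 \<le> K2"
  shows "\<exists>C. \<forall>\<^sub>F N in at_top. K1 * (N\<^sup>2 * A) powr (- (1 / 32)) + sqrt (K2 * (N * \<rho>) powr - \<beta>) \<le> C * ln (N\<^sup>2 * A) powr (- (1 / 12))"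
proof -
  define \<gamma> where "\<gamma> = min (1 / 32) (\<beta> / 4)"
  have \<gamma>: "0 < \<gamma>" "\<gamma> \<le> 1 / 32" "\<gamma> \<le> \<beta> / 4" unfolding \<gamma>_def using \<beta> by auto
  define K where "K = \<bar>K1\<bar> + sqrt (K2 * \<rho> powr - \<beta>) * A powr (\<beta> / 4)"
  have "filterlim (\<lambda>N::real. N\<^sup>2 * A) at_top at_top" using A by real_asymp
  then have "\<forall>\<^sub>F N in at_top. (N\<^sup>2 * A) powr - \<gamma> \<le> ln (N\<^sup>2 * A) powr (- (1/12))"
    by (rule eventually_compose_filterlim[OF ln_powr_le_powr[OF \<gamma>(1)]])
  moreover have "\<forall>\<^sub>F N in at_top. 1 \<le> N\<^sup>2 * A" using A by real_asymp
  moreover have "\<forall>\<^sub>F N::real in at_top. 0 < N" by (rule eventually_gt_at_top)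
  ultimately have "\<forall>\<^sub>F N in at_top. K1 * (N\<^sup>2 * A) powr (- (1 / 32)) + sqrt (K2 * (N * \<rho>) powr - \<beta>) \<le> K * ln (N\<^sup>2 * A) powr (- (1 / 12))"
  proof eventually_elim
    case (elim N)
    let ?a = "N\<^sup>2 * A"
    have "K1 * ?a powr (- (1 / 32)) \<le> \<bar>K1\<bar> * ?a powr - \<gamma>"
      using elim \<gamma> by (intro mult_mono powr_mono) auto
    moreover have "sqrt (K2 * (N * \<rho>) powr - \<beta>) \<le> sqrt (K2 * \<rho> powr - \<beta>) * A powr (\<beta> / 4) * ?a powr - \<gamma>"
    proof -
      have "sqrt (N powr - \<beta>) = N powr - (\<beta> / 2)"
        using powr_half_sqrt_powr[of N "- \<beta>"] elim by (simp add: powr_powr)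
      also have "\<dots> = A powr (\<beta> / 4) * ?a powr - (\<beta> / 4)"
        using elim A by (simp add: powr_mult powr_add[symmetric] powr_powr flip: powr_numeral)
      also have "\<dots> \<le> A powr (\<beta> / 4) * ?a powr - \<gamma>"
        using elim \<gamma> by (intro mult_left_mono powr_mono) auto
      finally have "sqrt (K2 * \<rho> powr - \<beta>) * sqrt (N powr - \<beta>) \<le> sqrt (K2 * \<rho> powr - \<beta>) * (A powr (\<beta> / 4) * ?a powr - \<gamma>)"
        using K by (intro mult_left_mono) auto
      then show ?thesis using elim by (simp add: powr_mult real_sqrt_mult mult_ac)
    qed
    ultimately have "K1 * ?a powr (- (1 / 32)) + sqrt (K2 * (N * \<rho>) powr - \<beta>) \<le> K * ?a powr - \<gamma>"
      unfolding K_def distrib_right by linarith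
    also have "\<dots> \<le> K * ln ?a powr (- (1 / 12))"
      using elim K unfolding K_def by (intro mult_left_mono) auto
    finally show ?case .
  qed
  then show ?thesis ..
qed


theorem theorem3p1:
  fixes M :: "'a measure"
    and g :: "real^2 \<Rightarrow> 'a \<Rightarrow> real"
    and G :: "'a \<Rightarrow> real^2"
    and X :: "'a \<Rightarrow> real"
    and \<sigma> lam \<alpha> :: real
    and T :: "(real^2) set"
  assumes "prob_space M"
    and "(\<lambda>(t, \<omega>). g t \<omega>) \<in> borel_measurable (borel \<Otimes>\<^sub>M M)"
    and "gaussian_field M g"
    and "stationary_field M g"
    and "isotropic_field M g"
    and "(\<integral>\<omega>. g 0 \<omega> \<partial>M) = 0"
    and "0 < \<sigma>" and "covariance M (g 0) (g 0) = \<sigma>\<^sup>2"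
    and "has_ms_gradient M g 0 G"
    and "0 < lam" and "covariance_matrix M G = lam *\<^sub>R mat 1"
    and "C_k 4 (covariance_function M g)"
    and "2 < \<alpha>" and "covariance_function M g \<in> O[at_infinity](\<lambda>t. norm t powr - \<alpha>)"
    and "X \<in> borel_measurable M" and "indep_of_field M X g"
    and "integrable M (\<lambda>\<omega>. \<bar>X \<omega>\<bar> ^ 3)"
    and "(\<integral>\<omega>. X \<omega> \<partial>M) = 0"
    and "rectangle T"
  shows "\<exists>C. \<forall>\<^sub>F N in at_top. \<forall>\<epsilon>>0. \<forall>u. \<forall>\<Theta>.
           cond_distribution M X \<Theta>
             (\<lambda>x. gaussian_law 0 (asymp_var (covariance_function M g) \<sigma> (u - \<epsilon> * x))) \<longrightarrow>
           wasserstein M (Z_stat g X \<sigma> \<epsilon> (dilate N T) u) \<Theta>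
             \<le> ennreal (C * ln (area (dilate N T)) powr (- (1 / 12)))"
proof -
  interpret perturbed_excursion M g \<sigma> X
    using assms by (simp add: perturbed_excursion_def perturbed_excursion_axioms_def excursion_field_def excursion_field_axioms_def)
  have "\<forall>t. r differentiable (at t)" using assms(12) by (simp add: eval_nat_numeral)
  then have rc: "continuous_on UNIV r"
    by (intro continuous_at_imp_continuous_on) (auto intro: differentiable_imp_continuous_within)
  have [measurable]: "r \<in> borel_measurable borel" using rc by (rule borel_measurable_continuous_onI)
  have \<alpha>: "0 < \<alpha>" using assms(13) by simp
  obtain c where c: "\<And>t. \<bar>r t\<bar> \<le> c * (1 + norm t) powr - \<alpha>"
    by (rule covariance_decay[OF \<alpha> assms(14)]) (rule that)
  \<comment> \<open>The boundary estimate asks for an exponent in the interval from 0 to 1 for which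
    \<open>\<bar>r z\<bar> * norm z powr \<beta>\<close> is integrable in the plane, that is
    \<open>\<beta> < \<alpha> - 2\<close>.\<close>
  define \<beta> where "\<beta> = min 1 ((\<alpha> - 2) / 2)"
  have \<beta>: "0 < \<beta>" "\<beta> \<le> 1" "2 < \<alpha> - \<beta>" unfolding \<beta>_def using assms(13) by (auto simp: min_def field_simps)
  have ri: "integrable lborel (\<lambda>z. \<bar>r z\<bar> * norm z powr \<beta>)"
    by (rule integrable_norm_powr_of_decay[OF _ c]) (use \<beta> in auto)
  interpret excursion_decay M g \<sigma> X
  proof
    show "integrable lborel r"
    proof (rule Bochner_Integration.integrable_bound)
      show "integrable lborel (\<lambda>t::real^2. c * (1 + norm t) powr - \<alpha>)"
        by (rule integrable_mult_right, rule integrable_one_plus_norm_powr) (use assms(13) in simp)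
      show "AE t in lborel. norm (r t) \<le> norm (c * (1 + norm t) powr - \<alpha>)"
        using order_trans[OF c abs_ge_self] by simp
    qed simp
  qed (use rc covariance_nondegenerate[OF \<alpha> c] in auto)
  obtain U where U: "open U" "convex U" "bounded U" "U \<noteq> {}" "U \<subseteq> T" "T \<subseteq> closure U"
    using rectangle_convex_core[OF assms(19)] .
  then obtain p \<rho> where p: "cball p \<rho> \<subseteq> U" and \<rho>: "0 < \<rho>"
    by (metis all_not_in_conv open_contains_cball)
  define A where "A = measure lborel U"
  have "0 < measure lborel (cball p \<rho>)" using \<rho> by (rule content_cball_pos)
  also have "\<dots> \<le> A"
    unfolding A_def using p U(1,3)
    by (intro measure_mono_fmeasurable) (auto intro!: fmeasurableI emeasure_bounded_finite)
  finally have A: "0 < A" .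
  \<comment> \<open>These constants, and with them \<open>C\<close> and the threshold for
    \<open>N\<close>, are fixed before \<open>\<epsilon>\<close>, \<open>u\<close> and
    \<open>\<Theta>\<close> are chosen; this is the uniformity claimed.\<close>
  define K1 where "K1 = clt_const \<sigma> ((\<integral>z. \<bar>r z\<bar> \<partial>lborel) + 1)"
  define K2 where "K2 = 4 / \<sigma>\<^sup>2 * (2 * (\<integral>z. \<bar>r z\<bar> * norm z powr \<beta> \<partial>lborel))"
  have "0 \<le> K2" unfolding K2_def by simp
  from ln_rate[OF A \<beta>(1) this, of K1 \<rho>] obtain C where
    C: "\<forall>\<^sub>F N in at_top. K1 * (N\<^sup>2 * A) powr (- (1 / 32)) + sqrt (K2 * (N * \<rho>) powr - \<beta>) \<le> C * ln (N\<^sup>2 * A) powr (- (1 / 12))" ..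
  moreover have "\<forall>\<^sub>F N in at_top. 1 \<le> N\<^sup>2 * A" using A by real_asymp
  moreover have "\<forall>\<^sub>F N::real in at_top. 0 < N" by (rule eventually_gt_at_top)
  ultimately have "\<forall>\<^sub>F N in at_top. \<forall>\<epsilon>>0. \<forall>u. \<forall>\<Theta>.
     cond_distribution M X \<Theta> (\<lambda>x. gaussian_law 0 (asymp_var r \<sigma> (u - \<epsilon> * x))) \<longrightarrow>
     wasserstein M (Z_stat g X \<sigma> \<epsilon> (dilate N T) u) \<Theta> \<le> ennreal (C * ln (area (dilate N T)) powr (- (1 / 12)))"
  proof eventually_elim
    case (elim N)
    let ?U = "(*\<^sub>R) N ` U"
    have UN: "open ?U" "convex ?U" "bounded ?U" "?U \<subseteq> dilate N T" "dilate N T \<subseteq> closure ?U"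
      using U elim(3) by (auto simp: dilate_def open_scaling convex_scaling bounded_scaling closure_scaleR[symmetric])
    have "measure lborel ?U = measure lebesgue ?U" using UN(1) by simp
    also have "\<dots> = N\<^sup>2 * A"
      using measure_lebesgue_affine[of N 0 U] U(1) elim(3) by (simp add: A_def)
    finally have mU: "measure lborel ?U = N\<^sup>2 * A" .
    have mT: "area (dilate N T) = N\<^sup>2 * A"
      using measure_between_convex_closure[OF UN, of "\<lambda>_. True"] UN(1) mU by simp
    \<comment> \<open>The inscribed ball grows with the dilation, which makes the edge correction
      tend to 0.\<close>
    have pN: "cball (N *\<^sub>R p) (N * \<rho>) \<subseteq> ?U"
      using cball_scale[of N p \<rho>] elim(3) p by (auto simp: image_mono)
    have A1: "1 \<le> measure lborel ?U" using elim(2) mU by simp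
    have N\<rho>: "0 < N * \<rho>" using elim(3) \<rho> by simp
    show ?case
    proof (intro allI impI)
      fix \<epsilon> u :: real and \<Theta>
      assume cd: "cond_distribution M X \<Theta> (\<lambda>x. gaussian_law 0 (asymp_var r \<sigma> (u - \<epsilon> * x)))"
      have "\<bar>(\<integral>\<omega>. h (Z_stat g X \<sigma> \<epsilon> (dilate N T) u \<omega>) \<partial>M) - (\<integral>\<omega>. h (\<Theta> \<omega>) \<partial>M)\<bar> \<le> C * ln (area (dilate N T)) powr (- (1 / 12))"
        if h: "1-lipschitz_on UNIV h" for h
        using convex_region_bound[OF UN A1 pN N\<rho> \<beta>(1,2) ri cd h] elim(1)
        unfolding mU mT K1_def K2_def by (simp add: mult_ac)
      then show "wasserstein M (Z_stat g X \<sigma> \<epsilon> (dilate N T) u) \<Theta> \<le> ennreal (C * ln (area (dilate N T)) powr (- (1 / 12)))"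
        unfolding wasserstein_def by (intro SUP_least ennreal_leI) auto
    qed
  qed
  then show ?thesis by (rule exI[of _ C])
qed

end
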